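(* Let $\mathbb{K}$ be a field and let $(Q,X)$ be a finite acyclic EI quiver whose assignment $X$ is action-free. Let $\mathcal{C}=\mathcal{C}(Q,X)$ and let $\mathbb{K}\mathcal{C}$ be its category algebra. Then there is an isomorphism of algebras $$\Pi(Q,X)\;\cong\; T_{\mathbb{K}\mathcal{C}}\big(\mathrm{Ext}^1_{\mathbb{K}\mathcal{C}}(D(\mathbb{K}\mathcal{C}),\mathbb{K}\mathcal{C})\big)$$ between the preprojective algebra of $(Q,X)$ and the tensor algebra of the $\mathbb{K}\mathcal{C}$-$\mathbb{K}\mathcal{C}$-bimodule $\mathrm{Ext}^1_{\mathbb{K}\mathcal{C}}(D(\mathbb{K}\mathcal{C}),\mathbb{K}\mathcal{C})$.
   Context: **Bisets.** For groups $G_1,G_2$, a $(G_1,G_2)$-biset is a set $Y$ with a left $G_1$-action and a right $G_2$-action such that $(g_1y)g_2=g_1(yg_2)$. Its dual biset is the $(G_2,G_1)$-biset $Y^\ast=\{y^\ast\mid y\in Y\}$ with $y^\ast g_1=(g_1^{-1}y)^\ast$ and $g_2y^\ast=(yg_2^{-1})^\ast$. For a $(G_1,G_2)$-biset $Y$ and a $(G_2,G_3)$-biset $Z$, the biset product $Y\times_{G_2}Z$ is the quotient of $Y\times Z$ by the equivalence relation $(yg,z)\sim(y,gz)$, a $(G_1,G_3)$-biset. **EI quivers.** A finite quiver $Q$ has finite vertex set $Q_0$, finite arrow set $Q_1$, and source and target maps $s,t$. Paths $p=\alpha_n\cdots\alpha_1$ are written from right to left, so $t(\alpha_i)=s(\alpha_{i+1})$;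 $e_i$ is the trivial path at $i$. $Q$ is acyclic if it has no nontrivial path $p$ with $s(p)=t(p)$. A finite EI quiver $(Q,X)$ is a finite quiver $Q$ together with a finite group $X(i)$ for each $i\in Q_0$ and a finite nonempty $(X(t(\alpha)),X(s(\alpha)))$-biset $X(\alpha)$ for each $\alpha\in Q_1$; it is acyclic if $Q$ is. The assignment $X$ is action-free if, for each $\alpha\in Q_1$, the left $X(t(\alpha))$-action and the right $X(s(\alpha))$-action on $X(\alpha)$ are both free. **Category and category algebra.** For a path $p=\alpha_n\cdots\alpha_1$ with $n\geq 1$ let $X(p)=X(\alpha_n)\times_{X(t(\alpha_{n-1}))}X(\alpha_{n-1})\times\cdots\times_{X(t(\alpha_1))}X(\alpha_1)$, and let $X(e_i)=X(i)$. The category $\mathcal{C}(Q,X)$ has object set $Q_0$ and $\mathrm{Hom}(x,y)=\bigsqcup_p X(p)$, over all paths $p$ from $x$ to $y$; composition is induced by the natural isomorphisms $X(p)\times_{X(t(q))}X(q)\cong X(pq)$. The category algebra $\mathbb{K}\mathcal{C}$ has the morphisms of $\mathcal{C}$ as a $\mathbb{K}$-basis, with product $\alpha\beta=\alpha\circ\beta$ if composable and $0$ otherwise. **Preprojective algebra.** For a finite acyclic EI quiver $(Q,X)$, let $\overline{Q}$ be obtained from $Q$ by adding a reverse arrow $\alpha^\ast:j\to i$ for each arrow $\alpha:i\to j$ of $Q$, and put $\overline{X}(i)=X(i)$, $\overline{X}(\alpha)=X(\alpha)$, $\overline{X}(\alpha^\ast)=X(\alpha)^\ast$. For $\alpha\in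 Q_1$, let $L_\alpha$ (resp. $R_\alpha$) be a set of representatives of the left $X(t(\alpha))$-orbits (resp. right $X(s(\alpha))$-orbits) of $X(\alpha)$. Then $$\Pi(Q,X)=\mathbb{K}\mathcal{C}(\overline{Q},\overline{X})/(\rho),\qquad \rho=\sum_{\alpha\in Q_1}\Big(\sum_{b\in R_\alpha}bb^\ast-\sum_{c\in L_\alpha}c^\ast c\Big),$$ where $(\rho)$ is the two-sided ideal generated by $\rho$ ($\rho$ does not depend on the choices of $R_\alpha,L_\alpha$). **Other notation.** $D=\mathrm{Hom}_{\mathbb{K}}(-,\mathbb{K})$. For a $\mathbb{K}$-algebra $B$ and a $B$-$B$-bimodule $V$ (with $\mathbb{K}$ acting centrally), $T_B(V)=B\oplus V\oplus V^{\otimes_B2}\oplus\cdots$ is the tensor algebra. $\mathrm{Ext}^1$ is taken over left modules; the left action of $\mathbb{K}\mathcal{C}$ on $\mathrm{Ext}^1_{\mathbb{K}\mathcal{C}}(D(\mathbb{K}\mathcal{C}),\mathbb{K}\mathcal{C})$ is induced by the right action on $D(\mathbb{K}\mathcal{C})$, and the right action by the right action on $\mathbb{K}\mathcal{C}$. *)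

theory Defs
  imports
    "HOL-Algebra.QuotRing"
    "HOL-Algebra.Module"
    "HOL-Library.Poly_Mapping"
    "HOL-Library.Set_Algebras"
    "Graph_Theory.Digraph"
    "Graph_Theory.Arc_Walk"
begin

section \<open>Bisets\<close>

record ('g, 'x) biset =
  bcarrier :: "'x set"
  lact :: "'g \<Rightarrow> 'x \<Rightarrow> 'x"
  ract :: "'x \<Rightarrow> 'g \<Rightarrow> 'x"

locale biset = G1: group G1 + G2: group G2
  for G1 :: "'g monoid" and G2 :: "'g monoid" and Y :: "('g, 'x) biset" +
  assumes lact_closed: "\<lbrakk>g \<in> carrier G1; y \<in> bcarrier Y\<rbrakk> \<Longrightarrow> lact Y g y \<in> bcarrier Y"
    and ract_closed: "\<lbrakk>g \<in> carrier G2; y \<in> bcarrier Y\<rbrakk> \<Longrightarrow> ract Y y g \<in> bcarrier Y"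
    and lact_one: "y \<in> bcarrier Y \<Longrightarrow> lact Y \<one>\<^bsub>G1\<^esub> y = y"
    and ract_one: "y \<in> bcarrier Y \<Longrightarrow> ract Y y \<one>\<^bsub>G2\<^esub> = y"
    and lact_mult: "\<lbrakk>g \<in> carrier G1; h \<in> carrier G1; y \<in> bcarrier Y\<rbrakk>
          \<Longrightarrow> lact Y (g \<otimes>\<^bsub>G1\<^esub> h) y = lact Y g (lact Y h y)"
    and ract_mult: "\<lbrakk>g \<in> carrier G2; h \<in> carrier G2; y \<in> bcarrier Y\<rbrakk>
          \<Longrightarrow> ract Y y (g \<otimes>\<^bsub>G2\<^esub> h) = ract Y (ract Y y g) h"
    and act_commute: "\<lbrakk>g \<in> carrier G1; h \<in> carrier G2; y \<in> bcarrier Y\<rbrakk>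
          \<Longrightarrow> ract Y (lact Y g y) h = lact Y g (ract Y y h)"

definition left_free :: "'g monoid \<Rightarrow> ('g, 'x) biset \<Rightarrow> bool" where
  "left_free G Y \<longleftrightarrow>
     (\<forall>g\<in>carrier G. \<forall>y\<in>bcarrier Y. lact Y g y = y \<longrightarrow> g = \<one>\<^bsub>G\<^esub>)"

definition right_free :: "'g monoid \<Rightarrow> ('g, 'x) biset \<Rightarrow> bool" where
  "right_free G Y \<longleftrightarrow>
     (\<forall>g\<in>carrier G. \<forall>y\<in>bcarrier Y. ract Y y g = y \<longrightarrow> g = \<one>\<^bsub>G\<^esub>)"

definition left_orbit_reps :: "'g monoid \<Rightarrow> ('g, 'x) biset \<Rightarrow> 'x set \<Rightarrow> bool" where
  "left_orbit_reps G Y L \<longleftrightarrow>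
     L \<subseteq> bcarrier Y \<and> (\<forall>y\<in>bcarrier Y. \<exists>!c. c \<in> L \<and> (\<exists>g\<in>carrier G. y = lact Y g c))"

definition right_orbit_reps :: "'g monoid \<Rightarrow> ('g, 'x) biset \<Rightarrow> 'x set \<Rightarrow> bool" where
  "right_orbit_reps G Y R \<longleftrightarrow>
     R \<subseteq> bcarrier Y \<and> (\<forall>y\<in>bcarrier Y. \<exists>!b. b \<in> R \<and> (\<exists>g\<in>carrier G. y = ract Y b g))"

text \<open>
  The formal symbol \<open>y\<^sup>*\<close> is represented by \<open>y\<close> itself; in the double quiver below the
  elements of \<open>Y\<close> and of its dual are told apart by the arrow they belong to.
\<close>

definition dual_biset :: "'g monoid \<Rightarrow> 'g monoid \<Rightarrow> ('g, 'x) biset \<Rightarrow> ('g, 'x) biset" where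
  "dual_biset G1 G2 Y =
     \<lparr>bcarrier = bcarrier Y,
      lact = (\<lambda>g y. ract Y y (inv\<^bsub>G2\<^esub> g)),
      ract = (\<lambda>y g. lact Y (inv\<^bsub>G1\<^esub> g) y)\<rparr>"


section \<open>EI quivers\<close>

text \<open>A quiver is a \<^type>\<open>pre_digraph\<close>: the source map is \<^const>\<open>tail\<close>, the target map is \<^const>\<open>head\<close>.\<close>

record ('v, 'a, 'g, 'x) assignment =
  vgrp :: "'v \<Rightarrow> 'g monoid"
  abis :: "'a \<Rightarrow> ('g, 'x) biset"

locale finite_EI_quiver = fin_digraph Q
  for Q :: "('v, 'a) pre_digraph" and X :: "('v, 'a, 'g, 'x) assignment" +
  assumes vgrp_group: "i \<in> verts Q \<Longrightarrow> group (vgrp X i)"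
    and vgrp_finite: "i \<in> verts Q \<Longrightarrow> finite (carrier (vgrp X i))"
    and abis_biset: "\<alpha> \<in> arcs Q \<Longrightarrow> biset (vgrp X (head Q \<alpha>)) (vgrp X (tail Q \<alpha>)) (abis X \<alpha>)"
    and abis_finite: "\<alpha> \<in> arcs Q \<Longrightarrow> finite (bcarrier (abis X \<alpha>))"
    and abis_nonempty: "\<alpha> \<in> arcs Q \<Longrightarrow> bcarrier (abis X \<alpha>) \<noteq> {}"

definition acyclic_quiver :: "('v, 'a) pre_digraph \<Rightarrow> bool" where
  "acyclic_quiver Q \<longleftrightarrow> \<not> (\<exists>u p. p \<noteq> [] \<and> pre_digraph.awalk Q u p u)"

definition action_free :: "('v, 'a) pre_digraph \<Rightarrow> ('v, 'a, 'g, 'x) assignment \<Rightarrow> bool" where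
  "action_free Q X \<longleftrightarrow>
     (\<forall>\<alpha>\<in>arcs Q. left_free (vgrp X (head Q \<alpha>)) (abis X \<alpha>) \<and>
                 right_free (vgrp X (tail Q \<alpha>)) (abis X \<alpha>))"

text \<open>
  Nontrivial paths \<open>\<alpha>\<^sub>n \<dots> \<alpha>\<^sub>1\<close> are lists \<open>[\<alpha>\<^sub>n, \<dots>, \<alpha>\<^sub>1]\<close>, that is, reversed arc walks.
  The iterated product \<open>X(\<alpha>\<^sub>n) \<times> \<dots> \<times> X(\<alpha>\<^sub>1)\<close> is formed in one step: tuples
  \<open>[x\<^sub>n, \<dots>, x\<^sub>1]\<close> modulo the equivalence relation generated by
  \<open>[\<dots>, x g, y, \<dots>] \<sim> [\<dots>, x, g y, \<dots>]\<close> at every pair of neighbouring positions.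
\<close>

definition path_tuples :: "('v, 'a, 'g, 'x) assignment \<Rightarrow> 'a list \<Rightarrow> 'x list set" where
  "path_tuples X p = {xs. list_all2 (\<lambda>\<alpha> x. x \<in> bcarrier (abis X \<alpha>)) p xs}"

definition path_step ::
  "('v, 'a) pre_digraph \<Rightarrow> ('v, 'a, 'g, 'x) assignment \<Rightarrow> 'a list \<Rightarrow> 'x list rel" where
  "path_step Q X p =
     {(xs[i := ract (abis X (p ! i)) (xs ! i) g],
       xs[Suc i := lact (abis X (p ! Suc i)) g (xs ! Suc i)]) | xs i g.
        xs \<in> path_tuples X p \<and> Suc i < length p \<and> g \<in> carrier (vgrp X (tail Q (p ! i)))}"

definition path_equiv ::
  "('v, 'a) pre_digraph \<Rightarrow> ('v, 'a, 'g, 'x) assignment \<Rightarrow> 'a list \<Rightarrow> 'x list rel" where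
  "path_equiv Q X p = (path_step Q X p \<union> (path_step Q X p)\<inverse>)\<^sup>*"

definition path_biset ::
  "('v, 'a) pre_digraph \<Rightarrow> ('v, 'a, 'g, 'x) assignment \<Rightarrow> 'a list \<Rightarrow> ('g, 'x list set) biset" where
  "path_biset Q X p =
     \<lparr>bcarrier = path_tuples X p // path_equiv Q X p,
      lact = (\<lambda>g c. \<Union>xs\<in>c. path_equiv Q X p `` {lact (abis X (hd p)) g (hd xs) # tl xs}),
      ract = (\<lambda>c g. \<Union>xs\<in>c. path_equiv Q X p `` {butlast xs @ [ract (abis X (last p)) (last xs) g]})\<rparr>"


section \<open>The category of an EI quiver\<close>

record ('o, 'm) category =
  obj :: "'o set"
  mor :: "'m set"
  src :: "'m \<Rightarrow> 'o"
  trg :: "'m \<Rightarrow> 'o"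
  ident :: "'o \<Rightarrow> 'm"
  comp :: "'m \<Rightarrow> 'm \<Rightarrow> 'm"

datatype ('v, 'a, 'g, 'x) ei_mor = Triv 'v 'g | Path "'a list" "'x list set"

definition ei_morphisms ::
  "('v, 'a) pre_digraph \<Rightarrow> ('v, 'a, 'g, 'x) assignment \<Rightarrow> ('v, 'a, 'g, 'x) ei_mor set" where
  "ei_morphisms Q X =
     {Triv i g | i g. i \<in> verts Q \<and> g \<in> carrier (vgrp X i)} \<union>
     {Path p c | p c. p \<noteq> [] \<and> (\<exists>u v. pre_digraph.awalk Q u (rev p) v) \<and>
                      c \<in> bcarrier (path_biset Q X p)}"

fun ei_src :: "('v, 'a) pre_digraph \<Rightarrow> ('v, 'a, 'g, 'x) ei_mor \<Rightarrow> 'v" where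
  "ei_src Q (Triv i g) = i"
| "ei_src Q (Path p c) = tail Q (last p)"

fun ei_trg :: "('v, 'a) pre_digraph \<Rightarrow> ('v, 'a, 'g, 'x) ei_mor \<Rightarrow> 'v" where
  "ei_trg Q (Triv i g) = i"
| "ei_trg Q (Path p c) = head Q (hd p)"

fun ei_comp ::
  "('v, 'a) pre_digraph \<Rightarrow> ('v, 'a, 'g, 'x) assignment \<Rightarrow>
   ('v, 'a, 'g, 'x) ei_mor \<Rightarrow> ('v, 'a, 'g, 'x) ei_mor \<Rightarrow> ('v, 'a, 'g, 'x) ei_mor" where
  "ei_comp Q X (Triv i g) (Triv j h) = Triv i (g \<otimes>\<^bsub>vgrp X i\<^esub> h)"
| "ei_comp Q X (Triv i g) (Path q d) = Path q (lact (path_biset Q X q) g d)"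
| "ei_comp Q X (Path p c) (Triv j h) = Path p (ract (path_biset Q X p) c h)"
| "ei_comp Q X (Path p c) (Path q d) =
     Path (p @ q) (\<Union>xs\<in>c. \<Union>ys\<in>d. path_equiv Q X (p @ q) `` {xs @ ys})"

definition ei_category ::
  "('v, 'a) pre_digraph \<Rightarrow> ('v, 'a, 'g, 'x) assignment \<Rightarrow>
   ('v, ('v, 'a, 'g, 'x) ei_mor) category" where
  "ei_category Q X =
     \<lparr>obj = verts Q, mor = ei_morphisms Q X, src = ei_src Q, trg = ei_trg Q,
      ident = (\<lambda>i. Triv i \<one>\<^bsub>vgrp X i\<^esub>), comp = ei_comp Q X\<rparr>"

definition arrow_mor ::
  "('v, 'a) pre_digraph \<Rightarrow> ('v, 'a, 'g, 'x) assignment \<Rightarrow> 'a \<Rightarrow> 'x \<Rightarrow> ('v, 'a, 'g, 'x) ei_mor" where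
  "arrow_mor Q X \<alpha> x = Path [\<alpha>] (path_equiv Q X [\<alpha>] `` {[x]})"


section \<open>Algebras\<close>

text \<open>
  An algebra over the field \<open>'k\<close> is a HOL-Algebra record of type \<open>('k, 'b) module\<close>,
  whose ring operations need not be commutative.
\<close>

definition category_algebra :: "('o, 'm) category \<Rightarrow> ('k::field, 'm \<Rightarrow>\<^sub>0 'k) module" where
  "category_algebra C =
     \<lparr>carrier = {f. Poly_Mapping.keys f \<subseteq> mor C},
      mult = (\<lambda>f g. \<Sum>a\<in>Poly_Mapping.keys f. \<Sum>b\<in>Poly_Mapping.keys g.
                if src C a = trg C b
                then Poly_Mapping.single (comp C a b)
                       (Poly_Mapping.lookup f a * Poly_Mapping.lookup g b)
                else 0),
      one = (\<Sum>i\<in>obj C. Poly_Mapping.single (ident C i) 1),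
      zero = 0,
      add = (+),
      smult = (\<lambda>c. Poly_Mapping.map ((*) c))\<rparr>"

definition quotient_algebra :: "('k, 'b) module \<Rightarrow> 'b set \<Rightarrow> ('k, 'b set) module" where
  "quotient_algebra A I =
     ring.extend (A Quot I)
       (module.fields (\<lambda>c S. \<Union>x\<in>S. I +>\<^bsub>A\<^esub> (c \<odot>\<^bsub>A\<^esub> x)))"

definition algebra_isomorphic :: "('k, 'b) module \<Rightarrow> ('k, 'c) module \<Rightarrow> bool"
    (infix \<open>\<cong>\<^sub>a\<^sub>l\<^sub>g\<close> 50) where
  "A \<cong>\<^sub>a\<^sub>l\<^sub>g B \<longleftrightarrow>
     (\<exists>h\<in>ring_iso A B. \<forall>c. \<forall>x\<in>carrier A. h (c \<odot>\<^bsub>A\<^esub> x) = c \<odot>\<^bsub>B\<^esub> h x)"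


section \<open>The preprojective algebra\<close>

datatype 'a double_arrow = Fwd 'a | Rev 'a

definition double_quiver :: "('v, 'a) pre_digraph \<Rightarrow> ('v, 'a double_arrow) pre_digraph" where
  "double_quiver Q =
     \<lparr>verts = verts Q,
      arcs = Fwd ` arcs Q \<union> Rev ` arcs Q,
      tail = (\<lambda>\<beta>. case \<beta> of Fwd \<alpha> \<Rightarrow> tail Q \<alpha> | Rev \<alpha> \<Rightarrow> head Q \<alpha>),
      head = (\<lambda>\<beta>. case \<beta> of Fwd \<alpha> \<Rightarrow> head Q \<alpha> | Rev \<alpha> \<Rightarrow> tail Q \<alpha>)\<rparr>"

definition double_assignment ::
  "('v, 'a) pre_digraph \<Rightarrow> ('v, 'a, 'g, 'x) assignment \<Rightarrow> ('v, 'a double_arrow, 'g, 'x) assignment" where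
  "double_assignment Q X =
     \<lparr>vgrp = vgrp X,
      abis = (\<lambda>\<beta>. case \<beta> of
                 Fwd \<alpha> \<Rightarrow> abis X \<alpha>
               | Rev \<alpha> \<Rightarrow> dual_biset (vgrp X (head Q \<alpha>)) (vgrp X (tail Q \<alpha>)) (abis X \<alpha>))\<rparr>"

definition double_category_algebra ::
  "('v, 'a) pre_digraph \<Rightarrow> ('v, 'a, 'g, 'x) assignment \<Rightarrow>
   ('k::field, ('v, 'a double_arrow, 'g, 'x) ei_mor \<Rightarrow>\<^sub>0 'k) module" where
  "double_category_algebra Q X =
     category_algebra (ei_category (double_quiver Q) (double_assignment Q X))"

definition double_elem ::
  "('v, 'a) pre_digraph \<Rightarrow> ('v, 'a, 'g, 'x) assignment \<Rightarrow> 'a double_arrow \<Rightarrow> 'x \<Rightarrow>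
   ('v, 'a double_arrow, 'g, 'x) ei_mor \<Rightarrow>\<^sub>0 'k::field" where
  "double_elem Q X \<beta> x =
     Poly_Mapping.single (arrow_mor (double_quiver Q) (double_assignment Q X) \<beta> x) 1"

text \<open>The element \<open>\<rho>\<close>, for given sets \<open>L \<alpha>\<close>, \<open>R \<alpha>\<close> of orbit representatives.\<close>

definition preprojective_relation ::
  "('v, 'a) pre_digraph \<Rightarrow> ('v, 'a, 'g, 'x) assignment \<Rightarrow> ('a \<Rightarrow> 'x set) \<Rightarrow> ('a \<Rightarrow> 'x set) \<Rightarrow>
   ('v, 'a double_arrow, 'g, 'x) ei_mor \<Rightarrow>\<^sub>0 'k::field" where
  "preprojective_relation Q X L R =
     (let A = (double_category_algebra Q X
                 :: ('k, ('v, 'a double_arrow, 'g, 'x) ei_mor \<Rightarrow>\<^sub>0 'k) module);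
          e = double_elem Q X
      in \<Sum>\<alpha>\<in>arcs Q. (\<Sum>b\<in>R \<alpha>. e (Fwd \<alpha>) b \<otimes>\<^bsub>A\<^esub> e (Rev \<alpha>) b)
                    - (\<Sum>c\<in>L \<alpha>. e (Rev \<alpha>) c \<otimes>\<^bsub>A\<^esub> e (Fwd \<alpha>) c))"

definition preprojective_algebra ::
  "('v, 'a) pre_digraph \<Rightarrow> ('v, 'a, 'g, 'x) assignment \<Rightarrow> ('a \<Rightarrow> 'x set) \<Rightarrow> ('a \<Rightarrow> 'x set) \<Rightarrow>
   ('k::field, (('v, 'a double_arrow, 'g, 'x) ei_mor \<Rightarrow>\<^sub>0 'k) set) module" where
  "preprojective_algebra Q X L R =
     quotient_algebra (double_category_algebra Q X)
       (Idl\<^bsub>double_category_algebra Q X\<^esub> {preprojective_relation Q X L R})"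


section \<open>Modules and bimodules over noncommutative rings\<close>

text \<open>
  A left module over a ring with elements in \<open>'b\<close> is a record \<open>('b, 'm) module\<close>, and a bimodule
  has a right scalar multiplication in addition. The fields \<^const>\<open>mult\<close> and \<^const>\<open>one\<close>, which
  HOL-Algebra's record forces on modules, carry no meaning and are left \<^const>\<open>undefined\<close>.
\<close>

record ('b, 'm) bimodule = "('b, 'm) module" +
  rsmult :: "'m \<Rightarrow> 'b \<Rightarrow> 'm"

definition regular_bimodule :: "('b, 'r) ring_scheme \<Rightarrow> ('b, 'b) bimodule" where
  "regular_bimodule A =
     \<lparr>carrier = carrier A, mult = undefined, one = undefined,
      zero = \<zero>\<^bsub>A\<^esub>, add = add A, smult = mult A, rsmult = mult A\<rparr>"

text \<open>\<open>D(A)\<close>, with \<open>(a \<cdot> \<xi> \<cdot> b)(x) = \<xi>(b x a)\<close>.\<close>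

definition dual_bimodule :: "('k::field, 'b) module \<Rightarrow> ('b, 'b \<Rightarrow> 'k) bimodule" where
  "dual_bimodule A =
     \<lparr>carrier = {\<xi> \<in> extensional (carrier A).
                  (\<forall>x\<in>carrier A. \<forall>y\<in>carrier A. \<xi> (x \<oplus>\<^bsub>A\<^esub> y) = \<xi> x + \<xi> y) \<and>
                  (\<forall>c. \<forall>x\<in>carrier A. \<xi> (c \<odot>\<^bsub>A\<^esub> x) = c * \<xi> x)},
      mult = undefined, one = undefined,
      zero = (\<lambda>x\<in>carrier A. 0),
      add = (\<lambda>\<xi> \<eta>. \<lambda>x\<in>carrier A. \<xi> x + \<eta> x),
      smult = (\<lambda>a \<xi>. \<lambda>x\<in>carrier A. \<xi> (x \<otimes>\<^bsub>A\<^esub> a)),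
      rsmult = (\<lambda>\<xi> b. \<lambda>x\<in>carrier A. \<xi> (b \<otimes>\<^bsub>A\<^esub> x))\<rparr>"

definition left_homs ::
  "('b, 'r) ring_scheme \<Rightarrow> ('b, 'm, 's) module_scheme \<Rightarrow> ('b, 'n, 't) module_scheme \<Rightarrow> ('m \<Rightarrow> 'n) ring" where
  "left_homs A M N =
     \<lparr>carrier = {f \<in> carrier M \<rightarrow>\<^sub>E carrier N.
                  (\<forall>x\<in>carrier M. \<forall>y\<in>carrier M. f (x \<oplus>\<^bsub>M\<^esub> y) = f x \<oplus>\<^bsub>N\<^esub> f y) \<and>
                  (\<forall>a\<in>carrier A. \<forall>x\<in>carrier M. f (a \<odot>\<^bsub>M\<^esub> x) = a \<odot>\<^bsub>N\<^esub> f x)},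
      mult = undefined, one = undefined,
      zero = (\<lambda>x\<in>carrier M. \<zero>\<^bsub>N\<^esub>),
      add = (\<lambda>f g. \<lambda>x\<in>carrier M. f x \<oplus>\<^bsub>N\<^esub> g x)\<rparr>"


section \<open>The first extension group\<close>

definition free_left_module :: "('b, 'r) ring_scheme \<Rightarrow> 'm set \<Rightarrow> ('b, 'm \<Rightarrow> 'b) module" where
  "free_left_module A S =
     \<lparr>carrier = {f. (\<forall>m\<in>S. f m \<in> carrier A) \<and> (\<forall>m. m \<notin> S \<longrightarrow> f m = \<zero>\<^bsub>A\<^esub>) \<and>
                    finite {m. f m \<noteq> \<zero>\<^bsub>A\<^esub>}},
      mult = undefined, one = undefined,
      zero = (\<lambda>m. \<zero>\<^bsub>A\<^esub>),
      add = (\<lambda>f g m. f m \<oplus>\<^bsub>A\<^esub> g m),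
      smult = (\<lambda>a f m. a \<otimes>\<^bsub>A\<^esub> f m)\<rparr>"

text \<open>
  The free presentation \<open>0 \<rightarrow> \<Omega> \<rightarrow> F \<rightarrow> M \<rightarrow> 0\<close>, where \<open>F\<close> is free on the underlying set of \<open>M\<close>.
\<close>

definition free_cover ::
  "('b, 'r) ring_scheme \<Rightarrow> ('b, 'm, 's) module_scheme \<Rightarrow> ('b, 'm \<Rightarrow> 'b) module" where
  "free_cover A M = free_left_module A (carrier M)"

definition free_cover_map ::
  "('b, 'r) ring_scheme \<Rightarrow> ('b, 'm, 's) module_scheme \<Rightarrow> ('m \<Rightarrow> 'b) \<Rightarrow> 'm" where
  "free_cover_map A M f = (\<Oplus>\<^bsub>M\<^esub>m\<in>{m. f m \<noteq> \<zero>\<^bsub>A\<^esub>}. f m \<odot>\<^bsub>M\<^esub> m)"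

definition syzygy ::
  "('b, 'r) ring_scheme \<Rightarrow> ('b, 'm, 's) module_scheme \<Rightarrow> ('b, 'm \<Rightarrow> 'b) module" where
  "syzygy A M = (free_cover A M)
     \<lparr>carrier := {f \<in> carrier (free_cover A M). free_cover_map A M f = \<zero>\<^bsub>M\<^esub>}\<rparr>"

text \<open>The endomorphism of \<open>F\<close> sending the basis element at \<open>m\<close> to the one at \<open>\<theta> m\<close>;
  it lifts an endomorphism \<open>\<theta>\<close> of \<open>M\<close>.\<close>

definition free_cover_lift ::
  "('b, 'r) ring_scheme \<Rightarrow> ('m \<Rightarrow> 'm) \<Rightarrow> ('m \<Rightarrow> 'b) \<Rightarrow> ('m \<Rightarrow> 'b)" where
  "free_cover_lift A \<theta> f = (\<lambda>m'. \<Oplus>\<^bsub>A\<^esub>m\<in>{m. f m \<noteq> \<zero>\<^bsub>A\<^esub> \<and> \<theta> m = m'}. f m)"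

definition ext1_boundaries ::
  "('b, 'r) ring_scheme \<Rightarrow> ('b, 'm, 's) module_scheme \<Rightarrow> ('b, 'n, 't) module_scheme \<Rightarrow>
   (('m \<Rightarrow> 'b) \<Rightarrow> 'n) set" where
  "ext1_boundaries A M N =
     (\<lambda>h. restrict h (carrier (syzygy A M))) ` carrier (left_homs A (free_cover A M) N)"

text \<open>
  \<open>Ext\<^sup>1(M, N)\<close> is the cokernel of the restriction map \<open>Hom(F, N) \<rightarrow> Hom(\<Omega>, N)\<close>.
  For bimodules \<open>M\<close>, \<open>N\<close> the left action of \<open>a\<close> is \<open>Ext\<^sup>1(\<theta>, N)\<close>, where \<open>\<theta>\<close> is the left module
  endomorphism \<open>m \<mapsto> m a\<close> of \<open>M\<close>; the right action of \<open>a\<close> is \<open>Ext\<^sup>1(M, \<theta>')\<close>, where \<open>\<theta>'\<close> is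
  \<open>n \<mapsto> n a\<close> on \<open>N\<close>.
\<close>

definition ext1_bimodule ::
  "('b, 'r) ring_scheme \<Rightarrow> ('b, 'm) bimodule \<Rightarrow> ('b, 'n) bimodule \<Rightarrow>
   ('b, (('m \<Rightarrow> 'b) \<Rightarrow> 'n) set) bimodule" where
  "ext1_bimodule A M N =
     (let \<Omega> = syzygy A M; H = left_homs A \<Omega> N; B = ext1_boundaries A M N in
      \<lparr>carrier = a_rcosets\<^bsub>H\<^esub> B, mult = undefined, one = undefined,
       zero = B,
       add = set_add H,
       smult = (\<lambda>a S. \<Union>\<phi>\<in>S. B +>\<^bsub>H\<^esub>
                  (\<lambda>\<omega>\<in>carrier \<Omega>. \<phi> (free_cover_lift A (\<lambda>m. rsmult M m a) \<omega>))),
       rsmult = (\<lambda>S a. \<Union>\<phi>\<in>S. B +>\<^bsub>H\<^esub> (\<lambda>\<omega>\<in>carrier \<Omega>. rsmult N (\<phi> \<omega>) a))\<rparr>)"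


section \<open>The tensor algebra of a bimodule\<close>

text \<open>
  For \<open>n \<ge> 1\<close> the \<open>n\<close>-th tensor power of \<open>V\<close> over \<open>B\<close> is the free abelian group on \<open>V\<^sup>n\<close> modulo
  the subgroup generated by the multiadditivity and the \<open>B\<close>-balancing relations.
\<close>

definition tensor_words :: "('b, 'v) bimodule \<Rightarrow> nat \<Rightarrow> 'v list set" where
  "tensor_words V n = {ws. set ws \<subseteq> carrier V \<and> length ws = n}"

inductive_set tensor_rels ::
  "('b, 'r) ring_scheme \<Rightarrow> ('b, 'v) bimodule \<Rightarrow> nat \<Rightarrow> ('v list \<Rightarrow>\<^sub>0 int) set"
  for B V n where
  zero: "0 \<in> tensor_rels B V n"
| diff: "\<lbrakk>f \<in> tensor_rels B V n; g \<in> tensor_rels B V n\<rbrakk> \<Longrightarrow> f - g \<in> tensor_rels B V n"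
| additive: "\<lbrakk>us @ v # ws \<in> tensor_words V n; v' \<in> carrier V\<rbrakk> \<Longrightarrow>
    frag_of (us @ (v \<oplus>\<^bsub>V\<^esub> v') # ws) - frag_of (us @ v # ws) - frag_of (us @ v' # ws)
      \<in> tensor_rels B V n"
| balanced: "\<lbrakk>us @ v # v' # ws \<in> tensor_words V n; b \<in> carrier B\<rbrakk> \<Longrightarrow>
    frag_of (us @ rsmult V v b # v' # ws) - frag_of (us @ v # (b \<odot>\<^bsub>V\<^esub> v') # ws)
      \<in> tensor_rels B V n"

definition tensor_power ::
  "('b, 'r) ring_scheme \<Rightarrow> ('b, 'v) bimodule \<Rightarrow> nat \<Rightarrow> ('v list \<Rightarrow>\<^sub>0 int) set set" where
  "tensor_power B V n = {f +o tensor_rels B V n | f. Poly_Mapping.keys f \<subseteq> tensor_words V n}"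

definition tensor_lact ::
  "('b, 'r) ring_scheme \<Rightarrow> ('b, 'v) bimodule \<Rightarrow> nat \<Rightarrow> 'b \<Rightarrow>
   ('v list \<Rightarrow>\<^sub>0 int) set \<Rightarrow> ('v list \<Rightarrow>\<^sub>0 int) set" where
  "tensor_lact B V n b S =
     (\<Union>f\<in>S. frag_extend (\<lambda>ws. frag_of ((b \<odot>\<^bsub>V\<^esub> hd ws) # tl ws)) f +o tensor_rels B V n)"

definition tensor_ract ::
  "('b, 'r) ring_scheme \<Rightarrow> ('b, 'v) bimodule \<Rightarrow> nat \<Rightarrow>
   ('v list \<Rightarrow>\<^sub>0 int) set \<Rightarrow> 'b \<Rightarrow> ('v list \<Rightarrow>\<^sub>0 int) set" where
  "tensor_ract B V n S b =
     (\<Union>f\<in>S. frag_extend (\<lambda>ws. frag_of (butlast ws @ [rsmult V (last ws) b])) f +o tensor_rels B V n)"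

definition tensor_concat ::
  "('b, 'r) ring_scheme \<Rightarrow> ('b, 'v) bimodule \<Rightarrow> nat \<Rightarrow>
   ('v list \<Rightarrow>\<^sub>0 int) set \<Rightarrow> ('v list \<Rightarrow>\<^sub>0 int) set \<Rightarrow> ('v list \<Rightarrow>\<^sub>0 int) set" where
  "tensor_concat B V n S T =
     (\<Union>f\<in>S. \<Union>g\<in>T. frag_extend (\<lambda>us. frag_extend (\<lambda>ws. frag_of (us @ ws)) g) f +o tensor_rels B V n)"

text \<open>
  An element of the tensor algebra is a pair \<open>(b, t)\<close> with \<open>b\<close> its component in degree \<open>0\<close> and
  \<open>t n\<close> its component in degree \<open>n \<ge> 1\<close>, a coset of \<^term>\<open>tensor_rels B V n\<close>. Sums of cosets
  are elementwise sums of sets. Scalars act through \<open>c \<mapsto> c \<cdot> 1\<^sub>B\<close>.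
\<close>

definition tensor_algebra ::
  "('k, 'b) module \<Rightarrow> ('b, 'v) bimodule \<Rightarrow> ('k, 'b \<times> (nat \<Rightarrow> ('v list \<Rightarrow>\<^sub>0 int) set)) module" where
  "tensor_algebra B V =
     \<lparr>carrier = {(b, t). b \<in> carrier B \<and> t \<in> (\<Pi>\<^sub>E n\<in>{1..}. tensor_power B V n) \<and>
                         finite {n \<in> {1..}. t n \<noteq> tensor_rels B V n}},
      mult = (\<lambda>(b, t) (b', t').
        (b \<otimes>\<^bsub>B\<^esub> b',
         \<lambda>n\<in>{1..}. tensor_lact B V n b (t' n) + tensor_ract B V n (t n) b'
                      + (\<Sum>i\<in>{1..<n}. tensor_concat B V n (t i) (t' (n - i))))),
      one = (\<one>\<^bsub>B\<^esub>, \<lambda>n\<in>{1..}. tensor_rels B V n),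
      zero = (\<zero>\<^bsub>B\<^esub>, \<lambda>n\<in>{1..}. tensor_rels B V n),
      add = (\<lambda>(b, t) (b', t'). (b \<oplus>\<^bsub>B\<^esub> b', \<lambda>n\<in>{1..}. t n + t' n)),
      smult = (\<lambda>c (b, t). (c \<odot>\<^bsub>B\<^esub> b, \<lambda>n\<in>{1..}. tensor_lact B V n (c \<odot>\<^bsub>B\<^esub> \<one>\<^bsub>B\<^esub>) (t n)))\<rparr>"

end

theory Submission
  imports Defs
begin

text \<open>
  Since the actions are free, the category is freely generated over its groups by the arrows, and all
  that is used about it are unique factorisation up to groups and cancellation. For such a category,
  with category algebra \<open>A\<close>, the first extension group of \<open>D(A)\<close> by \<open>A\<close> is the space of
  derivations \<open>A \<rightarrow> Hom(D(A), A)\<close> modulo inner ones. Modulo inner derivations, a derivation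
  vanishes on the groups; it is then determined by its values on the arrows, and these correspond to
  the elements of degree one in the double category, an element \<open>d x\<^sup>* e\<close> being the derivation
  that splits \<open>x\<close> out of a morphism. The inner derivations that vanish on the groups become the
  multiples of \<open>\<rho>\<close>. Finally, the double category is graded by the number of starred arrows, and its
  algebra is the tensor algebra over \<open>A\<close> of its degree one part, so dividing by \<open>\<rho>\<close> gives the
  tensor algebra of the extension group.
\<close>

section \<open>Category algebras\<close>

text \<open>The field is arbitrary: its characteristic may divide a group order, so derivations
  cannot be normalised by averaging. Freeness of the actions replaces this. The groups permute the
  morphisms freely, hence \<open>D(A)\<close> is free over the group algebras and the free cover has
  an equivariant linear section; a cocycle evaluated on the failure of that section to be
  \<open>A\<close>-linear is a derivation that vanishes on the groups. The relation comes from a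
  single map \<open>th\<close>, which turns the restriction of a functional to the groups into a
  group algebra element. Its commutator with \<open>A\<close> is the derivation of
  \<open>\<rho>\<close>, and every equivariant linear map from \<open>D(A)\<close> to
  \<open>A\<close> is a sum of maps \<open>\<xi> \<mapsto> th (\<xi> c) a\<close>; so two-sided
  multiples of \<open>\<rho>\<close> exhaust the trivial classes. Tensor powers are quotients of
  free abelian groups, without scalars or a basis at hand. The comparison map therefore starts at
  the double category and factors morphisms into pieces of degree one. Its laws hold modulo the
  tensor relations, its surjectivity yields the ring axioms of the target, and its inverse is built
  only modulo an ideal containing \<open>\<rho>\<close>.\<close>

abbreviation scal :: "'k::field \<Rightarrow> ('m \<Rightarrow>\<^sub>0 'k) \<Rightarrow> ('m \<Rightarrow>\<^sub>0 'k)" where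
  "scal c \<equiv> Poly_Mapping.map ((*) c)"

lemma lookup_scal [simp]: "Poly_Mapping.lookup (scal c f) a = c * Poly_Mapping.lookup f a"
  by (simp add: Poly_Mapping.map.rep_eq when_def)

lemma scal_single [simp]: "scal c (Poly_Mapping.single a k) = Poly_Mapping.single a (c * k)"
  by (rule poly_mapping_eqI) (simp add: lookup_single when_def)

lemma scal_add: "scal c (f + g) = scal c f + scal c g"
  by (rule poly_mapping_eqI) (simp add: lookup_add distrib_left)

lemma scal_add_left: "scal (c + d) f = scal c f + scal d f"
  by (rule poly_mapping_eqI) (simp add: lookup_add distrib_right)

lemma scal_uminus: "scal c (- f) = - scal c f"
  by (rule poly_mapping_eqI) simp

lemma scal_diff: "scal c (f - g) = scal c f - scal c g"
  by (rule poly_mapping_eqI) (simp add: lookup_minus right_diff_distrib)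

lemma scal_zero [simp]: "scal c 0 = 0" "scal 0 f = 0"
  by (rule poly_mapping_eqI, simp)+

lemma scal_one [simp]: "scal 1 f = f"
  by (rule poly_mapping_eqI) simp

lemma scal_scal: "scal c (scal d f) = scal (c * d) f"
  by (rule poly_mapping_eqI) (simp add: mult.assoc)

lemma scal_sum: "scal c (\<Sum>i\<in>I. f i) = (\<Sum>i\<in>I. scal c (f i))"
  by (rule poly_mapping_eqI) (simp add: lookup_sum sum_distrib_left)

lemma keys_scal: "Poly_Mapping.keys (scal c f) \<subseteq> Poly_Mapping.keys f"
  by (auto simp: in_keys_iff)

lemma keys_add_subset:
  "Poly_Mapping.keys f \<subseteq> M \<Longrightarrow> Poly_Mapping.keys g \<subseteq> M \<Longrightarrow> Poly_Mapping.keys (f + g) \<subseteq> M"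
  using keys_add[of f g] by blast

lemma keys_sum_subset:
  "(\<And>i. i \<in> I \<Longrightarrow> Poly_Mapping.keys (f i) \<subseteq> M) \<Longrightarrow> Poly_Mapping.keys (\<Sum>i\<in>I. f i) \<subseteq> M"
  using keys_sum[of f I] by blast

lemma pm_expand:
  fixes f :: "'m \<Rightarrow>\<^sub>0 'k::comm_monoid_add"
  assumes "finite S" "Poly_Mapping.keys f \<subseteq> S"
  shows "f = (\<Sum>a\<in>S. Poly_Mapping.single a (Poly_Mapping.lookup f a))"
proof (rule poly_mapping_eqI)
  fix b
  have "Poly_Mapping.lookup f b = (if b \<in> S then Poly_Mapping.lookup f b else 0)"
    using assms by (auto simp: in_keys_iff)
  also have "\<dots> = (\<Sum>a\<in>S. Poly_Mapping.lookup f a when a = b)"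
    using assms(1) by (simp add: when_def sum.delta')
  finally show "Poly_Mapping.lookup f b =
    Poly_Mapping.lookup (\<Sum>a\<in>S. Poly_Mapping.single a (Poly_Mapping.lookup f a)) b"
    by (simp add: lookup_sum lookup_single)
qed

text \<open>Linear identities in a category algebra are reduced to basis elements by this rule.
  Supports are tracked because the category laws hold only inside \<open>mor C\<close>.\<close>

lemma pm_induct [consumes 1, case_names zero single add]:
  fixes f :: "'m \<Rightarrow>\<^sub>0 'k::comm_monoid_add"
  assumes keys: "Poly_Mapping.keys f \<subseteq> M"
    and z: "P 0"
    and s: "\<And>a k. a \<in> M \<Longrightarrow> P (Poly_Mapping.single a k)"
    and a: "\<And>f g. Poly_Mapping.keys f \<subseteq> M \<Longrightarrow> Poly_Mapping.keys g \<subseteq> M \<Longrightarrow> P f \<Longrightarrow> P g \<Longrightarrow> P (f + g)"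
  shows "P f"
proof -
  have "P (\<Sum>a\<in>S. Poly_Mapping.single a (Poly_Mapping.lookup f a)) \<and>
        Poly_Mapping.keys (\<Sum>a\<in>S. Poly_Mapping.single a (Poly_Mapping.lookup f a)) \<subseteq> M"
    if "finite S" "S \<subseteq> M" for S
    using that
  proof induction
    case (insert x F)
    have "Poly_Mapping.keys (Poly_Mapping.single x (Poly_Mapping.lookup f x)) \<subseteq> M"
      using insert by simp
    then show ?case
      using insert by (simp add: a s keys_add_subset)
  qed (simp add: z)
  from this[OF finite_keys keys] show ?thesis
    using pm_expand[OF finite_keys subset_refl, of f] by simp
qed

text \<open>The product of \<open>category_algebra\<close> under its own name, so that bilinearity
  is available for arbitrary records, before any category law is assumed.\<close>

definition cmul :: "('o, 'm) category \<Rightarrow> ('m \<Rightarrow>\<^sub>0 'k::field) \<Rightarrow> ('m \<Rightarrow>\<^sub>0 'k) \<Rightarrow> ('m \<Rightarrow>\<^sub>0 'k)" where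
  "cmul C f g = (\<Sum>a\<in>Poly_Mapping.keys f. \<Sum>b\<in>Poly_Mapping.keys g.
                if src C a = trg C b
                then Poly_Mapping.single (comp C a b)
                       (Poly_Mapping.lookup f a * Poly_Mapping.lookup g b)
                else 0)"

definition cone :: "('o, 'm) category \<Rightarrow> ('m \<Rightarrow>\<^sub>0 'k::field)" where
  "cone C = (\<Sum>i\<in>obj C. Poly_Mapping.single (ident C i) 1)"

lemma category_algebra_simps [simp]:
  "carrier (category_algebra C) = {f. Poly_Mapping.keys f \<subseteq> mor C}"
  "mult (category_algebra C) = cmul C"
  "one (category_algebra C) = cone C"
  "zero (category_algebra C) = 0"
  "add (category_algebra C) = (+)"
  "smult (category_algebra C) = scal"
  by (auto simp: category_algebra_def cmul_def cone_def fun_eq_iff)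

text \<open>Enlarging the supports adds only zero terms. Bilinearity needs one index set for two
  summands whose supports differ.\<close>

lemma cmul_eq:
  assumes "finite S" "Poly_Mapping.keys f \<subseteq> S" "finite T" "Poly_Mapping.keys g \<subseteq> T"
  shows "cmul C f g = (\<Sum>a\<in>S. \<Sum>b\<in>T.
                if src C a = trg C b
                then Poly_Mapping.single (comp C a b)
                       (Poly_Mapping.lookup f a * Poly_Mapping.lookup g b)
                else 0)"
proof -
  have 1: "(\<Sum>b\<in>Poly_Mapping.keys g. if src C a = trg C b
                then Poly_Mapping.single (comp C a b)
                       (Poly_Mapping.lookup f a * Poly_Mapping.lookup g b) else 0) =
        (\<Sum>b\<in>T. if src C a = trg C b
                then Poly_Mapping.single (comp C a b)
                       (Poly_Mapping.lookup f a * Poly_Mapping.lookup g b) else 0)" for a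
    using assms by (intro sum.mono_neutral_left) (auto simp: in_keys_iff)
  show ?thesis
    unfolding cmul_def 1
    using assms by (intro sum.mono_neutral_left) (auto simp: in_keys_iff intro!: sum.neutral)
qed

lemma cmul_add_left: "cmul C (f + g) h = cmul C f h + cmul C g h"
proof -
  let ?S = "Poly_Mapping.keys f \<union> Poly_Mapping.keys g"
  have k: "Poly_Mapping.keys (f + g) \<subseteq> ?S" by (rule keys_add)
  show ?thesis
    apply (subst (1 2 3) cmul_eq[of ?S _ "Poly_Mapping.keys h"])
    using k by (auto simp: sum.distrib[symmetric] lookup_add distrib_right single_add intro!: sum.cong)
qed

lemma cmul_add_right: "cmul C h (f + g) = cmul C h f + cmul C h g"
proof -
  let ?S = "Poly_Mapping.keys f \<union> Poly_Mapping.keys g"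
  have k: "Poly_Mapping.keys (f + g) \<subseteq> ?S" by (rule keys_add)
  show ?thesis
    apply (subst (1 2 3) cmul_eq[of "Poly_Mapping.keys h" _ ?S])
    using k by (auto simp: sum.distrib[symmetric] lookup_add distrib_left single_add intro!: sum.cong)
qed

lemma cmul_zero [simp]: "cmul C 0 f = 0" "cmul C f 0 = 0"
  by (simp_all add: cmul_def)

lemma cmul_uminus: "cmul C (- f) g = - cmul C f g" "cmul C f (- g) = - cmul C f g"
  using cmul_add_left[of C f "- f" g] cmul_add_right[of C f g "- g"]
  by (simp_all add: eq_neg_iff_add_eq_0 add.commute)

lemma cmul_diff_left: "cmul C (f - g) h = cmul C f h - cmul C g h"
  using cmul_add_left[of C f "- g" h] by (simp add: cmul_uminus)

lemma cmul_diff_right: "cmul C h (f - g) = cmul C h f - cmul C h g"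
  using cmul_add_right[of C h f "- g"] by (simp add: cmul_uminus)

lemma cmul_sum_left: "cmul C (\<Sum>i\<in>I. f i) g = (\<Sum>i\<in>I. cmul C (f i) g)"
  by (induction I rule: infinite_finite_induct) (auto simp: cmul_add_left)

lemma cmul_sum_right: "cmul C f (\<Sum>i\<in>I. g i) = (\<Sum>i\<in>I. cmul C f (g i))"
  by (induction I rule: infinite_finite_induct) (auto simp: cmul_add_right)

lemma cmul_single: "cmul C (Poly_Mapping.single a k) (Poly_Mapping.single b l) =
   (if src C a = trg C b then Poly_Mapping.single (comp C a b) (k * l) else 0)"
  by (subst cmul_eq[of "{a}" _ "{b}"]) auto

lemma cmul_scal_left: "cmul C (scal c f) g = scal c (cmul C f g)"
proof -
  show ?thesis
    apply (subst cmul_eq[of "Poly_Mapping.keys f" _ "Poly_Mapping.keys g"])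
    using keys_scal[of c f] by (auto simp: cmul_def scal_sum mult.assoc intro!: sum.cong)
qed

lemma cmul_scal_right: "cmul C f (scal c g) = scal c (cmul C f g)"
proof -
  show ?thesis
    apply (subst cmul_eq[of "Poly_Mapping.keys f" _ "Poly_Mapping.keys g"])
    using keys_scal[of c g] by (auto simp: cmul_def scal_sum algebra_simps intro!: sum.cong)
qed

text \<open>Finitely many objects are enough for a unit, the sum of the identities. Morphisms may be
  infinite in number, as they are in the double of an EI quiver with at least one arrow.\<close>

locale cat =
  fixes C :: "('o, 'm) category"
  assumes finite_obj: "finite (obj C)"
    and src_obj [simp]: "a \<in> mor C \<Longrightarrow> src C a \<in> obj C"
    and trg_obj [simp]: "a \<in> mor C \<Longrightarrow> trg C a \<in> obj C"
    and ident_mor [simp]: "i \<in> obj C \<Longrightarrow> ident C i \<in> mor C"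
    and src_ident [simp]: "i \<in> obj C \<Longrightarrow> src C (ident C i) = i"
    and trg_ident [simp]: "i \<in> obj C \<Longrightarrow> trg C (ident C i) = i"
    and comp_mor [simp]: "\<lbrakk>a \<in> mor C; b \<in> mor C; src C a = trg C b\<rbrakk> \<Longrightarrow> comp C a b \<in> mor C"
    and src_comp [simp]: "\<lbrakk>a \<in> mor C; b \<in> mor C; src C a = trg C b\<rbrakk> \<Longrightarrow> src C (comp C a b) = src C b"
    and trg_comp [simp]: "\<lbrakk>a \<in> mor C; b \<in> mor C; src C a = trg C b\<rbrakk> \<Longrightarrow> trg C (comp C a b) = trg C a"
    and comp_assoc: "\<lbrakk>a \<in> mor C; b \<in> mor C; c \<in> mor C; src C a = trg C b; src C b = trg C c\<rbrakk>
      \<Longrightarrow> comp C (comp C a b) c = comp C a (comp C b c)"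
    and comp_ident_left [simp]: "\<lbrakk>a \<in> mor C; trg C a = i\<rbrakk> \<Longrightarrow> comp C (ident C i) a = a"
    and comp_ident_right [simp]: "\<lbrakk>a \<in> mor C; src C a = i\<rbrakk> \<Longrightarrow> comp C a (ident C i) = a"
begin

lemma cmul_closed:
  assumes "Poly_Mapping.keys f \<subseteq> mor C" "Poly_Mapping.keys g \<subseteq> mor C"
  shows "Poly_Mapping.keys (cmul C f g) \<subseteq> mor C"
  unfolding cmul_def using assms by (intro keys_sum_subset) (auto simp: subset_iff)

lemma cone_closed: "Poly_Mapping.keys (cone C) \<subseteq> mor C"
  unfolding cone_def by (intro keys_sum_subset) auto

lemma cmul_assoc:
  assumes "Poly_Mapping.keys f \<subseteq> mor C" "Poly_Mapping.keys g \<subseteq> mor C" "Poly_Mapping.keys h \<subseteq> mor C"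
  shows "cmul C (cmul C f g) h = cmul C f (cmul C g h)"
  using assms(1)
proof (induction rule: pm_induct)
  case (single a k)
  note a = this
  show ?case using assms(2)
  proof (induction rule: pm_induct)
    case (single b l)
    note b = this
    show ?case using assms(3)
    proof (induction rule: pm_induct)
      case (single c m)
      then show ?case using a b by (auto simp: cmul_single comp_assoc mult.assoc)
    qed (auto simp: cmul_add_right)
  qed (auto simp: cmul_add_right cmul_add_left)
qed (auto simp: cmul_add_left)

lemma cmul_cone_left:
  assumes "Poly_Mapping.keys f \<subseteq> mor C"
  shows "cmul C (cone C) f = f"
  using assms
proof (induction rule: pm_induct)
  case (single a k)
  have "cmul C (cone C) (Poly_Mapping.single a k) =
    (\<Sum>i\<in>obj C. if i = trg C a then Poly_Mapping.single a k else 0)"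
    unfolding cone_def cmul_sum_left using single by (intro sum.cong) (auto simp: cmul_single)
  then show ?case using single by (simp add: finite_obj)
qed (auto simp: cmul_add_right)

lemma cmul_cone_right:
  assumes "Poly_Mapping.keys f \<subseteq> mor C"
  shows "cmul C f (cone C) = f"
  using assms
proof (induction rule: pm_induct)
  case (single a k)
  have "cmul C (Poly_Mapping.single a k) (cone C) =
    (\<Sum>i\<in>obj C. if src C a = i then Poly_Mapping.single a k else 0)"
    unfolding cone_def cmul_sum_right using single by (intro sum.cong) (auto simp: cmul_single)
  then show ?case using single by (simp add: finite_obj)
qed (auto simp: cmul_add_left)

lemma category_algebra_ring: "ring (category_algebra C :: ('k::field, 'm \<Rightarrow>\<^sub>0 'k) module)"
proof (intro ringI abelian_groupI monoidI, goal_cases)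
  case (6 x)
  then show ?case
    by (auto intro!: exI[of _ "- x"])
qed (auto simp: cmul_assoc cmul_cone_left cmul_cone_right cmul_add_left cmul_add_right add.assoc
      add.commute dest: subsetD[OF keys_add] subsetD[OF cmul_closed] subsetD[OF cone_closed])

end

section \<open>The first extension group by derivations\<close>

text \<open>
  The last three axioms say that the category is freely generated, over its groups, by bisets with
  free actions on both sides.
\<close>

locale free_cat = cat C for C :: "('o, 'm) category" +
  fixes len :: "'m \<Rightarrow> nat"
  assumes finite_mor: "finite (mor C)"
    and len_comp [simp]: "\<lbrakk>a \<in> mor C; b \<in> mor C; src C a = trg C b\<rbrakk> \<Longrightarrow> len (comp C a b) = len a + len b"
    and len_ident [simp]: "i \<in> obj C \<Longrightarrow> len (ident C i) = 0"
    and len0_src: "\<lbrakk>a \<in> mor C; len a = 0\<rbrakk> \<Longrightarrow> trg C a = src C a"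
    and len0_inv: "\<lbrakk>a \<in> mor C; len a = 0\<rbrakk> \<Longrightarrow> \<exists>b\<in>mor C. len b = 0 \<and> src C b = src C a \<and>
        comp C a b = ident C (src C a) \<and> comp C b a = ident C (src C a)"
    and factor: "\<lbrakk>a \<in> mor C; len a = Suc n\<rbrakk> \<Longrightarrow>
        \<exists>x\<in>mor C. \<exists>c\<in>mor C. len x = 1 \<and> src C x = trg C c \<and> a = comp C x c"
    and levi: "\<lbrakk>a \<in> mor C; b \<in> mor C; a' \<in> mor C; b' \<in> mor C; src C a = trg C b; src C a' = trg C b';
        comp C a b = comp C a' b'; len b \<le> len b'\<rbrakk> \<Longrightarrow>
        \<exists>r\<in>mor C. src C r = trg C b \<and> trg C r = src C a' \<and> a = comp C a' r \<and> b' = comp C r b"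
    and cancel_left: "\<lbrakk>a \<in> mor C; b \<in> mor C; b' \<in> mor C; src C a = trg C b; src C a = trg C b';
        comp C a b = comp C a b'\<rbrakk> \<Longrightarrow> b = b'"
    and cancel_right: "\<lbrakk>a \<in> mor C; a' \<in> mor C; b \<in> mor C; src C a = trg C b; src C a' = trg C b;
        comp C a b = comp C a' b\<rbrakk> \<Longrightarrow> a = a'"
begin

definition linv :: "'m \<Rightarrow> 'm" where
  "linv a = (SOME b. b \<in> mor C \<and> len b = 0 \<and> src C b = src C a \<and>
        comp C a b = ident C (src C a) \<and> comp C b a = ident C (src C a))"

lemma linv:
  assumes "a \<in> mor C" "len a = 0"
  shows "linv a \<in> mor C" "len (linv a) = 0" "src C (linv a) = src C a" "trg C (linv a) = src C a"
    "comp C a (linv a) = ident C (src C a)" "comp C (linv a) a = ident C (src C a)"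
proof -
  have *: "linv a \<in> mor C \<and> len (linv a) = 0 \<and> src C (linv a) = src C a \<and>
        comp C a (linv a) = ident C (src C a) \<and> comp C (linv a) a = ident C (src C a)"
    unfolding linv_def by (rule someI_ex) (use len0_inv[OF assms] in \<open>simp add: Bex_def\<close>)
  then show "linv a \<in> mor C" "len (linv a) = 0" "src C (linv a) = src C a"
    "comp C a (linv a) = ident C (src C a)" "comp C (linv a) a = ident C (src C a)"
    by auto
  with * show "trg C (linv a) = src C a" using len0_src by metis
qed

section \<open>Orbits under right multiplication by invertible morphisms, and their
  representatives\<close>

definition orbit :: "'m \<Rightarrow> 'm set" where
  "orbit d = {comp C d h | h. h \<in> mor C \<and> len h = 0 \<and> trg C h = src C d}"

text \<open>The choice is made from the orbit as a set, so that all members of an orbit get the same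
  representative.\<close>

definition rp :: "'m \<Rightarrow> 'm" where
  "rp d = (SOME c. c \<in> orbit d)"

text \<open>The element is unique by left cancellation, which yields its transformation rule
  \<open>gp_comp\<close>.\<close>

definition gp :: "'m \<Rightarrow> 'm" where
  "gp d = (SOME h. h \<in> mor C \<and> len h = 0 \<and> trg C h = src C d \<and> comp C d h = rp d)"

lemma gp:
  assumes "d \<in> mor C"
  shows "gp d \<in> mor C" "len (gp d) = 0" "trg C (gp d) = src C d" "src C (gp d) = src C d"
    "comp C d (gp d) = rp d" "rp d \<in> mor C" "src C (rp d) = src C d"
proof -
  have "comp C d (ident C (src C d)) \<in> orbit d"
    unfolding orbit_def using assms by (intro CollectI exI[of _ "ident C (src C d)"]) simp
  then have "rp d \<in> orbit d" unfolding rp_def by (rule someI)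
  then have "\<exists>h. h \<in> mor C \<and> len h = 0 \<and> trg C h = src C d \<and> comp C d h = rp d"
    by (auto simp: orbit_def)
  from someI_ex[OF this, folded gp_def]
  show "gp d \<in> mor C" "len (gp d) = 0" "trg C (gp d) = src C d" "comp C d (gp d) = rp d" by auto
  then show "src C (gp d) = src C d" using len0_src by metis
  show "rp d \<in> mor C" "src C (rp d) = src C d"
    using \<open>comp C d (gp d) = rp d\<close>[symmetric] \<open>src C (gp d) = src C d\<close> \<open>trg C (gp d) = src C d\<close>
      \<open>gp d \<in> mor C\<close> assms by auto
qed

text \<open>An invertible \<open>g\<close> leaves the orbit of \<open>d\<close> unchanged, and the
  chosen representative depends on the orbit alone.\<close>

lemma rp_comp:
  assumes d: "d \<in> mor C" and g: "g \<in> mor C" "len g = 0" "trg C g = src C d"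
  shows "rp (comp C d g) = rp d"
proof -
  have sg: "src C g = trg C g" using len0_src g by metis
  have "orbit (comp C d g) = orbit d"
  proof (intro Set.set_eqI iffI)
    fix c assume "c \<in> orbit (comp C d g)"
    then obtain h where h: "h \<in> mor C" "len h = 0" "trg C h = src C g" "c = comp C (comp C d g) h"
      using assms by (auto simp: orbit_def)
    show "c \<in> orbit d"
      unfolding orbit_def using assms h by (auto intro!: exI[of _ "comp C g h"] simp: comp_assoc)
  next
    fix c assume "c \<in> orbit d"
    then obtain h where h: "h \<in> mor C" "len h = 0" "trg C h = src C d" "c = comp C d h"
      using assms by (auto simp: orbit_def)
    have "comp C d h = comp C (comp C d g) (comp C (linv g) h)"
      using assms h linv[OF g(1,2)] sg
      by (simp add: comp_assoc comp_assoc[of g "linv g" h, symmetric])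
    then show "c \<in> orbit (comp C d g)"
      unfolding orbit_def using assms h linv[OF g(1,2)] sg
      by (auto intro!: exI[of _ "comp C (linv g) h"])
  qed
  then show ?thesis by (simp add: rp_def)
qed

text \<open>Both sides carry \<open>d\<close> to the common representative of \<open>d\<close> and
  \<open>d g\<close>, so \<open>d\<close> can be cancelled.\<close>

lemma gp_comp:
  assumes d: "d \<in> mor C" and g: "g \<in> mor C" "len g = 0" "trg C g = src C d"
  shows "comp C g (gp (comp C d g)) = gp d"
proof (rule cancel_left[OF d])
  have sg: "src C g = trg C g" using len0_src g by metis
  note G = gp[of "comp C d g"] gp[of d]
  show "comp C g (gp (comp C d g)) \<in> mor C" "gp d \<in> mor C"
    "src C d = trg C (comp C g (gp (comp C d g)))" "src C d = trg C (gp d)"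
    using assms G by auto
  show "comp C d (comp C g (gp (comp C d g))) = comp C d (gp d)"
    using assms G rp_comp[OF assms] by (simp add: comp_assoc[symmetric])
qed

end

section \<open>The dual bimodule of the category algebra and its dual basis\<close>

locale alg_cat = free_cat C len for C :: "('o, 'm) category" and len +
  fixes kty :: "'k::field itself"
begin

abbreviation A :: "('k, 'm \<Rightarrow>\<^sub>0 'k) module" where
  "A \<equiv> category_algebra C"

abbreviation kC :: "('m \<Rightarrow>\<^sub>0 'k) set" where
  "kC \<equiv> {f. Poly_Mapping.keys f \<subseteq> mor C}"

abbreviation bs :: "'m \<Rightarrow> ('m \<Rightarrow>\<^sub>0 'k)" where
  "bs c \<equiv> Poly_Mapping.single c 1"

abbreviation dual :: "('m \<Rightarrow>\<^sub>0 'k, ('m \<Rightarrow>\<^sub>0 'k) \<Rightarrow> 'k) bimodule" where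
  "dual \<equiv> dual_bimodule A"

abbreviation DA :: "(('m \<Rightarrow>\<^sub>0 'k) \<Rightarrow> 'k) set" where
  "DA \<equiv> carrier dual"

abbreviation la :: "('m \<Rightarrow>\<^sub>0 'k) \<Rightarrow> (('m \<Rightarrow>\<^sub>0 'k) \<Rightarrow> 'k) \<Rightarrow> ('m \<Rightarrow>\<^sub>0 'k) \<Rightarrow> 'k" where
  "la \<equiv> smult dual"

abbreviation ra :: "(('m \<Rightarrow>\<^sub>0 'k) \<Rightarrow> 'k) \<Rightarrow> ('m \<Rightarrow>\<^sub>0 'k) \<Rightarrow> ('m \<Rightarrow>\<^sub>0 'k) \<Rightarrow> 'k" where
  "ra \<equiv> rsmult dual"

text \<open>The record \<open>dual\<close> carries only the actions of \<open>A\<close>, so the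
  field gets an operation of its own; \<open>ds_la\<close> identifies it with the action of
  multiples of the unit.\<close>

definition ds :: "'k \<Rightarrow> (('m \<Rightarrow>\<^sub>0 'k) \<Rightarrow> 'k) \<Rightarrow> ('m \<Rightarrow>\<^sub>0 'k) \<Rightarrow> 'k" where
  "ds k \<xi> = (\<lambda>x\<in>kC. k * \<xi> x)"

text \<open>The basis of the dual that is dual to the morphisms; see
  \<open>lin_expand\<close>.\<close>

definition dl :: "'m \<Rightarrow> ('m \<Rightarrow>\<^sub>0 'k) \<Rightarrow> 'k" where
  "dl d = (\<lambda>x\<in>kC. Poly_Mapping.lookup x d)"

lemma kC_add [simp]: "a \<in> kC \<Longrightarrow> b \<in> kC \<Longrightarrow> a + b \<in> kC"
  by (simp add: keys_add_subset)

lemma kC_diff [simp]: "a \<in> kC \<Longrightarrow> b \<in> kC \<Longrightarrow> a - b \<in> kC"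
  using keys_diff[of a b] by auto

lemma kC_cmul [simp]: "a \<in> kC \<Longrightarrow> b \<in> kC \<Longrightarrow> cmul C a b \<in> kC"
  by (simp add: cmul_closed)

lemma kC_scal [simp]: "a \<in> kC \<Longrightarrow> scal k a \<in> kC"
  using keys_scal[of k a] by auto

lemma kC_sum: "(\<And>i. i \<in> I \<Longrightarrow> a i \<in> kC) \<Longrightarrow> sum a I \<in> kC"
  by (simp add: keys_sum_subset)

lemma kC_basic [simp]: "0 \<in> kC" "cone C \<in> kC" "c \<in> mor C \<Longrightarrow> Poly_Mapping.single c k \<in> kC"
  by (simp_all add: cone_closed)

lemma dual_iff: "\<xi> \<in> DA \<longleftrightarrow> \<xi> \<in> extensional kC \<and>
   (\<forall>x\<in>kC. \<forall>y\<in>kC. \<xi> (x + y) = \<xi> x + \<xi> y) \<and> (\<forall>c. \<forall>x\<in>kC. \<xi> (scal c x) = c * \<xi> x)"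
  by (simp add: dual_bimodule_def)

lemma dual_ops:
  "zero dual = (\<lambda>x\<in>kC. 0)"
  "add dual \<xi> \<zeta> = (\<lambda>x\<in>kC. \<xi> x + \<zeta> x)"
  "la a \<xi> = (\<lambda>x\<in>kC. \<xi> (cmul C x a))"
  "ra \<xi> a = (\<lambda>x\<in>kC. \<xi> (cmul C a x))"
  by (simp_all add: dual_bimodule_def)

lemma dual_add: "\<xi> \<in> DA \<Longrightarrow> x \<in> kC \<Longrightarrow> y \<in> kC \<Longrightarrow> \<xi> (x + y) = \<xi> x + \<xi> y"
  by (simp add: dual_iff)

lemma dual_scal: "\<xi> \<in> DA \<Longrightarrow> x \<in> kC \<Longrightarrow> \<xi> (scal c x) = c * \<xi> x"
  by (simp add: dual_iff)

lemma dual_zero: "\<xi> \<in> DA \<Longrightarrow> \<xi> 0 = 0"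
  using dual_scal[of \<xi> 0 0] by simp

lemma dual_ext:
  assumes "\<xi> \<in> DA" "\<zeta> \<in> DA" "\<And>c. c \<in> mor C \<Longrightarrow> \<xi> (bs c) = \<zeta> (bs c)"
  shows "\<xi> = \<zeta>"
proof (rule extensionalityI[of _ kC])
  fix x :: "'m \<Rightarrow>\<^sub>0 'k" assume "x \<in> kC"
  then have "Poly_Mapping.keys x \<subseteq> mor C" by simp
  then show "\<xi> x = \<zeta> x"
  proof (induction rule: pm_induct)
    case (single a k)
    then show ?case
      using dual_scal[of \<xi> "bs a" k] dual_scal[of \<zeta> "bs a" k] assms by simp
  next
    case zero
    then show ?case using assms by (simp add: dual_zero)
  next
    case (add f g)
    then show ?case using assms by (simp add: dual_add)
  qed
qed (use assms in \<open>auto simp: dual_iff\<close>)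

lemma dual_apply [simp]:
  assumes "Poly_Mapping.keys x \<subseteq> mor C"
  shows "(\<xi> \<oplus>\<^bsub>dual\<^esub> \<zeta>) x = \<xi> x + \<zeta> x" "\<zero>\<^bsub>dual\<^esub> x = 0" "la a \<xi> x = \<xi> (cmul C x a)"
    "ra \<xi> a x = \<xi> (cmul C a x)" "ds k \<xi> x = k * \<xi> x" "dl d x = Poly_Mapping.lookup x d"
  using assms by (simp_all add: dual_ops ds_def dl_def)

lemma dualI:
  assumes "\<xi> = (\<lambda>x\<in>kC. h x)"
    and "\<And>x y. Poly_Mapping.keys x \<subseteq> mor C \<Longrightarrow> Poly_Mapping.keys y \<subseteq> mor C \<Longrightarrow> h (x + y) = h x + h y"
    and "\<And>c x. Poly_Mapping.keys x \<subseteq> mor C \<Longrightarrow> h (scal c x) = c * h x"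
  shows "\<xi> \<in> DA"
  unfolding dual_iff assms(1)
  using kC_add kC_scal by (simp add: assms(2,3))

lemma dual_add_closed [simp]: "\<xi> \<in> DA \<Longrightarrow> \<zeta> \<in> DA \<Longrightarrow> \<xi> \<oplus>\<^bsub>dual\<^esub> \<zeta> \<in> DA"
  by (rule dualI[OF dual_ops(2)]) (simp_all add: dual_add dual_scal algebra_simps)

lemma dual_zero_closed [simp]: "\<zero>\<^bsub>dual\<^esub> \<in> DA"
  by (rule dualI[OF dual_ops(1)]) simp_all

lemma ds_closed [simp]: "\<xi> \<in> DA \<Longrightarrow> ds k \<xi> \<in> DA"
  by (rule dualI[OF ds_def]) (simp_all add: dual_add dual_scal algebra_simps)

lemma dl_closed [simp]: "dl d \<in> DA"
  by (rule dualI[OF dl_def]) (simp_all add: lookup_add)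

lemma la_closed [simp]: "\<xi> \<in> DA \<Longrightarrow> Poly_Mapping.keys a \<subseteq> mor C \<Longrightarrow> la a \<xi> \<in> DA"
  by (rule dualI[OF dual_ops(3)]) (simp_all add: dual_add dual_scal cmul_closed cmul_add_left cmul_scal_left)

lemma ra_closed [simp]: "\<xi> \<in> DA \<Longrightarrow> Poly_Mapping.keys a \<subseteq> mor C \<Longrightarrow> ra \<xi> a \<in> DA"
  by (rule dualI[OF dual_ops(4)]) (simp_all add: dual_add dual_scal cmul_closed cmul_add_right cmul_scal_right)

lemma dual_abelian_monoid: "abelian_monoid dual"
proof (rule abelian_monoidI)
  fix \<xi> \<zeta> \<chi> assume *: "\<xi> \<in> DA" "\<zeta> \<in> DA" "\<chi> \<in> DA"
  show "\<xi> \<oplus>\<^bsub>dual\<^esub> \<zeta> \<oplus>\<^bsub>dual\<^esub> \<chi> = \<xi> \<oplus>\<^bsub>dual\<^esub> (\<zeta> \<oplus>\<^bsub>dual\<^esub> \<chi>)"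
    by (rule dual_ext) (simp_all add: * add.assoc)
next
  fix \<xi> assume *: "\<xi> \<in> DA"
  show "\<zero>\<^bsub>dual\<^esub> \<oplus>\<^bsub>dual\<^esub> \<xi> = \<xi>"
    by (rule dual_ext) (simp_all add: *)
next
  fix \<xi> \<zeta> assume *: "\<xi> \<in> DA" "\<zeta> \<in> DA"
  show "\<xi> \<oplus>\<^bsub>dual\<^esub> \<zeta> = \<zeta> \<oplus>\<^bsub>dual\<^esub> \<xi>"
    by (rule dual_ext) (simp_all add: * add.commute)
qed simp_all

lemma la_la: "\<xi> \<in> DA \<Longrightarrow> a \<in> kC \<Longrightarrow> b \<in> kC \<Longrightarrow> la (cmul C a b) \<xi> = la a (la b \<xi>)"
  and ra_la: "\<xi> \<in> DA \<Longrightarrow> a \<in> kC \<Longrightarrow> b \<in> kC \<Longrightarrow> ra (la a \<xi>) b = la a (ra \<xi> b)"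
  and la_add_left: "\<xi> \<in> DA \<Longrightarrow> a \<in> kC \<Longrightarrow> b \<in> kC \<Longrightarrow> la (a + b) \<xi> = la a \<xi> \<oplus>\<^bsub>dual\<^esub> la b \<xi>"
  and la_add_right: "\<xi> \<in> DA \<Longrightarrow> \<zeta> \<in> DA \<Longrightarrow> a \<in> kC \<Longrightarrow> la a (\<xi> \<oplus>\<^bsub>dual\<^esub> \<zeta>) = la a \<xi> \<oplus>\<^bsub>dual\<^esub> la a \<zeta>"
  and ra_add_left: "\<xi> \<in> DA \<Longrightarrow> \<zeta> \<in> DA \<Longrightarrow> a \<in> kC \<Longrightarrow> ra (\<xi> \<oplus>\<^bsub>dual\<^esub> \<zeta>) a = ra \<xi> a \<oplus>\<^bsub>dual\<^esub> ra \<zeta> a"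
  and la_scal: "\<xi> \<in> DA \<Longrightarrow> a \<in> kC \<Longrightarrow> la (scal k a) \<xi> = ds k (la a \<xi>)"
  and ra_ds: "\<xi> \<in> DA \<Longrightarrow> a \<in> kC \<Longrightarrow> ra (ds k \<xi>) a = ds k (ra \<xi> a)"
  unfolding dual_ops ds_def
  by (rule restrict_ext, simp add: cmul_closed cmul_assoc cmul_add_right cmul_scal_right dual_add dual_scal)+

lemma la_one: "\<xi> \<in> DA \<Longrightarrow> la (cone C) \<xi> = \<xi>"
  by (rule dual_ext) (simp_all add: cone_closed cmul_cone_right)

lemma ds_la: "\<xi> \<in> DA \<Longrightarrow> ds k \<xi> = la (scal k (cone C)) \<xi>"
  using la_scal[of \<xi> "cone C" k] by (simp add: la_one cone_closed)

lemma la_dl_single: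
  assumes "c \<in> mor C" "d \<in> mor C" "x \<in> mor C"
  shows "la (bs c) (dl d) (bs x) = (if src C x = trg C c \<and> comp C x c = d then 1 else 0)"
  using assms by (auto simp: dual_ops dl_def cmul_single lookup_single)

section \<open>Linear maps from the dual to the algebra, and derivations with values in such
  maps\<close>

definition lin :: "((('m \<Rightarrow>\<^sub>0 'k) \<Rightarrow> 'k) \<Rightarrow> ('m \<Rightarrow>\<^sub>0 'k)) \<Rightarrow> bool" where
  "lin \<theta> \<longleftrightarrow> (\<forall>\<xi>\<in>DA. \<theta> \<xi> \<in> kC \<and> (\<forall>k. \<theta> (ds k \<xi>) = scal k (\<theta> \<xi>)) \<and>
      (\<forall>\<zeta>\<in>DA. \<theta> (\<xi> \<oplus>\<^bsub>dual\<^esub> \<zeta>) = \<theta> \<xi> + \<theta> \<zeta>))"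

text \<open>Finiteness of \<open>mor C\<close> makes the functionals \<open>dl d\<close> a basis of
  the dual, with the values \<open>\<xi> (bs d)\<close> as coordinates.\<close>

lemma lin_expand:
  assumes \<theta>: "lin \<theta>" and \<xi>: "\<xi> \<in> DA"
  shows "\<theta> \<xi> = (\<Sum>d\<in>mor C. scal (\<xi> (bs d)) (\<theta> (dl d)))"
proof -
  \<comment> \<open>Partial sums of the expansion of \<open>\<xi>\<close>. They allow an induction
    over finite index sets without finite sums in the record \<open>dual\<close>.\<close>
  define p where "p S = (\<lambda>x\<in>kC. \<Sum>d\<in>S. \<xi> (bs d) * Poly_Mapping.lookup x d)" for S
  have p: "p S \<in> DA" for S
    by (rule dualI[OF p_def]) (simp_all add: lookup_add sum_distrib_left algebra_simps sum.distrib)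
  have "\<theta> (p S) = (\<Sum>d\<in>S. scal (\<xi> (bs d)) (\<theta> (dl d)))" if "finite S" for S
    using that
  proof induction
    case empty
    have "p {} = ds 0 \<xi>" by (auto simp: p_def ds_def)
    then show ?case using \<theta> \<xi> by (simp add: lin_def)
  next
    case (insert d S)
    have "p (insert d S) = ds (\<xi> (bs d)) (dl d) \<oplus>\<^bsub>dual\<^esub> p S"
      using insert by (auto simp: p_def ds_def dl_def dual_ops fun_eq_iff)
    then show ?case using insert \<theta> p by (simp add: lin_def)
  qed
  moreover have "p (mor C) = \<xi>"
    by (rule dual_ext[OF p \<xi>]) (simp add: p_def lookup_single when_def finite_mor if_distrib sum.delta' cong: if_cong)
  ultimately show ?thesis using finite_mor by metis
qed

text \<open>A map from \<open>A\<close> into the linear maps on the dual, uncurried. On such maps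
  \<open>a\<close> acts from the left by multiplying values and \<open>b\<close> from the right by
  precomposition with \<open>la b\<close>; the product clause is then the Leibniz rule.\<close>

definition der :: "(('m \<Rightarrow>\<^sub>0 'k) \<Rightarrow> (('m \<Rightarrow>\<^sub>0 'k) \<Rightarrow> 'k) \<Rightarrow> ('m \<Rightarrow>\<^sub>0 'k)) \<Rightarrow> bool" where
  "der \<eta> \<longleftrightarrow> (\<forall>a\<in>kC. \<forall>\<xi>\<in>DA. \<eta> a \<xi> \<in> kC \<and> (\<forall>k. \<eta> (scal k a) \<xi> = scal k (\<eta> a \<xi>)) \<and>
     (\<forall>b\<in>kC. \<eta> (a + b) \<xi> = \<eta> a \<xi> + \<eta> b \<xi> \<and>
              \<eta> (cmul C a b) \<xi> = cmul C a (\<eta> b \<xi>) + \<eta> a (la b \<xi>)) \<and>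
     (\<forall>\<zeta>\<in>DA. \<eta> a (\<xi> \<oplus>\<^bsub>dual\<^esub> \<zeta>) = \<eta> a \<xi> + \<eta> a \<zeta>))"

text \<open>Vanishing on length zero makes \<open>\<eta>\<close> linear over the group algebras on
  both sides, see \<open>rel_der_act_left\<close> and \<open>rel_der_act_right\<close>.\<close>

definition rel_der :: "(('m \<Rightarrow>\<^sub>0 'k) \<Rightarrow> (('m \<Rightarrow>\<^sub>0 'k) \<Rightarrow> 'k) \<Rightarrow> ('m \<Rightarrow>\<^sub>0 'k)) \<Rightarrow> bool" where
  "rel_der \<eta> \<longleftrightarrow> der \<eta> \<and> (\<forall>g\<in>mor C. \<forall>\<xi>\<in>DA. len g = 0 \<longrightarrow> \<eta> (bs g) \<xi> = 0)"

lemma derD: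
  assumes "der \<eta>" "a \<in> kC" "\<xi> \<in> DA"
  shows "\<eta> a \<xi> \<in> kC" "\<eta> (scal k a) \<xi> = scal k (\<eta> a \<xi>)"
    "b \<in> kC \<Longrightarrow> \<eta> (a + b) \<xi> = \<eta> a \<xi> + \<eta> b \<xi>"
    "b \<in> kC \<Longrightarrow> \<eta> (cmul C a b) \<xi> = cmul C a (\<eta> b \<xi>) + \<eta> a (la b \<xi>)"
    "\<zeta> \<in> DA \<Longrightarrow> \<eta> a (\<xi> \<oplus>\<^bsub>dual\<^esub> \<zeta>) = \<eta> a \<xi> + \<eta> a \<zeta>"
  using assms unfolding der_def by blast+

lemma der_zero:
  assumes "der \<eta>" "\<xi> \<in> DA"
  shows "\<eta> 0 \<xi> = 0"
  using derD(2)[OF assms(1) _ assms(2), of 0 0] by simp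

text \<open>The Leibniz rule for the unit times itself counts the value twice.\<close>

lemma der_one:
  assumes "der \<eta>" "\<xi> \<in> DA"
  shows "\<eta> (cone C) \<xi> = 0"
proof -
  have k: "Poly_Mapping.keys (\<eta> (cone C) \<xi>) \<subseteq> mor C"
    using derD(1)[OF assms(1) _ assms(2), of "cone C"] by (simp add: cone_closed)
  show ?thesis
    using derD(4)[OF assms(1) _ assms(2), of "cone C" "cone C"] k
    by (simp add: cmul_cone_left cone_closed la_one assms)
qed

text \<open>Homogeneity in the functional is not a clause of \<open>der\<close>. It follows from the
  Leibniz rule for \<open>a\<close> times \<open>k 1\<close>, because a derivation vanishes on
  multiples of the unit.\<close>

lemma der_lin:
  assumes "der \<eta>" "a \<in> kC"
  shows "lin (\<eta> a)"
proof -
  have "\<eta> a (ds k \<xi>) = scal k (\<eta> a \<xi>)" if \<xi>: "\<xi> \<in> DA" for k \<xi>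
  proof -
    have "\<eta> (cmul C a (scal k (cone C))) \<xi> =
       cmul C a (\<eta> (scal k (cone C)) \<xi>) + \<eta> a (la (scal k (cone C)) \<xi>)"
      by (rule derD(4)[OF assms \<xi>]) (rule kC_scal, rule kC_basic)
    then show ?thesis
      using derD(2)[OF assms(1) _ \<xi>] assms \<xi>
      by (simp add: ds_la[symmetric] der_one cmul_scal_right cmul_cone_right cone_closed)
  qed
  then show ?thesis unfolding lin_def using derD[OF assms] by blast
qed

text \<open>The Leibniz rule peels off one arrow at a time through \<open>factor\<close>, down to
  length zero, where both derivations vanish. In the functional, \<open>lin_expand\<close> reduces
  to the dual basis.\<close>

lemma rel_der_eqI:
  assumes "rel_der \<eta>" "rel_der \<eta>'"
    and eq: "\<And>x d. x \<in> mor C \<Longrightarrow> d \<in> mor C \<Longrightarrow> len x = 1 \<Longrightarrow> \<eta> (bs x) (dl d) = \<eta>' (bs x) (dl d)"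
    and a: "a \<in> kC" and \<xi>: "\<xi> \<in> DA"
  shows "\<eta> a \<xi> = \<eta>' a \<xi>"
proof -
  have d: "der \<eta>" "der \<eta>'" using assms by (auto simp: rel_der_def)
  have 1: "\<eta> (bs x) \<xi> = \<eta>' (bs x) \<xi>" if "x \<in> mor C" "len x = 1" "\<xi> \<in> DA" for x \<xi>
    using lin_expand[OF der_lin[OF d(1)] that(3), of "bs x"]
      lin_expand[OF der_lin[OF d(2)] that(3), of "bs x"] eq that by simp
  have 2: "\<eta> (bs c) \<xi> = \<eta>' (bs c) \<xi>" if "c \<in> mor C" "\<xi> \<in> DA" for c \<xi>
    using that
  proof (induction "len c" arbitrary: c \<xi>)
    case 0
    then show ?case using assms by (auto simp: rel_der_def)
  next
    case (Suc n)
    obtain x b where x: "x \<in> mor C" "b \<in> mor C" "len x = 1" "src C x = trg C b" "c = comp C x b"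
      using factor[of c n] Suc by auto
    have "n = len b" using Suc x by auto
    then have IH: "\<eta> (bs b) \<xi> = \<eta>' (bs b) \<xi>" using Suc x by blast
    have bc: "bs c = cmul C (bs x) (bs b)" using x by (simp add: cmul_single)
    show ?case unfolding bc
      using derD(4)[OF d(1), of "bs x" \<xi> "bs b"] derD(4)[OF d(2), of "bs x" \<xi> "bs b"] Suc x IH 1
      by simp
  qed
  show ?thesis
  proof -
    have "Poly_Mapping.keys a \<subseteq> mor C" using a by simp
    then show ?thesis
    proof (induction rule: pm_induct)
      case (single c k)
      then show ?case using derD(2)[OF d(1), of "bs c" \<xi> k] derD(2)[OF d(2), of "bs c" \<xi> k] 2 \<xi> by simp
    next
      case (add f g)
      then show ?case using derD(3)[OF d(1), of f \<xi> g] derD(3)[OF d(2), of f \<xi> g] \<xi> by simp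
    next
      case zero
      then show ?case using d \<xi> by (simp add: der_zero)
    qed
  qed
qed

end

section \<open>The free cover of the dual, its syzygy, and the group of cocycles\<close>

context alg_cat
begin

definition inF :: "((('m \<Rightarrow>\<^sub>0 'k) \<Rightarrow> 'k) \<Rightarrow> ('m \<Rightarrow>\<^sub>0 'k)) \<Rightarrow> bool" where
  "inF f \<longleftrightarrow> (\<forall>m. f m \<in> kC) \<and> (\<forall>m. m \<notin> DA \<longrightarrow> f m = 0) \<and> finite {m. f m \<noteq> 0}"

abbreviation F :: "('m \<Rightarrow>\<^sub>0 'k, (('m \<Rightarrow>\<^sub>0 'k) \<Rightarrow> 'k) \<Rightarrow> ('m \<Rightarrow>\<^sub>0 'k)) module" where
  "F \<equiv> free_cover A dual"

abbreviation Om :: "('m \<Rightarrow>\<^sub>0 'k, (('m \<Rightarrow>\<^sub>0 'k) \<Rightarrow> 'k) \<Rightarrow> ('m \<Rightarrow>\<^sub>0 'k)) module" where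
  "Om \<equiv> syzygy A dual"

abbreviation reg :: "('m \<Rightarrow>\<^sub>0 'k, 'm \<Rightarrow>\<^sub>0 'k) bimodule" where
  "reg \<equiv> regular_bimodule A"

lemma reg_simps [simp]:
  "carrier reg = kC" "zero reg = 0" "add reg = (+)" "smult reg = cmul C" "rsmult reg = cmul C"
  by (simp_all add: regular_bimodule_def)

lemma F_ops [simp]:
  "carrier F = Collect inF" "zero F = (\<lambda>m. 0)"
  "add F = (\<lambda>f g m. f m + g m)" "smult F = (\<lambda>a f m. cmul C a (f m))"
  unfolding free_cover_def free_left_module_def inF_def
  by (auto simp: fun_eq_iff)

definition biadd :: "(('m \<Rightarrow>\<^sub>0 'k) \<Rightarrow> (('m \<Rightarrow>\<^sub>0 'k) \<Rightarrow> 'k) \<Rightarrow> 'z::ab_group_add) \<Rightarrow> bool" where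
  "biadd \<beta> \<longleftrightarrow> (\<forall>m\<in>DA. \<forall>a\<in>kC. \<forall>b\<in>kC. \<beta> (a + b) m = \<beta> a m + \<beta> b m)"

text \<open>The additive map on the free cover with value \<open>\<beta> a m\<close> on
  \<open>a [m]\<close>. Evaluation, the cocycles of derivations and the boundaries below are all of
  this form.\<close>

definition esum :: "(('m \<Rightarrow>\<^sub>0 'k) \<Rightarrow> (('m \<Rightarrow>\<^sub>0 'k) \<Rightarrow> 'k) \<Rightarrow> 'z::ab_group_add) \<Rightarrow>
    ((('m \<Rightarrow>\<^sub>0 'k) \<Rightarrow> 'k) \<Rightarrow> ('m \<Rightarrow>\<^sub>0 'k)) \<Rightarrow> 'z" where
  "esum \<beta> f = (\<Sum>m\<in>{m. f m \<noteq> 0}. \<beta> (f m) m)"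

lemma inFD:
  assumes "inF f"
  shows "Poly_Mapping.keys (f m) \<subseteq> mor C" "f m \<noteq> 0 \<Longrightarrow> m \<in> DA" "finite {m. f m \<noteq> 0}"
  using assms unfolding inF_def by auto

lemma biadd_zero: "biadd \<beta> \<Longrightarrow> m \<in> DA \<Longrightarrow> \<beta> 0 m = 0"
proof -
  assume "biadd \<beta>" "m \<in> DA"
  then have "\<beta> (0 + 0) m = \<beta> 0 m + \<beta> 0 m" unfolding biadd_def using kC_basic(1) by blast
  then show ?thesis by simp
qed

lemma biaddD: "biadd \<beta> \<Longrightarrow> m \<in> DA \<Longrightarrow> Poly_Mapping.keys a \<subseteq> mor C \<Longrightarrow> Poly_Mapping.keys b \<subseteq> mor C \<Longrightarrow>
    \<beta> (a + b) m = \<beta> a m + \<beta> b m"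
  by (simp add: biadd_def)

lemma esum_superset:
  assumes "biadd \<beta>" "inF f" "finite S" "{m. f m \<noteq> 0} \<subseteq> S" "S \<subseteq> DA"
  shows "esum \<beta> f = (\<Sum>m\<in>S. \<beta> (f m) m)"
  unfolding esum_def using assms by (intro sum.mono_neutral_left) (auto simp: biadd_zero)

lemma inF_add [simp]: "inF f \<Longrightarrow> inF g \<Longrightarrow> inF (\<lambda>m. f m + g m)"
proof -
  assume f: "inF f" and g: "inF g"
  have "{m. f m + g m \<noteq> 0} \<subseteq> {m. f m \<noteq> 0} \<union> {m. g m \<noteq> 0}" by auto
  then have "finite {m. f m + g m \<noteq> 0}" using inFD(3)[OF f] inFD(3)[OF g] finite_subset by blast
  then show ?thesis
    using f g by (auto simp: inF_def keys_add_subset subsetD)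
qed

lemma inF_cmul [simp]: "inF f \<Longrightarrow> Poly_Mapping.keys a \<subseteq> mor C \<Longrightarrow> inF (\<lambda>m. cmul C a (f m))"
proof -
  assume f: "inF f" and a: "Poly_Mapping.keys a \<subseteq> mor C"
  have "{m. cmul C a (f m) \<noteq> 0} \<subseteq> {m. f m \<noteq> 0}" by auto
  then have "finite {m. cmul C a (f m) \<noteq> 0}" using inFD(3)[OF f] finite_subset by blast
  then show ?thesis
    using f a by (simp add: inF_def cmul_closed)
qed

lemma inF_zero [simp]: "inF (\<lambda>m. 0)"
  by (simp add: inF_def)

lemma inF_diff [simp]: "inF f \<Longrightarrow> inF g \<Longrightarrow> inF (\<lambda>m. f m - g m)"
proof -
  assume f: "inF f" and g: "inF g"
  have "{m. f m - g m \<noteq> 0} \<subseteq> {m. f m \<noteq> 0} \<union> {m. g m \<noteq> 0}" by auto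
  then have "finite {m. f m - g m \<noteq> 0}" using inFD(3)[OF f] inFD(3)[OF g] finite_subset by blast
  then show ?thesis
    using f g kC_diff by (simp add: inF_def)
qed

lemma inF_sum: "(\<And>i. i \<in> I \<Longrightarrow> inF (f i)) \<Longrightarrow> inF (\<lambda>m. \<Sum>i\<in>I. f i m)"
  by (induction I rule: infinite_finite_induct) auto

lemma esum_add:
  assumes "biadd \<beta>" "inF f" "inF g"
  shows "esum \<beta> (\<lambda>m. f m + g m) = esum \<beta> f + esum \<beta> g"
proof -
  let ?S = "{m. f m \<noteq> 0} \<union> {m. g m \<noteq> 0}"
  have S: "finite ?S" "?S \<subseteq> DA" using inFD[OF assms(2)] inFD[OF assms(3)] by auto
  show ?thesis
    apply (subst (1 2 3) esum_superset[OF assms(1) _ S(1) _ S(2)])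
    using assms S inFD(1) by (auto simp: sum.distrib[symmetric] intro!: sum.cong biaddD)
qed

lemma esum_zero [simp]: "esum \<beta> (\<lambda>m. 0) = 0"
  by (simp add: esum_def)

lemma esum_diff:
  assumes "biadd \<beta>" "inF f" "inF g"
  shows "esum \<beta> (\<lambda>m. f m - g m) = esum \<beta> f - esum \<beta> g"
  using esum_add[OF assms(1) inF_diff[OF assms(2,3)] assms(3)] by (simp add: algebra_simps)

lemma esum_sum:
  assumes "biadd \<beta>" "\<And>i. i \<in> I \<Longrightarrow> inF (f i)"
  shows "esum \<beta> (\<lambda>m. \<Sum>i\<in>I. f i m) = (\<Sum>i\<in>I. esum \<beta> (f i))"
  using assms(2)
  by (induction I rule: infinite_finite_induct) (auto simp: esum_add[OF assms(1)] inF_sum)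

lemma esum_cong: "inF f \<Longrightarrow> (\<And>m. m \<in> DA \<Longrightarrow> \<beta> (f m) m = \<gamma> (f m) m) \<Longrightarrow> esum \<beta> f = esum \<gamma> f"
  unfolding esum_def using inFD(2) by (auto intro!: sum.cong)

lemma esum_cmul:
  assumes "biadd \<beta>" "inF f" "Poly_Mapping.keys a \<subseteq> mor C"
  shows "esum \<beta> (\<lambda>m. cmul C a (f m)) = esum (\<lambda>b m. \<beta> (cmul C a b) m) f"
proof -
  have S: "finite {m. f m \<noteq> 0}" "{m. f m \<noteq> 0} \<subseteq> DA" using inFD[OF assms(2)] by auto
  show ?thesis
    apply (subst esum_superset[OF assms(1) inF_cmul[OF assms(2,3)] S(1) _ S(2)])
    by (auto simp: esum_def)
qed

text \<open>The element \<open>a [\<xi>]\<close> of the free cover.\<close>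

definition pt :: "('m \<Rightarrow>\<^sub>0 'k) \<Rightarrow> (('m \<Rightarrow>\<^sub>0 'k) \<Rightarrow> 'k) \<Rightarrow> (('m \<Rightarrow>\<^sub>0 'k) \<Rightarrow> 'k) \<Rightarrow> ('m \<Rightarrow>\<^sub>0 'k)" where
  "pt a \<xi> = (\<lambda>m. if m = \<xi> then a else 0)"

lemma inF_pt [simp]: "Poly_Mapping.keys a \<subseteq> mor C \<Longrightarrow> \<xi> \<in> DA \<Longrightarrow> inF (pt a \<xi>)"
  by (auto simp: inF_def pt_def)

lemma esum_pt [simp]:
  assumes "biadd \<beta>" "Poly_Mapping.keys a \<subseteq> mor C" "\<xi> \<in> DA"
  shows "esum \<beta> (pt a \<xi>) = \<beta> a \<xi>"
proof -
  have "{m. pt a \<xi> m \<noteq> 0} \<subseteq> {\<xi>}" "pt a \<xi> \<xi> = a" by (auto simp: pt_def)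
  then show ?thesis
    using esum_superset[OF assms(1) inF_pt[OF assms(2,3)], of "{\<xi>}"] assms(3) by simp
qed

lemma cmul_pt: "(\<lambda>m. cmul C a (pt b \<xi> m)) = pt (cmul C a b) \<xi>"
  by (auto simp: pt_def)

text \<open>The covering map followed by evaluation at \<open>x\<close>, see
  \<open>free_cover_map_eq\<close>. Working with field elements avoids finite sums in the record
  \<open>dual\<close>.\<close>

definition ev :: "((('m \<Rightarrow>\<^sub>0 'k) \<Rightarrow> 'k) \<Rightarrow> ('m \<Rightarrow>\<^sub>0 'k)) \<Rightarrow> ('m \<Rightarrow>\<^sub>0 'k) \<Rightarrow> 'k" where
  "ev f x = esum (\<lambda>a m. m (cmul C x a)) f"

lemma biadd_ev: "x \<in> kC \<Longrightarrow> biadd (\<lambda>a m. m (cmul C x a))"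
  by (simp add: biadd_def cmul_add_right dual_add cmul_closed)

lemma finsum_dual:
  assumes "finite S" "h \<in> S \<rightarrow> DA"
  shows "(\<Oplus>\<^bsub>dual\<^esub>m\<in>S. h m) = (\<lambda>x\<in>kC. \<Sum>m\<in>S. h m x)"
proof -
  interpret D: abelian_monoid dual by (rule dual_abelian_monoid)
  show ?thesis using assms
  proof (induction S rule: finite_induct)
    case empty
    show ?case by (simp add: dual_ops)
  next
    case (insert m S)
    then show ?case by (simp add: D.finsum_insert Pi_def) (auto simp: dual_ops)
  qed
qed

lemma free_cover_map_eq:
  assumes "inF f"
  shows "free_cover_map A dual f = (\<lambda>x\<in>kC. ev f x)"
proof -
  note f = inFD[OF assms]
  have "free_cover_map A dual f = (\<lambda>x\<in>kC. \<Sum>m\<in>{m. f m \<noteq> 0}. la (f m) m x)"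
    unfolding free_cover_map_def using f by (subst finsum_dual) auto
  then show ?thesis by (auto simp: ev_def esum_def)
qed

definition inO :: "((('m \<Rightarrow>\<^sub>0 'k) \<Rightarrow> 'k) \<Rightarrow> ('m \<Rightarrow>\<^sub>0 'k)) \<Rightarrow> bool" where
  "inO f \<longleftrightarrow> inF f \<and> (\<forall>x\<in>kC. ev f x = 0)"

lemma Om_ops [simp]:
  "carrier Om = Collect inO" "zero Om = (\<lambda>m. 0)"
  "add Om = (\<lambda>f g m. f m + g m)" "smult Om = (\<lambda>a f m. cmul C a (f m))"
proof -
  have "free_cover_map A dual f = \<zero>\<^bsub>dual\<^esub> \<longleftrightarrow> (\<forall>x\<in>kC. ev f x = 0)" if "inF f" for f
    unfolding free_cover_map_eq[OF that] dual_ops by (auto simp: fun_eq_iff)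
  then show "carrier Om = Collect inO"
    by (auto simp: syzygy_def inO_def)
qed (simp_all add: syzygy_def)

lemma inO_F: "inO f \<Longrightarrow> inF f"
  by (simp add: inO_def)

lemma inO_zero [simp]: "inO (\<lambda>m. 0)"
  by (simp add: inO_def ev_def)

lemma inO_add [simp]: "inO f \<Longrightarrow> inO g \<Longrightarrow> inO (\<lambda>m. f m + g m)"
  by (simp add: inO_def ev_def esum_add biadd_ev)

lemma inO_diff [simp]: "inO f \<Longrightarrow> inO g \<Longrightarrow> inO (\<lambda>m. f m - g m)"
  by (simp add: inO_def ev_def esum_diff biadd_ev)

lemma inO_cmul [simp]: "inO f \<Longrightarrow> Poly_Mapping.keys a \<subseteq> mor C \<Longrightarrow> inO (\<lambda>m. cmul C a (f m))"
proof -
  assume f: "inO f" and a: "Poly_Mapping.keys a \<subseteq> mor C"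
  have "ev (\<lambda>m. cmul C a (f m)) x = 0" if "x \<in> kC" for x
  proof -
    have "ev (\<lambda>m. cmul C a (f m)) x = ev f (cmul C x a)"
      unfolding ev_def using f a that inFD(1)[of f]
      by (simp add: esum_cmul inO_F biadd_ev) (auto simp: esum_def cmul_assoc inO_F)
    then show ?thesis using f a that by (simp add: inO_def cmul_closed)
  qed
  then show ?thesis using f a by (simp add: inO_def)
qed

lemma inO_sum: "(\<And>i. i \<in> I \<Longrightarrow> inO (f i)) \<Longrightarrow> inO (\<lambda>m. \<Sum>i\<in>I. f i m)"
  by (induction I rule: infinite_finite_induct) auto

abbreviation H :: "(((('m \<Rightarrow>\<^sub>0 'k) \<Rightarrow> 'k) \<Rightarrow> ('m \<Rightarrow>\<^sub>0 'k)) \<Rightarrow> ('m \<Rightarrow>\<^sub>0 'k)) ring" where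
  "H \<equiv> left_homs A Om reg"

abbreviation Bd :: "(((('m \<Rightarrow>\<^sub>0 'k) \<Rightarrow> 'k) \<Rightarrow> ('m \<Rightarrow>\<^sub>0 'k)) \<Rightarrow> ('m \<Rightarrow>\<^sub>0 'k)) set" where
  "Bd \<equiv> ext1_boundaries A dual reg"

text \<open>Linearity on a set of families, separated from the extensionality in
  \<open>left_homs\<close>, so that one predicate serves both the cover and the syzygy.\<close>

definition homF :: "(((('m \<Rightarrow>\<^sub>0 'k) \<Rightarrow> 'k) \<Rightarrow> ('m \<Rightarrow>\<^sub>0 'k)) \<Rightarrow> ('m \<Rightarrow>\<^sub>0 'k)) \<Rightarrow>
    ((('m \<Rightarrow>\<^sub>0 'k) \<Rightarrow> 'k) \<Rightarrow> ('m \<Rightarrow>\<^sub>0 'k)) set \<Rightarrow> bool" where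
  "homF \<phi> S \<longleftrightarrow> (\<forall>f\<in>S. \<phi> f \<in> kC \<and> (\<forall>g\<in>S. \<phi> (\<lambda>m. f m + g m) = \<phi> f + \<phi> g) \<and>
      (\<forall>a\<in>kC. \<phi> (\<lambda>m. cmul C a (f m)) = cmul C a (\<phi> f)))"

lemma H_iff: "\<phi> \<in> carrier H \<longleftrightarrow> \<phi> \<in> extensional (Collect inO) \<and> homF \<phi> (Collect inO)"
  by (auto simp: left_homs_def homF_def PiE_iff)

lemma H_ops [simp]: "add H \<phi> \<psi> = (\<lambda>f\<in>Collect inO. \<phi> f + \<psi> f)" "zero H = (\<lambda>f\<in>Collect inO. 0)"
  by (auto simp: left_homs_def)

lemma Bd_iff: "\<phi> \<in> Bd \<longleftrightarrow> (\<exists>h. homF h (Collect inF) \<and> \<phi> = restrict h (Collect inO))"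
proof
  assume "\<phi> \<in> Bd"
  then obtain h where "h \<in> carrier (left_homs A F reg)" "\<phi> = restrict h (Collect inO)"
    by (auto simp: ext1_boundaries_def)
  then show "\<exists>h. homF h (Collect inF) \<and> \<phi> = restrict h (Collect inO)"
    by (intro exI[of _ h]) (auto simp: left_homs_def homF_def PiE_iff)
next
  assume "\<exists>h. homF h (Collect inF) \<and> \<phi> = restrict h (Collect inO)"
  then obtain h where h: "homF h (Collect inF)" "\<phi> = restrict h (Collect inO)" by blast
  have "restrict h (Collect inF) \<in> carrier (left_homs A F reg)"
    using h(1) by (auto simp: left_homs_def homF_def PiE_iff)
  moreover have "\<phi> = restrict (restrict h (Collect inF)) (Collect inO)"
    using h(2) inO_F by (auto simp: restrict_def)
  ultimately show "\<phi> \<in> Bd" unfolding ext1_boundaries_def Om_ops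
    using image_eqI[of \<phi> "\<lambda>h. restrict h (Collect inO)" "restrict h (Collect inF)"] by blast
qed

lemma homFD:
  assumes "homF \<phi> S" "f \<in> S"
  shows "Poly_Mapping.keys (\<phi> f) \<subseteq> mor C" "g \<in> S \<Longrightarrow> \<phi> (\<lambda>m. f m + g m) = \<phi> f + \<phi> g"
    "Poly_Mapping.keys a \<subseteq> mor C \<Longrightarrow> \<phi> (\<lambda>m. cmul C a (f m)) = cmul C a (\<phi> f)"
  using assms unfolding homF_def by auto

lemma homF_restrict: "homF h (Collect inF) \<Longrightarrow> homF h (Collect inO)"
  using inO_F unfolding homF_def by auto

lemma homF_cong:
  assumes "homF h S" "\<And>f. f \<in> S \<Longrightarrow> h' f = h f" "\<And>f g. f \<in> S \<Longrightarrow> g \<in> S \<Longrightarrow> (\<lambda>m. f m + g m) \<in> S"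
    "\<And>a f. a \<in> kC \<Longrightarrow> f \<in> S \<Longrightarrow> (\<lambda>m. cmul C a (f m)) \<in> S"
  shows "homF h' S"
  using assms unfolding homF_def by simp

lemma homF_restr: "homF h (Collect inO) \<Longrightarrow> homF (restrict h (Collect inO)) (Collect inO)"
  by (rule homF_cong) auto

lemma homF_add: "homF \<phi> S \<Longrightarrow> homF \<psi> S \<Longrightarrow> homF (\<lambda>f. \<phi> f + \<psi> f) S"
  unfolding homF_def using kC_add by (simp add: cmul_add_right)

lemma homF_uminus: "homF \<phi> S \<Longrightarrow> homF (\<lambda>f. - \<phi> f) S"
  unfolding homF_def by (simp add: cmul_uminus)

lemma homF_zero: "homF (\<lambda>f. 0) S"
  by (simp add: homF_def)

lemma homF_diff:
  assumes "homF \<phi> S" "f \<in> S" "g \<in> S" "(\<lambda>m. f m - g m) \<in> S"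
  shows "\<phi> (\<lambda>m. f m - g m) = \<phi> f - \<phi> g"
  using homFD(2)[OF assms(1,4,3)] by (simp add: algebra_simps)

lemma homF_sum:
  assumes \<phi>: "homF \<phi> (Collect inO)" and "\<And>i. i \<in> I \<Longrightarrow> inO (f i)"
  shows "\<phi> (\<lambda>m. \<Sum>i\<in>I. f i m) = (\<Sum>i\<in>I. \<phi> (f i))"
proof -
  have z: "\<phi> (\<lambda>m. 0) = 0"
    using homF_diff[OF \<phi>, of "\<lambda>m. 0" "\<lambda>m. 0"] by simp
  show ?thesis using assms(2)
  proof (induction I rule: infinite_finite_induct)
    case (insert x I)
    then show ?case
      using homFD(2)[OF \<phi>, of "f x" "\<lambda>m. \<Sum>i\<in>I. f i m"] by (simp add: inO_sum)
  qed (simp_all add: z)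
qed

lemma H_abelian_group: "abelian_group H"
proof (rule abelian_groupI)
  fix \<phi> \<psi> \<chi> assume *: "\<phi> \<in> carrier H" "\<psi> \<in> carrier H" "\<chi> \<in> carrier H"
  then show "\<phi> \<oplus>\<^bsub>H\<^esub> \<psi> \<in> carrier H" by (simp add: H_iff homF_restr homF_add)
  from * show "\<phi> \<oplus>\<^bsub>H\<^esub> \<psi> = \<psi> \<oplus>\<^bsub>H\<^esub> \<phi>" "\<phi> \<oplus>\<^bsub>H\<^esub> \<psi> \<oplus>\<^bsub>H\<^esub> \<chi> = \<phi> \<oplus>\<^bsub>H\<^esub> (\<psi> \<oplus>\<^bsub>H\<^esub> \<chi>)"
    by (auto simp: fun_eq_iff algebra_simps)
  have "(\<lambda>f\<in>Collect inO. - \<phi> f) \<in> carrier H"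
    using * by (simp add: H_iff homF_restr homF_uminus)
  then show "\<exists>\<psi>\<in>carrier H. \<psi> \<oplus>\<^bsub>H\<^esub> \<phi> = \<zero>\<^bsub>H\<^esub>"
    by (rule bexI[rotated]) auto
  show "\<zero>\<^bsub>H\<^esub> \<oplus>\<^bsub>H\<^esub> \<phi> = \<phi>"
    using * by (auto simp: fun_eq_iff H_iff extensional_def)
qed (simp add: H_iff homF_restr homF_zero)

lemma Bd_subgroup: "abelian_subgroup Bd H"
proof -
  interpret H: abelian_group H by (rule H_abelian_group)
  have "subgroup Bd (add_monoid H)"
  proof (rule H.add.subgroupI, goal_cases)
    case 1
    show ?case by (auto simp: Bd_iff H_iff homF_restrict homF_restr)
  next
    case 2
    have "(\<lambda>f\<in>Collect inO. 0) \<in> Bd" unfolding Bd_iff by (auto intro!: exI[of _ "\<lambda>f. 0"] homF_zero)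
    then show ?case by blast
  next
    case (3 \<phi>)
    then obtain h where h: "homF h (Collect inF)" "\<phi> = restrict h (Collect inO)" by (auto simp: Bd_iff)
    have "(\<lambda>f\<in>Collect inO. - h f) \<in> Bd" unfolding Bd_iff using homF_uminus[OF h(1)] by blast
    moreover have "\<ominus>\<^bsub>H\<^esub> \<phi> = (\<lambda>f\<in>Collect inO. - h f)"
      using h homF_restrict[OF h(1)]
      by (intro H.minus_equality) (auto simp: H_iff homF_restr homF_uminus)
    ultimately show ?case by (simp add: a_inv_def)
  next
    case (4 \<phi> \<psi>)
    then obtain h h' where h: "homF h (Collect inF)" "\<phi> = restrict h (Collect inO)"
      "homF h' (Collect inF)" "\<psi> = restrict h' (Collect inO)" by (auto simp: Bd_iff)
    have "(\<lambda>f\<in>Collect inO. h f + h' f) \<in> Bd" unfolding Bd_iff using homF_add[OF h(1,3)] by blast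
    moreover have "\<phi> \<oplus>\<^bsub>H\<^esub> \<psi> = (\<lambda>f\<in>Collect inO. h f + h' f)"
      using h by auto
    ultimately show ?case by simp
  qed
  then show ?thesis
    by (intro abelian_subgroupI3 additive_subgroup.intro H.abelian_group_axioms)
qed

end

section \<open>The extension bimodule and the classes of derivations\<close>

context alg_cat
begin

abbreviation V :: "('m \<Rightarrow>\<^sub>0 'k, (((('m \<Rightarrow>\<^sub>0 'k) \<Rightarrow> 'k) \<Rightarrow> ('m \<Rightarrow>\<^sub>0 'k)) \<Rightarrow> ('m \<Rightarrow>\<^sub>0 'k)) set) bimodule" where
  "V \<equiv> ext1_bimodule A dual reg"

definition cl :: "(((('m \<Rightarrow>\<^sub>0 'k) \<Rightarrow> 'k) \<Rightarrow> ('m \<Rightarrow>\<^sub>0 'k)) \<Rightarrow> ('m \<Rightarrow>\<^sub>0 'k)) \<Rightarrow>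
    (((('m \<Rightarrow>\<^sub>0 'k) \<Rightarrow> 'k) \<Rightarrow> ('m \<Rightarrow>\<^sub>0 'k)) \<Rightarrow> ('m \<Rightarrow>\<^sub>0 'k)) set" where
  "cl \<phi> = Bd +>\<^bsub>H\<^esub> \<phi>"

lemma cl_eq_image: "cl \<phi> = {\<beta> \<oplus>\<^bsub>H\<^esub> \<phi> | \<beta>. \<beta> \<in> Bd}"
  unfolding cl_def a_r_coset_def' by blast

lemma carrier_V: "carrier V = cl ` carrier H"
  by (auto simp: ext1_bimodule_def Let_def A_RCOSETS_def' cl_def)

lemma cl_add:
  assumes "\<phi> \<in> carrier H" "\<psi> \<in> carrier H"
  shows "cl \<phi> \<oplus>\<^bsub>V\<^esub> cl \<psi> = cl (\<phi> \<oplus>\<^bsub>H\<^esub> \<psi>)"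
  using abelian_subgroup.a_rcos_sum[OF Bd_subgroup assms]
  by (simp add: ext1_bimodule_def Let_def cl_def)

lemma Bd_sub_H: "\<beta> \<in> Bd \<Longrightarrow> \<beta> \<in> carrier H"
  by (auto simp: Bd_iff H_iff homF_restrict homF_restr)

lemma cl_eq_iff:
  assumes "\<phi> \<in> carrier H" "\<psi> \<in> carrier H"
  shows "cl \<phi> = cl \<psi> \<longleftrightarrow> (\<lambda>f\<in>Collect inO. \<phi> f - \<psi> f) \<in> Bd"
proof
  interpret B: abelian_subgroup Bd H by (rule Bd_subgroup)
  assume "cl \<phi> = cl \<psi>"
  then have "\<phi> \<in> cl \<psi>" using B.a_rcos_self[OF assms(1)] by (simp add: cl_def)
  then obtain \<beta> where \<beta>: "\<beta> \<in> Bd" "\<phi> = \<beta> \<oplus>\<^bsub>H\<^esub> \<psi>" by (auto simp: cl_eq_image)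
  have "(\<lambda>f\<in>Collect inO. \<phi> f - \<psi> f) = \<beta>"
    using \<beta> Bd_sub_H[OF \<beta>(1)] by (auto simp: fun_eq_iff H_iff extensional_def)
  then show "(\<lambda>f\<in>Collect inO. \<phi> f - \<psi> f) \<in> Bd" using \<beta> by simp
next
  interpret B: abelian_subgroup Bd H by (rule Bd_subgroup)
  assume *: "(\<lambda>f\<in>Collect inO. \<phi> f - \<psi> f) \<in> Bd"
  have "\<phi> = (\<lambda>f\<in>Collect inO. \<phi> f - \<psi> f) \<oplus>\<^bsub>H\<^esub> \<psi>"
    using assms(1) by (auto simp: fun_eq_iff H_iff extensional_def)
  then have "\<phi> \<in> cl \<psi>" unfolding cl_eq_image using * by blast
  then show "cl \<phi> = cl \<psi>"
    using B.a_repr_independence[OF _ assms(2) B.a_subgroup] by (simp add: cl_def)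
qed

text \<open>The actions in \<open>ext1_bimodule\<close> are unions over representatives of a coset.
  For an additive operator that preserves boundaries all members of the union coincide, so a single
  representative can be used.\<close>

lemma cl_UN:
  assumes \<phi>: "\<phi> \<in> carrier H"
    and T: "\<And>\<psi>. \<psi> \<in> carrier H \<Longrightarrow> T \<psi> \<in> carrier H"
    and B: "\<And>\<beta>. \<beta> \<in> Bd \<Longrightarrow> T \<beta> \<in> Bd"
    and add: "\<And>\<psi> \<chi> f. \<psi> \<in> carrier H \<Longrightarrow> \<chi> \<in> carrier H \<Longrightarrow> inO f \<Longrightarrow> T (\<psi> \<oplus>\<^bsub>H\<^esub> \<chi>) f = T \<psi> f + T \<chi> f"
  shows "(\<Union>\<psi>\<in>cl \<phi>. cl (T \<psi>)) = cl (T \<phi>)"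
proof -
  interpret B: abelian_subgroup Bd H by (rule Bd_subgroup)
  interpret H: abelian_group H by (rule H_abelian_group)
  have "cl (T \<psi>) = cl (T \<phi>)" if "\<psi> \<in> cl \<phi>" for \<psi>
  proof -
    obtain \<beta> where \<beta>: "\<beta> \<in> Bd" "\<psi> = \<beta> \<oplus>\<^bsub>H\<^esub> \<phi>" using \<open>\<psi> \<in> cl \<phi>\<close> by (auto simp: cl_eq_image)
    have \<psi>: "\<psi> \<in> carrier H" using \<beta> Bd_sub_H \<phi> B.add.m_closed by force
    have "(\<lambda>f\<in>Collect inO. T \<psi> f - T \<phi> f) = T \<beta>"
      using add[OF Bd_sub_H[OF \<beta>(1)] \<phi>] Bd_sub_H[OF B[OF \<beta>(1)]] unfolding \<beta>(2)
      by (auto simp: fun_eq_iff H_iff extensional_def)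
    then show ?thesis using cl_eq_iff[OF T[OF \<psi>] T[OF \<phi>]] B[OF \<beta>(1)] by simp
  qed
  moreover have "\<phi> \<in> cl \<phi>" using B.a_rcos_self[OF \<phi>] by (simp add: cl_def)
  ultimately show ?thesis by blast
qed

lemma finsum_A: "finite S \<Longrightarrow> (\<And>m. m \<in> S \<Longrightarrow> Poly_Mapping.keys (h m) \<subseteq> mor C) \<Longrightarrow> finsum A h S = sum h S"
proof (induction S rule: finite_induct)
  case empty
  interpret ring A by (rule category_algebra_ring)
  show ?case using finsum_empty by simp
next
  case (insert x S)
  interpret ring A by (rule category_algebra_ring)
  show ?case using insert by (subst finsum_insert) auto
qed

abbreviation lift :: "('m \<Rightarrow>\<^sub>0 'k) \<Rightarrow> ((('m \<Rightarrow>\<^sub>0 'k) \<Rightarrow> 'k) \<Rightarrow> ('m \<Rightarrow>\<^sub>0 'k)) \<Rightarrow> (('m \<Rightarrow>\<^sub>0 'k) \<Rightarrow> 'k) \<Rightarrow> ('m \<Rightarrow>\<^sub>0 'k)" where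
  "lift a \<equiv> free_cover_lift A (\<lambda>m. ra m a)"

lemma biadd_pt: "biadd (\<lambda>b m. pt b (\<theta> m) m')"
  by (simp add: biadd_def pt_def)

lemma lift_eq:
  assumes "inF f"
  shows "lift a f = (\<lambda>m'. \<Sum>m\<in>{m. f m \<noteq> 0}. pt (f m) (ra m a) m')"
proof
  fix m'
  have "lift a f m' = (\<Sum>m\<in>{m. f m \<noteq> 0 \<and> ra m a = m'}. f m)"
    unfolding free_cover_lift_def using inFD[OF assms] by (subst finsum_A) auto
  also have "\<dots> = (\<Sum>m\<in>{m. f m \<noteq> 0}. if m' = ra m a then f m else 0)"
    using inFD(3)[OF assms] by (subst sum.inter_filter[symmetric]) (auto intro!: sum.cong)
  finally show "lift a f m' = (\<Sum>m\<in>{m. f m \<noteq> 0}. pt (f m) (ra m a) m')"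
    by (simp add: pt_def)
qed

lemma lift_esum: "inF f \<Longrightarrow> lift a f m' = esum (\<lambda>b m. pt b (ra m a) m') f"
  by (simp add: lift_eq esum_def)

lemma inF_lift [simp]:
  assumes "inF f" "Poly_Mapping.keys a \<subseteq> mor C"
  shows "inF (lift a f)"
  unfolding lift_eq[OF assms(1)] using inFD[OF assms(1)] assms(2) by (intro inF_sum) auto

lemma esum_lift:
  assumes "biadd \<beta>" "inF f" "Poly_Mapping.keys a \<subseteq> mor C"
  shows "esum \<beta> (lift a f) = esum (\<lambda>b m. \<beta> b (ra m a)) f"
proof -
  have "esum \<beta> (lift a f) = (\<Sum>m\<in>{m. f m \<noteq> 0}. esum \<beta> (pt (f m) (ra m a)))"
    unfolding lift_eq[OF assms(2)] using inFD[OF assms(2)] assms by (intro esum_sum) auto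
  also have "\<dots> = esum (\<lambda>b m. \<beta> b (ra m a)) f"
    unfolding esum_def[of "\<lambda>b m. \<beta> b (ra m a)"] using inFD[OF assms(2)] assms
    by (intro sum.cong) auto
  finally show ?thesis .
qed

text \<open>The lift covers right multiplication by \<open>a\<close> on the dual, so evaluating its
  result at \<open>x\<close> is evaluating \<open>f\<close> at \<open>a x\<close>.\<close>

lemma inO_lift [simp]:
  assumes "inO f" "Poly_Mapping.keys a \<subseteq> mor C"
  shows "inO (lift a f)"
proof -
  have f: "inF f" using assms inO_F by blast
  have "ev (lift a f) x = 0" if "x \<in> kC" for x
  proof -
    have "ev (lift a f) x = esum (\<lambda>b m. ra m a (cmul C x b)) f"
      unfolding ev_def by (rule esum_lift[OF biadd_ev[OF that] f assms(2)])
    also have "\<dots> = esum (\<lambda>b m. m (cmul C (cmul C a x) b)) f"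
      using inFD(1)[OF f] that assms(2) by (intro esum_cong f) (simp add: cmul_closed cmul_assoc)
    also have "\<dots> = ev f (cmul C a x)" by (simp add: ev_def)
    finally show ?thesis using assms that by (simp add: inO_def cmul_closed)
  qed
  then show ?thesis using f assms by (simp add: inO_def)
qed

lemma lift_add: "inF f \<Longrightarrow> inF g \<Longrightarrow> lift a (\<lambda>m. f m + g m) = (\<lambda>m. lift a f m + lift a g m)"
  by (rule ext) (simp add: lift_esum esum_add biadd_pt)

lemma lift_cmul:
  assumes "inF f" "Poly_Mapping.keys c \<subseteq> mor C"
  shows "lift a (\<lambda>m. cmul C c (f m)) = (\<lambda>m. cmul C c (lift a f m))"
proof
  fix m'
  have "pt (cmul C c b) m m' = cmul C c (pt b m m')" for b m by (simp add: pt_def)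
  then show "lift a (\<lambda>m. cmul C c (f m)) m' = cmul C c (lift a f m')"
    using assms by (simp add: lift_esum esum_cmul biadd_pt) (simp add: esum_def cmul_sum_right)
qed

lemma homF_lift:
  assumes "homF h S" "Poly_Mapping.keys a \<subseteq> mor C" "\<And>f. f \<in> S \<Longrightarrow> lift a f \<in> S" "S \<subseteq> Collect inF"
  shows "homF (\<lambda>f. h (lift a f)) S"
  unfolding homF_def
proof (intro ballI conjI)
  fix f assume f: "f \<in> S"
  then have f': "inF f" "lift a f \<in> S" using assms by auto
  show "h (lift a f) \<in> kC" using homFD(1)[OF assms(1) f'(2)] by simp
  show "h (lift a (\<lambda>m. f m + g m)) = h (lift a f) + h (lift a g)" if g: "g \<in> S" for g
    using homFD(2)[OF assms(1) f'(2) assms(3)[OF g]] f' g assms(4) by (auto simp: lift_add)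
  show "h (lift a (\<lambda>m. cmul C b (f m))) = cmul C b (h (lift a f))" if b: "b \<in> kC" for b
    using homFD(3)[OF assms(1) f'(2)] f' b by (auto simp: lift_cmul)
qed

lemma smult_cl:
  assumes \<phi>: "\<phi> \<in> carrier H" and a: "Poly_Mapping.keys a \<subseteq> mor C"
  shows "a \<odot>\<^bsub>V\<^esub> cl \<phi> = cl (\<lambda>f\<in>Collect inO. \<phi> (lift a f))"
proof -
  have O: "Collect inO \<subseteq> Collect inF" using inO_F by blast
  have *: "homF (\<lambda>f. h (lift a f)) (Collect inO)" if "homF h (Collect inO)" for h
    by (rule homF_lift[OF that a _ O]) (use a in auto)
  have "(\<Union>\<psi>\<in>cl \<phi>. cl (\<lambda>f\<in>Collect inO. \<psi> (lift a f))) = cl (\<lambda>f\<in>Collect inO. \<phi> (lift a f))"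
  proof (rule cl_UN[OF \<phi>])
    show "(\<lambda>f\<in>Collect inO. \<psi> (lift a f)) \<in> carrier H" if "\<psi> \<in> carrier H" for \<psi>
      using that * by (simp add: H_iff homF_restr)
    show "(\<lambda>f\<in>Collect inO. \<beta> (lift a f)) \<in> Bd" if \<beta>: "\<beta> \<in> Bd" for \<beta>
    proof -
      obtain h where h: "homF h (Collect inF)" "\<beta> = restrict h (Collect inO)"
        using \<beta> by (auto simp: Bd_iff)
      have "homF (\<lambda>f. h (lift a f)) (Collect inF)"
        by (rule homF_lift[OF h(1) a]) (use a in auto)
      then show ?thesis unfolding Bd_iff h(2) using a
        by (intro exI[of _ "\<lambda>f. h (lift a f)"] conjI restrict_ext) auto
    qed
  qed (use a in auto)
  then show ?thesis by (simp add: ext1_bimodule_def Let_def cl_def)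
qed

lemma homF_right: "homF h S \<Longrightarrow> Poly_Mapping.keys a \<subseteq> mor C \<Longrightarrow> homF (\<lambda>f. cmul C (h f) a) S"
  unfolding homF_def by (simp add: cmul_add_left cmul_assoc cmul_closed)

lemma rsmult_cl:
  assumes \<phi>: "\<phi> \<in> carrier H" and a: "Poly_Mapping.keys a \<subseteq> mor C"
  shows "rsmult V (cl \<phi>) a = cl (\<lambda>f\<in>Collect inO. cmul C (\<phi> f) a)"
proof -
  have "(\<Union>\<psi>\<in>cl \<phi>. cl (\<lambda>f\<in>Collect inO. cmul C (\<psi> f) a)) = cl (\<lambda>f\<in>Collect inO. cmul C (\<phi> f) a)"
  proof (rule cl_UN[OF \<phi>])
    show "(\<lambda>f\<in>Collect inO. cmul C (\<psi> f) a) \<in> carrier H" if "\<psi> \<in> carrier H" for \<psi>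
      using that a by (simp add: H_iff homF_restr homF_right)
    show "(\<lambda>f\<in>Collect inO. cmul C (\<beta> f) a) \<in> Bd" if \<beta>: "\<beta> \<in> Bd" for \<beta>
    proof -
      obtain h where h: "homF h (Collect inF)" "\<beta> = restrict h (Collect inO)"
        using \<beta> by (auto simp: Bd_iff)
      show ?thesis unfolding Bd_iff h(2) using homF_right[OF h(1) a]
        by (intro exI[of _ "\<lambda>f. cmul C (h f) a"] conjI restrict_ext) auto
    qed
  qed (use a in \<open>auto simp: cmul_add_left\<close>)
  then show ?thesis by (simp add: ext1_bimodule_def Let_def cl_def)
qed

text \<open>The cocycle of a derivation. On the whole cover the additive extension of
  \<open>\<eta>\<close> is not \<open>A\<close>-linear: its defect at \<open>a\<close> is
  \<open>\<eta> a\<close> applied to the image functional, and this vanishes exactly because the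
  domain is cut down to the syzygy.\<close>

definition ph :: "(('m \<Rightarrow>\<^sub>0 'k) \<Rightarrow> (('m \<Rightarrow>\<^sub>0 'k) \<Rightarrow> 'k) \<Rightarrow> ('m \<Rightarrow>\<^sub>0 'k)) \<Rightarrow>
    ((('m \<Rightarrow>\<^sub>0 'k) \<Rightarrow> 'k) \<Rightarrow> ('m \<Rightarrow>\<^sub>0 'k)) \<Rightarrow> ('m \<Rightarrow>\<^sub>0 'k)" where
  "ph \<eta> = (\<lambda>f\<in>Collect inO. esum \<eta> f)"

lemma der_biadd: "der \<eta> \<Longrightarrow> biadd \<eta>"
  by (simp add: biadd_def derD(3))

text \<open>On a syzygy the functionals \<open>la (f m) m\<close> add up to zero. Expanding
  \<open>\<theta>\<close> on the dual basis and exchanging the sums reduces the claim to the numbers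
  \<open>ev f (bs d)\<close>.\<close>

lemma lin_syzygy:
  assumes \<theta>: "lin \<theta>" and f: "inO f"
  shows "esum (\<lambda>b m. \<theta> (la b m)) f = 0"
proof -
  note f' = inFD[OF inO_F[OF f]]
  have "esum (\<lambda>b m. \<theta> (la b m)) f =
      (\<Sum>m\<in>{m. f m \<noteq> 0}. \<Sum>d\<in>mor C. scal (m (cmul C (bs d) (f m))) (\<theta> (dl d)))"
    unfolding esum_def using f' by (intro sum.cong refl) (simp add: lin_expand[OF \<theta>])
  also have "\<dots> = (\<Sum>d\<in>mor C. \<Sum>m\<in>{m. f m \<noteq> 0}. scal (m (cmul C (bs d) (f m))) (\<theta> (dl d)))"
    by (rule sum.swap)
  also have "\<dots> = (\<Sum>d\<in>mor C. scal (ev f (bs d)) (\<theta> (dl d)))"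
  proof (intro sum.cong refl poly_mapping_eqI)
  qed (simp add: ev_def esum_def lookup_sum sum_distrib_right)
  also have "\<dots> = 0" using f by (intro sum.neutral) (simp add: inO_def)
  finally show ?thesis .
qed

lemma homF_esum:
  assumes "\<And>m. m \<in> DA \<Longrightarrow> c m \<in> kC"
  shows "homF (esum (\<lambda>a m. cmul C a (c m))) (Collect inF)"
proof -
  have b: "biadd (\<lambda>a m. cmul C a (c m))" by (simp add: biadd_def cmul_add_left)
  show ?thesis unfolding homF_def
  proof (intro ballI conjI, goal_cases)
    case (1 f)
    then show ?case unfolding esum_def using assms inFD[of f] kC_cmul by (intro kC_sum) auto
  next
    case (2 f g)
    then show ?case using esum_add[OF b] by simp
  next
    case (3 f a)
    then show ?case
      using esum_cmul[OF b, of f a] assms inFD[of f]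
      by (auto simp: esum_def cmul_sum_right cmul_assoc intro!: sum.cong)
  qed
qed

lemma ph_H:
  assumes "der \<eta>"
  shows "ph \<eta> \<in> carrier H"
proof -
  have "homF (esum \<eta>) (Collect inO)"
    unfolding homF_def
  proof (intro ballI conjI, goal_cases)
    case (1 f)
    then show ?case unfolding esum_def using derD(1)[OF assms] inFD[OF inO_F, of f] by (intro kC_sum) auto
  next
    case (2 f g)
    then show ?case using esum_add[OF der_biadd[OF assms]] by (simp add: inO_F)
  next
    case (3 f a)
    then have f: "inO f" and a: "a \<in> kC" by auto
    note f' = inFD[OF inO_F[OF f]]
    have "esum \<eta> (\<lambda>m. cmul C a (f m)) = esum (\<lambda>b m. cmul C a (\<eta> b m) + \<eta> a (la b m)) f"
      using a f' by (subst esum_cmul[OF der_biadd[OF assms] inO_F[OF f]])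
        (auto simp: esum_def derD(4)[OF assms] intro!: sum.cong)
    also have "\<dots> = cmul C a (esum \<eta> f) + esum (\<lambda>b m. \<eta> a (la b m)) f"
      by (simp add: esum_def sum.distrib cmul_sum_right)
    also have "esum (\<lambda>b m. \<eta> a (la b m)) f = 0"
      by (rule lin_syzygy[OF der_lin[OF assms a] f])
    finally show ?case by simp
  qed
  then show ?thesis by (simp add: ph_def H_iff homF_restr)
qed

lemma ph_add: "ph \<eta> \<oplus>\<^bsub>H\<^esub> ph \<eta>' = ph (\<lambda>a \<xi>. \<eta> a \<xi> + \<eta>' a \<xi>)"
  by (auto simp: ph_def esum_def sum.distrib)

lemma ph_cong:
  assumes "\<And>a \<xi>. a \<in> kC \<Longrightarrow> \<xi> \<in> DA \<Longrightarrow> \<eta> a \<xi> = \<eta>' a \<xi>"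
  shows "ph \<eta> = ph \<eta>'"
  unfolding ph_def using assms inFD(1)[OF inO_F] by (intro restrict_ext esum_cong) (auto simp: inO_F)

lemma smult_ph:
  assumes "der \<eta>" "Poly_Mapping.keys a \<subseteq> mor C"
  shows "a \<odot>\<^bsub>V\<^esub> cl (ph \<eta>) = cl (ph (\<lambda>b \<xi>. \<eta> b (ra \<xi> a)))"
  unfolding smult_cl[OF ph_H[OF assms(1)] assms(2)]
  by (rule arg_cong[where f = cl], unfold ph_def, rule restrict_ext)
    (simp add: assms esum_lift[OF der_biadd[OF assms(1)]] inO_F)

lemma rsmult_ph:
  assumes "der \<eta>" "Poly_Mapping.keys a \<subseteq> mor C"
  shows "rsmult V (cl (ph \<eta>)) a = cl (ph (\<lambda>b \<xi>. cmul C (\<eta> b \<xi>) a))"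
  unfolding rsmult_cl[OF ph_H[OF assms(1)] assms(2)]
  by (rule arg_cong[where f = cl], unfold ph_def, rule restrict_ext)
    (simp add: esum_def cmul_sum_left)

text \<open>The part \<open>\<theta> (la a \<xi>)\<close> sums to zero on a syzygy, and the
  remaining part \<open>a \<theta>(\<xi>)\<close> extends linearly to the whole cover.\<close>

lemma ph_inner:
  assumes \<theta>: "lin \<theta>" and eq: "\<And>a \<xi>. a \<in> kC \<Longrightarrow> \<xi> \<in> DA \<Longrightarrow> \<eta> a \<xi> = cmul C a (\<theta> \<xi>) - \<theta> (la a \<xi>)"
  shows "ph \<eta> \<in> Bd"
proof -
  have "esum \<eta> f = esum (\<lambda>a m. cmul C a (\<theta> m)) f" if f: "inO f" for f
  proof -
    have "esum \<eta> f = esum (\<lambda>a m. cmul C a (\<theta> m) - \<theta> (la a m)) f"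
      using f eq inFD[OF inO_F[OF f]] by (intro esum_cong) (auto simp: inO_F)
    also have "\<dots> = esum (\<lambda>a m. cmul C a (\<theta> m)) f - esum (\<lambda>a m. \<theta> (la a m)) f"
      by (simp add: esum_def sum_subtractf)
    finally show ?thesis using lin_syzygy[OF \<theta> f] by simp
  qed
  then have "ph \<eta> = restrict (esum (\<lambda>a m. cmul C a (\<theta> m))) (Collect inO)"
    unfolding ph_def by (intro restrict_ext) auto
  moreover have "homF (esum (\<lambda>a m. cmul C a (\<theta> m))) (Collect inF)"
    by (rule homF_esum) (use \<theta> in \<open>simp add: lin_def\<close>)
  ultimately show ?thesis unfolding Bd_iff by blast
qed

text \<open>The extension of \<open>ph \<eta>\<close> to the free cover is evaluated on \<open>a [\<xi>] - [a \<xi>]\<close>.\<close>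

lemma ph_boundary:
  assumes \<eta>: "der \<eta>" and B: "ph \<eta> \<in> Bd"
  obtains \<theta> where "lin \<theta>" "\<And>a \<xi>. a \<in> kC \<Longrightarrow> \<xi> \<in> DA \<Longrightarrow> \<eta> a \<xi> = cmul C a (\<theta> \<xi>) - \<theta> (la a \<xi>)"
proof -
  obtain h where h: "homF h (Collect inF)" "ph \<eta> = restrict h (Collect inO)" using B by (auto simp: Bd_iff)
  have hd: "h (\<lambda>m. f m - g m) = h f - h g" if "inF f" "inF g" for f g
    using homF_diff[OF h(1), of f g] that by simp
  have h\<eta>: "h f = esum \<eta> f" if "inO f" for f
    using h(2) that unfolding ph_def by (metis mem_Collect_eq restrict_apply')
  define \<theta> where "\<theta> \<xi> = h (pt (cone C) \<xi>)" for \<xi>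
  have hpt: "h (pt a \<xi>) = cmul C a (\<theta> \<xi>)" if "Poly_Mapping.keys a \<subseteq> mor C" "\<xi> \<in> DA" for a \<xi>
    using homFD(3)[OF h(1), of "pt (cone C) \<xi>" a] that
    by (simp add: \<theta>_def cmul_pt cmul_cone_right cone_closed)
  have b\<eta>: "biadd \<eta>" by (rule der_biadd[OF \<eta>])
  have ev_pt: "ev (pt a \<xi>) x = \<xi> (cmul C x a)" if "Poly_Mapping.keys a \<subseteq> mor C" "\<xi> \<in> DA" "x \<in> kC" for a \<xi> x
    unfolding ev_def using that by (simp add: biadd_ev)
  have ev_diff: "ev (\<lambda>m. f m - g m) x = ev f x - ev g x" if "inF f" "inF g" "x \<in> kC" for f g x
    unfolding ev_def using that by (simp add: biadd_ev esum_diff)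
  \<comment> \<open>Elements of the cover with equal image differ by a syzygy, on which
    \<open>h\<close> and \<open>\<eta>\<close> agree. It is used for \<open>a [\<xi>]\<close>
    against \<open>1 [a \<xi>]\<close>, and for \<open>(k 1) [\<xi>]\<close> against
    \<open>1 [k \<xi>]\<close> to get homogeneity.\<close>
  have key: "cmul C a (\<theta> \<xi>) - h (pt b \<zeta>) = \<eta> a \<xi> - \<eta> b \<zeta>"
    if *: "a \<in> kC" "b \<in> kC" "\<xi> \<in> DA" "\<zeta> \<in> DA" and eq: "la a \<xi> = la b \<zeta>" for a b \<xi> \<zeta>
  proof -
    have "\<xi> (cmul C x a) = \<zeta> (cmul C x b)" if "x \<in> kC" for x
      using fun_cong[OF eq, of x] that by simp
    then have "inO (\<lambda>m. pt a \<xi> m - pt b \<zeta> m)"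
      using * by (simp add: inO_def ev_diff ev_pt)
    from h\<eta>[OF this] show ?thesis
      using * by (simp add: hd hpt esum_diff[OF b\<eta>] esum_pt[OF b\<eta>])
  qed
  have c: "cone C \<in> kC" by (rule kC_basic)
  have \<theta>k: "\<theta> \<xi> \<in> kC" if "\<xi> \<in> DA" for \<xi>
    using homFD(1)[OF h(1), of "pt (cone C) \<xi>"] that by (simp add: \<theta>_def cone_closed)
  have "\<eta> a \<xi> = cmul C a (\<theta> \<xi>) - \<theta> (la a \<xi>)" if "a \<in> kC" "\<xi> \<in> DA" for a \<xi>
    using key[OF that(1) c that(2), of "la a \<xi>"] that
    by (simp add: \<theta>_def[symmetric] la_one der_one[OF \<eta>])
  moreover have "lin \<theta>"
    unfolding lin_def
  proof (intro ballI conjI allI)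
    fix \<xi> assume \<xi>: "\<xi> \<in> DA"
    show "\<theta> \<xi> \<in> kC" using \<theta>k \<xi> by blast
    show "\<theta> (ds k \<xi>) = scal k (\<theta> \<xi>)" for k
    proof -
      have e: "la (scal k (cone C)) \<xi> = la (cone C) (ds k \<xi>)" using \<xi> by (simp add: la_one ds_la[symmetric])
      have "\<eta> (scal k (cone C)) \<xi> = 0" using derD(2)[OF \<eta> c \<xi>] \<xi> by (simp add: der_one[OF \<eta>])
      then show ?thesis
        using key[OF kC_scal[OF c] c \<xi> ds_closed[OF \<xi>] e] \<xi> \<theta>k
        by (simp add: \<theta>_def[symmetric] der_one[OF \<eta>] cmul_scal_left cmul_cone_left)
    qed
    show "\<theta> (\<xi> \<oplus>\<^bsub>dual\<^esub> \<zeta>) = \<theta> \<xi> + \<theta> \<zeta>" if \<zeta>: "\<zeta> \<in> DA" for \<zeta>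
    proof -
      \<comment> \<open>Additivity needs a syzygy with three terms,
        \<open>[\<xi> + \<zeta>] - [\<xi>] - [\<zeta>]\<close>, on which \<open>\<eta>\<close>
        vanishes because it kills the unit.\<close>
      define f where "f = (\<lambda>m. pt (cone C) (\<xi> \<oplus>\<^bsub>dual\<^esub> \<zeta>) m - pt (cone C) \<xi> m)"
      have f: "inF f" using \<xi> \<zeta> by (simp add: f_def cone_closed)
      have "ev f x = \<zeta> x" if "x \<in> kC" for x
        using \<xi> \<zeta> that by (simp add: f_def ev_diff ev_pt cone_closed cmul_cone_right)
      then have "inO (\<lambda>m. f m - pt (cone C) \<zeta> m)"
        using f \<zeta> by (simp add: inO_def ev_diff ev_pt cone_closed cmul_cone_right)
      from h\<eta>[OF this] have "h f - \<theta> \<zeta> = esum \<eta> f"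
        using f \<zeta> by (simp add: hd esum_diff[OF b\<eta>] esum_pt[OF b\<eta>] der_one[OF \<eta>] cone_closed \<theta>_def)
      moreover have "h f = \<theta> (\<xi> \<oplus>\<^bsub>dual\<^esub> \<zeta>) - \<theta> \<xi>" "esum \<eta> f = 0"
        using \<xi> \<zeta> by (simp_all add: f_def hd esum_diff[OF b\<eta>] esum_pt[OF b\<eta>] der_one[OF \<eta>] cone_closed \<theta>_def)
      ultimately show ?thesis by (simp add: algebra_simps)
    qed
  qed
  ultimately show ?thesis using that by blast
qed

end

section \<open>An equivariant section of the free cover, and normalised derivations\<close>

context alg_cat
begin

lemma ev_cmul:
  assumes "inF f" "Poly_Mapping.keys a \<subseteq> mor C" "x \<in> kC"
  shows "ev (\<lambda>m. cmul C a (f m)) x = ev f (cmul C x a)"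
  unfolding ev_def esum_cmul[OF biadd_ev[OF assms(3)] assms(1,2)]
  using assms inFD(1)[OF assms(1)] by (intro esum_cong) (simp_all add: cmul_assoc)

lemma ev_dual:
  assumes "inF f"
  shows "(\<lambda>x\<in>kC. ev f x) \<in> DA"
proof (rule dualI[OF refl])
  note f = inFD[OF assms]
  show "ev f (x + y) = ev f x + ev f y"
    if "Poly_Mapping.keys x \<subseteq> mor C" "Poly_Mapping.keys y \<subseteq> mor C" for x y
    unfolding ev_def esum_def sum.distrib[symmetric] using that f
    by (intro sum.cong refl) (simp add: cmul_add_left dual_add cmul_closed)
  show "ev f (scal c x) = c * ev f x" if "Poly_Mapping.keys x \<subseteq> mor C" for c x
    unfolding ev_def esum_def sum_distrib_left using that f
    by (intro sum.cong refl) (simp add: cmul_scal_left dual_scal cmul_closed)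
qed

lemma pt_sum: "pt (\<Sum>i\<in>I. a i) \<xi> m = (\<Sum>i\<in>I. pt (a i) \<xi> m)"
  by (simp add: pt_def)

lemma single_sum: "Poly_Mapping.single c (\<Sum>i\<in>I. k i) = (\<Sum>i\<in>I. Poly_Mapping.single c (k i))"
  by (induction I rule: infinite_finite_induct) (auto simp: single_add)

text \<open>
  A section of the free cover that is equivariant under the groups; it exists because \<open>D(A)\<close> is
  free as a module over the group algebras, on the functionals dual to the orbit representatives.
\<close>

definition sec :: "(('m \<Rightarrow>\<^sub>0 'k) \<Rightarrow> 'k) \<Rightarrow> (('m \<Rightarrow>\<^sub>0 'k) \<Rightarrow> 'k) \<Rightarrow> ('m \<Rightarrow>\<^sub>0 'k)" where
  "sec \<xi> = (\<lambda>m. \<Sum>d\<in>mor C. pt (Poly_Mapping.single (gp d) (\<xi> (bs d))) (dl (rp d)) m)"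

lemma inF_sec [simp]: "inF (sec \<xi>)"
  unfolding sec_def using gp(1) by (intro inF_sum inF_pt) auto

lemma ev_sec:
  assumes \<xi>: "\<xi> \<in> DA" and x: "x \<in> kC"
  shows "ev (sec \<xi>) x = \<xi> x"
proof -
  have "(\<lambda>x\<in>kC. ev (sec \<xi>) x) = \<xi>"
  proof (rule dual_ext[OF ev_dual[OF inF_sec] \<xi>])
    fix c assume c: "c \<in> mor C"
    have "ev (sec \<xi>) (bs c) =
      (\<Sum>d\<in>mor C. ev (pt (Poly_Mapping.single (gp d) (\<xi> (bs d))) (dl (rp d))) (bs c))"
      unfolding sec_def ev_def using c gp(1) by (intro esum_sum biadd_ev) auto
    also have "\<dots> = (\<Sum>d\<in>mor C. if d = c then \<xi> (bs d) else 0)"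
    proof (rule sum.cong[OF refl])
      fix d assume d: "d \<in> mor C"
      note g = gp[OF d]
      have b: "biadd (\<lambda>a m. m (cmul C (bs c) a))" by (rule biadd_ev) (use c in simp)
      have "ev (pt (Poly_Mapping.single (gp d) (\<xi> (bs d))) (dl (rp d))) (bs c) =
          dl (rp d) (cmul C (bs c) (Poly_Mapping.single (gp d) (\<xi> (bs d))))"
        unfolding ev_def by (rule esum_pt[OF b]) (use g(1) in simp_all)
      also have "\<dots> = (if src C c = src C d \<and> comp C c (gp d) = rp d then \<xi> (bs d) else 0)"
        using g(1,3) c by (simp add: cmul_single lookup_single when_def)
      \<comment> \<open>Right cancellation: \<open>c gp d = rp d = d gp d\<close> forces
        \<open>c = d\<close>.\<close>
      also have "(src C c = src C d \<and> comp C c (gp d) = rp d) = (d = c)"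
        using cancel_right[OF c d g(1)] g(3,5) by metis
      finally show "ev (pt (Poly_Mapping.single (gp d) (\<xi> (bs d))) (dl (rp d))) (bs c) =
        (if d = c then \<xi> (bs d) else 0)" .
    qed
    also have "\<dots> = \<xi> (bs c)" using c by (simp add: finite_mor)
    finally show "(\<lambda>x\<in>kC. ev (sec \<xi>) x) (bs c) = \<xi> (bs c)" using c by simp
  qed
  from fun_cong[OF this, of x] show ?thesis using x by simp
qed

lemma sec_add:
  "sec (\<xi> \<oplus>\<^bsub>dual\<^esub> \<zeta>) m = sec \<xi> m + sec \<zeta> m"
  unfolding sec_def sum.distrib[symmetric]
  by (rule sum.cong) (simp_all add: pt_def single_add)

lemma sec_ds: "sec (ds k \<xi>) m = scal k (sec \<xi> m)"
  unfolding sec_def scal_sum by (rule sum.cong) (simp_all add: pt_def)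

text \<open>Replacing the summation index \<open>d\<close> by \<open>d g\<close> keeps the orbit
  representative, and by \<open>gp_comp\<close> the factor \<open>g\<close> turns
  \<open>gp (d g)\<close> into \<open>gp d\<close>.\<close>

lemma sec_equivariant:
  assumes g: "g \<in> mor C" "len g = 0" and \<xi>: "\<xi> \<in> DA"
  shows "cmul C (bs g) (sec \<xi> m) = sec (la (bs g) \<xi>) m"
proof -
  have sg: "trg C g = src C g" using len0_src g by blast
  note gi = linv[OF g]
  let ?M = "{d \<in> mor C. src C d = src C g}"
  have "cmul C (bs g) (sec \<xi> m) =
    (\<Sum>d\<in>mor C. if src C d = src C g then pt (Poly_Mapping.single (comp C g (gp d)) (\<xi> (bs d))) (dl (rp d)) m else 0)"
    unfolding sec_def cmul_sum_right
    by (intro sum.cong refl) (auto simp: pt_def cmul_single gp)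
  also have "\<dots> = (\<Sum>d\<in>?M. pt (Poly_Mapping.single (comp C g (gp d)) (\<xi> (bs d))) (dl (rp d)) m)"
    by (simp add: sum.inter_filter finite_mor)
  also have "\<dots> = (\<Sum>d\<in>?M. pt (Poly_Mapping.single (gp d) (\<xi> (bs (comp C d g)))) (dl (rp d)) m)"
  proof (rule sum.reindex_bij_witness[of _ "\<lambda>d. comp C d g" "\<lambda>d. comp C d (linv g)"])
    fix d assume d: "d \<in> ?M"
    show "comp C (comp C d (linv g)) g = d" "comp C (comp C d g) (linv g) = d"
      "comp C d (linv g) \<in> ?M" "comp C d g \<in> ?M"
      using d g gi sg by (auto simp: comp_assoc)
    have "comp C d (linv g) \<in> mor C" "trg C g = src C (comp C d (linv g))"
      "comp C (comp C d (linv g)) g = d"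
      using d g gi sg by (auto simp: comp_assoc)
    then show "pt (Poly_Mapping.single (gp (comp C d (linv g))) (\<xi> (bs (comp C (comp C d (linv g)) g))))
         (dl (rp (comp C d (linv g)))) m =
        pt (Poly_Mapping.single (comp C g (gp d)) (\<xi> (bs d))) (dl (rp d)) m"
      using gp_comp[of "comp C d (linv g)" g] rp_comp[of "comp C d (linv g)" g] g by simp
  qed
  also have "\<dots> = (\<Sum>d\<in>mor C. if src C d = src C g then pt (Poly_Mapping.single (gp d) (\<xi> (bs (comp C d g)))) (dl (rp d)) m else 0)"
    by (simp add: sum.inter_filter finite_mor)
  also have "\<dots> = (\<Sum>d\<in>mor C. if src C d = src C g then pt (Poly_Mapping.single (gp d) (la (bs g) \<xi> (bs d))) (dl (rp d)) m else 0)"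
    using g sg by (intro sum.cong refl) (simp add: cmul_single)
  also have "\<dots> = sec (la (bs g) \<xi>) m"
    unfolding sec_def using g sg dual_zero[OF \<xi>]
    by (intro sum.cong refl) (auto simp: cmul_single pt_def)
  finally show ?thesis .
qed

text \<open>The section is linear, and on a syzygy the functionals to which it is applied have sum
  zero.\<close>

lemma sec_syzygy:
  assumes "inO f"
  shows "(\<Sum>m\<in>{m. f m \<noteq> 0}. sec (la (f m) m) m') = 0"
proof -
  note f = inFD[OF inO_F[OF assms]]
  have "(\<Sum>m\<in>{m. f m \<noteq> 0}. sec (la (f m) m) m') =
    (\<Sum>d\<in>mor C. pt (Poly_Mapping.single (gp d) (\<Sum>m\<in>{m. f m \<noteq> 0}. la (f m) m (bs d))) (dl (rp d)) m')"
    unfolding sec_def single_sum pt_sum by (rule sum.swap)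
  also have "\<dots> = 0"
  proof (rule sum.neutral, rule ballI)
    fix d assume d: "d \<in> mor C"
    have "(\<Sum>m\<in>{m. f m \<noteq> 0}. la (f m) m (bs d)) = ev f (bs d)"
      using d by (simp add: ev_def esum_def)
    also have "\<dots> = 0" using assms d by (simp add: inO_def)
    finally show "pt (Poly_Mapping.single (gp d) (\<Sum>m\<in>{m. f m \<noteq> 0}. la (f m) m (bs d))) (dl (rp d)) m' = 0"
      by (simp add: pt_def)
  qed
  finally show ?thesis .
qed

text \<open>Since \<open>sec\<close> is only linear, \<open>q a \<xi>\<close> measures its failure
  to be \<open>A\<close>-linear and lies in the syzygy. The cocycle evaluated there is a derivation,
  and equivariance of \<open>sec\<close> makes it vanish on the groups.\<close>

lemma carrier_H_rel_der:
  assumes \<phi>: "\<phi> \<in> carrier H"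
  obtains \<eta> where "rel_der \<eta>" "cl \<phi> = cl (ph \<eta>)"
proof -
  have h: "homF \<phi> (Collect inO)" using \<phi> by (simp add: H_iff)
  define q where "q a \<xi> = (\<lambda>m. cmul C a (sec \<xi> m) - sec (la a \<xi>) m)" for a \<xi>
  \<comment> \<open>The difference between a generator of the cover and the section of its image;
    the values of \<open>\<phi>\<close> on these syzygies give the boundary by which
    \<open>\<phi>\<close> and \<open>ph \<eta>\<close> differ.\<close>
  define r where "r \<xi> = (\<lambda>m. pt (cone C) \<xi> m - sec \<xi> m)" for \<xi>
  define \<eta> where "\<eta> a \<xi> = \<phi> (q a \<xi>)" for a \<xi>
  have ev_diff: "ev (\<lambda>m. f m - g m) x = ev f x - ev g x" if "inF f" "inF g" "x \<in> kC" for f g x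
    unfolding ev_def using that by (simp add: biadd_ev esum_diff)
  have q: "inO (q a \<xi>)" if "a \<in> kC" "\<xi> \<in> DA" for a \<xi>
    using that by (simp add: inO_def q_def ev_diff ev_cmul ev_sec cmul_closed)
  have r: "inO (r \<xi>)" if "\<xi> \<in> DA" for \<xi>
    using that by (simp add: inO_def r_def ev_diff ev_sec cone_closed)
      (simp add: ev_def biadd_ev cone_closed cmul_cone_right)
  have d: "der \<eta>"
    unfolding der_def
  proof (intro ballI conjI allI)
    fix a \<xi> assume a: "a \<in> kC" and \<xi>: "\<xi> \<in> DA"
    have qa: "q a \<xi> \<in> Collect inO" using q[OF a \<xi>] by simp
    show "\<eta> a \<xi> \<in> kC" using homFD(1)[OF h qa] by (simp add: \<eta>_def)
    show "\<eta> (scal k a) \<xi> = scal k (\<eta> a \<xi>)" for k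
    proof -
      have "q (scal k a) \<xi> = (\<lambda>m. cmul C (scal k (cone C)) (q a \<xi> m))"
        using a \<xi> inFD(1)[OF inF_sec] unfolding q_def
        by (simp add: la_scal sec_ds cmul_diff_right cmul_scal_left cmul_cone_left cmul_closed scal_diff)
      then show ?thesis
        using homFD(3)[OF h qa, of "scal k (cone C)"] homFD(1)[OF h qa] kC_scal[OF kC_basic(2), of k]
        by (simp add: \<eta>_def cmul_scal_left cmul_cone_left)
    qed
    show "\<eta> (a + b) \<xi> = \<eta> a \<xi> + \<eta> b \<xi>" if b: "b \<in> kC" for b
    proof -
      have "q (a + b) \<xi> = (\<lambda>m. q a \<xi> m + q b \<xi> m)"
        using a b \<xi> unfolding q_def by (simp add: la_add_left sec_add cmul_add_left algebra_simps)
      then show ?thesis using homFD(2)[OF h qa, of "q b \<xi>"] q[OF b \<xi>] by (simp add: \<eta>_def)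
    qed
    show "\<eta> (cmul C a b) \<xi> = cmul C a (\<eta> b \<xi>) + \<eta> a (la b \<xi>)" if b: "b \<in> kC" for b
    proof -
      have qb: "q b \<xi> \<in> Collect inO" "q a (la b \<xi>) \<in> Collect inO" using q a b \<xi> by auto
      have "q (cmul C a b) \<xi> = (\<lambda>m. cmul C a (q b \<xi> m) + q a (la b \<xi>) m)"
        using a b \<xi> inFD(1)[OF inF_sec] unfolding q_def by (simp add: la_la cmul_diff_right cmul_assoc)
      then show ?thesis
        using homFD(2)[OF h, of "\<lambda>m. cmul C a (q b \<xi> m)" "q a (la b \<xi>)"] homFD(3)[OF h qb(1), of a] qb a
        by (simp add: \<eta>_def)
    qed
    show "\<eta> a (\<xi> \<oplus>\<^bsub>dual\<^esub> \<zeta>) = \<eta> a \<xi> + \<eta> a \<zeta>" if \<zeta>: "\<zeta> \<in> DA" for \<zeta>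
    proof -
      have "q a (\<xi> \<oplus>\<^bsub>dual\<^esub> \<zeta>) = (\<lambda>m. q a \<xi> m + q a \<zeta> m)"
        using a \<xi> \<zeta> unfolding q_def by (simp add: la_add_right sec_add cmul_add_right algebra_simps)
      then show ?thesis using homFD(2)[OF h qa, of "q a \<zeta>"] q[OF a \<zeta>] by (simp add: \<eta>_def)
    qed
  qed
  have z: "\<phi> (\<lambda>m. 0) = 0" using homF_diff[OF h, of "\<lambda>m. 0" "\<lambda>m. 0"] by simp
  have "rel_der \<eta>"
    unfolding rel_der_def
  proof (intro conjI d ballI impI)
    fix g \<xi> assume "g \<in> mor C" "\<xi> \<in> DA" "len g = 0"
    then show "\<eta> (bs g) \<xi> = 0" by (simp add: \<eta>_def q_def sec_equivariant z)
  qed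
  moreover have "cl \<phi> = cl (ph \<eta>)"
  proof -
    have "\<phi> f = esum (\<lambda>a m. cmul C a (\<phi> (r m))) f + esum \<eta> f" if f: "inO f" for f
    proof -
      note f' = inFD[OF inO_F[OF f]]
      have rq: "inO (\<lambda>m'. cmul C (f m) (r m m') + q (f m) m m')" if "f m \<noteq> 0" for m
        using f' that q r by simp
      \<comment> \<open>Each generator \<open>[m]\<close> is \<open>r m\<close> plus
        \<open>sec m\<close>, and \<open>f m\<close> times \<open>sec m\<close> is
        \<open>q (f m) m\<close> plus the section of the functional \<open>la (f m) m\<close>. These
        last sections cancel by \<open>sec_syzygy\<close>.\<close>
      have "f = (\<lambda>m'. \<Sum>m\<in>{m. f m \<noteq> 0}. cmul C (f m) (r m m') + q (f m) m m')"
      proof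
        fix m'
        have "cmul C (f m) (r m m') + q (f m) m m' = (if m = m' then f m else 0) - sec (la (f m) m) m'" for m
          using f'(1) by (simp add: r_def q_def cmul_diff_right pt_def cmul_cone_right)
        then show "f m' = (\<Sum>m\<in>{m. f m \<noteq> 0}. cmul C (f m) (r m m') + q (f m) m m')"
          using f'(3) by (simp add: sum_subtractf sec_syzygy[OF f])
      qed
      then have "\<phi> f = \<phi> (\<lambda>m'. \<Sum>m\<in>{m. f m \<noteq> 0}. cmul C (f m) (r m m') + q (f m) m m')"
        by (rule arg_cong)
      also have "\<dots> = (\<Sum>m\<in>{m. f m \<noteq> 0}. \<phi> (\<lambda>m'. cmul C (f m) (r m m') + q (f m) m m'))"
        by (rule homF_sum[OF h]) (use rq in blast)
      also have "\<dots> = (\<Sum>m\<in>{m. f m \<noteq> 0}. cmul C (f m) (\<phi> (r m)) + \<eta> (f m) m)"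
      proof (rule sum.cong[OF refl])
        fix m assume m: "m \<in> {m. f m \<noteq> 0}"
        show "\<phi> (\<lambda>m'. cmul C (f m) (r m m') + q (f m) m m') = cmul C (f m) (\<phi> (r m)) + \<eta> (f m) m"
          using homFD(2)[OF h, of "\<lambda>m'. cmul C (f m) (r m m')" "q (f m) m"]
            homFD(3)[OF h, of "r m" "f m"] q[of "f m" m] r[of m] f' m
          by (simp add: \<eta>_def)
      qed
      finally show ?thesis by (simp add: esum_def sum.distrib)
    qed
    then have "(\<lambda>f\<in>Collect inO. \<phi> f - ph \<eta> f) = restrict (esum (\<lambda>a m. cmul C a (\<phi> (r m)))) (Collect inO)"
      by (intro restrict_ext) (simp add: ph_def)
    moreover have "homF (esum (\<lambda>a m. cmul C a (\<phi> (r m)))) (Collect inF)"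
      by (rule homF_esum) (use homFD(1)[OF h] r in simp)
    ultimately show ?thesis
      unfolding cl_eq_iff[OF \<phi> ph_H[OF d]] Bd_iff by blast
  qed
  ultimately show ?thesis using that by blast
qed

end

section \<open>The double category\<close>

definition lext :: "('m \<Rightarrow> ('z \<Rightarrow>\<^sub>0 'k::field)) \<Rightarrow> ('m \<Rightarrow>\<^sub>0 'k) \<Rightarrow> ('z \<Rightarrow>\<^sub>0 'k)" where
  "lext h f = (\<Sum>a\<in>Poly_Mapping.keys f. scal (Poly_Mapping.lookup f a) (h a))"

lemma lext_superset:
  assumes "finite S" "Poly_Mapping.keys f \<subseteq> S"
  shows "lext h f = (\<Sum>a\<in>S. scal (Poly_Mapping.lookup f a) (h a))"
  unfolding lext_def using assms by (intro sum.mono_neutral_left) (auto simp: in_keys_iff)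

lemma lext_single [simp]: "lext h (Poly_Mapping.single a k) = scal k (h a)"
  by (subst lext_superset[of "{a}"]) auto

lemma lext_zero [simp]: "lext h 0 = 0"
  by (simp add: lext_def)

lemma lext_add: "lext h (f + g) = lext h f + lext h g"
proof -
  let ?S = "Poly_Mapping.keys f \<union> Poly_Mapping.keys g"
  have k: "Poly_Mapping.keys (f + g) \<subseteq> ?S" by (rule keys_add)
  show ?thesis
    apply (subst (1 2 3) lext_superset[of ?S])
    using k by (auto simp: sum.distrib[symmetric] lookup_add scal_add_left intro!: sum.cong)
qed

lemma lext_scal: "lext h (scal c f) = scal c (lext h f)"
  by (subst lext_superset[of "Poly_Mapping.keys f"])
    (auto simp: keys_scal lext_def scal_sum scal_scal)

lemma lext_add_fun: "lext (\<lambda>a. h a + h' a) f = lext h f + lext h' f"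
  by (simp add: lext_def scal_add sum.distrib)

lemma keys_lext: "(\<And>a. a \<in> Poly_Mapping.keys f \<Longrightarrow> Poly_Mapping.keys (h a) \<subseteq> M) \<Longrightarrow> Poly_Mapping.keys (lext h f) \<subseteq> M"
  unfolding lext_def by (intro keys_sum_subset order_trans[OF keys_scal])

section \<open>The derivations that split an arrow out of a morphism\<close>

context alg_cat
begin

lemma rel_der_zero: "rel_der (\<lambda>a \<xi>. 0)"
  by (simp add: rel_der_def der_def)

lemma rel_derI:
  assumes "\<And>a \<xi>. a \<in> kC \<Longrightarrow> \<xi> \<in> DA \<Longrightarrow> \<eta> a \<xi> \<in> kC"
    and "\<And>a \<xi> k. a \<in> kC \<Longrightarrow> \<xi> \<in> DA \<Longrightarrow> \<eta> (scal k a) \<xi> = scal k (\<eta> a \<xi>)"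
    and "\<And>a b \<xi>. a \<in> kC \<Longrightarrow> b \<in> kC \<Longrightarrow> \<xi> \<in> DA \<Longrightarrow> \<eta> (a + b) \<xi> = \<eta> a \<xi> + \<eta> b \<xi>"
    and "\<And>a b \<xi>. a \<in> kC \<Longrightarrow> b \<in> kC \<Longrightarrow> \<xi> \<in> DA \<Longrightarrow> \<eta> (cmul C a b) \<xi> = cmul C a (\<eta> b \<xi>) + \<eta> a (la b \<xi>)"
    and "\<And>a \<xi> \<zeta>. a \<in> kC \<Longrightarrow> \<xi> \<in> DA \<Longrightarrow> \<zeta> \<in> DA \<Longrightarrow> \<eta> a (\<xi> \<oplus>\<^bsub>dual\<^esub> \<zeta>) = \<eta> a \<xi> + \<eta> a \<zeta>"
    and "\<And>g \<xi>. g \<in> mor C \<Longrightarrow> len g = 0 \<Longrightarrow> \<xi> \<in> DA \<Longrightarrow> \<eta> (bs g) \<xi> = 0"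
  shows "rel_der \<eta>"
  unfolding rel_der_def der_def by (intro conjI ballI allI impI assms)

lemma rel_der_add:
  assumes "rel_der \<eta>" "rel_der \<eta>'"
  shows "rel_der (\<lambda>a \<xi>. \<eta> a \<xi> + \<eta>' a \<xi>)"
proof -
  have d: "der \<eta>" "der \<eta>'" using assms by (auto simp: rel_der_def)
  note D = derD[OF d(1)] derD[OF d(2)]
  show ?thesis
  proof (rule rel_derI, goal_cases)
    case (1 a \<xi>)
    then show ?case using D(1,6) by (intro kC_add)
  next
    case (2 a \<xi> k)
    show ?case by (simp only: D(2,7)[OF 2] scal_add)
  next
    case (3 a b \<xi>)
    show ?case by (simp only: D(3,8)[OF 3(1,3,2)] add_ac)
  next
    case (4 a b \<xi>)
    show ?case by (simp only: D(4,9)[OF 4(1,3,2)] cmul_add_right add_ac)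
  next
    case (5 a \<xi> \<zeta>)
    show ?case by (simp only: D(5,10)[OF 5] add_ac)
  next
    case (6 g \<xi>)
    then show ?case using assms by (simp add: rel_der_def)
  qed
qed

lemma rel_der_scal:
  assumes "rel_der \<eta>"
  shows "rel_der (\<lambda>a \<xi>. scal k (\<eta> a \<xi>))"
proof -
  have d: "der \<eta>" using assms by (auto simp: rel_der_def)
  note D = derD[OF d]
  show ?thesis
  proof (rule rel_derI, goal_cases)
    case (1 a \<xi>)
    then show ?case using D(1) by (intro kC_scal)
  next
    case (2 a \<xi> k)
    show ?case by (simp only: D(2)[OF 2] scal_scal mult.commute)
  next
    case (3 a b \<xi>)
    show ?case by (simp only: D(3)[OF 3(1,3,2)] scal_add)
  next
    case (4 a b \<xi>)
    show ?case by (simp only: D(4)[OF 4(1,3,2)] cmul_scal_right scal_add)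
  next
    case (5 a \<xi> \<zeta>)
    show ?case by (simp only: D(5)[OF 5] scal_add)
  next
    case (6 g \<xi>)
    then show ?case using assms by (simp add: rel_der_def)
  qed
qed

lemma der_inner:
  assumes \<theta>: "lin \<theta>"
  shows "der (\<lambda>a \<xi>. \<theta> (la a \<xi>) - cmul C a (\<theta> \<xi>))"
proof -
  have k: "Poly_Mapping.keys (\<theta> \<xi>) \<subseteq> mor C" if "\<xi> \<in> DA" for \<xi> using \<theta> that by (simp add: lin_def)
  have a: "\<theta> (\<xi> \<oplus>\<^bsub>dual\<^esub> \<zeta>) = \<theta> \<xi> + \<theta> \<zeta>" if "\<xi> \<in> DA" "\<zeta> \<in> DA" for \<xi> \<zeta> using \<theta> that by (simp add: lin_def)
  have s: "\<theta> (ds c \<xi>) = scal c (\<theta> \<xi>)" if "\<xi> \<in> DA" for c \<xi> using \<theta> that by (simp add: lin_def)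
  show ?thesis unfolding der_def
  proof (intro ballI conjI allI)
    fix a \<xi> assume *: "a \<in> kC" "\<xi> \<in> DA"
    show "\<theta> (la a \<xi>) - cmul C a (\<theta> \<xi>) \<in> kC"
      by (rule kC_diff) (use * k in \<open>simp_all add: cmul_closed\<close>)
    show "\<theta> (la (scal c a) \<xi>) - cmul C (scal c a) (\<theta> \<xi>) = scal c (\<theta> (la a \<xi>) - cmul C a (\<theta> \<xi>))" for c
      using * by (simp add: la_scal s cmul_scal_left scal_diff)
    show "\<theta> (la (a + b) \<xi>) - cmul C (a + b) (\<theta> \<xi>) =
        \<theta> (la a \<xi>) - cmul C a (\<theta> \<xi>) + (\<theta> (la b \<xi>) - cmul C b (\<theta> \<xi>))" if "b \<in> kC" for b
      using * that by (simp add: la_add_left a cmul_add_left)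
    show "\<theta> (la (cmul C a b) \<xi>) - cmul C (cmul C a b) (\<theta> \<xi>) =
        cmul C a (\<theta> (la b \<xi>) - cmul C b (\<theta> \<xi>)) + (\<theta> (la a (la b \<xi>)) - cmul C a (\<theta> (la b \<xi>)))" if "b \<in> kC" for b
      using * that k by (simp add: la_la cmul_diff_right cmul_assoc)
    show "\<theta> (la a (\<xi> \<oplus>\<^bsub>dual\<^esub> \<zeta>)) - cmul C a (\<theta> (\<xi> \<oplus>\<^bsub>dual\<^esub> \<zeta>)) =
        \<theta> (la a \<xi>) - cmul C a (\<theta> \<xi>) + (\<theta> (la a \<zeta>) - cmul C a (\<theta> \<zeta>))" if "\<zeta> \<in> DA" for \<zeta>
      using * that by (simp add: la_add_right a cmul_add_right)
  qed
qed

lemma lookup_cmul_left: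
  assumes "g \<in> mor C" "e \<in> mor C" "src C g = trg C e" "Poly_Mapping.keys f \<subseteq> mor C"
  shows "Poly_Mapping.lookup (cmul C (bs g) f) (comp C g e) = Poly_Mapping.lookup f e"
  using assms(4)
proof (induction rule: pm_induct)
  case (single a k)
  have "src C g = trg C a \<Longrightarrow> comp C g a = comp C g e \<longleftrightarrow> a = e"
    using cancel_left[OF assms(1) single assms(2)] assms(3) by metis
  then show ?case using assms(3) by (cases "a = e") (simp_all add: cmul_single lookup_single when_def)
qed (simp_all add: cmul_add_right lookup_add)

lemma lookup_cmul_left_zero:
  assumes "g \<in> mor C" "trg C e \<noteq> trg C g" "Poly_Mapping.keys f \<subseteq> mor C"
  shows "Poly_Mapping.lookup (cmul C (bs g) f) e = 0"
  using assms(3)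
proof (induction rule: pm_induct)
  case (single a k)
  have "src C g = trg C a \<Longrightarrow> comp C g a \<noteq> e"
    using assms(1,2) single by auto
  then show ?case by (simp add: cmul_single lookup_single when_def)
qed (simp_all add: cmul_add_right lookup_add)

text \<open>The dual is generated over the group algebras by the functionals at orbit
  representatives; right cancellation by \<open>gp d\<close> gives the formula.\<close>

lemma dl_rp:
  assumes d: "d \<in> mor C"
  shows "dl d = la (bs (gp d)) (dl (rp d))"
proof (rule dual_ext)
  fix x assume x: "x \<in> mor C"
  note g = gp[OF d]
  have "(src C x = src C d \<and> comp C x (gp d) = rp d) = (x = d)"
    using cancel_right[OF x d g(1)] g(3,5) by metis
  then show "dl d (bs x) = la (bs (gp d)) (dl (rp d)) (bs x)"
    unfolding la_dl_single[OF g(1,6) x] g(3) using x by (simp add: lookup_single when_def)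
qed (use gp(1)[OF d] in auto)

definition dec :: "'m \<Rightarrow> 'm \<Rightarrow> ('m \<times> 'm) set" where
  "dec x c = {(p, q). p \<in> mor C \<and> q \<in> mor C \<and> src C p = trg C x \<and> src C x = trg C q \<and>
      comp C (comp C p x) q = c}"

text \<open>Once the arrow is removed, \<open>p\<close> stays on the side of the values and
  \<open>q\<close> on the side of the functional. Placing \<open>e\<close> and \<open>d\<close>
  there makes multiplication of \<open>d x* e\<close> from the left act on functionals and from the
  right on values, as in \<open>delta_ra\<close> and \<open>delta_right\<close>.\<close>

definition dd :: "'m \<Rightarrow> 'm \<Rightarrow> 'm \<Rightarrow> 'm \<Rightarrow> (('m \<Rightarrow>\<^sub>0 'k) \<Rightarrow> 'k) \<Rightarrow> ('m \<Rightarrow>\<^sub>0 'k)" where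
  "dd d x e c \<xi> = (\<Sum>(p, q)\<in>dec x c. scal (\<xi> (bs (comp C d q))) (bs (comp C p e)))"

definition delta :: "'m \<Rightarrow> 'm \<Rightarrow> 'm \<Rightarrow> ('m \<Rightarrow>\<^sub>0 'k) \<Rightarrow> (('m \<Rightarrow>\<^sub>0 'k) \<Rightarrow> 'k) \<Rightarrow> ('m \<Rightarrow>\<^sub>0 'k)" where
  "delta d x e a \<xi> = lext (\<lambda>c. dd d x e c \<xi>) a"

text \<open>Indexes the elements \<open>d x* e\<close>: the reversed arrow runs from the target of
  \<open>x\<close> to its source, so \<open>e\<close> must end at that target and \<open>d\<close>
  must start at that source.\<close>

definition triple :: "'m \<Rightarrow> 'm \<Rightarrow> 'm \<Rightarrow> bool" where
  "triple d x e \<longleftrightarrow> d \<in> mor C \<and> x \<in> mor C \<and> e \<in> mor C \<and> len x = 1 \<and> src C d = src C x \<and> trg C e = trg C x"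

lemma finite_dec [simp]: "finite (dec x c)"
  by (rule finite_subset[of _ "mor C \<times> mor C"]) (auto simp: dec_def finite_mor)

lemma dd_closed: "triple d x e \<Longrightarrow> Poly_Mapping.keys (dd d x e c \<xi>) \<subseteq> mor C"
  unfolding dd_def by (intro keys_sum_subset) (auto simp: dec_def triple_def split: if_splits)

text \<open>A factor of length one cannot be cut by the seam between \<open>c\<close> and
  \<open>c'\<close>. Comparing the lengths of \<open>q\<close> and \<open>c'\<close> tells, through
  \<open>levi\<close>, on which side of the seam it lies.\<close>

lemma dec_comp:
  assumes c: "c \<in> mor C" "c' \<in> mor C" "src C c = trg C c'" and x: "x \<in> mor C" "len x = 1"
  shows "dec x (comp C c c') = (\<lambda>(p, q). (comp C c p, q)) ` dec x c' \<union> (\<lambda>(p, q). (p, comp C q c')) ` dec x c"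
proof (intro Set.set_eqI iffI)
  fix z assume z: "z \<in> dec x (comp C c c')"
  obtain p q where pq: "z = (p, q)" by (cases z)
  have *: "p \<in> mor C" "q \<in> mor C" "src C p = trg C x" "src C x = trg C q"
    "comp C (comp C p x) q = comp C c c'" using z by (auto simp: pq dec_def)
  have px: "comp C p x \<in> mor C" "src C (comp C p x) = trg C q" using * x by auto
  show "z \<in> (\<lambda>(p, q). (comp C c p, q)) ` dec x c' \<union> (\<lambda>(p, q). (p, comp C q c')) ` dec x c"
  proof (cases "len c' \<le> len q")
    case True
    obtain r where r: "r \<in> mor C" "src C r = trg C c'" "trg C r = src C (comp C p x)"
      "c = comp C (comp C p x) r" "q = comp C r c'"
      using levi[OF c(1,2) px(1) *(2) c(3) px(2) *(5)[symmetric] True] by blast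
    have "(p, r) \<in> dec x c" using * r x by (simp add: dec_def)
    then show ?thesis unfolding pq r(5) by force
  next
    case False
    then have le: "len q \<le> len c'" by simp
    obtain r where r: "r \<in> mor C" "src C r = trg C q" "trg C r = src C c"
      "comp C p x = comp C c r" "c' = comp C r q"
      using levi[OF px(1) *(2) c(1,2) px(2) c(3) *(5) le] by blast
    \<comment> \<open>Here \<open>q\<close> is strictly shorter than \<open>c'\<close>, so the
      comparison morphism \<open>r\<close> has length at least one and a second use of
      \<open>levi\<close> splits \<open>x\<close> off it.\<close>
    have "len c' = len r + len q" using r * by simp
    then have "len x \<le> len r" using False x by simp
    obtain s where s: "s \<in> mor C" "src C s = trg C x" "trg C s = src C c" "p = comp C c s" "r = comp C s x"
      using levi[OF *(1) x(1) c(1) r(1) *(3) _ r(4) \<open>len x \<le> len r\<close>] r by auto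
    have "(s, q) \<in> dec x c'" using * r s x by (simp add: dec_def)
    then show ?thesis unfolding pq s(4) by force
  qed
next
  fix z assume "z \<in> (\<lambda>(p, q). (comp C c p, q)) ` dec x c' \<union> (\<lambda>(p, q). (p, comp C q c')) ` dec x c"
  then consider p q where "z = (comp C c p, q)" "(p, q) \<in> dec x c'" | p q where "z = (p, comp C q c')" "(p, q) \<in> dec x c"
    by auto
  then show "z \<in> dec x (comp C c c')"
  proof cases
    case 1
    then have "trg C p = trg C c'" using x by (auto simp: dec_def)
    then show ?thesis using 1 c x by (auto simp: dec_def comp_assoc)
  next
    case 2
    then have "src C q = src C c" using x by (auto simp: dec_def)
    then show ?thesis using 2 c x by (auto simp: dec_def comp_assoc)
  qed
qed

text \<open>The splittings inside \<open>c'\<close> leave \<open>c\<close> as a left factor of the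
  value, those inside \<open>c\<close> leave \<open>c'\<close> as an argument of the functional.
  Cancellation ensures that no splitting is counted twice.\<close>

lemma dd_comp:
  assumes c: "c \<in> mor C" "c' \<in> mor C" "src C c = trg C c'" and t: "triple d x e" and \<xi>: "\<xi> \<in> DA"
  shows "dd d x e (comp C c c') \<xi> = cmul C (bs c) (dd d x e c' \<xi>) + dd d x e c (la (bs c') \<xi>)"
proof -
  have x: "x \<in> mor C" "len x = 1" and d: "d \<in> mor C" "src C d = src C x" and e: "e \<in> mor C" "trg C e = trg C x"
    using t by (auto simp: triple_def)
  let ?h = "\<lambda>(p, q). scal (\<xi> (bs (comp C d q))) (bs (comp C p e))"
  let ?L = "\<lambda>(p, q). (comp C c p, q)" and ?R = "\<lambda>(p, q). (p, comp C q c')"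
  have trg_p: "trg C p = trg C c'" "len q < len c'" if "(p, q) \<in> dec x c'" for p q
    using that x by (auto simp: dec_def)
  have src_q: "src C q = src C c" if "(p, q) \<in> dec x c" for p q
    using that x by (auto simp: dec_def)
  \<comment> \<open>The two families are told apart by length: \<open>q\<close> is shorter than
    \<open>c'\<close> in the first and at least as long in the second.\<close>
  have disj: "?L ` dec x c' \<inter> ?R ` dec x c = {}"
  proof -
    have False if "(p, q) \<in> dec x c'" "(p', q') \<in> dec x c" "q = comp C q' c'" for p q p' q'
      using trg_p(2)[OF that(1)] src_q[OF that(2)] that c by (auto simp: dec_def)
    then show ?thesis by auto
  qed
  have injL: "inj_on ?L (dec x c')"
  proof (rule inj_onI)
    fix z z' assume z: "z \<in> dec x c'" "z' \<in> dec x c'" "?L z = ?L z'"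
    obtain p q p' where zz: "z = (p, q)" "z' = (p', q)" using z(3) by (cases z; cases z') auto
    have *: "(p, q) \<in> dec x c'" "(p', q) \<in> dec x c'" "comp C c p = comp C c p'"
      using z by (simp_all add: zz)
    have "p \<in> mor C" "p' \<in> mor C" using * by (auto simp: dec_def)
    then show "z = z'"
      unfolding zz using cancel_left[OF c(1) _ _ _ _ *(3)] trg_p(1)[OF *(1)] trg_p(1)[OF *(2)] c(3) by simp
  qed
  have injR: "inj_on ?R (dec x c)"
  proof (rule inj_onI)
    fix z z' assume z: "z \<in> dec x c" "z' \<in> dec x c" "?R z = ?R z'"
    obtain p q q' where zz: "z = (p, q)" "z' = (p, q')" using z(3) by (cases z; cases z') auto
    have *: "(p, q) \<in> dec x c" "(p, q') \<in> dec x c" "comp C q c' = comp C q' c'"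
      using z by (simp_all add: zz)
    have "q \<in> mor C" "q' \<in> mor C" using * by (auto simp: dec_def)
    then show "z = z'"
      unfolding zz using cancel_right[OF _ _ c(2) _ _ *(3)] src_q[OF *(1)] src_q[OF *(2)] c(3) by simp
  qed
  have "dd d x e (comp C c c') \<xi> = sum ?h (?L ` dec x c') + sum ?h (?R ` dec x c)"
    unfolding dd_def dec_comp[OF c x] by (rule sum.union_disjoint) (use disj in auto)
  also have "sum ?h (?L ` dec x c') = cmul C (bs c) (dd d x e c' \<xi>)"
    unfolding dd_def cmul_sum_right sum.reindex[OF injL]
  proof (rule sum.cong[OF refl], clarify)
    fix p q assume pq: "(p, q) \<in> dec x c'"
    have "comp C (comp C c p) e = comp C c (comp C p e)" "src C c = trg C (comp C p e)"
      using pq trg_p[OF pq] c e by (auto simp: dec_def comp_assoc)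
    then show "(?h \<circ> ?L) (p, q) = cmul C (bs c) (scal (\<xi> (bs (comp C d q))) (bs (comp C p e)))"
      by (simp add: cmul_scal_right cmul_single)
  qed
  also have "sum ?h (?R ` dec x c) = dd d x e c (la (bs c') \<xi>)"
    unfolding dd_def sum.reindex[OF injR]
  proof (rule sum.cong[OF refl], clarify)
    fix p q assume pq: "(p, q) \<in> dec x c"
    have "comp C d (comp C q c') = comp C (comp C d q) c'" "src C (comp C d q) = trg C c'" "comp C d q \<in> mor C"
      using pq src_q[OF pq] c d by (auto simp: dec_def comp_assoc)
    then show "(?h \<circ> ?R) (p, q) = scal (la (bs c') \<xi> (bs (comp C d q))) (bs (comp C p e))"
      by (simp add: cmul_single)
  qed
  finally show ?thesis .
qed

lemma dd_comp_zero:
  assumes c: "c \<in> mor C" "c' \<in> mor C" "src C c \<noteq> trg C c'" and t: "triple d x e" and \<xi>: "\<xi> \<in> DA"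
  shows "cmul C (bs c) (dd d x e c' \<xi>) = 0" "dd d x e c (la (bs c') \<xi>) = 0"
proof -
  have x: "x \<in> mor C" "len x = 1" and d: "d \<in> mor C" "src C d = src C x" and e: "e \<in> mor C" "trg C e = trg C x"
    using t by (auto simp: triple_def)
  show "cmul C (bs c) (dd d x e c' \<xi>) = 0"
    unfolding dd_def cmul_sum_right
  proof (rule sum.neutral, clarify)
    fix p q assume "(p, q) \<in> dec x c'"
    then have "trg C (comp C p e) = trg C c'" using x e by (auto simp: dec_def)
    then show "cmul C (bs c) (scal (\<xi> (bs (comp C d q))) (bs (comp C p e))) = 0"
      using c by (simp add: cmul_scal_right cmul_single)
  qed
  show "dd d x e c (la (bs c') \<xi>) = 0"
    unfolding dd_def
  proof (rule sum.neutral, clarify)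
    fix p q assume "(p, q) \<in> dec x c"
    then have "src C (comp C d q) = src C c" "comp C d q \<in> mor C" using x d by (auto simp: dec_def)
    then show "scal (la (bs c') \<xi> (bs (comp C d q))) (bs (comp C p e)) = 0"
      using c \<xi> by (simp add: cmul_single dual_zero)
  qed
qed

lemma dd_lin:
  assumes "triple d x e" "\<xi> \<in> DA"
  shows "\<zeta> \<in> DA \<Longrightarrow> dd d x e c (\<xi> \<oplus>\<^bsub>dual\<^esub> \<zeta>) = dd d x e c \<xi> + dd d x e c \<zeta>"
    "dd d x e c (ds k \<xi>) = scal k (dd d x e c \<xi>)"
  using assms unfolding dd_def scal_sum sum.distrib[symmetric]
  by (auto simp: triple_def dec_def single_add distrib_right intro!: sum.cong split: prod.splits)

lemma delta_rel_der:
  assumes t: "triple d x e"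
  shows "rel_der (delta d x e)"
proof -
  have k: "Poly_Mapping.keys (delta d x e a \<xi>) \<subseteq> mor C" for a \<xi>
    unfolding delta_def by (rule keys_lext) (rule dd_closed[OF t])
  have add\<xi>: "delta d x e a (\<xi> \<oplus>\<^bsub>dual\<^esub> \<zeta>) = delta d x e a \<xi> + delta d x e a \<zeta>" if "\<xi> \<in> DA" "\<zeta> \<in> DA" for a \<xi> \<zeta>
    unfolding delta_def lext_add_fun[symmetric] using dd_lin(1)[OF t] that by simp
  have sc: "delta d x e a (ds l \<xi>) = scal l (delta d x e a \<xi>)" if "\<xi> \<in> DA" for a \<xi> l
    unfolding delta_def lext_def scal_sum using dd_lin(2)[OF t that]
    by (intro sum.cong refl) (simp add: scal_scal mult.commute)
  have leib: "delta d x e (cmul C a b) \<xi> = cmul C a (delta d x e b \<xi>) + delta d x e a (la b \<xi>)"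
    if a: "Poly_Mapping.keys a \<subseteq> mor C" and b: "Poly_Mapping.keys b \<subseteq> mor C" and \<xi>: "\<xi> \<in> DA" for a b \<xi>
    using a
  proof (induction rule: pm_induct)
    case (single c l)
    note c = this
    show ?case using b
    proof (induction rule: pm_induct)
      case zero
      \<comment> \<open>The zero of the algebra acts as the zero scalar, so homogeneity in the
        functional settles this case.\<close>
      have "la 0 \<xi> = ds 0 \<xi>" using ds_la[OF \<xi>, of 0] by simp
      then show ?case using sc[OF \<xi>, of _ 0] by (simp add: delta_def)
    next
      case (single c' l')
      have la': "la (Poly_Mapping.single c' l') \<xi> = ds l' (la (bs c') \<xi>)"
        using la_scal[OF \<xi>, of "bs c'" l'] single by simp
      have "la (bs c') \<xi> \<in> DA" using \<xi> single by simp
      note m = dd_lin(2)[OF t this, of c l']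
      show ?case
        using dd_comp[OF c single _ t \<xi>] dd_comp_zero[OF c single _ t \<xi>] \<xi> single
          cmul_scal_left[of C l "bs c"] cmul_scal_right[of C "bs c" l']
        by (cases "src C c = trg C c'")
          (simp_all add: la' m sc delta_def cmul_single scal_add scal_scal cmul_scal_right mult.commute)
    next
      case (add f g)
      then show ?case using \<xi> c
        by (simp add: la_add_left add\<xi>) (simp add: delta_def cmul_add_right lext_add algebra_simps)
    qed
  qed (simp_all add: delta_def cmul_add_left lext_add algebra_simps)
  have len0: "delta d x e (bs g) \<xi> = 0" if "g \<in> mor C" "len g = 0" for g \<xi>
  proof -
    have "dec x g = {}" using that t by (auto simp: dec_def triple_def)
    then show ?thesis by (simp add: delta_def dd_def)
  qed
  show ?thesis
    unfolding rel_der_def der_def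
    using k add\<xi> leib len0 by (auto simp: delta_def lext_add lext_scal)
qed

text \<open>By cancellation \<open>d'\<close> determines \<open>q\<close> and \<open>e'\<close>
  determines \<open>p\<close>, so at most one splitting contributes and the coefficient is 0 or
  1.\<close>

lemma delta_dl:
  assumes t: "triple d x e" and d': "d' \<in> mor C"
  shows "Poly_Mapping.lookup (delta d x e (bs y) (dl d')) e' =
    (if \<exists>(p, q)\<in>dec x y. comp C d q = d' \<and> comp C p e = e' then 1 else 0)"
proof -
  have t': "d \<in> mor C" "x \<in> mor C" "e \<in> mor C" "src C d = src C x" "trg C e = trg C x"
    using t by (auto simp: triple_def)
  have "Poly_Mapping.lookup (delta d x e (bs y) (dl d')) e' =
      (\<Sum>pq\<in>dec x y. if comp C d (snd pq) = d' \<and> comp C (fst pq) e = e' then 1 else 0)"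
    unfolding delta_def dd_def using t'
    by (auto simp: lookup_sum lookup_single when_def dec_def intro!: sum.cong)
  also have "\<dots> = (if \<exists>(p, q)\<in>dec x y. comp C d q = d' \<and> comp C p e = e' then 1 else 0)"
  proof (cases "\<exists>(p, q)\<in>dec x y. comp C d q = d' \<and> comp C p e = e'")
    case True
    then obtain p q where pq: "(p, q) \<in> dec x y" "comp C d q = d'" "comp C p e = e'" by auto
    have "(comp C d (snd z) = d' \<and> comp C (fst z) e = e') = (z = (p, q))" if "z \<in> dec x y" for z
    proof -
      obtain p' q' where z: "z = (p', q')" by (cases z)
      have m: "p \<in> mor C" "q \<in> mor C" "src C p = trg C x" "src C x = trg C q"
         "p' \<in> mor C" "q' \<in> mor C" "src C p' = trg C x" "src C x = trg C q'"
        using pq(1) that by (auto simp: dec_def z)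
      have "q' = q" if "comp C d q' = d'"
        by (rule cancel_left[OF t'(1)]) (use m t' that pq in auto)
      moreover have "p' = p" if "comp C p' e = e'"
        by (rule cancel_right[OF _ _ t'(3)]) (use m t' that pq in auto)
      ultimately show ?thesis using pq by (auto simp: z)
    qed
    then have "(\<Sum>pq\<in>dec x y. if comp C d (snd pq) = d' \<and> comp C (fst pq) e = e' then 1 else 0) =
        (\<Sum>z\<in>dec x y. if z = (p, q) then 1 else (0::'k))" by (intro sum.cong) auto
    then show ?thesis using pq True by (simp add: sum.delta')
  next
    case False
    then have "(\<Sum>pq\<in>dec x y. if comp C d (snd pq) = d' \<and> comp C (fst pq) e = e' then 1 else 0) = (0::'k)"
      by (intro sum.neutral) auto
    then show ?thesis using False by simp
  qed
  finally show ?thesis .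
qed

lemma delta_ra:
  assumes t: "triple d x e" and c: "c \<in> mor C" and \<xi>: "\<xi> \<in> DA"
  shows "delta d x e a (ra \<xi> (bs c)) = (if src C c = trg C d then delta (comp C c d) x e a \<xi> else 0)"
proof -
  have t': "d \<in> mor C" "src C d = src C x" using t by (auto simp: triple_def)
  have "dd d x e y (ra \<xi> (bs c)) = (if src C c = trg C d then dd (comp C c d) x e y \<xi> else 0)" for y
    unfolding dd_def using t' c dual_zero[OF \<xi>]
    by (auto simp: dec_def cmul_single comp_assoc intro!: sum.cong sum.neutral)
  then show ?thesis by (simp add: delta_def lext_def)
qed

lemma delta_right:
  assumes t: "triple d x e" and c: "c \<in> mor C"
  shows "cmul C (delta d x e a \<xi>) (bs c) = (if src C e = trg C c then delta d x (comp C e c) a \<xi> else 0)"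
proof -
  have t': "e \<in> mor C" "trg C e = trg C x" using t by (auto simp: triple_def)
  have "cmul C (dd d x e y \<xi>) (bs c) = (if src C e = trg C c then dd d x (comp C e c) y \<xi> else 0)" for y
    unfolding dd_def cmul_sum_left using t' c
    by (auto simp: dec_def cmul_single cmul_scal_left comp_assoc intro!: sum.cong sum.neutral)
  then show ?thesis by (simp add: delta_def lext_def cmul_sum_left cmul_scal_left)
qed

end

text \<open>
  A category whose degree zero part is a copy of \<open>C\<close>; in the application \<open>dg\<close> counts the starred
  arrows of a morphism of \<open>\<C>(\<bar>Q, \<bar>X)\<close>.
\<close>

locale graded_cat = cat C + D: cat D
  for C :: "('o, 'm) category" and D :: "('o, 'n) category" +
  fixes iota :: "'m \<Rightarrow> 'n" and dg :: "'n \<Rightarrow> nat"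
  assumes iota_mor [simp]: "c \<in> mor C \<Longrightarrow> iota c \<in> mor D"
    and src_iota [simp]: "c \<in> mor C \<Longrightarrow> src D (iota c) = src C c"
    and trg_iota [simp]: "c \<in> mor C \<Longrightarrow> trg D (iota c) = trg C c"
    and dg_iota [simp]: "c \<in> mor C \<Longrightarrow> dg (iota c) = 0"
    and iota_comp: "\<lbrakk>a \<in> mor C; b \<in> mor C; src C a = trg C b\<rbrakk> \<Longrightarrow> iota (comp C a b) = comp D (iota a) (iota b)"
    and obj_eq: "obj D = obj C"
    and iota_ident: "i \<in> obj C \<Longrightarrow> iota (ident C i) = ident D i"
    and iota_inj: "inj_on iota (mor C)"
    and iota_surj: "\<lbrakk>w \<in> mor D; dg w = 0\<rbrakk> \<Longrightarrow> \<exists>c\<in>mor C. w = iota c"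
    and dg_comp [simp]: "\<lbrakk>v \<in> mor D; w \<in> mor D; src D v = trg D w\<rbrakk> \<Longrightarrow> dg (comp D v w) = dg v + dg w"
    and dg_levi: "\<lbrakk>v \<in> mor D; w \<in> mor D; v' \<in> mor D; w' \<in> mor D; src D v = trg D w; src D v' = trg D w';
        comp D v w = comp D v' w'; dg v = dg v'\<rbrakk> \<Longrightarrow>
        \<exists>r\<in>mor D. (src D r = trg D w \<and> trg D r = src D v' \<and> v = comp D v' r \<and> w' = comp D r w) \<or>
                  (src D r = trg D w' \<and> trg D r = src D v \<and> v' = comp D v r \<and> w = comp D r w')"
    and dg_factor: "\<lbrakk>w \<in> mor D; dg w = Suc (Suc n)\<rbrakk> \<Longrightarrow>
        \<exists>u\<in>mor D. \<exists>v\<in>mor D. dg u = 1 \<and> src D u = trg D v \<and> w = comp D u v"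
begin

abbreviation kD :: "('n \<Rightarrow>\<^sub>0 'k::field) set" where
  "kD \<equiv> {u. Poly_Mapping.keys u \<subseteq> mor D}"

abbreviation bD :: "'n \<Rightarrow> ('n \<Rightarrow>\<^sub>0 'k::field)" where
  "bD w \<equiv> Poly_Mapping.single w 1"

abbreviation M1 :: "'n set" where
  "M1 \<equiv> {w \<in> mor D. dg w = 1}"

definition emb :: "('m \<Rightarrow>\<^sub>0 'k::field) \<Rightarrow> ('n \<Rightarrow>\<^sub>0 'k)" where
  "emb a = lext (\<lambda>c. bD (iota c)) a"

lemma emb_simps [simp]:
  "emb 0 = 0" "emb (Poly_Mapping.single c k) = Poly_Mapping.single (iota c) k"
  by (simp_all add: emb_def)

lemma emb_add: "emb (a + b) = emb a + emb b"
  by (simp add: emb_def lext_add)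

lemma emb_scal: "emb (scal k a) = scal k (emb a)"
  by (simp add: emb_def lext_scal)

lemma emb_closed: "Poly_Mapping.keys a \<subseteq> mor C \<Longrightarrow> Poly_Mapping.keys (emb a) \<subseteq> mor D"
  unfolding emb_def by (rule keys_lext) auto

lemma emb_deg0: "Poly_Mapping.keys a \<subseteq> mor C \<Longrightarrow> Poly_Mapping.keys (emb a) \<subseteq> {w \<in> mor D. dg w = 0}"
  unfolding emb_def by (rule keys_lext) auto

lemma emb_sum: "emb (\<Sum>i\<in>I. a i) = (\<Sum>i\<in>I. emb (a i))"
  by (induction I rule: infinite_finite_induct) (auto simp: emb_add)

lemma emb_cone: "emb (cone C) = cone D"
  by (simp add: cone_def emb_sum obj_eq iota_ident)

lemma dg_cmul:
  assumes "Poly_Mapping.keys f \<subseteq> {w \<in> mor D. dg w = m}" "Poly_Mapping.keys g \<subseteq> {w \<in> mor D. dg w = n}"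
  shows "Poly_Mapping.keys (cmul D f g) \<subseteq> {w \<in> mor D. dg w = m + n}"
  unfolding cmul_def
proof (intro keys_sum_subset)
  fix a b assume "a \<in> Poly_Mapping.keys f" "b \<in> Poly_Mapping.keys g"
  then have "a \<in> mor D" "dg a = m" "b \<in> mor D" "dg b = n" using assms by blast+
  then show "Poly_Mapping.keys (if src D a = trg D b then Poly_Mapping.single (comp D a b)
      (Poly_Mapping.lookup f a * Poly_Mapping.lookup g b) else 0) \<subseteq> {w \<in> mor D. dg w = m + n}"
    by simp
qed

lemma M1_cmul:
  assumes "Poly_Mapping.keys u \<subseteq> M1" "Poly_Mapping.keys b \<subseteq> mor C"
  shows "Poly_Mapping.keys (cmul D (emb b) u) \<subseteq> M1" "Poly_Mapping.keys (cmul D u (emb b)) \<subseteq> M1"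
  using dg_cmul[OF emb_deg0[OF assms(2)] assms(1)] dg_cmul[OF assms(1) emb_deg0[OF assms(2)]] by simp_all

lemma ideal_D:
  assumes "ideal I (category_algebra D :: ('k::field, 'n \<Rightarrow>\<^sub>0 'k) module)"
  shows "0 \<in> I" "x \<in> I \<Longrightarrow> y \<in> I \<Longrightarrow> x + y \<in> I" "x \<in> I \<Longrightarrow> - x \<in> I"
    "x \<in> I \<Longrightarrow> Poly_Mapping.keys x \<subseteq> mor D"
    "x \<in> I \<Longrightarrow> Poly_Mapping.keys b \<subseteq> mor D \<Longrightarrow> cmul D b x \<in> I"
    "x \<in> I \<Longrightarrow> Poly_Mapping.keys b \<subseteq> mor D \<Longrightarrow> cmul D x b \<in> I"
proof -
  interpret I: ideal I "category_algebra D :: ('k, 'n \<Rightarrow>\<^sub>0 'k) module" by fact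
  show "0 \<in> I" using additive_subgroup.zero_closed[OF I.is_additive_subgroup] by simp
  show "x \<in> I \<Longrightarrow> y \<in> I \<Longrightarrow> x + y \<in> I" using additive_subgroup.a_closed[OF I.is_additive_subgroup] by simp
  show k: "x \<in> I \<Longrightarrow> Poly_Mapping.keys x \<subseteq> mor D" for x using I.a_subset by auto
  show "x \<in> I \<Longrightarrow> Poly_Mapping.keys b \<subseteq> mor D \<Longrightarrow> cmul D b x \<in> I" using I.I_l_closed by simp
  show "x \<in> I \<Longrightarrow> Poly_Mapping.keys b \<subseteq> mor D \<Longrightarrow> cmul D x b \<in> I" using I.I_r_closed by simp
  show "x \<in> I \<Longrightarrow> - x \<in> I"
  proof -
    assume x: "x \<in> I"
    have "cmul D (- cone D) x \<in> I"
      using I.I_l_closed[OF x, of "- cone D"] by (simp add: D.cone_closed)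
    then show ?thesis using k[OF x] by (simp add: cmul_uminus D.cmul_cone_left)
  qed
qed

end

text \<open>
  Here \<open>Rr\<close> and \<open>Ll\<close> are the orbit representatives of all arrows taken together.
\<close>

locale double_cat = alg_cat C len kty + graded_cat C D iota dg
  for C :: "('o, 'm) category" and len and kty :: "'k::field itself" and D :: "('o, 'n) category"
    and iota :: "'m \<Rightarrow> 'n" and dg :: "'n \<Rightarrow> nat" +
  fixes star :: "'m \<Rightarrow> 'n" and Rr Ll :: "'m set"
  assumes star_mor [simp]: "\<lbrakk>x \<in> mor C; len x = 1\<rbrakk> \<Longrightarrow> star x \<in> mor D"
    and src_star [simp]: "\<lbrakk>x \<in> mor C; len x = 1\<rbrakk> \<Longrightarrow> src D (star x) = trg C x"
    and trg_star [simp]: "\<lbrakk>x \<in> mor C; len x = 1\<rbrakk> \<Longrightarrow> trg D (star x) = src C x"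
    and dg_star [simp]: "\<lbrakk>x \<in> mor C; len x = 1\<rbrakk> \<Longrightarrow> dg (star x) = 1"
    and star_act: "\<lbrakk>y \<in> mor C; len y = 1; g \<in> mor C; h \<in> mor C; len g = 0; len h = 0; src C g = trg C y; src C y = trg C h\<rbrakk>
      \<Longrightarrow> comp D (comp D (iota h) (star (comp C (comp C g y) h))) (iota g) = star y"
    and dg1_triple: "\<lbrakk>w \<in> mor D; dg w = 1\<rbrakk> \<Longrightarrow> \<exists>d x e. triple d x e \<and> w = comp D (comp D (iota d) (star x)) (iota e)"
    and star_eq: "\<lbrakk>triple d x e; triple d' x' e';
        comp D (comp D (iota d) (star x)) (iota e) = comp D (comp D (iota d') (star x')) (iota e')\<rbrakk> \<Longrightarrow>
        \<exists>g\<in>mor C. \<exists>h\<in>mor C. len g = 0 \<and> len h = 0 \<and> src C g = trg C x \<and> trg C h = src C x \<and>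
          x' = comp C (comp C g x) h \<and> d' = comp C d h \<and> e' = comp C g e"
    and Rr: "Rr \<subseteq> {x \<in> mor C. len x = 1}" "\<lbrakk>x \<in> mor C; len x = 1\<rbrakk> \<Longrightarrow>
        \<exists>!b. b \<in> Rr \<and> (\<exists>h\<in>mor C. len h = 0 \<and> trg C h = src C b \<and> x = comp C b h)"
    and Ll: "Ll \<subseteq> {x \<in> mor C. len x = 1}" "\<lbrakk>x \<in> mor C; len x = 1\<rbrakk> \<Longrightarrow>
        \<exists>!c. c \<in> Ll \<and> (\<exists>g\<in>mor C. len g = 0 \<and> src C g = trg C c \<and> x = comp C g c)"
begin

abbreviation bk :: "'n \<Rightarrow> ('n \<Rightarrow>\<^sub>0 'k)" where
  "bk w \<equiv> Poly_Mapping.single w 1"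

definition jn :: "'m \<Rightarrow> 'm \<Rightarrow> 'm \<Rightarrow> 'n" where
  "jn d x e = comp D (comp D (iota d) (star x)) (iota e)"

definition rho :: "'n \<Rightarrow>\<^sub>0 'k" where
  "rho = (\<Sum>b\<in>Rr. bk (comp D (iota b) (star b))) - (\<Sum>c\<in>Ll. bk (comp D (star c) (iota c)))"

lemma tripleD:
  assumes "triple d x e"
  shows "d \<in> mor C" "x \<in> mor C" "e \<in> mor C" "len x = 1" "src C d = src C x" "trg C e = trg C x"
  using assms by (auto simp: triple_def)

lemma jn_mor:
  assumes "triple d x e"
  shows "jn d x e \<in> mor D" "dg (jn d x e) = 1" "src D (jn d x e) = src C e" "trg D (jn d x e) = trg C d"
  using tripleD[OF assms] by (simp_all add: jn_def)

text \<open>By \<open>star_act\<close> the reversed arrow satisfies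
  \<open>(g x h)* = h^-1 x* g^-1\<close>, so the outer factors \<open>h\<close> and \<open>g\<close>
  cancel.\<close>

lemma jn_act:
  assumes t: "triple d x e" and g: "g \<in> mor C" "len g = 0" "src C g = trg C x" and h: "h \<in> mor C" "len h = 0" "trg C h = src C x"
  shows "jn (comp C d h) (comp C (comp C g x) h) (comp C g e) = jn d x e"
proof -
  note t' = tripleD[OF t]
  define y where "y = comp C (comp C g x) h"
  have y: "y \<in> mor C" "len y = 1" "src C y = src C h" "trg C y = trg C g"
    using t' g h by (simp_all add: y_def)
  have sh: "src C h = trg C h" "trg C g = src C g" using len0_src g h by metis+
  have "comp D (comp D (iota (comp C d h)) (star y)) (iota (comp C g e)) =
    comp D (comp D (iota d) (comp D (comp D (iota h) (star y)) (iota g))) (iota e)"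
    using t' g h y sh by (simp add: iota_comp D.comp_assoc)
  also have "comp D (comp D (iota h) (star y)) (iota g) = star x"
    unfolding y_def using t' g h by (intro star_act) simp_all
  finally show ?thesis by (simp add: jn_def y_def)
qed

lemma iota_jn:
  assumes "triple d x e" "c \<in> mor C"
  shows "src C c = trg C d \<Longrightarrow> comp D (iota c) (jn d x e) = jn (comp C c d) x e"
    "src C e = trg C c \<Longrightarrow> comp D (jn d x e) (iota c) = jn d x (comp C e c)"
  using tripleD[OF assms(1)] assms(2) by (simp_all add: jn_def iota_comp D.comp_assoc)

lemma triple_comp:
  assumes "triple d x e" "c \<in> mor C"
  shows "src C c = trg C d \<Longrightarrow> triple (comp C c d) x e" "src C e = trg C c \<Longrightarrow> triple d x (comp C e c)"
  using assms by (simp_all add: triple_def)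

definition tri :: "'n \<Rightarrow> 'm \<times> 'm \<times> 'm" where
  "tri w = (SOME (d, x, e). triple d x e \<and> w = jn d x e)"

lemma tri_ex:
  assumes "w \<in> M1"
  obtains d x e where "tri w = (d, x, e)" "triple d x e" "w = jn d x e"
proof -
  have "\<exists>t. case t of (d, x, e) \<Rightarrow> triple d x e \<and> w = jn d x e"
    using dg1_triple[of w] assms by (auto simp: jn_def)
  from someI_ex[OF this, folded tri_def] show ?thesis using that by (auto split: prod.splits)
qed

lemma finite_M1: "finite M1"
proof (rule finite_subset)
  show "M1 \<subseteq> (\<lambda>(d, x, e). jn d x e) ` (mor C \<times> mor C \<times> mor C)"
  proof
    fix w assume "w \<in> M1"
    then obtain d x e where "triple d x e" "w = jn d x e" by (rule tri_ex)
    then show "w \<in> (\<lambda>(d, x, e). jn d x e) ` (mor C \<times> mor C \<times> mor C)"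
      using tripleD[of d x e] by force
  qed
qed (simp add: finite_mor)

text \<open>A degree one morphism comes from several triples and \<open>tri\<close> picks one; by
  \<open>delta_cong\<close> the derivation is the same for all of them, as recorded in
  \<open>DD_jn\<close>.\<close>

definition DD :: "('n \<Rightarrow>\<^sub>0 'k) \<Rightarrow> ('m \<Rightarrow>\<^sub>0 'k) \<Rightarrow> (('m \<Rightarrow>\<^sub>0 'k) \<Rightarrow> 'k) \<Rightarrow> ('m \<Rightarrow>\<^sub>0 'k)" where
  "DD u a \<xi> = lext (\<lambda>w. case tri w of (d, x, e) \<Rightarrow> delta d x e a \<xi>) u"

lemma DD_add: "DD (u + u') = (\<lambda>a \<xi>. DD u a \<xi> + DD u' a \<xi>)"
  by (simp add: DD_def lext_add fun_eq_iff)

lemma DD_single: "DD (Poly_Mapping.single w k) = (\<lambda>a \<xi>. scal k (case tri w of (d, x, e) \<Rightarrow> delta d x e a \<xi>))"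
  by (simp add: DD_def fun_eq_iff)

lemma DD_zero: "DD 0 = (\<lambda>a \<xi>. 0)"
  by (simp add: DD_def fun_eq_iff)

lemma DD_rel_der:
  assumes "Poly_Mapping.keys u \<subseteq> M1"
  shows "rel_der (DD u)"
  using assms
proof (induction rule: pm_induct)
  case (single w k)
  then obtain d x e where "tri w = (d, x, e)" "triple d x e" "w = jn d x e" by (rule tri_ex)
  then show ?case using rel_der_scal[OF delta_rel_der] by (simp add: DD_single)
qed (simp_all add: DD_zero rel_der_zero DD_add rel_der_add)

text \<open>If \<open>y\<close> has length one, the outer factors in \<open>y = p x q\<close> have
  length zero. Such a splitting is therefore the same as a change of the triple representing
  \<open>d x* e\<close>, by \<open>jn_act\<close> in one direction and \<open>star_eq\<close> in the
  other.\<close>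

lemma delta_jn:
  assumes t: "triple d x e" and y: "y \<in> mor C" "len y = 1" and d': "d' \<in> mor C" "e' \<in> mor C"
  shows "Poly_Mapping.lookup (delta d x e (bs y) (dl d')) e' =
    (if src C d' = src C y \<and> trg C e' = trg C y \<and> jn d x e = jn d' y e' then 1 else 0)"
proof -
  note t' = tripleD[OF t]
  have "(\<exists>(p, q)\<in>dec x y. comp C d q = d' \<and> comp C p e = e') \<longleftrightarrow>
    (src C d' = src C y \<and> trg C e' = trg C y \<and> jn d x e = jn d' y e')"
  proof
    assume "\<exists>(p, q)\<in>dec x y. comp C d q = d' \<and> comp C p e = e'"
    then obtain p q where pq: "p \<in> mor C" "q \<in> mor C" "src C p = trg C x" "src C x = trg C q"
      "comp C (comp C p x) q = y" "comp C d q = d'" "comp C p e = e'" by (auto simp: dec_def)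
    have "len y = len p + len x + len q" using pq t' by auto
    then have l: "len p = 0" "len q = 0" using y t' by auto
    have "src C d' = src C y" "trg C e' = trg C y" using pq t' by auto
    then show "src C d' = src C y \<and> trg C e' = trg C y \<and> jn d x e = jn d' y e'"
      using jn_act[OF t pq(1) l(1) pq(3) pq(2) l(2) pq(4)[symmetric]] pq(5-7) by simp
  next
    assume *: "src C d' = src C y \<and> trg C e' = trg C y \<and> jn d x e = jn d' y e'"
    then have "triple d' y e'" using y d' by (simp add: triple_def)
    from star_eq[OF t this] * obtain g h where "g \<in> mor C" "h \<in> mor C" "src C g = trg C x" "trg C h = src C x"
       "y = comp C (comp C g x) h" "d' = comp C d h" "e' = comp C g e" by (auto simp: jn_def)
    then show "\<exists>(p, q)\<in>dec x y. comp C d q = d' \<and> comp C p e = e'"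
      by (intro bexI[of _ "(g, h)"]) (simp_all add: dec_def)
  qed
  then show ?thesis unfolding delta_dl[OF t d'(1)] by simp
qed

text \<open>A relative derivation is determined by its coefficients at arrows, and by
  \<open>delta_jn\<close> these see only the morphism \<open>jn d x e\<close>.\<close>

lemma delta_cong:
  assumes t: "triple d x e" "triple d' x' e'" and eq: "jn d x e = jn d' x' e'" and a: "a \<in> kC" "\<xi> \<in> DA"
  shows "delta d x e a \<xi> = delta d' x' e' a \<xi>"
proof (rule rel_der_eqI[OF delta_rel_der[OF t(1)] delta_rel_der[OF t(2)] _ a])
  fix y c assume y: "y \<in> mor C" "c \<in> mor C" "len y = 1"
  have k: "Poly_Mapping.keys (delta d x e (bs y) (dl c)) \<subseteq> mor C" "Poly_Mapping.keys (delta d' x' e' (bs y) (dl c)) \<subseteq> mor C"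
    using delta_rel_der[OF t(1)] delta_rel_der[OF t(2)] derD(1)[of _ "bs y" "dl c"] y
    by (auto simp: rel_der_def)
  show "delta d x e (bs y) (dl c) = delta d' x' e' (bs y) (dl c)"
  proof (rule poly_mapping_eqI)
    fix b
    show "Poly_Mapping.lookup (delta d x e (bs y) (dl c)) b = Poly_Mapping.lookup (delta d' x' e' (bs y) (dl c)) b"
    proof (cases "b \<in> mor C")
      case True
      show ?thesis unfolding delta_jn[OF t(1) y(1,3,2) True] delta_jn[OF t(2) y(1,3,2) True] eq ..
    next
      case False
      then have "b \<notin> Poly_Mapping.keys (delta d x e (bs y) (dl c))" "b \<notin> Poly_Mapping.keys (delta d' x' e' (bs y) (dl c))"
        using k by auto
      then show ?thesis by (simp add: in_keys_iff)
    qed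
  qed
qed

lemma DD_jn:
  assumes "triple d x e" "a \<in> kC" "\<xi> \<in> DA"
  shows "DD (Poly_Mapping.single (jn d x e) k) a \<xi> = scal k (delta d x e a \<xi>)"
proof -
  have "jn d x e \<in> M1" using jn_mor[OF assms(1)] by simp
  then obtain d' x' e' where *: "tri (jn d x e) = (d', x', e')" "triple d' x' e'" "jn d x e = jn d' x' e'"
    by (rule tri_ex)
  show ?thesis using delta_cong[OF assms(1) *(2,3) assms(2,3)] by (simp add: DD_single *(1))
qed

text \<open>Every degree one morphism has the form \<open>jn d y e\<close>, so \<open>u\<close> can
  be read off from \<open>DD u\<close>: this is the injectivity behind
  \<open>vv_kernel\<close>.\<close>

lemma DD_coeff:
  assumes u: "Poly_Mapping.keys u \<subseteq> M1" and y: "y \<in> mor C" "len y = 1" and d: "d \<in> mor C" "e \<in> mor C"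
  shows "Poly_Mapping.lookup (DD u (bs y) (dl d)) e =
    (if src C d = src C y \<and> trg C e = trg C y then Poly_Mapping.lookup u (jn d y e) else 0)"
  using u
proof (induction rule: pm_induct)
  case (single w k)
  then obtain d' x' e' where *: "tri w = (d', x', e')" "triple d' x' e'" "w = jn d' x' e'"
    by (rule tri_ex)
  show ?case by (simp add: DD_single *(1) delta_jn[OF *(2) y d]) (simp add: *(3) lookup_single when_def)
qed (simp_all add: DD_zero DD_add lookup_add)

lemma DD_eqI:
  assumes \<eta>: "rel_der \<eta>" and u: "Poly_Mapping.keys u \<subseteq> M1"
    and eq: "\<And>y d e. y \<in> mor C \<Longrightarrow> len y = 1 \<Longrightarrow> d \<in> mor C \<Longrightarrow> e \<in> mor C \<Longrightarrow> Poly_Mapping.lookup (\<eta> (bs y) (dl d)) e =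
      (if src C d = src C y \<and> trg C e = trg C y then Poly_Mapping.lookup u (jn d y e) else 0)"
    and a: "a \<in> kC" "\<xi> \<in> DA"
  shows "DD u a \<xi> = \<eta> a \<xi>"
proof (rule rel_der_eqI[OF DD_rel_der[OF u] \<eta> _ a])
  fix y c assume y: "y \<in> mor C" "c \<in> mor C" "len y = 1"
  have k: "Poly_Mapping.keys (DD u (bs y) (dl c)) \<subseteq> mor C" "Poly_Mapping.keys (\<eta> (bs y) (dl c)) \<subseteq> mor C"
    using DD_rel_der[OF u] \<eta> derD(1)[of _ "bs y" "dl c"] y by (auto simp: rel_der_def)
  show "DD u (bs y) (dl c) = \<eta> (bs y) (dl c)"
  proof (rule poly_mapping_eqI)
    fix b
    show "Poly_Mapping.lookup (DD u (bs y) (dl c)) b = Poly_Mapping.lookup (\<eta> (bs y) (dl c)) b"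
    proof (cases "b \<in> mor C")
      case True
      show ?thesis unfolding DD_coeff[OF u y(1,3,2) True] eq[OF y(1,3,2) True] ..
    next
      case False
      then have "b \<notin> Poly_Mapping.keys (DD u (bs y) (dl c))" "b \<notin> Poly_Mapping.keys (\<eta> (bs y) (dl c))"
        using k by auto
      then show ?thesis by (simp add: in_keys_iff)
    qed
  qed
qed

text \<open>Left multiplication prolongs \<open>d\<close>, which for the derivation is right
  multiplication of the functional; by \<open>smult_ph\<close> that is the left action on the
  extension group.\<close>

lemma DD_left:
  assumes u: "Poly_Mapping.keys u \<subseteq> M1" and b: "Poly_Mapping.keys b \<subseteq> mor C" and a: "a \<in> kC" "\<xi> \<in> DA"
  shows "DD (cmul D (emb b) u) a \<xi> = DD u a (ra \<xi> b)"
  using b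
proof (induction rule: pm_induct)
  case zero
  have z: "ra \<xi> 0 = ds 0 \<xi>" using a by (auto simp: dual_ops ds_def dual_zero)
  have "lin (DD u a)" using DD_rel_der[OF u] der_lin a by (simp add: rel_der_def)
  then show ?case using a by (simp add: z DD_zero lin_def)
next
  case (single c k)
  note c = this
  have rk: "ra \<xi> (Poly_Mapping.single c k) = ds k (ra \<xi> (bs c))"
    unfolding dual_ops ds_def
  proof (rule restrict_ext)
    fix z :: "'m \<Rightarrow>\<^sub>0 'k" assume z: "z \<in> kC"
    have "cmul C (Poly_Mapping.single c k) z = scal k (cmul C (bs c) z)"
      using cmul_scal_left[of C k "bs c" z] by simp
    then show "\<xi> (cmul C (Poly_Mapping.single c k) z) = k * (\<lambda>x\<in>kC. \<xi> (cmul C (bs c) x)) z"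
      using z c a by (simp add: dual_scal cmul_closed)
  qed
  have l: "lin (DD u a)" using DD_rel_der[OF u] der_lin a by (simp add: rel_der_def)
  have r: "ra \<xi> (bs c) \<in> DA" using a c by simp
  have "DD (cmul D (bk (iota c)) u) a \<xi> = DD u a (ra \<xi> (bs c))"
    using u
  proof (induction rule: pm_induct)
    case (single w l)
    then obtain d x e where *: "tri w = (d, x, e)" "triple d x e" "w = jn d x e" by (rule tri_ex)
    show ?case
    proof (cases "src C c = trg C d")
      case True
      then show ?thesis using DD_jn[OF triple_comp(1)[OF *(2) c True] a] DD_jn[OF *(2) a(1) r] c
        by (simp add: *(3) cmul_single jn_mor[OF *(2)] iota_jn[OF *(2)] delta_ra[OF *(2) c a(2)])
    next
      case False
      then show ?thesis using DD_jn[OF *(2) a(1) r] c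
        by (simp add: *(3) cmul_single jn_mor[OF *(2)] delta_ra[OF *(2) c a(2)] DD_zero)
    qed
  qed (simp_all add: cmul_add_right DD_add DD_zero)
  moreover have "cmul D (emb (Poly_Mapping.single c k)) u = scal k (cmul D (bk (iota c)) u)"
    using cmul_scal_left[of D k "bk (iota c)" u] by simp
  ultimately show ?case
    using l r by (simp add: rk lin_def) (simp add: DD_def lext_scal)
next
  case (add f g)
  have l: "lin (DD u a)" using DD_rel_der[OF u] der_lin a by (simp add: rel_der_def)
  have "ra \<xi> (f + g) = ra \<xi> f \<oplus>\<^bsub>dual\<^esub> ra \<xi> g"
    unfolding dual_ops using add a
    by (intro restrict_ext) (simp add: cmul_add_left dual_add cmul_closed)
  then show ?case using add l a by (simp add: emb_add cmul_add_left DD_add lin_def)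
qed

lemma DD_right:
  assumes u: "Poly_Mapping.keys u \<subseteq> M1" and b: "Poly_Mapping.keys b \<subseteq> mor C" and a: "a \<in> kC" "\<xi> \<in> DA"
  shows "DD (cmul D u (emb b)) a \<xi> = cmul C (DD u a \<xi>) b"
  using b
proof (induction rule: pm_induct)
  case (single c k)
  note c = this
  have "DD (cmul D u (bk (iota c))) a \<xi> = cmul C (DD u a \<xi>) (bs c)"
    using u
  proof (induction rule: pm_induct)
    case (single w l)
    then obtain d x e where *: "tri w = (d, x, e)" "triple d x e" "w = jn d x e" by (rule tri_ex)
    show ?case
    proof (cases "src C e = trg C c")
      case True
      then show ?thesis using DD_jn[OF triple_comp(2)[OF *(2) c True] a] DD_jn[OF *(2) a] c
        by (simp add: *(3) cmul_single jn_mor[OF *(2)] iota_jn[OF *(2)] cmul_scal_left delta_right[OF *(2) c])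
    next
      case False
      then show ?thesis using DD_jn[OF *(2) a] c
        by (simp add: *(3) cmul_single jn_mor[OF *(2)] cmul_scal_left delta_right[OF *(2) c] DD_zero)
    qed
  qed (simp_all add: cmul_add_left DD_add DD_zero)
  moreover have "cmul D u (emb (Poly_Mapping.single c k)) = scal k (cmul D u (bk (iota c)))"
    using cmul_scal_right[of D u k "bk (iota c)"] by simp
  moreover have "cmul C (DD u a \<xi>) (Poly_Mapping.single c k) = scal k (cmul C (DD u a \<xi>) (bs c))"
    using cmul_scal_right[of C "DD u a \<xi>" k "bs c"] by simp
  ultimately show ?case by simp (simp add: DD_def lext_scal)
qed (simp_all add: DD_zero emb_add cmul_add_right DD_add)

end

section \<open>Extension classes of degree one elements: bimodule laws and surjectivity\<close>

context double_cat
begin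

definition vv :: "('n \<Rightarrow>\<^sub>0 'k) \<Rightarrow> (((('m \<Rightarrow>\<^sub>0 'k) \<Rightarrow> 'k) \<Rightarrow> ('m \<Rightarrow>\<^sub>0 'k)) \<Rightarrow> ('m \<Rightarrow>\<^sub>0 'k)) set" where
  "vv u = cl (ph (DD u))"

lemma DD_der: "Poly_Mapping.keys u \<subseteq> M1 \<Longrightarrow> der (DD u)"
  using DD_rel_der by (simp add: rel_der_def)

lemma vv_closed: "Poly_Mapping.keys u \<subseteq> M1 \<Longrightarrow> vv u \<in> carrier V"
  unfolding vv_def carrier_V using ph_H[OF DD_der] by blast

lemma vv_add:
  assumes "Poly_Mapping.keys u \<subseteq> M1" "Poly_Mapping.keys u' \<subseteq> M1"
  shows "vv (u + u') = vv u \<oplus>\<^bsub>V\<^esub> vv u'"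
  unfolding vv_def cl_add[OF ph_H[OF DD_der[OF assms(1)]] ph_H[OF DD_der[OF assms(2)]]] ph_add DD_add ..

lemma vv_left:
  assumes "Poly_Mapping.keys u \<subseteq> M1" "Poly_Mapping.keys b \<subseteq> mor C"
  shows "vv (cmul D (emb b) u) = b \<odot>\<^bsub>V\<^esub> vv u"
  unfolding vv_def smult_ph[OF DD_der[OF assms(1)] assms(2)]
  by (rule arg_cong[where f = cl], rule ph_cong, rule DD_left[OF assms])

lemma vv_right:
  assumes "Poly_Mapping.keys u \<subseteq> M1" "Poly_Mapping.keys b \<subseteq> mor C"
  shows "vv (cmul D u (emb b)) = rsmult V (vv u) b"
  unfolding vv_def rsmult_ph[OF DD_der[OF assms(1)] assms(2)]
  by (rule arg_cong[where f = cl], rule ph_cong, rule DD_right[OF assms])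

lemma rel_der_act_left:
  assumes \<eta>: "rel_der \<eta>" and g: "g \<in> mor C" "len g = 0" and b: "Poly_Mapping.keys b \<subseteq> mor C" and \<xi>: "\<xi> \<in> DA"
  shows "\<eta> (cmul C (bs g) b) \<xi> = cmul C (bs g) (\<eta> b \<xi>)"
proof -
  have "\<eta> (bs g) (la b \<xi>) = 0" using \<eta> g la_closed[OF \<xi> b] by (simp add: rel_der_def)
  then show ?thesis using derD(4)[of \<eta> "bs g" \<xi> b] \<eta> g b \<xi> by (simp add: rel_der_def)
qed

lemma rel_der_act_right:
  assumes \<eta>: "rel_der \<eta>" and g: "g \<in> mor C" "len g = 0" and b: "Poly_Mapping.keys b \<subseteq> mor C" and \<xi>: "\<xi> \<in> DA"
  shows "\<eta> (cmul C b (bs g)) \<xi> = \<eta> b (la (bs g) \<xi>)"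
proof -
  have "\<eta> (bs g) \<xi> = 0" using \<eta> g \<xi> by (simp add: rel_der_def)
  then show ?thesis using derD(4)[of \<eta> b \<xi> "bs g"] \<eta> g b \<xi> by (simp add: rel_der_def)
qed

text \<open>Multiplying \<open>y\<close> by the identity at its source, respectively its target,
  does not change it, but annihilates \<open>dl d\<close>, respectively the coefficient at
  \<open>e\<close>, when the endpoints do not match.\<close>

lemma rel_der_coeff_zero:
  assumes \<eta>: "rel_der \<eta>" and y: "y \<in> mor C" "len y = 1" and d: "d \<in> mor C" "e \<in> mor C"
    and n: "\<not> (src C d = src C y \<and> trg C e = trg C y)"
  shows "Poly_Mapping.lookup (\<eta> (bs y) (dl d)) e = 0"
proof (cases "src C d = src C y")
  case False
  let ?i = "ident C (src C y)"
  have z: "la (bs ?i) (dl d) = ds 0 (dl d)"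
  proof (rule dual_ext)
    fix c assume c: "c \<in> mor C"
    have "\<not> (src C c = trg C ?i \<and> comp C c ?i = d)" using c y False by auto
    then show "la (bs ?i) (dl d) (bs c) = ds 0 (dl d) (bs c)"
      unfolding la_dl_single[OF ident_mor[OF src_obj[OF y(1)]] d(1) c] using c by simp
  qed (use y in auto)
  have "bs y = cmul C (bs y) (bs ?i)" using y by (simp add: cmul_single)
  then have "\<eta> (bs y) (dl d) = \<eta> (bs y) (la (bs ?i) (dl d))"
    using rel_der_act_right[OF \<eta>, of ?i "bs y" "dl d"] y by simp
  also have "\<dots> = 0"
    unfolding z using der_lin[of \<eta> "bs y"] \<eta> y by (simp add: rel_der_def lin_def)
  finally show ?thesis by simp
next
  case True
  then have n': "trg C e \<noteq> trg C y" using n by simp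
  let ?i = "ident C (trg C y)"
  have "bs y = cmul C (bs ?i) (bs y)" using y by (simp add: cmul_single)
  then have "\<eta> (bs y) (dl d) = cmul C (bs ?i) (\<eta> (bs y) (dl d))"
    using rel_der_act_left[OF \<eta>, of ?i "bs y" "dl d"] y by simp
  moreover have "Poly_Mapping.keys (\<eta> (bs y) (dl d)) \<subseteq> mor C"
    using derD(1)[of \<eta> "bs y" "dl d"] \<eta> y by (simp add: rel_der_def)
  ultimately show ?thesis
    using lookup_cmul_left_zero[of ?i e "\<eta> (bs y) (dl d)"] n' y by simp
qed

text \<open>A relative derivation is linear over the groups on both sides. Hence its coefficient at
  \<open>(x, d, e)\<close> depends only on the morphism \<open>d x* e\<close>, not on the
  triple.\<close>

lemma rel_der_coeff_act:
  assumes \<eta>: "rel_der \<eta>" and t: "triple d x e"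
    and g: "g \<in> mor C" "len g = 0" "src C g = trg C x" and h: "h \<in> mor C" "len h = 0" "trg C h = src C x"
  shows "Poly_Mapping.lookup (\<eta> (bs (comp C (comp C g x) h)) (dl (comp C d h))) (comp C g e) =
    Poly_Mapping.lookup (\<eta> (bs x) (dl d)) e"
proof -
  note t' = tripleD[OF t]
  have xh: "comp C x h \<in> mor C" using t' h by simp
  have d\<eta>: "der \<eta>" using \<eta> by (simp add: rel_der_def)
  have "la (bs h) (dl (comp C d h)) = dl d"
  proof (rule dual_ext)
    fix c assume c: "c \<in> mor C"
    have dh: "comp C d h \<in> mor C" using t' h by simp
    have "(src C c = trg C h \<and> comp C c h = comp C d h) = (c = d)"
      using cancel_right[OF c t'(1) h(1)] t'(5) h(3) by metis
    then show "la (bs h) (dl (comp C d h)) (bs c) = dl d (bs c)"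
      unfolding la_dl_single[OF h(1) dh c] using c by (simp add: lookup_single when_def)
  qed (use h in auto)
  then have 1: "\<eta> (cmul C (bs x) (bs h)) (dl (comp C d h)) = \<eta> (bs x) (dl d)"
    using rel_der_act_right[OF \<eta> h(1,2), of "bs x" "dl (comp C d h)"] t' by simp
  have "bs (comp C (comp C g x) h) = cmul C (bs g) (cmul C (bs x) (bs h))"
    using t' g h by (simp add: cmul_single comp_assoc)
  then have "\<eta> (bs (comp C (comp C g x) h)) (dl (comp C d h)) = cmul C (bs g) (\<eta> (bs x) (dl d))"
    using rel_der_act_left[OF \<eta> g(1,2), of "cmul C (bs x) (bs h)" "dl (comp C d h)"] 1 t' h xh
    by (simp add: cmul_single)
  moreover have "Poly_Mapping.keys (\<eta> (bs x) (dl d)) \<subseteq> mor C"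
    using derD(1)[OF d\<eta>, of "bs x" "dl d"] t' by simp
  ultimately show ?thesis using lookup_cmul_left[of g e "\<eta> (bs x) (dl d)"] g t' by simp
qed

text \<open>The coefficients of \<open>\<eta>\<close> at arrows are constant on all triples of one
  morphism, so they are the coefficients of an element of degree one, and arrows determine
  \<open>\<eta>\<close>.\<close>

lemma DD_surj:
  assumes \<eta>: "rel_der \<eta>"
  shows "\<exists>u. Poly_Mapping.keys u \<subseteq> M1 \<and> (\<forall>a\<in>kC. \<forall>\<xi>\<in>DA. DD u a \<xi> = \<eta> a \<xi>)"
proof -
  define t where "t w = (case tri w of (d, x, e) \<Rightarrow> Poly_Mapping.lookup (\<eta> (bs x) (dl d)) e)" for w
  define u where "u = (\<Sum>w\<in>M1. Poly_Mapping.single w (t w))"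
  have k: "Poly_Mapping.keys u \<subseteq> M1" unfolding u_def by (intro keys_sum_subset) auto
  have lu: "Poly_Mapping.lookup u w = t w" if "w \<in> M1" for w
    using that finite_M1 by (simp add: u_def lookup_sum lookup_single when_def)
  have eq: "DD u a \<xi> = \<eta> a \<xi>" if a: "a \<in> kC" "\<xi> \<in> DA" for a \<xi>
  proof (rule DD_eqI[OF \<eta> k _ a])
    fix y d e assume y: "y \<in> mor C" "len y = 1" and d: "d \<in> mor C" "e \<in> mor C"
    show "Poly_Mapping.lookup (\<eta> (bs y) (dl d)) e =
      (if src C d = src C y \<and> trg C e = trg C y then Poly_Mapping.lookup u (jn d y e) else 0)"
    proof (cases "src C d = src C y \<and> trg C e = trg C y")
      case True
      then have t1: "triple d y e" using y d by (simp add: triple_def)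
      then have w: "jn d y e \<in> M1" using jn_mor[OF t1] by simp
      then obtain d' x' e' where *: "tri (jn d y e) = (d', x', e')" "triple d' x' e'" "jn d y e = jn d' x' e'"
        by (rule tri_ex)
      from star_eq[OF *(2) t1] *(3) obtain g h where "g \<in> mor C" "h \<in> mor C" "len g = 0" "len h = 0"
        "src C g = trg C x'" "trg C h = src C x'" "y = comp C (comp C g x') h" "d = comp C d' h" "e = comp C g e'"
        by (auto simp: jn_def)
      then have "Poly_Mapping.lookup (\<eta> (bs y) (dl d)) e = Poly_Mapping.lookup (\<eta> (bs x') (dl d')) e'"
        using rel_der_coeff_act[OF \<eta> *(2)] by simp
      also have "\<dots> = Poly_Mapping.lookup u (jn d y e)" using lu[OF w] by (simp add: t_def *(1))
      finally show ?thesis using True by simp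
    next
      case False
      show ?thesis unfolding rel_der_coeff_zero[OF \<eta> y d False] if_not_P[OF False] ..
    qed
  qed
  show ?thesis by (intro exI[of _ u] conjI ballI k eq)
qed

lemma vv_surj:
  assumes "z \<in> carrier V"
  obtains u where "Poly_Mapping.keys u \<subseteq> M1" "z = vv u"
proof -
  obtain \<phi> where \<phi>: "\<phi> \<in> carrier H" "z = cl \<phi>" using assms by (auto simp: carrier_V)
  obtain \<eta> where \<eta>: "rel_der \<eta>" "cl \<phi> = cl (ph \<eta>)" using carrier_H_rel_der[OF \<phi>(1)] .
  obtain u where u: "Poly_Mapping.keys u \<subseteq> M1" "\<forall>a\<in>kC. \<forall>\<xi>\<in>DA. DD u a \<xi> = \<eta> a \<xi>"
    using DD_surj[OF \<eta>(1)] by (elim exE conjE)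
  have "ph (DD u) = ph \<eta>" by (rule ph_cong) (rule u(2)[rule_format])
  then have "z = vv u" using \<eta>(2) \<phi>(2) by (simp add: vv_def)
  with u(1) show ?thesis using that by blast
qed

section \<open>The map behind \<open>rho\<close>, and the inner derivations that vanish on the
  groups\<close>

abbreviation G0 :: "'m set" where
  "G0 \<equiv> {g \<in> mor C. len g = 0}"

text \<open>On each group algebra this is the usual identification of the dual with the algebra,
  sending the functional at \<open>d\<close> to the inverse of \<open>d\<close>; functionals at
  morphisms of positive length go to zero.\<close>

definition th :: "(('m \<Rightarrow>\<^sub>0 'k) \<Rightarrow> 'k) \<Rightarrow> ('m \<Rightarrow>\<^sub>0 'k)" where
  "th \<xi> = (\<Sum>g\<in>G0. Poly_Mapping.single g (\<xi> (bs (linv g))))"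

lemma finite_G0: "finite G0"
  using finite_mor by simp

lemma linv_mor: "g \<in> G0 \<Longrightarrow> linv g \<in> mor C"
  using linv(1) by simp

lemma th_lin: "lin th"
  unfolding lin_def
proof (intro ballI conjI allI)
  fix \<xi> k assume \<xi>: "\<xi> \<in> DA"
  show "th \<xi> \<in> kC" unfolding th_def by (intro kC_sum kC_basic(3)) simp
  show "th (ds k \<xi>) = scal k (th \<xi>)"
    unfolding th_def scal_sum by (intro sum.cong refl) (simp add: linv_mor)
  show "th (\<xi> \<oplus>\<^bsub>dual\<^esub> \<zeta>) = th \<xi> + th \<zeta>" if "\<zeta> \<in> DA" for \<zeta>
    unfolding th_def sum.distrib[symmetric] by (intro sum.cong refl) (simp add: linv_mor single_add)
qed

text \<open>Substituting \<open>g k\<close> for the summation index turns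
  \<open>linv (g k) g\<close> into \<open>linv k\<close>.\<close>

lemma th_act:
  assumes g: "g \<in> mor C" "len g = 0" and \<xi>: "\<xi> \<in> DA"
  shows "th (la (bs g) \<xi>) = cmul C (bs g) (th \<xi>)"
proof -
  note gi = linv[OF g]
  have sg: "trg C g = src C g" using len0_src g by blast
  let ?K = "{k \<in> G0. trg C k = src C g}"
  have "cmul C (bs g) (th \<xi>) = (\<Sum>k\<in>G0. if trg C k = src C g then Poly_Mapping.single (comp C g k) (\<xi> (bs (linv k))) else 0)"
    unfolding th_def cmul_sum_right by (intro sum.cong refl) (simp add: cmul_single)
  also have "\<dots> = (\<Sum>k\<in>?K. Poly_Mapping.single (comp C g k) (\<xi> (bs (linv k))))"
    by (rule sum.inter_filter[OF finite_G0, symmetric])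
  also have "\<dots> = (\<Sum>k\<in>?K. Poly_Mapping.single k (\<xi> (bs (comp C (linv k) g))))"
  proof (rule sum.reindex_bij_witness[of _ "\<lambda>k. comp C (linv g) k" "\<lambda>k. comp C g k"])
    fix k assume k: "k \<in> ?K"
    then have k': "k \<in> mor C" "len k = 0" "trg C k = src C g" by auto
    have sk: "src C k = trg C k" using len0_src k' by metis
    show "comp C (linv g) (comp C g k) = k" "comp C g (comp C (linv g) k) = k"
      using k' g gi sg by (simp_all add: comp_assoc[symmetric])
    show "comp C g k \<in> ?K" "comp C (linv g) k \<in> ?K" using k' g gi sg by simp_all
    have gk: "comp C g k \<in> mor C" "len (comp C g k) = 0" "src C (comp C g k) = src C k" using k' g by simp_all
    note gki = linv[OF gk(1,2)] and ki = linv[OF k'(1,2)]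
    have "comp C (linv (comp C g k)) g = linv k"
    proof (rule cancel_right[of _ _ k])
      show "comp C (comp C (linv (comp C g k)) g) k = comp C (linv k) k"
        using gki ki gk k' g sg sk by (simp add: comp_assoc)
    qed (use gki ki gk k' g sg sk in simp_all)
    then show "Poly_Mapping.single (comp C g k) (\<xi> (bs (comp C (linv (comp C g k)) g))) =
      Poly_Mapping.single (comp C g k) (\<xi> (bs (linv k)))" by simp
  qed
  also have "\<dots> = (\<Sum>k\<in>G0. if trg C k = src C g then Poly_Mapping.single k (\<xi> (bs (comp C (linv k) g))) else 0)"
    by (rule sum.inter_filter[OF finite_G0])
  also have "\<dots> = th (la (bs g) \<xi>)"
    unfolding th_def
  proof (intro sum.cong refl)
    fix k assume "k \<in> G0"
    then have k: "k \<in> mor C" "len k = 0" by auto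
    note ki = linv[OF k]
    have "src C (linv k) = trg C g \<longleftrightarrow> trg C k = src C g" using ki len0_src[OF k] sg by simp
    then show "(if trg C k = src C g then Poly_Mapping.single k (\<xi> (bs (comp C (linv k) g))) else 0) =
      Poly_Mapping.single k (la (bs g) \<xi> (bs (linv k)))"
      using ki dual_zero[OF \<xi>] by (simp add: cmul_single)
  qed
  finally show ?thesis ..
qed

text \<open>The sign is opposite to that in \<open>ph_inner\<close>. With it \<open>inn\<close> is
  the derivation of \<open>rho\<close> itself, and \<open>vv_rho\<close> applies
  \<open>ph_inner\<close> to \<open>- th\<close>.\<close>

definition inn :: "('m \<Rightarrow>\<^sub>0 'k) \<Rightarrow> (('m \<Rightarrow>\<^sub>0 'k) \<Rightarrow> 'k) \<Rightarrow> ('m \<Rightarrow>\<^sub>0 'k)" where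
  "inn a \<xi> = th (la a \<xi>) - cmul C a (th \<xi>)"

lemma inn_rel_der: "rel_der inn"
  using der_inner[OF th_lin] unfolding rel_der_def by (simp add: inn_def[abs_def] th_act)

lemma lookup_th:
  assumes "e \<in> mor C"
  shows "Poly_Mapping.lookup (th \<xi>) e = (if len e = 0 then \<xi> (bs (linv e)) else 0)"
  using assms by (simp add: th_def lookup_sum lookup_single when_def finite_mor)

lemma rho_keys: "Poly_Mapping.keys rho \<subseteq> M1"
proof -
  have "Poly_Mapping.keys (\<Sum>b\<in>Rr. bk (comp D (iota b) (star b))) \<subseteq> M1"
    using Rr(1) by (intro keys_sum_subset) auto
  moreover have "Poly_Mapping.keys (\<Sum>c\<in>Ll. bk (comp D (star c) (iota c))) \<subseteq> M1"
    using Ll(1) by (intro keys_sum_subset) auto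
  ultimately show ?thesis
    unfolding rho_def using keys_diff by fast
qed

text \<open>The term \<open>b b*\<close> is \<open>jn b b 1\<close>. Its other triples have
  \<open>d = b h\<close>, \<open>y = g b h\<close> and \<open>e = g\<close>, so it occurs precisely
  where \<open>e\<close> is a group element and \<open>y = e d\<close>; then \<open>b\<close> is the
  representative of the right orbit of \<open>d\<close>.\<close>

lemma lookup_rho_right:
  assumes t: "triple d y e"
  shows "Poly_Mapping.lookup (\<Sum>b\<in>Rr. bk (comp D (iota b) (star b))) (jn d y e) =
    (if len e = 0 \<and> src C e = trg C d \<and> y = comp C e d then 1 else 0)"
proof -
  note t' = tripleD[OF t]
  have fin: "finite Rr" using Rr(1) finite_mor finite_subset by (metis (no_types, lifting) mem_Collect_eq subsetD subsetI)
  have tb: "triple b b (ident C (trg C b))" and jb: "comp D (iota b) (star b) = jn b b (ident C (trg C b))" if "b \<in> Rr" for b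
    using that Rr(1) by (auto simp: triple_def jn_def iota_ident D.comp_ident_right)
  have fwd: "len e = 0 \<and> src C e = trg C d \<and> y = comp C e d \<and> (\<exists>h\<in>mor C. len h = 0 \<and> trg C h = src C b \<and> d = comp C b h)"
    if b: "b \<in> Rr" and eq: "jn b b (ident C (trg C b)) = jn d y e" for b
  proof -
    have bm: "b \<in> mor C" using b Rr(1) by auto
    obtain g h where gh: "g \<in> mor C" "h \<in> mor C" "len g = 0" "len h = 0" "src C g = trg C b" "trg C h = src C b"
      "y = comp C (comp C g b) h" "d = comp C b h" "e = comp C g (ident C (trg C b))"
      using star_eq[OF tb[OF b] t] eq by (auto simp: jn_def)
    have e: "e = g" using gh(9) gh(1,5) by simp
    have "y = comp C e d" using gh bm by (simp add: e comp_assoc)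
    then show ?thesis using gh bm by (auto simp: e)
  qed
  show ?thesis
  proof (cases "len e = 0 \<and> src C e = trg C d \<and> y = comp C e d")
    case True
    have "len d = 1" using True t' by auto
    from Rr(2)[OF t'(1) this] obtain b0 h where b0: "b0 \<in> Rr" "h \<in> mor C" "len h = 0" "trg C h = src C b0" "d = comp C b0 h"
      and uniq: "\<And>b. b \<in> Rr \<Longrightarrow> \<exists>h\<in>mor C. len h = 0 \<and> trg C h = src C b \<and> d = comp C b h \<Longrightarrow> b = b0"
      by blast
    have b0m: "b0 \<in> mor C" using b0 Rr(1) by auto
    have "jn d y e = jn (comp C b0 h) (comp C (comp C e b0) h) (comp C e (ident C (trg C b0)))"
      using True b0 b0m t' by (simp add: comp_assoc)
    also have "\<dots> = jn b0 b0 (ident C (trg C b0))"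
      using True b0 b0m t' by (intro jn_act[OF tb[OF b0(1)]]) auto
    finally have j0: "jn b0 b0 (ident C (trg C b0)) = jn d y e" ..
    have "Poly_Mapping.lookup (\<Sum>b\<in>Rr. bk (comp D (iota b) (star b))) (jn d y e) = (\<Sum>b\<in>Rr. if b = b0 then 1 else 0)"
      unfolding lookup_sum
    proof (rule sum.cong[OF refl])
      fix b assume b: "b \<in> Rr"
      have "comp D (iota b) (star b) = jn d y e \<longleftrightarrow> b = b0"
        using fwd[OF b] uniq[OF b] j0 jb[OF b] by metis
      then show "Poly_Mapping.lookup (bk (comp D (iota b) (star b))) (jn d y e) = (if b = b0 then 1 else 0)"
        by (simp add: lookup_single when_def)
    qed
    then show ?thesis using True b0(1) fin by simp
  next
    case False
    have "Poly_Mapping.lookup (\<Sum>b\<in>Rr. bk (comp D (iota b) (star b))) (jn d y e) = 0"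
      unfolding lookup_sum
    proof (rule sum.neutral, rule ballI)
      fix b assume b: "b \<in> Rr"
      have "comp D (iota b) (star b) \<noteq> jn d y e" using fwd[OF b] jb[OF b] False by metis
      then show "Poly_Mapping.lookup (bk (comp D (iota b) (star b))) (jn d y e) = 0"
        by (simp add: lookup_single when_def)
    qed
    then show ?thesis using False by simp
  qed
qed

text \<open>Mirror image of the previous count: the term \<open>c* c\<close> is
  \<open>jn 1 c c\<close>, with other triples \<open>d = h\<close>, \<open>y = g c h\<close> and
  \<open>e = g c\<close>. Now \<open>d\<close> is the group element and \<open>c\<close> represents
  the left orbit of \<open>e\<close>.\<close>

lemma lookup_rho_left:
  assumes t: "triple d y e"
  shows "Poly_Mapping.lookup (\<Sum>c\<in>Ll. bk (comp D (star c) (iota c))) (jn d y e) =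
    (if len d = 0 \<and> src C e = trg C d \<and> y = comp C e d then 1 else 0)"
proof -
  note t' = tripleD[OF t]
  have fin: "finite Ll" using Ll(1) finite_mor finite_subset by (metis (no_types, lifting) mem_Collect_eq subsetD subsetI)
  have tb: "triple (ident C (src C c)) c c" and jb: "comp D (star c) (iota c) = jn (ident C (src C c)) c c" if "c \<in> Ll" for c
    using that Ll(1) by (auto simp: triple_def jn_def iota_ident D.comp_ident_left)
  have fwd: "len d = 0 \<and> src C e = trg C d \<and> y = comp C e d \<and> (\<exists>g\<in>mor C. len g = 0 \<and> src C g = trg C c \<and> e = comp C g c)"
    if c: "c \<in> Ll" and eq: "jn (ident C (src C c)) c c = jn d y e" for c
  proof -
    have cm: "c \<in> mor C" using c Ll(1) by auto
    obtain g h where gh: "g \<in> mor C" "h \<in> mor C" "len g = 0" "len h = 0" "src C g = trg C c" "trg C h = src C c"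
      "y = comp C (comp C g c) h" "d = comp C (ident C (src C c)) h" "e = comp C g c"
      using star_eq[OF tb[OF c] t] eq by (auto simp: jn_def)
    have d: "d = h" using gh(8) gh(2,6) by simp
    have "y = comp C e d" using gh cm by (simp add: d)
    then show ?thesis using gh cm by (auto simp: d)
  qed
  show ?thesis
  proof (cases "len d = 0 \<and> src C e = trg C d \<and> y = comp C e d")
    case True
    have "len e = 1" using True t' by auto
    from Ll(2)[OF t'(3) this] obtain c0 g where c0: "c0 \<in> Ll" "g \<in> mor C" "len g = 0" "src C g = trg C c0" "e = comp C g c0"
      and uniq: "\<And>c. c \<in> Ll \<Longrightarrow> \<exists>g\<in>mor C. len g = 0 \<and> src C g = trg C c \<and> e = comp C g c \<Longrightarrow> c = c0"
      by blast
    have c0m: "c0 \<in> mor C" using c0 Ll(1) by auto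
    have "jn d y e = jn (comp C (ident C (src C c0)) d) (comp C (comp C g c0) d) (comp C g c0)"
      using True c0 c0m t' by simp
    also have "\<dots> = jn (ident C (src C c0)) c0 c0"
      using True c0 c0m t' by (intro jn_act[OF tb[OF c0(1)]]) auto
    finally have j0: "jn (ident C (src C c0)) c0 c0 = jn d y e" ..
    have "Poly_Mapping.lookup (\<Sum>c\<in>Ll. bk (comp D (star c) (iota c))) (jn d y e) = (\<Sum>c\<in>Ll. if c = c0 then 1 else 0)"
      unfolding lookup_sum
    proof (rule sum.cong[OF refl])
      fix c assume c: "c \<in> Ll"
      have "comp D (star c) (iota c) = jn d y e \<longleftrightarrow> c = c0"
        using fwd[OF c] uniq[OF c] j0 jb[OF c] by metis
      then show "Poly_Mapping.lookup (bk (comp D (star c) (iota c))) (jn d y e) = (if c = c0 then 1 else 0)"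
        by (simp add: lookup_single when_def)
    qed
    then show ?thesis using True c0(1) fin by simp
  next
    case False
    have "Poly_Mapping.lookup (\<Sum>c\<in>Ll. bk (comp D (star c) (iota c))) (jn d y e) = 0"
      unfolding lookup_sum
    proof (rule sum.neutral, rule ballI)
      fix c assume c: "c \<in> Ll"
      have "comp D (star c) (iota c) \<noteq> jn d y e" using fwd[OF c] jb[OF c] False by metis
      then show "Poly_Mapping.lookup (bk (comp D (star c) (iota c))) (jn d y e) = 0"
        by (simp add: lookup_single when_def)
    qed
    then show ?thesis using False by simp
  qed
qed

text \<open>Coefficients are compared at an arrow \<open>y\<close>. The first term of
  \<open>inn\<close> contributes where \<open>e\<close> is a group element and matches the sum over
  \<open>Rr\<close>; the second contributes where \<open>d\<close> is one and matches the sum over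
  \<open>Ll\<close>. In both cases the condition is \<open>y = e d\<close>.\<close>

lemma DD_rho:
  assumes a: "a \<in> kC" "\<xi> \<in> DA"
  shows "DD rho a \<xi> = inn a \<xi>"
proof (rule DD_eqI[OF inn_rel_der rho_keys _ a])
  fix y d e assume y: "y \<in> mor C" "len y = 1" and d: "d \<in> mor C" "e \<in> mor C"
  show "Poly_Mapping.lookup (inn (bs y) (dl d)) e =
      (if src C d = src C y \<and> trg C e = trg C y then Poly_Mapping.lookup rho (jn d y e) else 0)"
  proof (cases "src C d = src C y \<and> trg C e = trg C y")
    case False
    show ?thesis unfolding rel_der_coeff_zero[OF inn_rel_der y d False] if_not_P[OF False] ..
  next
    case True
    then have t: "triple d y e" using y d by (simp add: triple_def)
    have "Poly_Mapping.lookup (th (la (bs y) (dl d))) e =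
      (if len e = 0 \<and> src C e = trg C d \<and> y = comp C e d then 1 else 0)"
    proof (cases "len e = 0")
      case e0: True
      note ei = linv[OF d(2) e0]
      have te: "trg C e = src C e" by (rule len0_src[OF d(2) e0])
      have "(src C (linv e) = trg C y \<and> comp C (linv e) y = d) = (src C e = trg C d \<and> y = comp C e d)"
      proof
        assume *: "src C (linv e) = trg C y \<and> comp C (linv e) y = d"
        then have "comp C e d = comp C (comp C e (linv e)) y" "trg C d = trg C (linv e)"
          using ei(1,3,4) y(1) d * comp_assoc[OF d(2) ei(1) y(1)] by auto
        then show "src C e = trg C d \<and> y = comp C e d" using ei True te y by simp
      next
        assume *: "src C e = trg C d \<and> y = comp C e d"
        then have "comp C (linv e) y = comp C (comp C (linv e) e) d" using comp_assoc[OF ei(1) d(2,1)] ei(3,4) te * by simp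
        then show "src C (linv e) = trg C y \<and> comp C (linv e) y = d" using ei * True te d by simp
      qed
      then show ?thesis
        unfolding lookup_th[OF d(2)] using la_dl_single[OF y(1) d(1) ei(1)] e0 by simp
    qed (simp add: lookup_th[OF d(2)])
    moreover have "Poly_Mapping.lookup (cmul C (bs y) (th (dl d))) e =
      (if len d = 0 \<and> src C e = trg C d \<and> y = comp C e d then 1 else 0)"
    proof -
      have "Poly_Mapping.lookup (cmul C (bs y) (th (dl d))) e =
        (\<Sum>g\<in>G0. if linv g = d \<and> src C y = trg C g \<and> comp C y g = e then 1 else 0)"
        unfolding th_def cmul_sum_right lookup_sum using linv_mor
        by (intro sum.cong refl) (auto simp: cmul_single lookup_single when_def)
      also have "\<dots> = (if len d = 0 \<and> src C e = trg C d \<and> y = comp C e d then 1 else 0)"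
      proof (cases "len d = 0")
        case d0: True
        note di = linv[OF d(1) d0]
        note dii = linv[OF di(1,2)]
        have td: "trg C d = src C d" by (rule len0_src[OF d(1) d0])
        \<comment> \<open>At most one group element contributes to the sum, the inverse of
          \<open>d\<close>.\<close>
        have "(linv g = d \<and> src C y = trg C g \<and> comp C y g = e) = (g = linv d \<and> src C e = trg C d \<and> y = comp C e d)"
          if g: "g \<in> G0" for g
        proof
          from g have g: "g \<in> mor C" "len g = 0" by auto
          note gi = linv[OF g]
          assume *: "linv g = d \<and> src C y = trg C g \<and> comp C y g = e"
          have sg: "trg C g = src C g" by (rule len0_src[OF g])
          have "g = linv d"
          proof (rule cancel_left[OF d(1) g(1) di(1)])
            show "comp C d g = comp C d (linv d)" using * gi di by auto
          qed (use * gi di sg in auto)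
          moreover have "src C e = trg C d" using * g y sg gi by auto
          moreover have "comp C e d = comp C y (comp C g d)"
            using * comp_assoc[OF y(1) g(1) d(1)] gi(4) sg gi(3) by auto
          then have "comp C e d = y" using * gi sg y g by auto
          ultimately show "g = linv d \<and> src C e = trg C d \<and> y = comp C e d" by simp
        next
          assume *: "g = linv d \<and> src C e = trg C d \<and> y = comp C e d"
          have "linv (linv d) = d"
            by (rule cancel_left[OF di(1) dii(1) d(1)]) (use di dii td in auto)
          moreover have "comp C y g = comp C e (comp C d g)"
            using * comp_assoc[OF d(2,1) di(1)] di(4) by auto
          then have "comp C y g = e" using * di d td by auto
          moreover have "src C y = trg C g" using * di d td by auto
          ultimately show "linv g = d \<and> src C y = trg C g \<and> comp C y g = e" using * by simp
        qed
        then have "(\<Sum>g\<in>G0. if linv g = d \<and> src C y = trg C g \<and> comp C y g = e then 1 else 0) =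
          (\<Sum>g\<in>G0. if g = linv d then (if src C e = trg C d \<and> y = comp C e d then 1 else (0::'k)) else 0)"
          by (intro sum.cong refl) auto
        also have "\<dots> = (if src C e = trg C d \<and> y = comp C e d then 1 else 0)"
          using di finite_mor by simp
        finally show ?thesis using d0 by simp
      next
        case False
        then show ?thesis using linv(2) by (auto intro!: sum.neutral)
      qed
      finally show ?thesis .
    qed
    ultimately show ?thesis
      using True by (simp add: inn_def lookup_minus rho_def lookup_rho_right[OF t] lookup_rho_left[OF t])
  qed
qed

lemma vv_eq_iff:
  assumes "Poly_Mapping.keys u \<subseteq> M1" "Poly_Mapping.keys u' \<subseteq> M1"
  shows "vv u = vv u' \<longleftrightarrow> ph (DD (u - u')) \<in> Bd"
proof -
  have "DD u a \<xi> = DD (u - u') a \<xi> + DD u' a \<xi>" for a \<xi>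
    using DD_add[of "u - u'" u'] by simp
  then have "(\<lambda>f\<in>Collect inO. ph (DD u) f - ph (DD u') f) = ph (DD (u - u'))"
    by (simp add: ph_def esum_def sum.distrib cong: restrict_cong)
  then show ?thesis
    unfolding vv_def cl_eq_iff[OF ph_H[OF DD_der[OF assms(1)]] ph_H[OF DD_der[OF assms(2)]]] by simp
qed

lemma vv_rho: "vv rho = vv 0"
proof -
  have "lin (\<lambda>\<xi>. - th \<xi>)"
    using th_lin unfolding lin_def by (simp add: scal_uminus)
  then have "ph (DD rho) \<in> Bd"
    by (rule ph_inner) (simp add: DD_rho inn_def cmul_uminus)
  then show ?thesis using vv_eq_iff[OF rho_keys, of 0] by simp
qed

text \<open>The orbit of a representative \<open>c\<close> consists of the \<open>c g^-1\<close>,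
  and for such a \<open>d\<close> the element \<open>gp d\<close> is \<open>g\<close>
  itself.\<close>

lemma th_ra:
  assumes c: "c \<in> rp ` mor C" and \<xi>: "\<xi> \<in> DA"
  shows "th (ra \<xi> (bs c)) = (\<Sum>d\<in>{d \<in> mor C. rp d = c}. Poly_Mapping.single (gp d) (\<xi> (bs d)))"
proof -
  obtain d0 where d0: "d0 \<in> mor C" "c = rp d0" using c by blast
  note g0 = gp[OF d0(1)]
  have cm: "c \<in> mor C" using g0 d0 by simp
  have rpc: "rp c = c" using rp_comp[OF d0(1) g0(1-3)] g0(5) d0(2) by simp
  note gc = gp[OF cm]
  \<comment> \<open>A representative is its own representative, so the element carrying it there is
    the identity.\<close>
  have gpc: "gp c = ident C (src C c)"
    by (rule cancel_left[OF cm gc(1)]) (use gc rpc cm in auto)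
  let ?K = "{g \<in> G0. trg C g = src C c}"
  have "th (ra \<xi> (bs c)) = (\<Sum>g\<in>G0. if trg C g = src C c then Poly_Mapping.single g (\<xi> (bs (comp C c (linv g)))) else 0)"
    unfolding th_def
  proof (intro sum.cong refl)
    fix g assume "g \<in> G0"
    then have g: "g \<in> mor C" "len g = 0" by auto
    note gi = linv[OF g]
    have "src C c = trg C (linv g) \<longleftrightarrow> trg C g = src C c" using gi len0_src[OF g] by auto
    then show "Poly_Mapping.single g (ra \<xi> (bs c) (bs (linv g))) =
      (if trg C g = src C c then Poly_Mapping.single g (\<xi> (bs (comp C c (linv g)))) else 0)"
      using gi dual_zero[OF \<xi>] by (simp add: cmul_single)
  qed
  also have "\<dots> = (\<Sum>g\<in>?K. Poly_Mapping.single g (\<xi> (bs (comp C c (linv g)))))"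
    by (rule sum.inter_filter[OF finite_G0, symmetric])
  also have "\<dots> = (\<Sum>d\<in>{d \<in> mor C. rp d = c}. Poly_Mapping.single (gp d) (\<xi> (bs d)))"
  proof (rule sum.reindex_bij_witness[of _ gp "\<lambda>g. comp C c (linv g)"])
    fix g assume "g \<in> ?K"
    then have g: "g \<in> mor C" "len g = 0" "trg C g = src C c" by auto
    note gi = linv[OF g(1,2)]
    have sg: "trg C g = src C g" by (rule len0_src[OF g(1,2)])
    have li: "trg C (linv g) = src C c" using gi g sg by simp
    let ?d = "comp C c (linv g)"
    have d: "?d \<in> mor C" "src C ?d = src C (linv g)" using cm gi li by simp_all
    note gd = gp[OF d(1)]
    show r: "?d \<in> {d \<in> mor C. rp d = c}"
      using rp_comp[OF cm gi(1,2) li] rpc d by simp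
    have "comp C (linv g) (gp ?d) = comp C (linv g) g"
      using gp_comp[OF cm gi(1,2) li] gpc gi sg g by simp
    then show gpd: "gp ?d = g"
      by (intro cancel_left[OF gi(1) gd(1) g(1)]) (use gd d gi sg in simp_all)
    then show "Poly_Mapping.single (gp ?d) (\<xi> (bs ?d)) = Poly_Mapping.single g (\<xi> (bs ?d))" by simp
  next
    fix d assume "d \<in> {d \<in> mor C. rp d = c}"
    then have d: "d \<in> mor C" "rp d = c" by auto
    note gd = gp[OF d(1)]
    note gi = linv[OF gd(1,2)]
    show "gp d \<in> ?K" using gd d by auto
    show "comp C c (linv (gp d)) = d"
      using comp_assoc[OF d(1) gd(1) gi(1)] gd gi d by simp
  qed
  finally show ?thesis .
qed

text \<open>An equivariant map is fixed by its values on \<open>dl c\<close> for orbit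
  representatives \<open>c\<close>, by \<open>dl_rp\<close>. Collecting the basis expansion orbit by
  orbit shows that \<open>th\<close> generates all equivariant maps under the two-sided action of
  \<open>A\<close>.\<close>

lemma th_expand:
  assumes \<theta>: "lin \<theta>" and act: "\<And>g \<xi>. g \<in> mor C \<Longrightarrow> len g = 0 \<Longrightarrow> \<xi> \<in> DA \<Longrightarrow> \<theta> (la (bs g) \<xi>) = cmul C (bs g) (\<theta> \<xi>)"
    and \<xi>: "\<xi> \<in> DA"
  shows "\<theta> \<xi> = (\<Sum>c\<in>rp ` mor C. cmul C (th (ra \<xi> (bs c))) (\<theta> (dl c)))"
proof -
  have "\<theta> \<xi> = (\<Sum>d\<in>mor C. cmul C (Poly_Mapping.single (gp d) (\<xi> (bs d))) (\<theta> (dl (rp d))))"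
    unfolding lin_expand[OF \<theta> \<xi>]
  proof (intro sum.cong refl)
    fix d assume d: "d \<in> mor C"
    note g = gp[OF d]
    have "\<theta> (dl d) = cmul C (bs (gp d)) (\<theta> (dl (rp d)))"
      using act[OF g(1,2) dl_closed[of "rp d"]] dl_rp[OF d] by simp
    then show "scal (\<xi> (bs d)) (\<theta> (dl d)) = cmul C (Poly_Mapping.single (gp d) (\<xi> (bs d))) (\<theta> (dl (rp d)))"
      using cmul_scal_left[of C "\<xi> (bs d)" "bs (gp d)"] by simp
  qed
  also have "\<dots> = (\<Sum>c\<in>rp ` mor C. \<Sum>d\<in>{d \<in> mor C. rp d = c}. cmul C (Poly_Mapping.single (gp d) (\<xi> (bs d))) (\<theta> (dl (rp d))))"
    by (rule sum.image_gen[OF finite_mor])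
  also have "\<dots> = (\<Sum>c\<in>rp ` mor C. cmul C (th (ra \<xi> (bs c))) (\<theta> (dl c)))"
    by (intro sum.cong refl) (simp add: th_ra[OF _ \<xi>] cmul_sum_left)
  finally show ?thesis .
qed

text \<open>A trivial class makes the derivation of \<open>w\<close> inner, by some
  \<open>\<theta>\<close>; as it vanishes on the groups, \<open>\<theta>\<close> is equivariant.
  Writing \<open>\<theta>\<close> through \<open>th\<close> writes the inner derivation through
  \<open>inn\<close>, that is, \<open>w\<close> as a sum of two-sided multiples of
  \<open>rho\<close>.\<close>

lemma vv_kernel:
  assumes u: "Poly_Mapping.keys u \<subseteq> M1" "Poly_Mapping.keys u' \<subseteq> M1" and eq: "vv u = vv u'"
    and I: "ideal I (category_algebra D :: ('k, 'n \<Rightarrow>\<^sub>0 'k) module)" "rho \<in> I"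
  shows "u - u' \<in> I"
proof -
  define w where "w = u - u'"
  have w: "Poly_Mapping.keys w \<subseteq> M1" using u keys_diff[of u u'] by (auto simp: w_def)
  note I' = ideal_D[OF I(1)]
  have "ph (DD w) \<in> Bd" using eq vv_eq_iff[OF u] by (simp add: w_def)
  then obtain \<theta> where \<theta>: "lin \<theta>" "\<And>a \<xi>. a \<in> kC \<Longrightarrow> \<xi> \<in> DA \<Longrightarrow> DD w a \<xi> = cmul C a (\<theta> \<xi>) - \<theta> (la a \<xi>)"
    using ph_boundary[OF DD_der[OF w]] by blast
  have act: "\<theta> (la (bs g) \<xi>) = cmul C (bs g) (\<theta> \<xi>)" if "g \<in> mor C" "len g = 0" "\<xi> \<in> DA" for g \<xi>
    using \<theta>(2)[of "bs g" \<xi>] DD_rel_der[OF w] that by (simp add: rel_der_def)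
  have rpm: "c \<in> mor C" if "c \<in> rp ` mor C" for c using that gp(6) by auto
  have \<theta>k: "Poly_Mapping.keys (\<theta> \<xi>) \<subseteq> mor C" if "\<xi> \<in> DA" for \<xi> using \<theta>(1) that by (simp add: lin_def)
  \<comment> \<open>The term of \<open>th_expand\<close> for \<open>\<theta>\<close> at
    \<open>c\<close>, with \<open>th\<close> replaced by \<open>rho\<close>.\<close>
  define y where "y c = cmul D (cmul D (emb (bs c)) rho) (emb (\<theta> (dl c)))" for c
  define Y where "Y = (\<Sum>c\<in>rp ` mor C. y c)"
  have yM: "Poly_Mapping.keys (cmul D (emb (bs c)) rho) \<subseteq> M1" "Poly_Mapping.keys (y c) \<subseteq> M1"
    if "c \<in> rp ` mor C" for c
  proof -
    show 1: "Poly_Mapping.keys (cmul D (emb (bs c)) rho) \<subseteq> M1"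
      using M1_cmul(1)[OF rho_keys, of "bs c"] rpm[OF that] by simp
    show "Poly_Mapping.keys (y c) \<subseteq> M1"
      unfolding y_def by (rule M1_cmul(2)[OF 1 \<theta>k]) simp
  qed
  have "Y \<in> I" if "finite S" "S \<subseteq> rp ` mor C" "Y = sum y S" for S Y
    using that
  proof (induction arbitrary: Y rule: finite_induct)
    case empty
    then show ?case using I' by simp
  next
    case (insert c S)
    have "y c \<in> I" unfolding y_def
      by (intro I'(5,6) I(2) emb_closed \<theta>k dl_closed) (use rpm insert in auto)
    then show ?case using insert I'(2) by simp
  qed
  then have YI: "Y \<in> I" using finite_mor Y_def by blast
  have YM: "Poly_Mapping.keys Y \<subseteq> M1" unfolding Y_def using yM by (intro keys_sum_subset)
  have DDY: "DD Y a \<xi> = - DD w a \<xi>" if a: "a \<in> kC" "\<xi> \<in> DA" for a \<xi>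
  proof -
    have DDs: "DD (sum y S) a \<xi> = (\<Sum>c\<in>S. DD (y c) a \<xi>)" for S
      by (induction S rule: infinite_finite_induct) (simp_all add: DD_add DD_zero)
    have "DD Y a \<xi> = (\<Sum>c\<in>rp ` mor C. DD (y c) a \<xi>)" unfolding Y_def by (rule DDs)
    also have "\<dots> = (\<Sum>c\<in>rp ` mor C. cmul C (th (ra (la a \<xi>) (bs c))) (\<theta> (dl c)) -
        cmul C a (cmul C (th (ra \<xi> (bs c))) (\<theta> (dl c))))"
    proof (rule sum.cong[OF refl])
      fix c assume c: "c \<in> rp ` mor C"
      have cm: "c \<in> mor C" by (rule rpm[OF c])
      have r: "ra \<xi> (bs c) \<in> DA" using a cm by simp
      have tk: "Poly_Mapping.keys (th (ra \<xi> (bs c))) \<subseteq> mor C" using th_lin r by (simp add: lin_def)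
      have "DD (y c) a \<xi> = cmul C (inn a (ra \<xi> (bs c))) (\<theta> (dl c))"
        unfolding y_def using DD_right[OF yM(1)[OF c] \<theta>k a] DD_left[OF rho_keys _ a, of "bs c"] DD_rho[OF a(1) r] cm
        by simp
      also have "\<dots> = cmul C (th (ra (la a \<xi>) (bs c))) (\<theta> (dl c)) - cmul C a (cmul C (th (ra \<xi> (bs c))) (\<theta> (dl c)))"
        using a cm tk \<theta>k by (simp add: inn_def cmul_diff_left ra_la cmul_assoc)
      finally show "DD (y c) a \<xi> = \<dots>" .
    qed
    also have "\<dots> = \<theta> (la a \<xi>) - cmul C a (\<theta> \<xi>)"
    proof -
      have la: "la a \<xi> \<in> DA" using a by simp
      have "\<theta> \<xi> = (\<Sum>c\<in>rp ` mor C. cmul C (th (ra \<xi> (bs c))) (\<theta> (dl c)))"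
        by (rule th_expand[OF \<theta>(1) act a(2)])
      moreover have "\<theta> (la a \<xi>) = (\<Sum>c\<in>rp ` mor C. cmul C (th (ra (la a \<xi>) (bs c))) (\<theta> (dl c)))"
        by (rule th_expand[OF \<theta>(1) act la])
      ultimately show ?thesis by (simp only: sum_subtractf cmul_sum_right)
    qed
    finally show ?thesis using \<theta>(2)[OF a] by simp
  qed
  have wY: "Poly_Mapping.keys (w + Y) \<subseteq> M1" by (rule keys_add_subset[OF w YM])
  \<comment> \<open>The two derivations cancel by \<open>DDY\<close>, and \<open>DD_coeff\<close>
    reads the coefficients of \<open>w + Y\<close> off their sum.\<close>
  have "w + Y = 0"
  proof (rule poly_mapping_eqI)
    fix z
    show "Poly_Mapping.lookup (w + Y) z = Poly_Mapping.lookup 0 z"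
    proof (cases "z \<in> M1")
      case True
      then obtain d x e where t: "triple d x e" "z = jn d x e" by (rule tri_ex)
      note t' = tripleD[OF t(1)]
      have "DD (w + Y) (bs x) (dl d) = 0" using DDY[of "bs x" "dl d"] t' by (simp add: DD_add)
      then show ?thesis using DD_coeff[OF wY t'(2,4,1,3)] t' t(2) by simp
    next
      case False
      then show ?thesis using wY by (metis in_keys_iff lookup_zero subsetD)
    qed
  qed
  then have "w = - Y" by (simp add: eq_neg_iff_add_eq_0)
  then show ?thesis using I'(3)[OF YI] by (simp add: w_def)
qed

end

section \<open>Tensor algebras\<close>

lemma frag_coset_plus:
  fixes N :: "('v list \<Rightarrow>\<^sub>0 int) set"
  assumes "\<And>x y. x \<in> N \<Longrightarrow> y \<in> N \<Longrightarrow> x + y \<in> N" "0 \<in> N"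
  shows "(f +o N) + (g +o N) = (f + g) +o N"
proof -
  have "N + N = N"
    using assms by (force simp: set_plus_def)
  then show ?thesis by (simp add: set_plus_rearrange)
qed

text \<open>
  A graded category together with a surjection \<open>vv\<close> from the degree one part of its category algebra
  onto a bimodule, with kernel inside every ideal containing \<open>rho\<close>.
\<close>

locale graded_tensor = graded_cat C D iota dg
  for C :: "('o, 'm) category" and D :: "('o, 'n) category" and iota :: "'m \<Rightarrow> 'n" and dg :: "'n \<Rightarrow> nat" +
  fixes V :: "('m \<Rightarrow>\<^sub>0 'k::field, 'v) bimodule" and vv :: "('n \<Rightarrow>\<^sub>0 'k) \<Rightarrow> 'v" and rho :: "'n \<Rightarrow>\<^sub>0 'k"
  assumes vv_closed: "Poly_Mapping.keys u \<subseteq> M1 \<Longrightarrow> vv u \<in> carrier V"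
    and vv_add: "\<lbrakk>Poly_Mapping.keys u \<subseteq> M1; Poly_Mapping.keys u' \<subseteq> M1\<rbrakk> \<Longrightarrow> vv (u + u') = vv u \<oplus>\<^bsub>V\<^esub> vv u'"
    and vv_left: "\<lbrakk>Poly_Mapping.keys u \<subseteq> M1; Poly_Mapping.keys b \<subseteq> mor C\<rbrakk> \<Longrightarrow> vv (cmul D (emb b) u) = b \<odot>\<^bsub>V\<^esub> vv u"
    and vv_right: "\<lbrakk>Poly_Mapping.keys u \<subseteq> M1; Poly_Mapping.keys b \<subseteq> mor C\<rbrakk> \<Longrightarrow> vv (cmul D u (emb b)) = rsmult V (vv u) b"
    and vv_surj: "z \<in> carrier V \<Longrightarrow> \<exists>u. Poly_Mapping.keys u \<subseteq> M1 \<and> z = vv u"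
    and vv_kernel: "\<lbrakk>Poly_Mapping.keys u \<subseteq> M1; Poly_Mapping.keys u' \<subseteq> M1; vv u = vv u';
        ideal I (category_algebra D :: ('k, 'n \<Rightarrow>\<^sub>0 'k) module); rho \<in> I\<rbrakk> \<Longrightarrow> u - u' \<in> I"
    and rho_keys: "Poly_Mapping.keys rho \<subseteq> M1"
    and vv_rho: "vv rho = vv 0"
begin

abbreviation A :: "('k, 'm \<Rightarrow>\<^sub>0 'k) module" where
  "A \<equiv> category_algebra C"

abbreviation kC :: "('m \<Rightarrow>\<^sub>0 'k) set" where
  "kC \<equiv> {f. Poly_Mapping.keys f \<subseteq> mor C}"

abbreviation N :: "nat \<Rightarrow> ('v list \<Rightarrow>\<^sub>0 int) set" where
  "N n \<equiv> tensor_rels A V n"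

abbreviation W :: "nat \<Rightarrow> 'v list set" where
  "W n \<equiv> tensor_words V n"

text \<open>The bimodule laws are transported along the surjection \<open>vv\<close> from the degree
  one elements, where they are laws of the category algebra.\<close>

lemma V_ops:
  assumes z: "z \<in> carrier V" "z' \<in> carrier V" and a: "a \<in> kC" "b \<in> kC"
  shows "z \<oplus>\<^bsub>V\<^esub> z' \<in> carrier V" "a \<odot>\<^bsub>V\<^esub> z \<in> carrier V" "rsmult V z a \<in> carrier V"
    "a \<odot>\<^bsub>V\<^esub> (z \<oplus>\<^bsub>V\<^esub> z') = a \<odot>\<^bsub>V\<^esub> z \<oplus>\<^bsub>V\<^esub> a \<odot>\<^bsub>V\<^esub> z'"
    "rsmult V (z \<oplus>\<^bsub>V\<^esub> z') a = rsmult V z a \<oplus>\<^bsub>V\<^esub> rsmult V z' a"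
    "(a + b) \<odot>\<^bsub>V\<^esub> z = a \<odot>\<^bsub>V\<^esub> z \<oplus>\<^bsub>V\<^esub> b \<odot>\<^bsub>V\<^esub> z"
    "rsmult V z (a + b) = rsmult V z a \<oplus>\<^bsub>V\<^esub> rsmult V z b"
    "a \<odot>\<^bsub>V\<^esub> (rsmult V z b) = rsmult V (a \<odot>\<^bsub>V\<^esub> z) b"
proof -
  obtain u u' where u: "Poly_Mapping.keys u \<subseteq> M1" "z = vv u" "Poly_Mapping.keys u' \<subseteq> M1" "z' = vv u'"
    using vv_surj[OF z(1)] vv_surj[OF z(2)] by (elim exE conjE)
  have a': "Poly_Mapping.keys a \<subseteq> mor C" "Poly_Mapping.keys b \<subseteq> mor C" using a by auto
  have uD: "Poly_Mapping.keys u \<subseteq> mor D" using u by auto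
  note m = M1_cmul[OF u(1) a'(1)] M1_cmul[OF u(3) a'(1)] M1_cmul[OF u(1) a'(2)]
  show "z \<oplus>\<^bsub>V\<^esub> z' \<in> carrier V"
    using vv_closed[OF keys_add_subset[OF u(1,3)]] vv_add[OF u(1,3)] u by simp
  show "a \<odot>\<^bsub>V\<^esub> z \<in> carrier V" using vv_closed[OF m(1)] vv_left[OF u(1) a'(1)] u by simp
  show "rsmult V z a \<in> carrier V" using vv_closed[OF m(2)] vv_right[OF u(1) a'(1)] u by simp
  show "a \<odot>\<^bsub>V\<^esub> (z \<oplus>\<^bsub>V\<^esub> z') = a \<odot>\<^bsub>V\<^esub> z \<oplus>\<^bsub>V\<^esub> a \<odot>\<^bsub>V\<^esub> z'"
    using vv_left[OF keys_add_subset[OF u(1,3)] a'(1)] vv_left[OF u(1) a'(1)] vv_left[OF u(3) a'(1)]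
      vv_add[OF u(1,3)] vv_add[OF m(1,3)] u by (simp add: cmul_add_right)
  show "rsmult V (z \<oplus>\<^bsub>V\<^esub> z') a = rsmult V z a \<oplus>\<^bsub>V\<^esub> rsmult V z' a"
    using vv_right[OF keys_add_subset[OF u(1,3)] a'(1)] vv_right[OF u(1) a'(1)] vv_right[OF u(3) a'(1)]
      vv_add[OF u(1,3)] vv_add[OF m(2,4)] u by (simp add: cmul_add_left)
  show "(a + b) \<odot>\<^bsub>V\<^esub> z = a \<odot>\<^bsub>V\<^esub> z \<oplus>\<^bsub>V\<^esub> b \<odot>\<^bsub>V\<^esub> z"
    using vv_left[OF u(1) keys_add_subset[OF a']] vv_left[OF u(1) a'(1)] vv_left[OF u(1) a'(2)]
      vv_add[OF m(1,5)] u by (simp add: emb_add cmul_add_left)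
  show "rsmult V z (a + b) = rsmult V z a \<oplus>\<^bsub>V\<^esub> rsmult V z b"
    using vv_right[OF u(1) keys_add_subset[OF a']] vv_right[OF u(1) a'(1)] vv_right[OF u(1) a'(2)]
      vv_add[OF m(2,6)] u by (simp add: emb_add cmul_add_right)
  have "cmul D (emb a) (cmul D u (emb b)) = cmul D (cmul D (emb a) u) (emb b)"
    using uD a' by (simp add: D.cmul_assoc emb_closed)
  then show "a \<odot>\<^bsub>V\<^esub> (rsmult V z b) = rsmult V (a \<odot>\<^bsub>V\<^esub> z) b"
    using vv_left[OF m(6) a'(1)] vv_right[OF m(1) a'(2)] vv_left[OF u(1) a'(1)] vv_right[OF u(1) a'(2)] u by simp
qed

lemma N_uminus: "f \<in> N n \<Longrightarrow> - f \<in> N n"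
  using tensor_rels.diff[OF tensor_rels.zero, of f A V n] by simp

lemma N_add: "f \<in> N n \<Longrightarrow> g \<in> N n \<Longrightarrow> f + g \<in> N n"
  using tensor_rels.diff[of f A V n "- g"] N_uminus by simp

section \<open>Congruence modulo the tensor relations\<close>

definition eqv :: "nat \<Rightarrow> ('v list \<Rightarrow>\<^sub>0 int) \<Rightarrow> ('v list \<Rightarrow>\<^sub>0 int) \<Rightarrow> bool" where
  "eqv n f g \<longleftrightarrow> f - g \<in> N n"

lemma eqv_refl [simp]: "eqv n f f"
  by (simp add: eqv_def tensor_rels.zero)

lemma eqv_sym: "eqv n f g \<Longrightarrow> eqv n g f"
  unfolding eqv_def using N_uminus by force

lemma eqv_trans [trans]: "eqv n f g \<Longrightarrow> eqv n g h \<Longrightarrow> eqv n f h"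
  unfolding eqv_def using N_add[of "f - g" n "g - h"] by simp

lemma eqv_eq_trans [trans]: "eqv n f g \<Longrightarrow> g = h \<Longrightarrow> eqv n f h" "f = g \<Longrightarrow> eqv n g h \<Longrightarrow> eqv n f h"
  by simp_all

lemma eqv_add: "eqv n f f' \<Longrightarrow> eqv n g g' \<Longrightarrow> eqv n (f + g) (f' + g')"
  unfolding eqv_def using N_add[of "f - f'" n "g - g'"] by (simp add: algebra_simps)

lemma eqv_diff: "eqv n f f' \<Longrightarrow> eqv n g g' \<Longrightarrow> eqv n (f - g) (f' - g')"
  unfolding eqv_def using tensor_rels.diff[of "f - f'" A V n "g - g'"] by (simp add: algebra_simps)

lemma eqv_sum: "(\<And>i. i \<in> S \<Longrightarrow> eqv n (f i) (g i)) \<Longrightarrow> eqv n (sum f S) (sum g S)"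
  by (induction S rule: infinite_finite_induct) (auto simp: eqv_add)

lemma eqv_zero_iff: "eqv n f 0 \<longleftrightarrow> f \<in> N n"
  by (simp add: eqv_def)

lemma coset_eq_iff: "f +o N n = g +o N n \<longleftrightarrow> eqv n f g"
proof
  assume "f +o N n = g +o N n"
  moreover have "f + 0 \<in> f +o N n" using tensor_rels.zero by (rule set_plus_intro2)
  ultimately have "f \<in> g +o N n" by simp
  then show "eqv n f g" unfolding elt_set_plus_def eqv_def by auto
next
  assume fg: "eqv n f g"
  have "f +o N n \<subseteq> g +o N n" if "eqv n f g" for f g
  proof
    fix z assume "z \<in> f +o N n"
    then obtain x where x: "x \<in> N n" "z = f + x" by (auto simp: elt_set_plus_def)
    have "z = g + ((f - g) + x)" "(f - g) + x \<in> N n" using x N_add[of "f - g" n x] that by (simp_all add: eqv_def)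
    then show "z \<in> g +o N n" unfolding elt_set_plus_def by blast
  qed
  then show "f +o N n = g +o N n" using fg eqv_sym by blast
qed

lemma coset_zero: "0 +o N n = N n"
  by (auto simp: elt_set_plus_def)

lemma coset_add: "(f +o N n) + (g +o N n) = (f + g) +o N n"
  by (rule frag_coset_plus) (auto intro: N_add tensor_rels.zero)

lemma coset_sum: "finite S \<Longrightarrow> (f +o N n) + (\<Sum>i\<in>S. g i +o N n) = (f + (\<Sum>i\<in>S. g i)) +o N n"
proof (induction S arbitrary: f rule: finite_induct)
  case empty
  show ?case by simp
next
  case (insert x S)
  have "(f +o N n) + (\<Sum>i\<in>insert x S. g i +o N n) = ((f +o N n) + (g x +o N n)) + (\<Sum>i\<in>S. g i +o N n)"
    using insert by (simp add: add.assoc)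
  then show ?case using insert by (simp add: coset_add add.assoc)
qed

lemma words_iff [simp]: "us @ ws \<in> W n \<longleftrightarrow> set us \<subseteq> carrier V \<and> set ws \<subseteq> carrier V \<and> length us + length ws = n"
  "v # ws \<in> W n \<longleftrightarrow> v \<in> carrier V \<and> set ws \<subseteq> carrier V \<and> Suc (length ws) = n"
  by (auto simp: tensor_words_def)

lemma W_iff: "ws \<in> W n \<longleftrightarrow> set ws \<subseteq> carrier V \<and> length ws = n"
  by (auto simp: tensor_words_def)

lemma N_keys: "f \<in> N n \<Longrightarrow> Poly_Mapping.keys f \<subseteq> W n"
proof (induction rule: tensor_rels.induct)
  case (diff f g)
  then show ?case using keys_diff[of f g] by blast
next
  case (additive us v ws v')
  have "v \<oplus>\<^bsub>V\<^esub> v' \<in> carrier V" using additive V_ops(1)[of v v' 0 0] by simp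
  then show ?case using additive
    by (intro order_trans[OF keys_diff] Un_least) (auto simp: keys_frag_of)
next
  case (balanced us v v' ws b)
  have "rsmult V v b \<in> carrier V" "b \<odot>\<^bsub>V\<^esub> v' \<in> carrier V"
    using balanced V_ops(2)[of v' v' b 0] V_ops(3)[of v v b 0] by simp_all
  then show ?case using balanced
    by (intro order_trans[OF keys_diff] Un_least) (auto simp: keys_frag_of)
qed simp

text \<open>A map compatible with differences is controlled by its values on the two families of
  generating relations.\<close>

lemma N_map:
  assumes zero: "G 0 = 0" and diff: "\<And>f g. G (f - g) = G f - G g"
    and additive: "\<And>us v ws v'. us @ v # ws \<in> W n \<Longrightarrow> v' \<in> carrier V \<Longrightarrow>
       G (frag_of (us @ (v \<oplus>\<^bsub>V\<^esub> v') # ws)) - G (frag_of (us @ v # ws)) - G (frag_of (us @ v' # ws)) \<in> S"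
    and balanced: "\<And>us v v' ws b. us @ v # v' # ws \<in> W n \<Longrightarrow> b \<in> kC \<Longrightarrow>
       G (frag_of (us @ rsmult V v b # v' # ws)) - G (frag_of (us @ v # (b \<odot>\<^bsub>V\<^esub> v') # ws)) \<in> S"
    and S: "0 \<in> S" "\<And>x y. x \<in> S \<Longrightarrow> y \<in> S \<Longrightarrow> x - y \<in> S"
    and f: "f \<in> N n"
  shows "G f \<in> S"
  using f
proof (induction rule: tensor_rels.induct)
  case (balanced us v v' ws b)
  then show ?case using assms(4)[of us v v' ws b] by (simp add: diff)
next
  case (additive us v ws v')
  then show ?case using assms(3)[of us v ws v'] by (simp add: diff)
qed (simp_all add: zero diff S)

lemma eqv_additive:
  assumes "us @ v # ws \<in> W n" "v' \<in> carrier V"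
  shows "eqv n (frag_of (us @ (v \<oplus>\<^bsub>V\<^esub> v') # ws)) (frag_of (us @ v # ws) + frag_of (us @ v' # ws))"
  using tensor_rels.additive[OF assms, of A] by (simp add: eqv_def algebra_simps)

lemma eqv_balanced:
  assumes "us @ v # v' # ws \<in> W n" "b \<in> kC"
  shows "eqv n (frag_of (us @ rsmult V v b # v' # ws)) (frag_of (us @ v # (b \<odot>\<^bsub>V\<^esub> v') # ws))"
  unfolding eqv_def by (rule tensor_rels.balanced) (use assms in simp_all)

definition Lm :: "('m \<Rightarrow>\<^sub>0 'k) \<Rightarrow> ('v list \<Rightarrow>\<^sub>0 int) \<Rightarrow> ('v list \<Rightarrow>\<^sub>0 int)" where
  "Lm b = frag_extend (\<lambda>ws. frag_of ((b \<odot>\<^bsub>V\<^esub> hd ws) # tl ws))"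

definition Rm :: "('v list \<Rightarrow>\<^sub>0 int) \<Rightarrow> ('m \<Rightarrow>\<^sub>0 'k) \<Rightarrow> ('v list \<Rightarrow>\<^sub>0 int)" where
  "Rm f b = frag_extend (\<lambda>ws. frag_of (butlast ws @ [rsmult V (last ws) b])) f"

definition cc :: "('v list \<Rightarrow>\<^sub>0 int) \<Rightarrow> ('v list \<Rightarrow>\<^sub>0 int) \<Rightarrow> ('v list \<Rightarrow>\<^sub>0 int)" where
  "cc f g = frag_extend (\<lambda>us. frag_extend (\<lambda>ws. frag_of (us @ ws)) g) f"

lemma Lm_simps [simp]: "Lm b 0 = 0" "Lm b (f - g) = Lm b f - Lm b g" "Lm b (f + g) = Lm b f + Lm b g"
    "Lm b (frag_of (v # ws)) = frag_of ((b \<odot>\<^bsub>V\<^esub> v) # ws)"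
  by (simp_all add: Lm_def frag_extend_diff frag_extend_add)

lemma Rm_simps [simp]: "Rm 0 b = 0" "Rm (f - g) b = Rm f b - Rm g b" "Rm (f + g) b = Rm f b + Rm g b"
    "Rm (frag_of (ws @ [v])) b = frag_of (ws @ [rsmult V v b])"
  by (simp_all add: Rm_def frag_extend_diff frag_extend_add)

lemma cc_left [simp]: "cc 0 g = 0" "cc (f - f') g = cc f g - cc f' g" "cc (f + f') g = cc f g + cc f' g"
  by (simp_all add: cc_def frag_extend_diff frag_extend_add)

lemma cc_right [simp]: "cc f 0 = 0" "cc f (g - g') = cc f g - cc f g'" "cc f (g + g') = cc f g + cc f g'"
proof -
  have d: "cc f (g - g') = cc f g - cc f g'" for f g g'
  proof -
    have "Poly_Mapping.keys f \<subseteq> UNIV" by simp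
    then show ?thesis
      by (induction rule: frag_induction) (simp_all add: cc_def frag_extend_diff)
  qed
  show "cc f (g - g') = cc f g - cc f g'" by (rule d)
  show z: "cc f 0 = 0" using d[of f 0 0] by simp
  show "cc f (g + g') = cc f g + cc f g'"
    using d[of f g "- g'"] d[of f 0 g'] z by simp
qed

lemma cc_frag_of [simp]: "cc (frag_of us) (frag_of ws) = frag_of (us @ ws)"
  by (simp add: cc_def)

text \<open>If a relation sits in the first position, additivity of the left action or its
  compatibility with the right action turns it into another relation. In any other position only an
  uninvolved first letter changes.\<close>

lemma Lm_N:
  assumes b: "b \<in> kC" and f: "f \<in> N n"
  shows "Lm b f \<in> N n"
proof (rule N_map[where G = "Lm b", OF _ _ _ _ tensor_rels.zero tensor_rels.diff f])
  fix us v ws v' assume *: "us @ v # ws \<in> W n" "v' \<in> carrier V"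
  have v: "v \<in> carrier V" using * by simp
  show "Lm b (frag_of (us @ (v \<oplus>\<^bsub>V\<^esub> v') # ws)) - Lm b (frag_of (us @ v # ws)) - Lm b (frag_of (us @ v' # ws)) \<in> N n"
  proof (cases us)
    case Nil
    then show ?thesis
      using tensor_rels.additive[of "[]" "b \<odot>\<^bsub>V\<^esub> v" ws V n "b \<odot>\<^bsub>V\<^esub> v'" A] * V_ops(2,4)[OF v *(2) b b] V_ops(2)[OF *(2) v b b]
      by simp
  next
    case (Cons x xs)
    then show ?thesis
      using tensor_rels.additive[of "(b \<odot>\<^bsub>V\<^esub> x) # xs" v ws V n v' A] * V_ops(2)[of x x b b] b by simp
  qed
next
  fix us v v' ws c assume *: "us @ v # v' # ws \<in> W n" "c \<in> kC"
  have v: "v \<in> carrier V" "v' \<in> carrier V" using * by simp_all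
  show "Lm b (frag_of (us @ rsmult V v c # v' # ws)) - Lm b (frag_of (us @ v # (c \<odot>\<^bsub>V\<^esub> v') # ws)) \<in> N n"
  proof (cases us)
    case Nil
    then show ?thesis
      using tensor_rels.balanced[of "[]" "b \<odot>\<^bsub>V\<^esub> v" v' ws V n c A] * V_ops(2,8)[OF v b *(2)] by simp
  next
    case (Cons x xs)
    then show ?thesis
      using tensor_rels.balanced[of "(b \<odot>\<^bsub>V\<^esub> x) # xs" v v' ws V n c A] * V_ops(2)[of x x b b] b by simp
  qed
qed simp_all

lemma Rm_Cons [simp]: "ws \<noteq> [] \<Longrightarrow> Rm (frag_of (us @ ws)) b = frag_of (us @ butlast ws @ [rsmult V (last ws) b])"
  by (simp add: Rm_def butlast_append)

lemma Rm_N: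
  assumes b: "b \<in> kC" and f: "f \<in> N n"
  shows "Rm f b \<in> N n"
proof (rule N_map[where G = "\<lambda>f. Rm f b", OF _ _ _ _ tensor_rels.zero tensor_rels.diff f])
  fix us v ws v' assume *: "us @ v # ws \<in> W n" "v' \<in> carrier V"
  have v: "v \<in> carrier V" using * by simp
  show "Rm (frag_of (us @ (v \<oplus>\<^bsub>V\<^esub> v') # ws)) b - Rm (frag_of (us @ v # ws)) b - Rm (frag_of (us @ v' # ws)) b \<in> N n"
  proof (cases ws rule: rev_cases)
    case Nil
    then show ?thesis
      using tensor_rels.additive[of us "rsmult V v b" "[]" V n "rsmult V v' b" A] * V_ops(3,5)[OF v *(2) b b] V_ops(3)[OF *(2) v b b]
      by simp
  next
    case (snoc xs x)
    then show ?thesis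
      using tensor_rels.additive[of us v "xs @ [rsmult V x b]" V n v' A] * V_ops(3)[of x x b b] b by simp
  qed
next
  fix us v v' ws c assume *: "us @ v # v' # ws \<in> W n" "c \<in> kC"
  have v: "v \<in> carrier V" "v' \<in> carrier V" using * by simp_all
  show "Rm (frag_of (us @ rsmult V v c # v' # ws)) b - Rm (frag_of (us @ v # (c \<odot>\<^bsub>V\<^esub> v') # ws)) b \<in> N n"
  proof (cases ws rule: rev_cases)
    case Nil
    then show ?thesis
      using tensor_rels.balanced[of us v "rsmult V v' b" "[]" V n c A] * V_ops(3)[OF v(2,1) b *(2)] V_ops(8)[OF v(2,1) *(2) b] by simp
  next
    case (snoc xs x)
    then show ?thesis
      using tensor_rels.balanced[of us v v' "xs @ [rsmult V x b]" V n c A] * V_ops(3)[of x x b b] b by simp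
  qed
qed simp_all

lemma cc_N_left:
  assumes f: "f \<in> N n" and g: "Poly_Mapping.keys g \<subseteq> W m"
  shows "cc f g \<in> N (n + m)"
  using g
proof (induction rule: frag_induction)
  case (one ws)
  show ?case
  proof (rule N_map[where G = "\<lambda>f. cc f (frag_of ws)", OF _ _ _ _ tensor_rels.zero tensor_rels.diff f])
    fix us v ws' v' assume *: "us @ v # ws' \<in> W n" "v' \<in> carrier V"
    then show "cc (frag_of (us @ (v \<oplus>\<^bsub>V\<^esub> v') # ws')) (frag_of ws) - cc (frag_of (us @ v # ws')) (frag_of ws)
        - cc (frag_of (us @ v' # ws')) (frag_of ws) \<in> N (n + m)"
      using tensor_rels.additive[of us v "ws' @ ws" V "n + m" v' A] one by (simp add: W_iff)
  next
    fix us v v' ws' c assume *: "us @ v # v' # ws' \<in> W n" "c \<in> kC"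
    then show "cc (frag_of (us @ rsmult V v c # v' # ws')) (frag_of ws)
        - cc (frag_of (us @ v # (c \<odot>\<^bsub>V\<^esub> v') # ws')) (frag_of ws) \<in> N (n + m)"
      using tensor_rels.balanced[of us v v' "ws' @ ws" V "n + m" c A] one by (simp add: W_iff)
  qed simp_all
qed (simp_all add: tensor_rels.zero tensor_rels.diff)

lemma cc_N_right:
  assumes f: "f \<in> N n" and g: "Poly_Mapping.keys g \<subseteq> W m"
  shows "cc g f \<in> N (m + n)"
  using g
proof (induction rule: frag_induction)
  case (one us')
  show ?case
  proof (rule N_map[where G = "\<lambda>f. cc (frag_of us') f", OF _ _ _ _ tensor_rels.zero tensor_rels.diff f])
    fix us v ws' v' assume *: "us @ v # ws' \<in> W n" "v' \<in> carrier V"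
    then show "cc (frag_of us') (frag_of (us @ (v \<oplus>\<^bsub>V\<^esub> v') # ws')) - cc (frag_of us') (frag_of (us @ v # ws'))
        - cc (frag_of us') (frag_of (us @ v' # ws')) \<in> N (m + n)"
      using tensor_rels.additive[of "us' @ us" v ws' V "m + n" v' A] one by (simp add: W_iff)
  next
    fix us v v' ws' c assume *: "us @ v # v' # ws' \<in> W n" "c \<in> kC"
    then show "cc (frag_of us') (frag_of (us @ rsmult V v c # v' # ws'))
        - cc (frag_of us') (frag_of (us @ v # (c \<odot>\<^bsub>V\<^esub> v') # ws')) \<in> N (m + n)"
      using tensor_rels.balanced[of "us' @ us" v v' ws' V "m + n" c A] one by (simp add: W_iff)
  qed simp_all
qed (simp_all add: tensor_rels.zero tensor_rels.diff)

lemma eqv_Lm: "b \<in> kC \<Longrightarrow> eqv n f g \<Longrightarrow> eqv n (Lm b f) (Lm b g)"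
  unfolding eqv_def using Lm_N[of b "f - g" n] by simp

lemma eqv_Rm: "b \<in> kC \<Longrightarrow> eqv n f g \<Longrightarrow> eqv n (Rm f b) (Rm g b)"
  unfolding eqv_def using Rm_N[of b "f - g" n] by simp

lemma eqv_cc:
  assumes "eqv n f f'" "eqv m g g'" "Poly_Mapping.keys f' \<subseteq> W n" "Poly_Mapping.keys g \<subseteq> W m"
  shows "eqv (n + m) (cc f g) (cc f' g')"
proof -
  have "eqv (n + m) (cc f g) (cc f' g)"
    using cc_N_left[of "f - f'" n g m] assms by (simp add: eqv_def)
  also have "eqv (n + m) (cc f' g) (cc f' g')"
    using cc_N_right[of "g - g'" m f' n] assms by (simp add: eqv_def)
  finally show ?thesis .
qed

text \<open>The operations on tensor powers are unions over representatives; for operations that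
  respect congruence the union is a single coset.\<close>

lemma UN_coset:
  assumes "\<And>g. eqv n g f \<Longrightarrow> h g = z"
  shows "(\<Union>g\<in>f +o N n. h g) = z"
proof -
  have "eqv n g f" if "g \<in> f +o N n" for g using that by (auto simp: elt_set_plus_def eqv_def)
  moreover have "f + 0 \<in> f +o N n" using tensor_rels.zero by (rule set_plus_intro2)
  ultimately show ?thesis using assms by fastforce
qed

lemma tensor_lact_coset: "b \<in> kC \<Longrightarrow> tensor_lact A V n b (f +o N n) = Lm b f +o N n"
  unfolding tensor_lact_def Lm_def[symmetric] by (rule UN_coset) (simp add: coset_eq_iff eqv_Lm)

lemma tensor_ract_coset: "b \<in> kC \<Longrightarrow> tensor_ract A V n (f +o N n) b = Rm f b +o N n"
  unfolding tensor_ract_def Rm_def[symmetric] by (rule UN_coset) (simp add: coset_eq_iff eqv_Rm)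

lemma eqv_keys: "eqv n f g \<Longrightarrow> Poly_Mapping.keys g \<subseteq> W n \<Longrightarrow> Poly_Mapping.keys f \<subseteq> W n"
  using N_keys[of "f - g" n] keys_add_subset[of "f - g" "W n" g] by (simp add: eqv_def)

lemma tensor_concat_coset:
  assumes "Poly_Mapping.keys f \<subseteq> W n" "Poly_Mapping.keys g \<subseteq> W m"
  shows "tensor_concat A V (n + m) (f +o N n) (g +o N m) = cc f g +o N (n + m)"
  unfolding tensor_concat_def cc_def[symmetric]
proof (rule UN_coset)
  fix f' assume f': "eqv n f' f"
  show "(\<Union>g'\<in>g +o N m. cc f' g' +o N (n + m)) = cc f g +o N (n + m)"
    by (rule UN_coset) (simp add: coset_eq_iff eqv_cc f' assms eqv_keys)
qed

end

section \<open>Words from factorisations into morphisms of degree one\<close>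

context graded_tensor
begin

text \<open>The empty list singles out no object whose identity it could denote;
  \<open>chain\<close> excludes it.\<close>

primrec compl :: "'n list \<Rightarrow> 'n" where
  "compl [] = undefined"
| "compl (w # ws) = (if ws = [] then w else comp D w (compl ws))"

primrec chain :: "'n list \<Rightarrow> bool" where
  "chain [] = False"
| "chain (w # ws) = (w \<in> M1 \<and> (ws \<noteq> [] \<longrightarrow> chain ws \<and> src D w = trg D (compl ws)))"

text \<open>Formal sums of words have integer coefficients, so a field element must be stored inside
  a letter; the first letter is the normal position.\<close>

definition wd :: "'k \<Rightarrow> 'n list \<Rightarrow> 'v list" where
  "wd k ws = vv (Poly_Mapping.single (hd ws) k) # map (\<lambda>w. vv (bD w)) (tl ws)"

lemma chainD:
  assumes "chain ws"
  shows "ws \<noteq> []" "set ws \<subseteq> M1" "compl ws \<in> mor D" "dg (compl ws) = length ws"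
    "trg D (compl ws) = trg D (hd ws)" "src D (compl ws) = src D (last ws)"
proof -
  have "ws \<noteq> [] \<and> set ws \<subseteq> M1 \<and> compl ws \<in> mor D \<and> dg (compl ws) = length ws \<and>
    trg D (compl ws) = trg D (hd ws) \<and> src D (compl ws) = src D (last ws)"
    using assms
  proof (induction ws)
    case (Cons w ws)
    then show ?case by (cases "ws = []") simp_all
  qed simp
  then show "ws \<noteq> []" "set ws \<subseteq> M1" "compl ws \<in> mor D" "dg (compl ws) = length ws"
    "trg D (compl ws) = trg D (hd ws)" "src D (compl ws) = src D (last ws)" by blast+
qed

lemma chain_append:
  assumes "chain us" "chain ws" "src D (compl us) = trg D (compl ws)"
  shows "chain (us @ ws) \<and> compl (us @ ws) = comp D (compl us) (compl ws)"
  using assms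
proof (induction us)
  case (Cons u us)
  note w = chainD[OF Cons(3)]
  show ?case
  proof (cases "us = []")
    case True
    then show ?thesis using Cons w by simp
  next
    case False
    then have us: "chain us" "u \<in> M1" "src D u = trg D (compl us)" using Cons by auto
    note v = chainD[OF us(1)]
    have s: "src D (compl us) = trg D (compl ws)" using Cons(4) False us v by simp
    show ?thesis using Cons.IH[OF us(1) Cons(3) s] us v w s False by (simp add: D.comp_assoc)
  qed
qed simp

lemma M1_single [simp]: "w \<in> M1 \<Longrightarrow> Poly_Mapping.keys (Poly_Mapping.single w k) \<subseteq> M1"
  by simp

lemma vv_single_closed: "w \<in> M1 \<Longrightarrow> vv (Poly_Mapping.single w k) \<in> carrier V"
  by (rule vv_closed) simp

lemma vv_zero_closed [simp]: "vv 0 \<in> carrier V"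
  by (rule vv_closed) simp

lemma wd_W: "ws \<noteq> [] \<Longrightarrow> set ws \<subseteq> M1 \<Longrightarrow> wd k ws \<in> W (length ws)"
  by (cases ws) (auto simp: wd_def W_iff intro!: vv_single_closed)

lemma vv_single_right:
  assumes "w \<in> M1" "c \<in> mor C"
  shows "rsmult V (vv (Poly_Mapping.single w k)) (Poly_Mapping.single c l) =
    (if src D w = trg C c then vv (Poly_Mapping.single (comp D w (iota c)) (k * l)) else vv 0)"
proof -
  have "Poly_Mapping.keys (Poly_Mapping.single c l) \<subseteq> mor C" using assms by simp
  from vv_right[OF M1_single[OF assms(1)] this, of k] show ?thesis
    using assms(2) by (cases "src D w = trg C c") (simp_all add: cmul_single)
qed

lemma vv_single_left:
  assumes "w \<in> M1" "c \<in> mor C"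
  shows "Poly_Mapping.single c l \<odot>\<^bsub>V\<^esub> vv (Poly_Mapping.single w k) =
    (if src C c = trg D w then vv (Poly_Mapping.single (comp D (iota c) w) (l * k)) else vv 0)"
proof -
  have "Poly_Mapping.keys (Poly_Mapping.single c l) \<subseteq> mor C" using assms by simp
  from vv_left[OF M1_single[OF assms(1)] this, of k] show ?thesis
    using assms(2) by (cases "src C c = trg D w") (simp_all add: cmul_single)
qed

lemma vv_scal:
  assumes "w \<in> M1"
  shows "rsmult V (vv (Poly_Mapping.single w k)) (scal l (cone C)) = vv (Poly_Mapping.single w (k * l))"
    "scal l (cone C) \<odot>\<^bsub>V\<^esub> vv (Poly_Mapping.single w k) = vv (Poly_Mapping.single w (l * k))"
proof -
  have k: "Poly_Mapping.keys (scal l (cone C :: 'm \<Rightarrow>\<^sub>0 'k)) \<subseteq> mor C"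
    by (rule order_trans[OF keys_scal cone_closed])
  have w: "Poly_Mapping.keys (Poly_Mapping.single w k) \<subseteq> mor D" using assms by simp
  have e: "emb (scal l (cone C)) = scal l (cone D)" by (simp add: emb_scal emb_cone)
  show "rsmult V (vv (Poly_Mapping.single w k)) (scal l (cone C)) = vv (Poly_Mapping.single w (k * l))"
    using vv_right[OF M1_single[OF assms] k, of k] w
    by (simp add: e cmul_scal_right D.cmul_cone_right mult.commute)
  show "scal l (cone C) \<odot>\<^bsub>V\<^esub> vv (Poly_Mapping.single w k) = vv (Poly_Mapping.single w (l * k))"
    using vv_left[OF M1_single[OF assms] k, of k] w
    by (simp add: e cmul_scal_left D.cmul_cone_left)
qed

text \<open>Additivity applied to \<open>vv 0 + vv 0 = vv 0\<close> makes the word congruent to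
  twice itself.\<close>

lemma eqv_vv_zero:
  assumes "us @ vv 0 # ws \<in> W n"
  shows "eqv n (frag_of (us @ vv 0 # ws)) 0"
proof -
  have "vv 0 \<oplus>\<^bsub>V\<^esub> vv 0 = vv 0" using vv_add[of 0 0] by simp
  then have "eqv n (frag_of (us @ vv 0 # ws)) (frag_of (us @ vv 0 # ws) + frag_of (us @ vv 0 # ws))"
    using eqv_additive[OF assms vv_zero_closed] by simp
  from eqv_diff[OF this eqv_refl[of n "frag_of (us @ vv 0 # ws)"]] show ?thesis
    using eqv_sym by simp
qed

lemma eqv_Cons:
  assumes "z \<in> carrier V" "eqv n (frag_of zs) (frag_of zs')"
  shows "eqv (Suc n) (frag_of (z # zs)) (frag_of (z # zs'))"
proof -
  have "Poly_Mapping.keys (frag_of [z]) \<subseteq> W 1" using assms(1) by (simp add: keys_frag_of)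
  from cc_N_right[OF assms(2)[unfolded eqv_def] this] show ?thesis by (simp add: eqv_def)
qed

text \<open>A scalar is a multiple of the unit of \<open>A\<close>, so balancing moves it across
  each tensor sign until all scalars are collected in the first letter.\<close>

lemma eqv_scal:
  assumes "ps \<noteq> []" "fst ` set ps \<subseteq> M1"
  shows "eqv (length ps) (frag_of (map (\<lambda>(w, k). vv (Poly_Mapping.single w k)) ps))
      (frag_of (wd (prod_list (map snd ps)) (map fst ps)))"
  using assms
proof (induction ps)
  case (Cons p ps)
  obtain w k where p: "p = (w, k)" by (cases p)
  have w: "w \<in> M1" using Cons p by simp
  show ?case
  proof (cases "ps = []")
    case True
    then show ?thesis by (simp add: p wd_def)
  next
    case False
    define K where "K = prod_list (map snd ps)"
    obtain w1 k1 ps' where ps: "ps = (w1, k1) # ps'" using False by (metis list.exhaust surj_pair)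
    have M: "fst ` set ps \<subseteq> M1" using Cons by simp
    then have w1: "w1 \<in> M1" "fst ` set ps' \<subseteq> M1" using ps by auto
    let ?r = "map (\<lambda>w. vv (bD w)) (map fst ps')"
    have rc: "set ?r \<subseteq> carrier V" using w1(2) by (auto intro!: vv_single_closed)
    have "eqv (Suc (length ps)) (frag_of (vv (Poly_Mapping.single w k) # map (\<lambda>(w, k). vv (Poly_Mapping.single w k)) ps))
      (frag_of (vv (Poly_Mapping.single w k) # wd K (map fst ps)))"
      unfolding K_def by (rule eqv_Cons[OF vv_single_closed[OF w] Cons.IH[OF False M]])
    also have "wd K (map fst ps) = (scal K (cone C) \<odot>\<^bsub>V\<^esub> vv (bD w1)) # ?r"
      using vv_scal(2)[OF w1(1), of K 1] by (simp add: wd_def ps)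
    also have "eqv (Suc (length ps)) (frag_of (vv (Poly_Mapping.single w k) # (scal K (cone C) \<odot>\<^bsub>V\<^esub> vv (bD w1)) # ?r))
      (frag_of (rsmult V (vv (Poly_Mapping.single w k)) (scal K (cone C)) # vv (bD w1) # ?r))"
    proof (rule eqv_sym, rule eqv_balanced[of "[]", simplified])
      show "Poly_Mapping.keys (scal K (cone C)) \<subseteq> mor C" by (rule order_trans[OF keys_scal cone_closed])
    qed (use rc w w1 ps vv_single_closed in auto)
    also have "rsmult V (vv (Poly_Mapping.single w k)) (scal K (cone C)) # vv (bD w1) # ?r =
      wd (k * K) (map fst (p # ps))"
      using vv_scal(1)[OF w] by (simp add: wd_def p ps)
    finally show ?thesis by (simp add: p K_def)
  qed
qed simp

lemma wd_Cons: "ws \<noteq> [] \<Longrightarrow> wd k (w # ws) = vv (Poly_Mapping.single w k) # wd 1 ws"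
  by (cases ws) (simp_all add: wd_def)

text \<open>The factor \<open>c\<close> at the end of the first letter passes across the first
  tensor sign to the second letter. The remaining letters then have the composite of
  \<open>us\<close>, so the shorter case compares them with \<open>us\<close>.\<close>

lemma eqv_wd_step:
  assumes ch: "chain (w1 # ws)" "chain (u1 # us)" and ne: "ws \<noteq> []" "us \<noteq> []" "length ws = length us"
    and c: "c \<in> mor C" "src C c = trg D (compl ws)" "trg C c = src D u1"
    and eq: "w1 = comp D u1 (iota c)" "compl us = comp D (iota c) (compl ws)"
    and IH: "\<And>ws' us'. chain ws' \<Longrightarrow> chain us' \<Longrightarrow> length ws' = length us' \<Longrightarrow> length ws' = length ws \<Longrightarrow>
       compl ws' = compl us' \<Longrightarrow> eqv (length ws) (frag_of (wd 1 ws')) (frag_of (wd 1 us'))"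
  shows "eqv (Suc (length ws)) (frag_of (wd k (w1 # ws))) (frag_of (wd k (u1 # us)))"
proof -
  have cw: "chain ws" and cu: "chain us" and w1: "w1 \<in> M1" and u1: "u1 \<in> M1" using ch ne by auto
  note w = chainD[OF cw]
  obtain v vs where ws: "ws = v # vs" using ne by (cases ws) auto
  have v: "v \<in> M1" "set vs \<subseteq> M1" using w(2) ws by auto
  have cv: "src C c = trg D v" using c(2) w(5) ws by simp
  let ?v = "comp D (iota c) v"
  have v': "?v \<in> M1" using c v cv by auto
  have "chain (?v # vs) \<and> compl (?v # vs) = comp D (iota c) (compl ws)"
  proof (cases "vs = []")
    case True
    then show ?thesis using ws v' by simp
  next
    case False
    then have "chain vs" "src D v = trg D (compl vs)" using cw ws by auto
    then show ?thesis using chainD[of vs] v v' c cv False ws by (simp add: D.comp_assoc)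
  qed
  then have "eqv (length ws) (frag_of (wd 1 us)) (frag_of (wd 1 (?v # vs)))"
    using IH[of us "?v # vs"] cu eq(2) ne ws by simp
  then have "eqv (Suc (length ws)) (frag_of (vv (Poly_Mapping.single u1 k) # wd 1 us))
      (frag_of (vv (Poly_Mapping.single u1 k) # wd 1 (?v # vs)))"
    by (rule eqv_Cons[OF vv_single_closed[OF u1]])
  also have "wd 1 (?v # vs) = (Poly_Mapping.single c 1 \<odot>\<^bsub>V\<^esub> vv (bD v)) # map (\<lambda>w. vv (bD w)) vs"
    using vv_single_left[OF v(1) c(1), of 1 1] cv by (simp add: wd_def)
  also have "eqv (Suc (length ws)) (frag_of (vv (Poly_Mapping.single u1 k) # (Poly_Mapping.single c 1 \<odot>\<^bsub>V\<^esub> vv (bD v)) # map (\<lambda>w. vv (bD w)) vs))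
     (frag_of (rsmult V (vv (Poly_Mapping.single u1 k)) (Poly_Mapping.single c 1) # vv (bD v) # map (\<lambda>w. vv (bD w)) vs))"
    by (rule eqv_sym, rule eqv_balanced[of "[]", simplified]) (use v u1 ws c vv_single_closed in auto)
  also have "rsmult V (vv (Poly_Mapping.single u1 k)) (Poly_Mapping.single c 1) # vv (bD v) # map (\<lambda>w. vv (bD w)) vs = wd k (w1 # ws)"
    using vv_single_right[OF u1 c(1), of k 1] c(3) eq(1) by (simp add: wd_def ws)
  finally show ?thesis using wd_Cons[OF ne(2)] eqv_sym by simp
qed

text \<open>Independence of the factorisation. The two first letters have the same degree, so
  \<open>dg_levi\<close> compares them by a morphism of degree zero, which lies in \<open>C\<close>
  and may cross the tensor sign. Either first letter may be the longer one, hence the two symmetric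
  cases.\<close>

lemma eqv_wd:
  assumes "chain ws" "chain us" "length ws = length us" "compl ws = compl us"
  shows "eqv (length ws) (frag_of (wd k ws)) (frag_of (wd k us))"
  using assms
proof (induction "length ws" arbitrary: ws us k rule: less_induct)
  case less
  obtain w1 ws' where ws: "ws = w1 # ws'" using less.prems by (cases ws) auto
  obtain u1 us' where us: "us = u1 # us'" using less.prems by (cases us) auto
  show ?case
  proof (cases "ws' = []")
    case True
    then show ?thesis using less.prems ws us by simp
  next
    case False
    then have ne: "ws' \<noteq> []" "us' \<noteq> []" "length ws' = length us'" using less.prems ws us by auto
    have cw: "chain ws'" "w1 \<in> M1" "src D w1 = trg D (compl ws')" using less.prems(1) ws ne by auto
    have cu: "chain us'" "u1 \<in> M1" "src D u1 = trg D (compl us')" using less.prems(2) us ne by auto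
    note w = chainD[OF cw(1)] and u = chainD[OF cu(1)]
    have e: "comp D w1 (compl ws') = comp D u1 (compl us')" using less.prems(4) ws us ne by simp
    have "dg w1 = dg u1" using cw(2) cu(2) by simp
    from dg_levi[OF _ w(3) _ u(3) cw(3) cu(3) e this] cw(2) cu(2) obtain r where r: "r \<in> mor D"
      "(src D r = trg D (compl ws') \<and> trg D r = src D u1 \<and> w1 = comp D u1 r \<and> compl us' = comp D r (compl ws')) \<or>
       (src D r = trg D (compl us') \<and> trg D r = src D w1 \<and> u1 = comp D w1 r \<and> compl ws' = comp D r (compl us'))"
      by auto
    \<comment> \<open>Both first letters have degree one, and \<open>r\<close> accounts for the
      difference of their degrees.\<close>
    have "dg r = 0"
      using r(2)
    proof
      assume *: "src D r = trg D (compl ws') \<and> trg D r = src D u1 \<and> w1 = comp D u1 r \<and> compl us' = comp D r (compl ws')"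
      have "dg (comp D u1 r) = dg u1 + dg r" using * cu(2) r(1) by (intro dg_comp) auto
      then show ?thesis using * cw(2) cu(2) by simp
    next
      assume *: "src D r = trg D (compl us') \<and> trg D r = src D w1 \<and> u1 = comp D w1 r \<and> compl ws' = comp D r (compl us')"
      have "dg (comp D w1 r) = dg w1 + dg r" using * cw(2) r(1) by (intro dg_comp) auto
      then show ?thesis using * cw(2) cu(2) by simp
    qed
    then obtain c where c: "c \<in> mor C" "r = iota c" using iota_surj[OF r(1)] by blast
    have IH: "eqv (length ws') (frag_of (wd 1 xs)) (frag_of (wd 1 ys))"
      if "chain xs" "chain ys" "length xs = length ys" "length xs = length ws'" "compl xs = compl ys" for xs ys
      using less.hyps[of xs ys 1] that ws by simp
    show ?thesis using r(2)
    proof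
      assume *: "src D r = trg D (compl ws') \<and> trg D r = src D u1 \<and> w1 = comp D u1 r \<and> compl us' = comp D r (compl ws')"
      have "eqv (Suc (length ws')) (frag_of (wd k (w1 # ws'))) (frag_of (wd k (u1 # us')))"
        by (rule eqv_wd_step[where c = c]) (use * c ne less.prems ws us IH in auto)
      then show ?thesis by (simp add: ws us)
    next
      assume *: "src D r = trg D (compl us') \<and> trg D r = src D w1 \<and> u1 = comp D w1 r \<and> compl ws' = comp D r (compl us')"
      have "eqv (Suc (length us')) (frag_of (wd k (u1 # us'))) (frag_of (wd k (w1 # ws')))"
        by (rule eqv_wd_step[where c = c]) (use * c ne less.prems ws us IH in auto)
      then show ?thesis using ne by (simp add: ws us eqv_sym)
    qed
  qed
qed

definition fc :: "'n \<Rightarrow> 'n list" where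
  "fc w = (SOME ws. chain ws \<and> compl ws = w)"

lemma chain_ex: "w \<in> mor D \<Longrightarrow> dg w = Suc n \<Longrightarrow> \<exists>ws. chain ws \<and> compl ws = w"
proof (induction n arbitrary: w)
  case 0
  then have "chain [w] \<and> compl [w] = w" by simp
  then show ?case by blast
next
  case (Suc n)
  obtain u v where uv: "u \<in> mor D" "v \<in> mor D" "dg u = 1" "src D u = trg D v" "w = comp D u v"
    using dg_factor[OF Suc(2,3)] by blast
  have "dg v = Suc n" using uv Suc by simp
  then obtain ws where ws: "chain ws" "compl ws = v" using Suc.IH[OF uv(2)] by blast
  then have "chain (u # ws) \<and> compl (u # ws) = w" using uv chainD(1)[OF ws(1)] by simp
  then show ?case by blast
qed

lemma fc:
  assumes "w \<in> mor D" "dg w = n" "1 \<le> n"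
  shows "chain (fc w)" "compl (fc w) = w" "length (fc w) = n"
proof -
  have "\<exists>ws. chain ws \<and> compl ws = w" using chain_ex[OF assms(1), of "n - 1"] assms by simp
  from someI_ex[OF this, folded fc_def] show *: "chain (fc w)" "compl (fc w) = w" by auto
  show "length (fc w) = n" using chainD(4)[OF *(1)] * assms by simp
qed

definition tau :: "'k \<Rightarrow> 'n \<Rightarrow> ('v list \<Rightarrow>\<^sub>0 int)" where
  "tau k w = frag_of (wd k (fc w))"

lemma tau_keys: "w \<in> mor D \<Longrightarrow> dg w = n \<Longrightarrow> 1 \<le> n \<Longrightarrow> Poly_Mapping.keys (tau k w) \<subseteq> W n"
  unfolding tau_def using fc[of w n] wd_W[of "fc w" k] chainD(1,2)[of "fc w"] by (simp add: keys_frag_of)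

lemma tau_eq: "chain ws \<Longrightarrow> eqv (length ws) (frag_of (wd k ws)) (tau k (compl ws))"
  unfolding tau_def using chainD[of ws] fc[of "compl ws" "length ws"]
  by (intro eqv_wd) (auto simp: Suc_le_eq)

lemma tau_add:
  assumes "w \<in> mor D" "dg w = n" "1 \<le> n"
  shows "eqv n (tau (k + l) w) (tau k w + tau l w)"
proof -
  note f = fc[OF assms]
  note c = chainD[OF f(1)]
  obtain v vs where vs: "fc w = v # vs" using c(1) by (cases "fc w") auto
  have v: "v \<in> M1" using c(2) vs by simp
  have "vv (Poly_Mapping.single v (k + l)) = vv (Poly_Mapping.single v k) \<oplus>\<^bsub>V\<^esub> vv (Poly_Mapping.single v l)"
    using vv_add[OF M1_single[OF v] M1_single[OF v], of k l] by (simp add: single_add)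
  then show ?thesis
    using eqv_additive[of "[]" "vv (Poly_Mapping.single v k)" "map (\<lambda>w. vv (bD w)) vs" n "vv (Poly_Mapping.single v l)"]
      wd_W[OF c(1,2), of k] f(3) vv_single_closed[OF v]
    by (simp add: tau_def wd_def vs W_iff)
qed

lemma tau_zero:
  assumes "w \<in> mor D" "dg w = n" "1 \<le> n"
  shows "eqv n (tau 0 w) 0"
  using eqv_diff[OF tau_add[OF assms, of 0 0] eqv_refl[of n "tau 0 w"]] eqv_sym by simp

text \<open>A representative of the component in degree \<open>n\<close>. It is additive only modulo
  the relations, because \<open>tau\<close> carries its scalar inside a letter.\<close>

definition gam :: "nat \<Rightarrow> ('n \<Rightarrow>\<^sub>0 'k) \<Rightarrow> ('v list \<Rightarrow>\<^sub>0 int)" where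
  "gam n u = (\<Sum>w\<in>{w \<in> Poly_Mapping.keys u. dg w = n}. tau (Poly_Mapping.lookup u w) w)"

lemma gam_zero [simp]: "gam n 0 = 0"
  by (simp add: gam_def)

lemma gam_superset:
  assumes "finite S" "Poly_Mapping.keys u \<subseteq> S" "S \<subseteq> mor D" "1 \<le> n"
  shows "eqv n (gam n u) (\<Sum>w\<in>{w \<in> S. dg w = n}. tau (Poly_Mapping.lookup u w) w)"
proof -
  let ?K = "{w \<in> Poly_Mapping.keys u. dg w = n}" and ?S = "{w \<in> S. dg w = n}"
  have "(\<Sum>w\<in>?S. tau (Poly_Mapping.lookup u w) w) = (\<Sum>w\<in>?S - ?K. tau (Poly_Mapping.lookup u w) w) + gam n u"
    unfolding gam_def using assms by (intro sum.subset_diff) auto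
  moreover have "eqv n (\<Sum>w\<in>?S - ?K. tau (Poly_Mapping.lookup u w) w) (\<Sum>w\<in>?S - ?K. 0)"
  proof (rule eqv_sum)
    fix w assume "w \<in> ?S - ?K"
    then have "w \<in> mor D" "dg w = n" "Poly_Mapping.lookup u w = 0" using assms by (auto simp: in_keys_iff)
    then show "eqv n (tau (Poly_Mapping.lookup u w) w) 0" using tau_zero assms(4) by simp
  qed
  ultimately show ?thesis
    using eqv_add[OF _ eqv_refl[of n "gam n u"], of "\<Sum>w\<in>?S - ?K. tau (Poly_Mapping.lookup u w) w" 0] eqv_sym by simp
qed

lemma gam_add:
  assumes "Poly_Mapping.keys u \<subseteq> mor D" "Poly_Mapping.keys v \<subseteq> mor D" "1 \<le> n"
  shows "eqv n (gam n (u + v)) (gam n u + gam n v)"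
proof -
  let ?S = "Poly_Mapping.keys u \<union> Poly_Mapping.keys v"
  have S: "finite ?S" "?S \<subseteq> mor D" using assms by auto
  have "eqv n (gam n (u + v)) (\<Sum>w\<in>{w \<in> ?S. dg w = n}. tau (Poly_Mapping.lookup (u + v) w) w)"
    by (rule gam_superset[OF S(1) keys_add S(2) assms(3)])
  also have "eqv n \<dots> (\<Sum>w\<in>{w \<in> ?S. dg w = n}. tau (Poly_Mapping.lookup u w) w + tau (Poly_Mapping.lookup v w) w)"
    unfolding lookup_add using S(2) assms(3) by (intro eqv_sum tau_add) auto
  also have "eqv n \<dots> (gam n u + gam n v)"
    unfolding sum.distrib
    by (intro eqv_add eqv_sym[OF gam_superset]) (use S assms(3) in auto)
  finally show ?thesis .
qed

lemma gam_sum: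
  assumes "\<And>i. i \<in> S \<Longrightarrow> Poly_Mapping.keys (u i) \<subseteq> mor D" "1 \<le> n"
  shows "eqv n (gam n (\<Sum>i\<in>S. u i)) (\<Sum>i\<in>S. gam n (u i))"
  using assms(1)
proof (induction S rule: infinite_finite_induct)
  case (insert x S)
  have "eqv n (gam n (u x + (\<Sum>i\<in>S. u i))) (gam n (u x) + gam n (\<Sum>i\<in>S. u i))"
    using insert by (intro gam_add keys_sum_subset assms(2)) auto
  also have "eqv n \<dots> (gam n (u x) + (\<Sum>i\<in>S. gam n (u i)))"
    using insert by (intro eqv_add) auto
  finally show ?case using insert by simp
qed auto

lemma gam_diff:
  assumes "Poly_Mapping.keys u \<subseteq> mor D" "Poly_Mapping.keys v \<subseteq> mor D" "1 \<le> n"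
  shows "eqv n (gam n (u - v)) (gam n u - gam n v)"
proof -
  have "Poly_Mapping.keys (u - v) \<subseteq> mor D" using keys_diff[of u v] assms by blast
  from eqv_sym[OF eqv_diff[OF gam_add[OF this assms(2,3)] eqv_refl[of n "gam n v"]]] show ?thesis by simp
qed

lemma gam_single_ne: "dg w \<noteq> n \<Longrightarrow> gam n (Poly_Mapping.single w k) = 0"
  unfolding gam_def by (rule sum.neutral) (auto split: if_splits)

lemma gam_single: "w \<in> mor D \<Longrightarrow> dg w = n \<Longrightarrow> 1 \<le> n \<Longrightarrow> eqv n (gam n (Poly_Mapping.single w k)) (tau k w)"
  using gam_superset[of "{w}" "Poly_Mapping.single w k" n] by (simp add: Collect_conv_if)

lemma gam_deg: "Poly_Mapping.keys u \<subseteq> {w \<in> mor D. dg w = m} \<Longrightarrow> m \<noteq> n \<Longrightarrow> gam n u = 0"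
  unfolding gam_def by (rule sum.neutral) auto

lemma gam_keys: "Poly_Mapping.keys u \<subseteq> mor D \<Longrightarrow> 1 \<le> n \<Longrightarrow> Poly_Mapping.keys (gam n u) \<subseteq> W n"
  unfolding gam_def by (intro keys_sum_subset tau_keys) auto

definition p0 :: "('n \<Rightarrow>\<^sub>0 'k) \<Rightarrow> ('m \<Rightarrow>\<^sub>0 'k)" where
  "p0 u = lext (\<lambda>w. if dg w = 0 then Poly_Mapping.single (the_inv_into (mor C) iota w) 1 else 0) u"

lemma p0_iota: "c \<in> mor C \<Longrightarrow> p0 (Poly_Mapping.single (iota c) k) = Poly_Mapping.single c k"
  by (simp add: p0_def the_inv_into_f_f[OF iota_inj])

lemma p0_single_ne: "dg w \<noteq> 0 \<Longrightarrow> p0 (Poly_Mapping.single w k) = 0"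
  by (simp add: p0_def)

lemma p0_add: "p0 (u + v) = p0 u + p0 v"
  by (simp add: p0_def lext_add)

lemma p0_zero [simp]: "p0 0 = 0"
  by (simp add: p0_def)

lemma p0_scal: "p0 (scal k u) = scal k (p0 u)"
  by (simp add: p0_def lext_scal)

lemma p0_sum: "p0 (\<Sum>i\<in>S. u i) = (\<Sum>i\<in>S. p0 (u i))"
  by (induction S rule: infinite_finite_induct) (auto simp: p0_add)

lemma p0_deg: "Poly_Mapping.keys u \<subseteq> {w \<in> mor D. dg w = m} \<Longrightarrow> m \<noteq> 0 \<Longrightarrow> p0 u = 0"
  unfolding p0_def lext_def by (rule sum.neutral) auto

lemma p0_closed:
  assumes "Poly_Mapping.keys u \<subseteq> mor D"
  shows "Poly_Mapping.keys (p0 u) \<subseteq> mor C"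
  using assms
proof (induction rule: pm_induct)
  case (single w k)
  show ?case
  proof (cases "dg w = 0")
    case True
    then obtain c where "c \<in> mor C" "w = iota c" using iota_surj[OF single] by blast
    then show ?thesis by (simp add: p0_iota)
  qed (simp add: p0_single_ne)
qed (simp_all add: p0_add keys_add_subset)

lemma p0_emb: "Poly_Mapping.keys b \<subseteq> mor C \<Longrightarrow> p0 (emb b) = b"
  by (induction rule: pm_induct) (simp_all add: p0_iota p0_add emb_add)

lemma p0_cmul:
  assumes "Poly_Mapping.keys u \<subseteq> mor D" "Poly_Mapping.keys u' \<subseteq> mor D"
  shows "p0 (cmul D u u') = cmul C (p0 u) (p0 u')"
  using assms(1)
proof (induction rule: pm_induct)
  case (single w k)
  note w = this
  show ?case using assms(2)
  proof (induction rule: pm_induct)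
    case (single w' l)
    show ?case
    proof (cases "dg w = 0 \<and> dg w' = 0")
      case True
      then obtain c c' where "c \<in> mor C" "w = iota c" "c' \<in> mor C" "w' = iota c'"
        using iota_surj[OF single] iota_surj[OF w] by blast
      then show ?thesis by (auto simp: cmul_single p0_iota iota_comp[symmetric])
    next
      case False
      have "p0 (if src D w = trg D w' then Poly_Mapping.single (comp D w w') (k * l) else 0) = 0"
      proof (cases "src D w = trg D w'")
        case True
        then have "dg (comp D w w') \<noteq> 0" using False w single by auto
        then show ?thesis using True by (simp add: p0_single_ne)
      qed simp
      moreover have "cmul C (p0 (Poly_Mapping.single w k)) (p0 (Poly_Mapping.single w' l)) = 0"
        using False p0_single_ne by auto
      ultimately show ?thesis by (simp add: cmul_single)
    qed
  qed (simp_all add: cmul_add_right p0_add)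
qed (simp_all add: cmul_add_left p0_add)

section \<open>Products of words and the product of the tensor algebra\<close>

lemma Lm_add_scalar:
  assumes f: "Poly_Mapping.keys f \<subseteq> W n" and n: "1 \<le> n" and ab: "a \<in> kC" "b \<in> kC"
  shows "eqv n (Lm (a + b) f) (Lm a f + Lm b f)"
  using f
proof (induction rule: frag_induction)
  case (one ws)
  obtain z zs where ws: "ws = z # zs" using one n by (cases ws) (auto simp: W_iff)
  have z: "z \<in> carrier V" using one ws by simp
  show ?case
    using eqv_additive[of "[]" "a \<odot>\<^bsub>V\<^esub> z" zs n "b \<odot>\<^bsub>V\<^esub> z"] V_ops(2,6)[OF z z ab] V_ops(2)[OF z z ab(2,1)] one
    by (simp add: ws)
next
  case (diff f g)
  then show ?case using eqv_diff[OF diff] by (simp add: algebra_simps)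
qed simp

lemma Rm_add_scalar:
  assumes f: "Poly_Mapping.keys f \<subseteq> W n" and n: "1 \<le> n" and ab: "a \<in> kC" "b \<in> kC"
  shows "eqv n (Rm f (a + b)) (Rm f a + Rm f b)"
  using f
proof (induction rule: frag_induction)
  case (one ws)
  obtain z zs where ws: "ws = zs @ [z]" using one n by (cases ws rule: rev_cases) (auto simp: W_iff)
  have z: "z \<in> carrier V" using one ws by simp
  show ?case
    using eqv_additive[of zs "rsmult V z a" "[]" n "rsmult V z b"] V_ops(3,7)[OF z z ab] V_ops(3)[OF z z ab(2,1)] one
    by (simp add: ws)
next
  case (diff f g)
  then show ?case using eqv_diff[OF diff] by (simp add: algebra_simps)
qed simp

lemma Lm_zero:
  assumes "Poly_Mapping.keys f \<subseteq> W n" "1 \<le> n"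
  shows "eqv n (Lm 0 f) 0"
  using eqv_sym[OF eqv_diff[OF Lm_add_scalar[OF assms, of 0 0] eqv_refl[of n "Lm 0 f"]]] by simp

lemma Rm_zero:
  assumes "Poly_Mapping.keys f \<subseteq> W n" "1 \<le> n"
  shows "eqv n (Rm f 0) 0"
  using eqv_sym[OF eqv_diff[OF Rm_add_scalar[OF assms, of 0 0] eqv_refl[of n "Rm f 0"]]] by simp

text \<open>A representative of the degree \<open>n\<close> component of the product in
  \<open>tensor_algebra\<close>, where degree zero acts through the bimodule structure and positive
  degrees are concatenated.\<close>

definition mm :: "nat \<Rightarrow> ('n \<Rightarrow>\<^sub>0 'k) \<Rightarrow> ('n \<Rightarrow>\<^sub>0 'k) \<Rightarrow> ('v list \<Rightarrow>\<^sub>0 int)" where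
  "mm n u u' = Lm (p0 u) (gam n u') + Rm (gam n u) (p0 u') + (\<Sum>i\<in>{1..<n}. cc (gam i u) (gam (n - i) u'))"

lemma eqv_cc':
  assumes "i \<in> {1..<n}" "eqv i f f'" "eqv (n - i) g g'" "Poly_Mapping.keys f' \<subseteq> W i" "Poly_Mapping.keys g \<subseteq> W (n - i)"
  shows "eqv n (cc f g) (cc f' g')"
  using eqv_cc[OF assms(2-5)] assms(1) by simp

lemma mm_add_left:
  assumes u: "Poly_Mapping.keys u \<subseteq> mor D" "Poly_Mapping.keys v \<subseteq> mor D" and u': "Poly_Mapping.keys u' \<subseteq> mor D" and n: "1 \<le> n"
  shows "eqv n (mm n (u + v) u') (mm n u u' + mm n v u')"
proof -
  have 1: "eqv n (Lm (p0 (u + v)) (gam n u')) (Lm (p0 u) (gam n u') + Lm (p0 v) (gam n u'))"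
    unfolding p0_add using p0_closed u gam_keys[OF u' n] n by (intro Lm_add_scalar) auto
  have 2: "eqv n (Rm (gam n (u + v)) (p0 u')) (Rm (gam n u) (p0 u') + Rm (gam n v) (p0 u'))"
    using eqv_Rm[OF _ gam_add[OF u n], of "p0 u'"] p0_closed[OF u'] by simp
  have 3: "eqv n (\<Sum>i\<in>{1..<n}. cc (gam i (u + v)) (gam (n - i) u'))
      (\<Sum>i\<in>{1..<n}. cc (gam i u) (gam (n - i) u') + cc (gam i v) (gam (n - i) u'))"
  proof (rule eqv_sum)
    fix i assume i: "i \<in> {1..<n}"
    have "eqv n (cc (gam i (u + v)) (gam (n - i) u')) (cc (gam i u + gam i v) (gam (n - i) u'))"
      using i u u' by (intro eqv_cc'[OF i] gam_add eqv_refl keys_add_subset gam_keys) auto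
    then show "eqv n (cc (gam i (u + v)) (gam (n - i) u')) (cc (gam i u) (gam (n - i) u') + cc (gam i v) (gam (n - i) u'))"
      by simp
  qed
  show ?thesis using eqv_add[OF eqv_add[OF 1 2] 3] by (simp add: mm_def sum.distrib algebra_simps)
qed

lemma mm_add_right:
  assumes u: "Poly_Mapping.keys u \<subseteq> mor D" "Poly_Mapping.keys v \<subseteq> mor D" and u': "Poly_Mapping.keys u' \<subseteq> mor D" and n: "1 \<le> n"
  shows "eqv n (mm n u' (u + v)) (mm n u' u + mm n u' v)"
proof -
  have 1: "eqv n (Rm (gam n u') (p0 (u + v))) (Rm (gam n u') (p0 u) + Rm (gam n u') (p0 v))"
    unfolding p0_add using p0_closed u gam_keys[OF u' n] n by (intro Rm_add_scalar) auto
  have 2: "eqv n (Lm (p0 u') (gam n (u + v))) (Lm (p0 u') (gam n u) + Lm (p0 u') (gam n v))"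
    using eqv_Lm[OF _ gam_add[OF u n], of "p0 u'"] p0_closed[OF u'] by simp
  have 3: "eqv n (\<Sum>i\<in>{1..<n}. cc (gam i u') (gam (n - i) (u + v)))
      (\<Sum>i\<in>{1..<n}. cc (gam i u') (gam (n - i) u) + cc (gam i u') (gam (n - i) v))"
  proof (rule eqv_sum)
    fix i assume i: "i \<in> {1..<n}"
    have "eqv n (cc (gam i u') (gam (n - i) (u + v))) (cc (gam i u') (gam (n - i) u + gam (n - i) v))"
      using i u u' by (intro eqv_cc'[OF i] gam_add eqv_refl keys_add_subset gam_keys) auto
    then show "eqv n (cc (gam i u') (gam (n - i) (u + v))) (cc (gam i u') (gam (n - i) u) + cc (gam i u') (gam (n - i) v))"
      by simp
  qed
  show ?thesis using eqv_add[OF eqv_add[OF 2 1] 3] by (simp add: mm_def sum.distrib algebra_simps)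
qed

lemma mm_zero:
  assumes "Poly_Mapping.keys u \<subseteq> mor D" "1 \<le> n"
  shows "eqv n (mm n 0 u) 0" "eqv n (mm n u 0) 0"
  using Lm_zero[OF gam_keys[OF assms] assms(2)] Rm_zero[OF gam_keys[OF assms] assms(2)] by (simp_all add: mm_def)

lemma wd_append: "us \<noteq> [] \<Longrightarrow> wd k us @ wd l ws =
    map (\<lambda>(w, k). vv (Poly_Mapping.single w k)) ((hd us, k) # map (\<lambda>w. (w, 1)) (tl us) @ (hd ws, l) # map (\<lambda>w. (w, 1)) (tl ws))"
  by (simp add: wd_def)

text \<open>For composable factors the two words join to a chain for the composite, and
  \<open>eqv_scal\<close> merges the two scalars. Otherwise an identity inserted at the seam fixes
  the last letter on its left and annihilates the first letter on its right.\<close>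

lemma cc_tau:
  assumes w: "w \<in> mor D" "dg w = i" "1 \<le> i" and w': "w' \<in> mor D" "dg w' = j" "1 \<le> j"
  shows "eqv (i + j) (cc (tau k w) (tau l w')) (if src D w = trg D w' then tau (k * l) (comp D w w') else 0)"
proof -
  note f = fc[OF w] and f' = fc[OF w']
  note c = chainD[OF f(1)] and c' = chainD[OF f'(1)]
  show ?thesis
  proof (cases "src D w = trg D w'")
    case True
    define ps where "ps = (hd (fc w), k) # map (\<lambda>w. (w, 1)) (tl (fc w)) @ (hd (fc w'), l) # map (\<lambda>w. (w, 1)) (tl (fc w'))"
    have fst: "map fst ps = fc w @ fc w'" using c(1) c'(1) by (simp add: ps_def o_def)
    have ne: "ps \<noteq> []" by (simp add: ps_def)
    have snd: "prod_list (map snd ps) = k * l" by (simp add: ps_def o_def map_replicate_const prod_list_replicate)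
    have len: "length ps = i + j" using arg_cong[OF fst, of length] f(3) f'(3) by simp
    have "fst ` set ps = set (fc w @ fc w')" using arg_cong[OF fst, of set] by simp
    then have M: "fst ` set ps \<subseteq> M1" using c(2) c'(2) by simp
    have "eqv (i + j) (frag_of (wd k (fc w) @ wd l (fc w'))) (frag_of (wd (k * l) (fc w @ fc w')))"
      using eqv_scal[OF ne M] wd_append[OF c(1), of k l "fc w'"] len fst snd by (simp add: ps_def[symmetric])
    also have "eqv (i + j) \<dots> (tau (k * l) (comp D w w'))"
      using tau_eq[of "fc w @ fc w'" "k * l"] chain_append[OF f(1) f'(1)] f f' True by simp
    finally show ?thesis using True by (simp add: tau_def)
  next
    case False
    obtain us u where us: "fc w = us @ [u]" using c(1) by (cases "fc w" rule: rev_cases) auto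
    obtain v vs where vs: "fc w' = v # vs" using c'(1) by (cases "fc w'") auto
    have uv: "src D u \<noteq> trg D v" using False f(2) f'(2) c(6) c'(5) us vs by simp
    have u: "u \<in> M1" "set us \<subseteq> M1" and v: "v \<in> M1" "set vs \<subseteq> M1" using c(2) c'(2) us vs by auto
    obtain zs kk where zs: "wd k (fc w) = zs @ [vv (Poly_Mapping.single u kk)]"
    proof (cases us)
      case Nil
      then show ?thesis using that[of "[]" k] by (simp add: wd_def us)
    next
      case (Cons x xs)
      then show ?thesis using that[of "vv (Poly_Mapping.single x k) # map (\<lambda>w. vv (bD w)) xs" 1] by (simp add: wd_def us)
    qed
    have W1: "wd k (fc w) \<in> W i" "wd l (fc w') \<in> W j" using wd_W[OF c(1,2)] wd_W[OF c'(1,2)] f(3) f'(3) by auto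
    \<comment> \<open>The identity at the source of the last letter \<open>u\<close>; it is not the
      identity at the target of \<open>v\<close>, so it sends that letter to
      \<open>vv 0\<close>.\<close>
    let ?i = "ident C (src D u)"
    let ?r = "map (\<lambda>w. vv (bD w)) vs"
    have so: "src D u \<in> obj C" using u D.src_obj obj_eq by auto
    have id: "comp D u (iota ?i) = u" using u so iota_ident by simp
    have r: "rsmult V (vv (Poly_Mapping.single u kk)) (Poly_Mapping.single ?i 1) = vv (Poly_Mapping.single u kk)"
      using vv_single_right[OF u(1) ident_mor[OF so], of kk 1] id so by simp
    have l: "Poly_Mapping.single ?i 1 \<odot>\<^bsub>V\<^esub> vv (Poly_Mapping.single v l) = vv 0"
      using vv_single_left[OF v(1) ident_mor[OF so], of 1 l] uv so by simp
    have Z: "set zs \<subseteq> carrier V" "Suc (length zs) = i" "vv (Poly_Mapping.single u kk) \<in> carrier V"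
      using W1(1) unfolding zs W_iff by simp_all
    have R: "set ?r \<subseteq> carrier V" "Suc (length vs) = j" "vv (Poly_Mapping.single v l) \<in> carrier V"
      using W1(2) by (simp_all add: W_iff wd_def vs)
    have "zs @ vv (Poly_Mapping.single u kk) # vv (Poly_Mapping.single v l) # ?r \<in> W (i + j)"
      using Z R by simp
    from eqv_balanced[OF this, of "Poly_Mapping.single ?i 1"] so
    have "eqv (i + j) (frag_of (zs @ vv (Poly_Mapping.single u kk) # vv (Poly_Mapping.single v l) # ?r))
       (frag_of ((zs @ [vv (Poly_Mapping.single u kk)]) @ vv 0 # ?r))"
      by (simp add: r l)
    also have "eqv (i + j) \<dots> 0"
      by (rule eqv_vv_zero) (use Z R in simp)
    finally show ?thesis using False by (simp add: tau_def zs) (simp add: wd_def vs)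
  qed
qed

text \<open>Only the first letter, which also carries the scalar, changes. If it survives, the new
  letters form a chain with composite \<open>c w\<close>.\<close>

lemma Lm_tau:
  assumes c: "c \<in> mor C" and w: "w \<in> mor D" "dg w = n" "1 \<le> n"
  shows "eqv n (Lm (Poly_Mapping.single c k) (tau l w)) (if src C c = trg D w then tau (k * l) (comp D (iota c) w) else 0)"
proof -
  note f = fc[OF w]
  note h = chainD[OF f(1)]
  obtain v vs where vs: "fc w = v # vs" using h(1) by (cases "fc w") auto
  have v: "v \<in> M1" "set vs \<subseteq> M1" using h(2) vs by auto
  have t: "trg D w = trg D v" using h(5) f(2) vs by simp
  have lf: "Suc (length vs) = n" using f(3) vs by simp
  let ?r = "map (\<lambda>w. vv (bD w)) vs"
  have L: "Lm (Poly_Mapping.single c k) (tau l w) =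
    frag_of ((if src C c = trg D v then vv (Poly_Mapping.single (comp D (iota c) v) (k * l)) else vv 0) # ?r)"
    using vv_single_left[OF v(1) c, of k l] by (simp add: tau_def wd_def vs)
  show ?thesis
  proof (cases "src C c = trg D v")
    case True
    let ?v = "comp D (iota c) v"
    have v': "?v \<in> M1" using c v True by auto
    have "chain (?v # vs) \<and> compl (?v # vs) = comp D (iota c) w"
    proof (cases "vs = []")
      case t: True
      then show ?thesis using f(2) vs v' by simp
    next
      case False
      then have "chain vs" "src D v = trg D (compl vs)" "w = comp D v (compl vs)" using f(1,2) vs by auto
      then show ?thesis using chainD[of vs] v v' c True False by (simp add: D.comp_assoc)
    qed
    then show ?thesis using tau_eq[of "?v # vs" "k * l"] L True t lf by (simp add: wd_def)
  next
    case False
    have "eqv n (frag_of ([] @ vv 0 # ?r)) 0"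
      by (rule eqv_vv_zero) (use v lf in \<open>auto simp: W_iff intro!: vv_single_closed\<close>)
    then show ?thesis using False L t by simp
  qed
qed

lemma Rm_tau:
  assumes c: "c \<in> mor C" and w: "w \<in> mor D" "dg w = n" "1 \<le> n"
  shows "eqv n (Rm (tau k w) (Poly_Mapping.single c l)) (if src D w = trg C c then tau (k * l) (comp D w (iota c)) else 0)"
proof -
  note f = fc[OF w]
  note h = chainD[OF f(1)]
  obtain us u where us: "fc w = us @ [u]" using h(1) by (cases "fc w" rule: rev_cases) auto
  have u: "u \<in> M1" "set us \<subseteq> M1" using h(2) us by auto
  have t: "src D w = src D u" using h(6) f(2) us by simp
  have lf: "Suc (length us) = n" using f(3) us by simp
  \<comment> \<open>The scalar of \<open>tau\<close> sits in the first letter and \<open>c\<close>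
    acts on the last. These coincide only in degree one; otherwise the two scalars have to be
    brought together by \<open>eqv_scal\<close>.\<close>
  show ?thesis
  proof (cases "us = []")
    case True
    have L: "Rm (tau k w) (Poly_Mapping.single c l) =
      frag_of ([] @ (if src D u = trg C c then vv (Poly_Mapping.single (comp D u (iota c)) (k * l)) else vv 0) # [])"
      using vv_single_right[OF u(1) c, of k l] Rm_simps(4)[of "[]" "vv (Poly_Mapping.single u k)"]
      by (simp add: tau_def wd_def us True)
    have w: "w = u" using f(2) us True by simp
    show ?thesis
    proof (cases "src D u = trg C c")
      case s: True
      have "chain [comp D u (iota c)]" using u c s by simp
      then show ?thesis using tau_eq[of "[comp D u (iota c)]" "k * l"] L s lf True by (simp add: wd_def w)
    next
      case False
      have "eqv n (frag_of ([] @ vv 0 # [])) 0"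
        by (rule eqv_vv_zero) (use lf True in simp)
      then show ?thesis using False L t by simp
    qed
  next
    case False
    obtain x xs where x: "us = x # xs" using False by (cases us) auto
    let ?ps = "(x, k) # map (\<lambda>w. (w, 1)) xs"
    let ?z = "if src D u = trg C c then vv (Poly_Mapping.single (comp D u (iota c)) l) else vv 0"
    have L: "Rm (tau k w) (Poly_Mapping.single c l) = frag_of (wd k us @ [?z])"
      using vv_single_right[OF u(1) c, of 1 l] Rm_simps(4)[of "vv (Poly_Mapping.single x k) # map (\<lambda>w. vv (bD w)) xs" "vv (bD u)"]
      by (simp add: tau_def wd_def us x)
    show ?thesis
    proof (cases "src D u = trg C c")
      case s: True
      let ?u = "comp D u (iota c)"
      have u': "?u \<in> M1" using u c s by auto
      \<comment> \<open>\<open>chain\<close> and \<open>compl\<close> recurse from the left, so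
        detaching the last letter takes an induction.\<close>
      have "chain us \<and> src D (compl us) = trg D u \<and> w = comp D (compl us) u"
        using f(1,2) False unfolding us
      proof (induction us arbitrary: w)
        case (Cons y ys)
        show ?case
        proof (cases "ys = []")
          case False
          then have ys: "chain (ys @ [u])" "y \<in> M1" "src D y = trg D (compl (ys @ [u]))" using Cons.prems by auto
          have IH: "chain ys \<and> src D (compl ys) = trg D u \<and> compl (ys @ [u]) = comp D (compl ys) u"
            by (rule Cons.IH[OF ys(1) refl False])
          note ch = chainD[OF IH[THEN conjunct1]]
          have "trg D (compl (ys @ [u])) = trg D (compl ys)" using IH ch u by simp
          then show ?thesis using IH ch ys u Cons.prems(2) False by (auto simp: D.comp_assoc)
        qed (use Cons.prems in auto)
      qed simp
      then have ch: "chain us" "src D (compl us) = trg D u" "w = comp D (compl us) u" by auto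
      note cu = chainD[OF ch(1)]
      have cu': "chain (us @ [?u]) \<and> compl (us @ [?u]) = comp D w (iota c)"
        using chain_append[OF ch(1), of "[?u]"] u' u c s cu ch by (simp add: D.comp_assoc)
      define ps where "ps = (x, k) # map (\<lambda>w. (w, 1)) xs @ [(?u, l)]"
      have fst: "map fst ps = us @ [?u]" by (simp add: ps_def x o_def)
      have snd: "prod_list (map snd ps) = k * l" by (simp add: ps_def o_def map_replicate_const prod_list_replicate)
      have len: "length ps = n" using arg_cong[OF fst, of length] lf by simp
      have "fst ` set ps = set (us @ [?u])" using arg_cong[OF fst, of set] by simp
      then have M: "fst ` set ps \<subseteq> M1" using u u' by simp
      have "wd k us @ [?z] = map (\<lambda>(w, k). vv (Poly_Mapping.single w k)) ps"
        using s by (simp add: wd_def x ps_def)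
      then have "eqv n (frag_of (wd k us @ [?z])) (frag_of (wd (k * l) (us @ [?u])))"
        using eqv_scal[OF _ M] len fst snd by (auto simp: ps_def)
      also have "eqv n \<dots> (tau (k * l) (comp D w (iota c)))"
        using tau_eq[of "us @ [?u]" "k * l"] cu' lf by simp
      finally show ?thesis using L s t by simp
    next
      case s: False
      have "eqv n (frag_of (wd k us @ vv 0 # [])) 0"
        by (rule eqv_vv_zero) (use wd_W[OF False u(2), of k] lf in \<open>simp add: W_iff\<close>)
      then show ?thesis using s L t by simp
    qed
  qed
qed

end

section \<open>The algebra homomorphism onto the tensor algebra\<close>

context graded_tensor
begin

text \<open>For two basis elements only one of the three parts of \<open>mm\<close> can be nonzero,
  according to whether the left factor, the right factor or neither has degree zero.\<close>

lemma mm_single: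
  assumes w: "w \<in> mor D" and w': "w' \<in> mor D" and n: "1 \<le> n"
  shows "eqv n (gam n (cmul D (Poly_Mapping.single w k) (Poly_Mapping.single w' l)))
      (mm n (Poly_Mapping.single w k) (Poly_Mapping.single w' l))"
proof -
  let ?u = "Poly_Mapping.single w k" and ?u' = "Poly_Mapping.single w' l"
  let ?t = "if src D w = trg D w' then tau (k * l) (comp D w w') else 0"
  have k: "Poly_Mapping.keys ?u \<subseteq> mor D" "Poly_Mapping.keys ?u' \<subseteq> mor D" using w w' by simp_all
  have L: "eqv n (Lm (p0 ?u) (gam n ?u')) (if dg w = 0 \<and> dg w' = n then ?t else 0)"
  proof (cases "dg w = 0 \<and> dg w' = n")
    case True
    then obtain c where c: "c \<in> mor C" "w = iota c" using iota_surj[OF w] by blast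
    have "eqv n (Lm (p0 ?u) (gam n ?u')) (Lm (Poly_Mapping.single c k) (tau l w'))"
      unfolding c(2) p0_iota[OF c(1)] by (rule eqv_Lm) (use c True n w' gam_single in auto)
    also have "eqv n \<dots> ?t" using Lm_tau[OF c(1) w', of n k l] True n c by (cases "src C c = trg D w'") simp_all
    finally show ?thesis using True by simp
  next
    case False
    then have "p0 ?u = 0 \<or> gam n ?u' = 0" using p0_single_ne gam_single_ne by blast
    then show ?thesis using Lm_zero[OF gam_keys[OF k(2) n] n] False by auto
  qed
  have R: "eqv n (Rm (gam n ?u) (p0 ?u')) (if dg w' = 0 \<and> dg w = n then ?t else 0)"
  proof (cases "dg w' = 0 \<and> dg w = n")
    case True
    then obtain c where c: "c \<in> mor C" "w' = iota c" using iota_surj[OF w'] by blast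
    have "eqv n (Rm (gam n ?u) (p0 ?u')) (Rm (tau k w) (Poly_Mapping.single c l))"
      unfolding c(2) p0_iota[OF c(1)] by (rule eqv_Rm) (use c True n w gam_single in auto)
    also have "eqv n \<dots> ?t" using Rm_tau[OF c(1) w, of n k l] True n c by (cases "src D w = trg C c") simp_all
    finally show ?thesis using True by simp
  next
    case False
    then have "p0 ?u' = 0 \<or> gam n ?u = 0" using p0_single_ne gam_single_ne by blast
    then show ?thesis using Rm_zero[OF gam_keys[OF k(1) n] n] False by auto
  qed
  have S: "eqv n (\<Sum>i\<in>{1..<n}. cc (gam i ?u) (gam (n - i) ?u')) (if 1 \<le> dg w \<and> 1 \<le> dg w' \<and> dg w + dg w' = n then ?t else 0)"
  proof -
    have "eqv n (\<Sum>i\<in>{1..<n}. cc (gam i ?u) (gam (n - i) ?u')) (\<Sum>i\<in>{1..<n}. if i = dg w then (if dg w + dg w' = n then ?t else 0) else 0)"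
    proof (rule eqv_sum)
      fix i assume i: "i \<in> {1..<n}"
      show "eqv n (cc (gam i ?u) (gam (n - i) ?u')) (if i = dg w then (if dg w + dg w' = n then ?t else 0) else 0)"
      proof (cases "i = dg w \<and> dg w + dg w' = n")
        case True
        then have j: "dg w' = n - i" "1 \<le> n - i" "1 \<le> i" using i by auto
        have "eqv n (cc (gam i ?u) (gam (n - i) ?u')) (cc (tau k w) (tau l w'))"
          using True j w w' k by (intro eqv_cc'[OF i] gam_single tau_keys gam_keys) auto
        also have "eqv n \<dots> ?t" using cc_tau[OF w _ j(3) w' j(1,2), of k l] True i by simp
        finally show ?thesis using True by simp
      next
        case False
        then have "dg w \<noteq> i \<or> dg w' \<noteq> n - i" using i by auto
        then have "gam i ?u = 0 \<or> gam (n - i) ?u' = 0" using gam_single_ne by blast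
        then show ?thesis using False by auto
      qed
    qed
    also have "(\<Sum>i\<in>{1..<n}. if i = dg w then (if dg w + dg w' = n then ?t else 0) else 0) =
       (if 1 \<le> dg w \<and> 1 \<le> dg w' \<and> dg w + dg w' = n then ?t else 0)"
      by (auto simp: sum.delta)
    finally show ?thesis .
  qed
  have "eqv n (mm n ?u ?u') (if dg w + dg w' = n then ?t else 0)"
  proof -
    \<comment> \<open>The cases exclude each other: since \<open>n\<close> is positive, the degrees
      cannot both be zero.\<close>
    have "(if dg w = 0 \<and> dg w' = n then ?t else 0) + (if dg w' = 0 \<and> dg w = n then ?t else 0) +
       (if 1 \<le> dg w \<and> 1 \<le> dg w' \<and> dg w + dg w' = n then ?t else 0) = (if dg w + dg w' = n then ?t else 0)"
      using n by (cases "dg w = 0"; cases "dg w' = 0") auto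
    then show ?thesis unfolding mm_def using eqv_add[OF eqv_add[OF L R] S] by (simp only:)
  qed
  moreover have "eqv n (gam n (cmul D ?u ?u')) (if dg w + dg w' = n then ?t else 0)"
  proof (cases "src D w = trg D w'")
    case True
    then have m: "comp D w w' \<in> mor D" "dg (comp D w w') = dg w + dg w'" using w w' by auto
    show ?thesis
    proof (cases "dg w + dg w' = n")
      case t: True
      then show ?thesis using gam_single[OF m(1), of n "k * l"] m n True by (simp add: cmul_single)
    next
      case False
      then show ?thesis using gam_single_ne[of "comp D w w'" n "k * l"] m True by (simp add: cmul_single)
    qed
  qed (simp add: cmul_single)
  ultimately show ?thesis using eqv_trans eqv_sym by blast
qed

lemma gam_mult:
  assumes u: "Poly_Mapping.keys u \<subseteq> mor D" and u': "Poly_Mapping.keys u' \<subseteq> mor D" and n: "1 \<le> n"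
  shows "eqv n (gam n (cmul D u u')) (mm n u u')"
  using u
proof (induction rule: pm_induct)
  case zero
  then show ?case using mm_zero(1)[OF u' n] by (simp add: eqv_sym)
next
  case (single w k)
  note w = this
  have kw: "Poly_Mapping.keys (Poly_Mapping.single w k) \<subseteq> mor D" using w by simp
  show ?case using u'
  proof (induction rule: pm_induct)
    case zero
    then show ?case using mm_zero(2)[OF kw n] by (simp add: eqv_sym)
  next
    case (single w' l)
    then show ?case using mm_single[OF w single n] by simp
  next
    case (add f g)
    have "eqv n (gam n (cmul D (Poly_Mapping.single w k) f + cmul D (Poly_Mapping.single w k) g))
       (gam n (cmul D (Poly_Mapping.single w k) f) + gam n (cmul D (Poly_Mapping.single w k) g))"
      by (rule gam_add[OF D.cmul_closed[OF kw add(1)] D.cmul_closed[OF kw add(2)] n])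
    also have "eqv n \<dots> (mm n (Poly_Mapping.single w k) f + mm n (Poly_Mapping.single w k) g)"
      by (rule eqv_add[OF add(3,4)])
    also have "eqv n \<dots> (mm n (Poly_Mapping.single w k) (f + g))"
      by (rule eqv_sym[OF mm_add_right[OF add(1,2) kw n]])
    finally show ?case by (simp add: cmul_add_right)
  qed
next
  case (add f g)
  have "eqv n (gam n (cmul D f u' + cmul D g u')) (gam n (cmul D f u') + gam n (cmul D g u'))"
    by (rule gam_add[OF D.cmul_closed[OF add(1) u'] D.cmul_closed[OF add(2) u'] n])
  also have "eqv n \<dots> (mm n f u' + mm n g u')" by (rule eqv_add[OF add(3,4)])
  also have "eqv n \<dots> (mm n (f + g) u')" by (rule eqv_sym[OF mm_add_left[OF add(1,2) u' n]])
  finally show ?case by (simp add: cmul_add_left)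
qed

lemma gam_scal:
  assumes "Poly_Mapping.keys u \<subseteq> mor D" and n: "1 \<le> n"
  shows "eqv n (gam n (scal c u)) (Lm (scal c (cone C)) (gam n u))"
  using assms(1)
proof (induction rule: pm_induct)
  case (single w k)
  show ?case
  proof (cases "dg w = n")
    case True
    note f = fc[OF single True n]
    note h = chainD[OF f(1)]
    obtain v vs where vs: "fc w = v # vs" using h(1) by (cases "fc w") auto
    have v: "v \<in> M1" using h(2) vs by simp
    have kc: "scal c (cone C) \<in> kC" using order_trans[OF keys_scal cone_closed] by blast
    have "eqv n (Lm (scal c (cone C)) (gam n (Poly_Mapping.single w k))) (Lm (scal c (cone C)) (tau k w))"
      by (rule eqv_Lm[OF kc gam_single[OF single True n]])
    also have "Lm (scal c (cone C)) (tau k w) = tau (c * k) w"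
      using vv_scal(2)[OF v, of c k] by (simp add: tau_def wd_def vs)
    also have "eqv n (tau (c * k) w) (gam n (scal c (Poly_Mapping.single w k)))"
      using gam_single[OF single True n, of "c * k"] eqv_sym by simp
    finally show ?thesis by (rule eqv_sym)
  qed (simp add: gam_single_ne)
next
  case (add f g)
  have "eqv n (gam n (scal c f + scal c g)) (gam n (scal c f) + gam n (scal c g))"
    using add by (intro gam_add n order_trans[OF keys_scal])
  also have "eqv n \<dots> (Lm (scal c (cone C)) (gam n f) + Lm (scal c (cone C)) (gam n g))"
    by (rule eqv_add[OF add(3,4)])
  also have "Lm (scal c (cone C)) (gam n f) + Lm (scal c (cone C)) (gam n g) = Lm (scal c (cone C)) (gam n f + gam n g)"
    by simp
  also have "eqv n \<dots> (Lm (scal c (cone C)) (gam n (f + g)))"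
    using add order_trans[OF keys_scal cone_closed] by (intro eqv_Lm eqv_sym[OF gam_add] n) auto
  finally show ?case by (simp add: scal_add)
qed simp

lemma gam_one: 
  assumes "Poly_Mapping.keys u \<subseteq> M1"
  shows "eqv 1 (gam 1 u) (frag_of [vv u])"
  using assms
proof (induction rule: pm_induct)
  case zero
  show ?case using eqv_vv_zero[of "[]" "[]" 1] eqv_sym by simp
next
  case (single w k)
  then have w: "w \<in> mor D" "dg w = 1" by auto
  have "chain [w]" using single by simp
  from eqv_sym[OF tau_eq[OF this, of k]] have "eqv 1 (tau k w) (frag_of [vv (Poly_Mapping.single w k)])"
    by (simp add: wd_def)
  with gam_single[OF w] show ?case using eqv_trans by blast
next
  case (add f g)
  have "eqv 1 (gam 1 (f + g)) (gam 1 f + gam 1 g)" using add by (intro gam_add) auto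
  also have "eqv 1 \<dots> (frag_of [vv f] + frag_of [vv g])" by (rule eqv_add[OF add(3,4)])
  also have "eqv 1 \<dots> (frag_of [vv (f + g)])"
    using eqv_sym[OF eqv_additive[of "[]" "vv f" "[]" 1 "vv g"]] vv_add[OF add(1,2)] vv_closed add by simp
  finally show ?case .
qed

text \<open>The first letter is lifted by \<open>vv_surj\<close> and the rest by induction; the
  product of the lifts works because \<open>gam_mult\<close> turns it into concatenation.\<close>

lemma gam_word:
  assumes "zs \<in> W (Suc n)"
  shows "\<exists>u. Poly_Mapping.keys u \<subseteq> {w \<in> mor D. dg w = Suc n} \<and> eqv (Suc n) (gam (Suc n) u) (frag_of zs)"
  using assms
proof (induction n arbitrary: zs)
  case 0
  then obtain z where z: "zs = [z]" "z \<in> carrier V" by (auto simp: W_iff length_Suc_conv)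
  obtain u where u: "Poly_Mapping.keys u \<subseteq> M1" "z = vv u" using vv_surj[OF z(2)] by (elim exE conjE)
  show ?case by (rule exI[of _ u]) (use u z gam_one[OF u(1)] in simp)
next
  case (Suc n)
  then obtain z zs' where z: "zs = z # zs'" "z \<in> carrier V" "zs' \<in> W (Suc n)"
    by (cases zs) (auto simp: W_iff)
  obtain u where u: "Poly_Mapping.keys u \<subseteq> M1" "z = vv u" using vv_surj[OF z(2)] by (elim exE conjE)
  obtain u' where u': "Poly_Mapping.keys u' \<subseteq> {w \<in> mor D. dg w = Suc n}" "eqv (Suc n) (gam (Suc n) u') (frag_of zs')"
    using Suc.IH[OF z(3)] by (elim exE conjE)
  let ?n = "Suc (Suc n)"
  have k: "Poly_Mapping.keys u \<subseteq> mor D" "Poly_Mapping.keys u' \<subseteq> mor D" using u u' by auto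
  have d: "Poly_Mapping.keys (cmul D u u') \<subseteq> {w \<in> mor D. dg w = ?n}"
    using dg_cmul[OF u(1) u'(1)] by simp
  have "eqv ?n (gam ?n (cmul D u u')) (mm ?n u u')" by (rule gam_mult[OF k]) simp
  also have "eqv ?n (mm ?n u u') (cc (gam 1 u) (gam (Suc n) u'))"
  proof -
    have p: "p0 u = 0" by (rule p0_deg[OF u(1)]) simp
    have g: "gam ?n u = 0" by (rule gam_deg[OF u(1)]) simp
    \<comment> \<open>\<open>u\<close> is homogeneous of degree one, so only the summand at
      \<open>i = 1\<close> survives.\<close>
    have "(\<Sum>i\<in>{1..<?n}. cc (gam i u) (gam (?n - i) u')) = (\<Sum>i\<in>{1..<?n}. if i = 1 then cc (gam 1 u) (gam (Suc n) u') else 0)"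
      using gam_deg[OF u(1)] by (intro sum.cong refl) auto
    then have s: "(\<Sum>i\<in>{1..<?n}. cc (gam i u) (gam (?n - i) u')) = cc (gam 1 u) (gam (Suc n) u')"
      by (simp add: sum.delta)
    show ?thesis
      using eqv_add[OF Lm_zero[OF gam_keys[OF k(2)], of ?n] eqv_refl, of "cc (gam 1 u) (gam (Suc n) u')"]
      by (simp only: mm_def p g s Rm_simps) simp
  qed
  also have "eqv ?n \<dots> (cc (frag_of [z]) (frag_of zs'))"
    using eqv_cc[OF gam_one[OF u(1)] u'(2)] u(2) z gam_keys[OF k(2)] by (simp add: keys_frag_of)
  finally show ?case using d by (intro exI[of _ "cmul D u u'"]) (simp add: z)
qed

lemma gam_surj:
  assumes "Poly_Mapping.keys f \<subseteq> W n" "1 \<le> n"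
  shows "\<exists>u. Poly_Mapping.keys u \<subseteq> {w \<in> mor D. dg w = n} \<and> eqv n (gam n u) f"
  using assms(1)
proof (induction rule: frag_induction)
  case zero
  show ?case by (rule exI[of _ 0]) simp
next
  case (one zs)
  then show ?case using gam_word[of zs "n - 1"] assms(2) by simp
next
  case (diff f g)
  then obtain u v where u: "Poly_Mapping.keys u \<subseteq> {w \<in> mor D. dg w = n}" "eqv n (gam n u) f"
     and v: "Poly_Mapping.keys v \<subseteq> {w \<in> mor D. dg w = n}" "eqv n (gam n v) g" by (elim exE conjE)
  have "eqv n (gam n (u - v)) (gam n u - gam n v)" using u v assms(2) by (intro gam_diff) auto
  also have "eqv n \<dots> (f - g)" by (rule eqv_diff[OF u(2) v(2)])
  finally show ?case using u v keys_diff[of u v] by (intro exI[of _ "u - v"]) auto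
qed

definition Gam :: "('n \<Rightarrow>\<^sub>0 'k) \<Rightarrow> ('m \<Rightarrow>\<^sub>0 'k) \<times> (nat \<Rightarrow> ('v list \<Rightarrow>\<^sub>0 int) set)" where
  "Gam u = (p0 u, \<lambda>n\<in>{1..}. gam n u +o N n)"

abbreviation T :: "('k, ('m \<Rightarrow>\<^sub>0 'k) \<times> (nat \<Rightarrow> ('v list \<Rightarrow>\<^sub>0 int) set)) module" where
  "T \<equiv> tensor_algebra A V"

lemma Gam_eq_iff: "Gam u = Gam v \<longleftrightarrow> p0 u = p0 v \<and> (\<forall>n\<ge>1. eqv n (gam n u) (gam n v))"
proof -
  have "(\<lambda>n\<in>{1..}. gam n u +o N n) = (\<lambda>n\<in>{1..}. gam n v +o N n) \<longleftrightarrow> (\<forall>n\<ge>1. gam n u +o N n = gam n v +o N n)"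
    by (auto simp: fun_eq_iff restrict_def)
  then show ?thesis by (simp add: Gam_def coset_eq_iff)
qed

lemma T_simps:
  "carrier T = {(b, t). b \<in> kC \<and> t \<in> (\<Pi>\<^sub>E n\<in>{1..}. tensor_power A V n) \<and> finite {n \<in> {1..}. t n \<noteq> N n}}"
  "one T = (cone C, \<lambda>n\<in>{1..}. N n)" "zero T = (0, \<lambda>n\<in>{1..}. N n)"
  "(b, t) \<oplus>\<^bsub>T\<^esub> (b', t') = (b + b', \<lambda>n\<in>{1..}. t n + t' n)"
  "c \<odot>\<^bsub>T\<^esub> (b, t) = (scal c b, \<lambda>n\<in>{1..}. tensor_lact A V n (scal c (cone C)) (t n))"
  "(b, t) \<otimes>\<^bsub>T\<^esub> (b', t') = (cmul C b b',
         \<lambda>n\<in>{1..}. tensor_lact A V n b (t' n) + tensor_ract A V n (t n) b'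
                      + (\<Sum>i\<in>{1..<n}. tensor_concat A V n (t i) (t' (n - i))))"
  by (simp_all add: tensor_algebra_def)

lemma Gam_closed:
  assumes "Poly_Mapping.keys u \<subseteq> mor D"
  shows "Gam u \<in> carrier T"
proof -
  have "{n \<in> {1..}. gam n u +o N n \<noteq> N n} \<subseteq> dg ` Poly_Mapping.keys u"
  proof (rule subsetI, rule ccontr)
    fix n assume n: "n \<in> {n \<in> {1..}. gam n u +o N n \<noteq> N n}" "n \<notin> dg ` Poly_Mapping.keys u"
    then have "{w \<in> Poly_Mapping.keys u. dg w = n} = {}" by auto
    then have "gam n u = 0" unfolding gam_def by (simp only: sum.empty)
    then show False using n by (simp add: coset_zero)
  qed
  then have "finite {n \<in> {1..}. gam n u +o N n \<noteq> N n}" by (rule finite_subset) simp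
  moreover have "gam n u +o N n \<in> tensor_power A V n" if "1 \<le> n" for n
    unfolding tensor_power_def using gam_keys[OF assms that] by blast
  moreover have "{n \<in> {1..}. (\<lambda>n\<in>{1..}. gam n u +o N n) n \<noteq> N n} = {n \<in> {1..}. gam n u +o N n \<noteq> N n}" by auto
  ultimately show ?thesis
    unfolding T_simps Gam_def using p0_closed[OF assms] by auto
qed

lemma Gam_add:
  assumes "Poly_Mapping.keys u \<subseteq> mor D" "Poly_Mapping.keys v \<subseteq> mor D"
  shows "Gam (u + v) = Gam u \<oplus>\<^bsub>T\<^esub> Gam v"
proof -
  have "gam n (u + v) +o N n = (gam n u +o N n) + (gam n v +o N n)" if "1 \<le> n" for n
    using gam_add[OF assms that] by (simp add: coset_add coset_eq_iff)
  then show ?thesis unfolding Gam_def T_simps by (auto simp: p0_add fun_eq_iff)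
qed

lemma Gam_mult:
  assumes "Poly_Mapping.keys u \<subseteq> mor D" "Poly_Mapping.keys v \<subseteq> mor D"
  shows "Gam (cmul D u v) = Gam u \<otimes>\<^bsub>T\<^esub> Gam v"
proof -
  let ?t = "\<lambda>u. \<lambda>n\<in>{1..}. gam n u +o N n"
  have "gam n (cmul D u v) +o N n = tensor_lact A V n (p0 u) (?t v n) + tensor_ract A V n (?t u n) (p0 v)
                      + (\<Sum>i\<in>{1..<n}. tensor_concat A V n (?t u i) (?t v (n - i)))" if n: "1 \<le> n" for n
  proof -
    have "(\<Sum>i\<in>{1..<n}. tensor_concat A V n (?t u i) (?t v (n - i))) = (\<Sum>i\<in>{1..<n}. cc (gam i u) (gam (n - i) v) +o N n)"
    proof (rule sum.cong[OF refl])
      fix i assume i: "i \<in> {1..<n}"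
      then have "tensor_concat A V (i + (n - i)) (gam i u +o N i) (gam (n - i) v +o N (n - i)) = cc (gam i u) (gam (n - i) v) +o N (i + (n - i))"
        using assms by (intro tensor_concat_coset gam_keys) auto
      moreover have "Suc 0 \<le> n - i" using i by (simp add: Suc_le_eq)
      ultimately show "tensor_concat A V n (?t u i) (?t v (n - i)) = cc (gam i u) (gam (n - i) v) +o N n"
        using i by simp
    qed
    moreover have "tensor_lact A V n (p0 u) (?t v n) = Lm (p0 u) (gam n v) +o N n" "tensor_ract A V n (?t u n) (p0 v) = Rm (gam n u) (p0 v) +o N n"
      using n p0_closed assms by (simp_all add: tensor_lact_coset tensor_ract_coset)
    ultimately show ?thesis
      using gam_mult[OF assms n] by (simp add: coset_add coset_sum coset_eq_iff mm_def)
  qed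
  then have "(\<lambda>n\<in>{1..}. gam n (cmul D u v) +o N n) = (\<lambda>n\<in>{1..}. tensor_lact A V n (p0 u) (?t v n) + tensor_ract A V n (?t u n) (p0 v)
                      + (\<Sum>i\<in>{1..<n}. tensor_concat A V n (?t u i) (?t v (n - i))))"
    by (intro restrict_ext) simp
  then show ?thesis unfolding Gam_def T_simps p0_cmul[OF assms] by simp
qed

lemma Gam_scal:
  assumes "Poly_Mapping.keys u \<subseteq> mor D"
  shows "Gam (scal c u) = c \<odot>\<^bsub>T\<^esub> Gam u"
proof -
  have "gam n (scal c u) +o N n = tensor_lact A V n (scal c (cone C)) (gam n u +o N n)" if "1 \<le> n" for n
  proof -
    have "scal c (cone C) \<in> kC" using order_trans[OF keys_scal cone_closed] by blast
    then show ?thesis using gam_scal[OF assms that, of c] by (simp only: tensor_lact_coset coset_eq_iff)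
  qed
  then show ?thesis unfolding Gam_def T_simps by (auto simp: p0_scal fun_eq_iff)
qed

lemma Gam_zero: "Gam 0 = \<zero>\<^bsub>T\<^esub>"
  by (simp add: Gam_def T_simps coset_zero)

lemma Gam_one: "Gam (cone D) = \<one>\<^bsub>T\<^esub>"
proof -
  have c: "cone D = emb (cone C :: 'm \<Rightarrow>\<^sub>0 'k)" by (simp add: emb_cone)
  have "gam n (cone D) = 0" if "1 \<le> n" for n
    unfolding c by (rule gam_deg[OF emb_deg0[OF cone_closed]]) (use that in simp)
  then show ?thesis
    unfolding Gam_def T_simps using p0_emb[OF cone_closed] by (auto simp: c coset_zero fun_eq_iff)
qed

lemma Gam_surj:
  assumes "z \<in> carrier T"
  shows "\<exists>u. Poly_Mapping.keys u \<subseteq> mor D \<and> Gam u = z"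
proof -
  obtain b t where z: "z = (b, t)" "Poly_Mapping.keys b \<subseteq> mor C" "t \<in> (\<Pi>\<^sub>E n\<in>{1..}. tensor_power A V n)"
    "finite {n \<in> {1..}. t n \<noteq> N n}" using assms by (auto simp: T_simps)
  let ?S = "{n \<in> {1..}. t n \<noteq> N n}"
  have "\<exists>f u. t n = f +o N n \<and> Poly_Mapping.keys u \<subseteq> {w \<in> mor D. dg w = n} \<and> eqv n (gam n u) f" if n: "1 \<le> n" for n
  proof -
    have "t n \<in> tensor_power A V n" using z(3) n by (auto simp: PiE_iff)
    then obtain f where "t n = f +o N n" "Poly_Mapping.keys f \<subseteq> W n" by (auto simp: tensor_power_def)
    then show ?thesis using gam_surj[of f n] n by blast
  qed
  then have "\<forall>n. \<exists>u. 1 \<le> n \<longrightarrow> t n = gam n u +o N n \<and> Poly_Mapping.keys u \<subseteq> {w \<in> mor D. dg w = n}"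
    using coset_eq_iff by metis
  then obtain u where u: "\<And>n. 1 \<le> n \<Longrightarrow> t n = gam n (u n) +o N n" "\<And>n. 1 \<le> n \<Longrightarrow> Poly_Mapping.keys (u n) \<subseteq> {w \<in> mor D. dg w = n}"
    by metis
  \<comment> \<open>A sum of homogeneous lifts, finite because \<open>t\<close> has finite support;
    the grading recovers each summand.\<close>
  define y where "y = emb b + (\<Sum>n\<in>?S. u n)"
  have um: "Poly_Mapping.keys (u n) \<subseteq> mor D" if "n \<in> ?S" for n using u(2)[of n] that by auto
  have ks: "Poly_Mapping.keys (\<Sum>n\<in>?S. u n) \<subseteq> mor D" by (rule keys_sum_subset[OF um])
  have k: "Poly_Mapping.keys y \<subseteq> mor D" unfolding y_def by (rule keys_add_subset[OF emb_closed[OF z(2)] ks])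
  have "(\<Sum>n\<in>?S. p0 (u n)) = 0" using p0_deg[OF u(2)] by (intro sum.neutral) auto
  then have "p0 y = b" using p0_emb[OF z(2)] by (simp add: y_def p0_add p0_sum)
  moreover have "gam n y +o N n = t n" if n: "1 \<le> n" for n
  proof -
    have "eqv n (gam n y) (gam n (emb b) + gam n (\<Sum>m\<in>?S. u m))"
      unfolding y_def by (rule gam_add[OF emb_closed[OF z(2)] ks n])
    also have "gam n (emb b) = 0" by (rule gam_deg[OF emb_deg0[OF z(2)]]) (use n in simp)
    also have "eqv n (0 + gam n (\<Sum>m\<in>?S. u m)) (\<Sum>m\<in>?S. gam n (u m))"
      unfolding add_0 by (rule gam_sum[OF um n])
    also have "(\<Sum>m\<in>?S. gam n (u m)) = (\<Sum>m\<in>?S. if m = n then gam n (u n) else 0)"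
      using gam_deg[OF u(2)] by (intro sum.cong refl) auto
    also have "\<dots> = (if n \<in> ?S then gam n (u n) else 0)" using z(4) by (simp add: sum.delta)
    finally have e: "gam n y +o N n = (if n \<in> ?S then gam n (u n) else 0) +o N n"
      by (simp only: coset_eq_iff)
    show ?thesis
    proof (cases "n \<in> ?S")
      case True
      then show ?thesis using e u(1)[OF n] by (simp only: if_True)
    next
      case False
      then have "t n = N n" using n by simp
      then show ?thesis using e False by (simp only: if_False coset_zero)
    qed
  qed
  then have "(\<lambda>n\<in>{1..}. gam n y +o N n) = t" using z(3) by (auto simp: fun_eq_iff PiE_iff extensional_def)
  ultimately show ?thesis using k z(1) by (intro exI[of _ y]) (simp add: Gam_def)
qed

lemma Gam_rho: "Gam rho = Gam 0"
proof -
  have "eqv 1 (gam 1 rho) 0"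
  proof -
    have "eqv 1 (frag_of [vv rho]) 0" using eqv_vv_zero[of "[]" "[]" 1] by (simp add: vv_rho)
    with gam_one[OF rho_keys] show ?thesis by (rule eqv_trans)
  qed
  moreover have "gam n rho = 0" if "n \<noteq> 1" for n using gam_deg[OF rho_keys] that by simp
  moreover have "p0 rho = 0" using p0_deg[OF rho_keys] by simp
  ultimately show ?thesis unfolding Gam_eq_iff by (metis eqv_refl gam_zero p0_zero)
qed

section \<open>The kernel of the homomorphism\<close>

definition sz :: "'v \<Rightarrow> ('n \<Rightarrow>\<^sub>0 'k)" where
  "sz z = (SOME u. Poly_Mapping.keys u \<subseteq> M1 \<and> z = vv u)"

lemma sz: "z \<in> carrier V \<Longrightarrow> Poly_Mapping.keys (sz z) \<subseteq> M1 \<and> vv (sz z) = z"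
  using someI_ex[OF vv_surj[of z]] by (simp add: sz_def)

primrec prodl :: "'v list \<Rightarrow> ('n \<Rightarrow>\<^sub>0 'k)" where
  "prodl [] = cone D"
| "prodl (z # zs) = cmul D (sz z) (prodl zs)"

lemma sz_keys: "z \<in> carrier V \<Longrightarrow> Poly_Mapping.keys (sz z) \<subseteq> mor D"
  using sz[of z] by auto

lemma prodl_keys: "set zs \<subseteq> carrier V \<Longrightarrow> Poly_Mapping.keys (prodl zs) \<subseteq> mor D"
  by (induction zs) (simp_all add: D.cone_closed D.cmul_closed sz_keys)

lemma prodl_append: "set us \<subseteq> carrier V \<Longrightarrow> set ws \<subseteq> carrier V \<Longrightarrow> prodl (us @ ws) = cmul D (prodl us) (prodl ws)"
  by (induction us) (simp_all add: prodl_keys D.cmul_cone_left D.cmul_assoc sz_keys)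

text \<open>A map back from words, multiplying chosen preimages of the letters. Another choice of
  preimages changes the result only within any ideal that contains \<open>rho\<close>.\<close>

definition Psi :: "('v list \<Rightarrow>\<^sub>0 int) \<Rightarrow> ('n \<Rightarrow>\<^sub>0 'k)" where
  "Psi f = (\<Sum>zs\<in>Poly_Mapping.keys f. scal (of_int (Poly_Mapping.lookup f zs)) (prodl zs))"

lemma Psi_superset: "finite S \<Longrightarrow> Poly_Mapping.keys f \<subseteq> S \<Longrightarrow> Psi f = (\<Sum>zs\<in>S. scal (of_int (Poly_Mapping.lookup f zs)) (prodl zs))"
  unfolding Psi_def by (rule sum.mono_neutral_left) (auto simp: in_keys_iff)

lemma Psi_simps [simp]: "Psi 0 = 0" "Psi (frag_of zs) = prodl zs"
  by (simp_all add: Psi_def keys_frag_of)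

lemma Psi_diff [simp]: "Psi (f - g) = Psi f - Psi g"
proof -
  let ?S = "Poly_Mapping.keys f \<union> Poly_Mapping.keys g"
  have "scal (of_int (Poly_Mapping.lookup (f - g) zs)) (prodl zs) =
    scal (of_int (Poly_Mapping.lookup f zs)) (prodl zs) - scal (of_int (Poly_Mapping.lookup g zs)) (prodl zs)" for zs
    by (rule poly_mapping_eqI) (simp add: lookup_minus algebra_simps)
  then show ?thesis
    using Psi_superset[of ?S "f - g"] Psi_superset[of ?S f] Psi_superset[of ?S g] keys_diff[of f g]
    by (simp add: sum_subtractf)
qed

lemma Psi_sum: "Psi (\<Sum>i\<in>S. f i) = (\<Sum>i\<in>S. Psi (f i))"
proof (induction S rule: infinite_finite_induct)
  case (insert x S)
  have "Psi (f x + g) = Psi (f x) + Psi g" for g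
    using Psi_diff[of "f x" "- g"] Psi_diff[of 0 g] by simp
  then show ?case using insert by simp
qed simp_all

context
  fixes I :: "('n \<Rightarrow>\<^sub>0 'k) set"
  assumes I: "ideal I (category_algebra D :: ('k, 'n \<Rightarrow>\<^sub>0 'k) module)" and rI: "rho \<in> I"
begin

lemma I_diff: "x \<in> I \<Longrightarrow> y \<in> I \<Longrightarrow> x - y \<in> I"
  using ideal_D(2)[OF I, of x "- y"] ideal_D(3)[OF I, of y] by simp

lemma I_sum: "(\<And>i. i \<in> S \<Longrightarrow> f i \<in> I) \<Longrightarrow> sum f S \<in> I"
  by (induction S rule: infinite_finite_induct) (simp_all add: ideal_D(1,2)[OF I])

lemma sz_cong: "z \<in> carrier V \<Longrightarrow> Poly_Mapping.keys u \<subseteq> M1 \<Longrightarrow> vv u = z \<Longrightarrow> sz z - u \<in> I"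
  using sz[of z] vv_kernel[OF _ _ _ I rI, of "sz z" u] by simp

lemma prodl_middle:
  assumes "set us \<subseteq> carrier V" "set ws \<subseteq> carrier V" "x \<in> I"
  shows "cmul D (prodl us) (cmul D x (prodl ws)) \<in> I"
  by (intro ideal_D(5,6)[OF I] assms(3) prodl_keys assms)

text \<open>\<open>vv\<close> is additive and balanced, so by \<open>sz_cong\<close> the chosen
  preimages are additive and balanced modulo \<open>I\<close>. Multiplying by the outer letters
  stays inside \<open>I\<close>.\<close>

lemma Psi_N:
  assumes "f \<in> N n"
  shows "Psi f \<in> I"
proof (rule N_map[OF _ _ _ _ ideal_D(1)[OF I] I_diff assms])
  fix us v ws v' assume "us @ v # ws \<in> W n" and v': "v' \<in> carrier V"
  then have m: "set us \<subseteq> carrier V" "set ws \<subseteq> carrier V" "v \<in> carrier V" by auto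
  have vs: "v \<oplus>\<^bsub>V\<^esub> v' \<in> carrier V" using V_ops(1)[OF m(3) v', of 0 0] by simp
  have s: "Poly_Mapping.keys (sz v + sz v') \<subseteq> M1" using sz[OF m(3)] sz[OF v'] by (intro keys_add_subset) auto
  have "sz (v \<oplus>\<^bsub>V\<^esub> v') - (sz v + sz v') \<in> I"
    by (rule sz_cong[OF vs s]) (use vv_add[of "sz v" "sz v'"] sz[OF m(3)] sz[OF v'] in simp)
  from prodl_middle[OF m(1,2) this] show "Psi (frag_of (us @ (v \<oplus>\<^bsub>V\<^esub> v') # ws)) - Psi (frag_of (us @ v # ws)) - Psi (frag_of (us @ v' # ws)) \<in> I"
    using m vs v' by (simp add: prodl_append cmul_diff_left cmul_diff_right cmul_add_left cmul_add_right algebra_simps)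
next
  fix us v v' ws b assume "us @ v # v' # ws \<in> W n" and b: "b \<in> kC"
  then have m: "set us \<subseteq> carrier V" "set ws \<subseteq> carrier V" "v \<in> carrier V" "v' \<in> carrier V" by auto
  have c: "rsmult V v b \<in> carrier V" "b \<odot>\<^bsub>V\<^esub> v' \<in> carrier V" using V_ops(2,3)[OF m(4,3) b b] V_ops(3)[OF m(3,4) b b] by auto
  have b': "Poly_Mapping.keys b \<subseteq> mor C" using b by simp
  note s = sz[OF m(3), THEN conjunct1] sz[OF m(4), THEN conjunct1]
  have sv: "vv (sz v) = v" "vv (sz v') = v'" using sz m by auto
  have 1: "sz (rsmult V v b) - cmul D (sz v) (emb b) \<in> I"
    by (rule sz_cong[OF c(1) M1_cmul(2)[OF s(1) b']]) (use vv_right[OF s(1) b'] sv in simp)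
  have 2: "sz (b \<odot>\<^bsub>V\<^esub> v') - cmul D (emb b) (sz v') \<in> I"
    by (rule sz_cong[OF c(2) M1_cmul(1)[OF s(2) b']]) (use vv_left[OF s(2) b'] sv in simp)
  note k = sz_keys[OF m(3)] sz_keys[OF m(4)] sz_keys[OF c(1)] sz_keys[OF c(2)] emb_closed[OF b']
  \<comment> \<open>Both preimage errors are subtracted; the middle terms, the product of
    \<open>sz v\<close>, \<open>emb b\<close> and \<open>sz v'\<close> bracketed in two ways, cancel
    by associativity.\<close>
  have "cmul D (sz (rsmult V v b) - cmul D (sz v) (emb b)) (sz v') - cmul D (sz v) (sz (b \<odot>\<^bsub>V\<^esub> v') - cmul D (emb b) (sz v')) \<in> I"
    by (intro I_diff ideal_D(5,6)[OF I] 1 2 k)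
  then have "cmul D (sz (rsmult V v b)) (sz v') - cmul D (sz v) (sz (b \<odot>\<^bsub>V\<^esub> v')) \<in> I"
    using k by (simp add: cmul_diff_left cmul_diff_right D.cmul_assoc)
  from prodl_middle[OF m(1,2) this] show "Psi (frag_of (us @ rsmult V v b # v' # ws)) - Psi (frag_of (us @ v # (b \<odot>\<^bsub>V\<^esub> v') # ws)) \<in> I"
    using m c k by (simp add: prodl_append prodl_keys cmul_diff_left cmul_diff_right D.cmul_assoc D.cmul_closed)
qed simp_all

text \<open>Each letter is \<open>vv\<close> of a known element, whose chosen preimage agrees with
  it modulo \<open>I\<close>; the errors are passed through the product letter by letter.\<close>

lemma prodl_wd: "chain ws \<Longrightarrow> prodl (wd k ws) - Poly_Mapping.single (compl ws) k \<in> I"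
proof (induction ws arbitrary: k)
  case (Cons w ws)
  have w: "w \<in> M1" using Cons by simp
  have c: "vv (Poly_Mapping.single w k) \<in> carrier V" by (rule vv_single_closed[OF w])
  have 1: "sz (vv (Poly_Mapping.single w k)) - Poly_Mapping.single w k \<in> I"
    by (rule sz_cong[OF c M1_single[OF w] refl])
  show ?case
  proof (cases "ws = []")
    case True
    then show ?thesis using 1 sz_keys[OF c] by (simp add: wd_def D.cmul_cone_right)
  next
    case False
    then have ch: "chain ws" "src D w = trg D (compl ws)" using Cons by auto
    note h = chainD[OF ch(1)]
    have p: "Poly_Mapping.keys (prodl (wd 1 ws)) \<subseteq> mor D"
      using wd_W[OF h(1,2), of 1] by (intro prodl_keys) (simp add: W_iff)
    have kw: "Poly_Mapping.keys (Poly_Mapping.single w k) \<subseteq> mor D" using w by simp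
    have "cmul D (sz (vv (Poly_Mapping.single w k)) - Poly_Mapping.single w k) (prodl (wd 1 ws)) +
      cmul D (Poly_Mapping.single w k) (prodl (wd 1 ws) - Poly_Mapping.single (compl ws) 1) \<in> I"
      by (intro ideal_D(2)[OF I] ideal_D(5,6)[OF I] 1 Cons.IH[OF ch(1)] p kw)
    moreover have "cmul D (Poly_Mapping.single w k) (Poly_Mapping.single (compl ws) 1) = Poly_Mapping.single (comp D w (compl ws)) k"
      using ch(2) by (simp add: cmul_single)
    ultimately show ?thesis using False by (simp add: wd_Cons cmul_diff_left cmul_diff_right)
  qed
qed simp

text \<open>The homogeneous part of \<open>u\<close> in degree \<open>n\<close> agrees modulo
  \<open>I\<close> with \<open>Psi\<close> of its words, and these words are relations when the
  image vanishes. In degree zero \<open>emb\<close> inverts the projection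
  \<open>p0\<close>.\<close>

lemma Gam_kernel:
  assumes u: "Poly_Mapping.keys u \<subseteq> mor D" and G: "Gam u = Gam 0"
  shows "u \<in> I"
proof -
  have p: "p0 u = 0" and g: "\<And>n. 1 \<le> n \<Longrightarrow> gam n u \<in> N n" using G by (simp_all add: Gam_eq_iff eqv_zero_iff)
  let ?pt = "\<lambda>n. \<Sum>w\<in>{w \<in> Poly_Mapping.keys u. dg w = n}. Poly_Mapping.single w (Poly_Mapping.lookup u w)"
  have "u = (\<Sum>w\<in>Poly_Mapping.keys u. Poly_Mapping.single w (Poly_Mapping.lookup u w))"
    by (rule pm_expand[OF finite_keys subset_refl])
  also have "\<dots> = (\<Sum>n\<in>dg ` Poly_Mapping.keys u. ?pt n)" by (rule sum.image_gen[OF finite_keys])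
  finally have "u = (\<Sum>n\<in>dg ` Poly_Mapping.keys u. ?pt n)" .
  moreover have "?pt n \<in> I" for n
  proof (cases "n = 0")
    case True
    \<comment> \<open>Degree zero morphisms are exactly the image of \<open>iota\<close>, so this
      part is recovered from \<open>p0 u\<close> without words.\<close>
    have "?pt 0 = emb (p0 u)"
    proof -
      have "emb (p0 u) = (\<Sum>w\<in>Poly_Mapping.keys u. if dg w = 0 then Poly_Mapping.single w (Poly_Mapping.lookup u w) else 0)"
        unfolding p0_def lext_def emb_sum
      proof (rule sum.cong[OF refl])
        fix w assume w: "w \<in> Poly_Mapping.keys u"
        show "emb (scal (Poly_Mapping.lookup u w) (if dg w = 0 then Poly_Mapping.single (the_inv_into (mor C) iota w) 1 else 0)) =
          (if dg w = 0 then Poly_Mapping.single w (Poly_Mapping.lookup u w) else 0)"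
        proof (cases "dg w = 0")
          case True
          then obtain c where "c \<in> mor C" "w = iota c" using iota_surj[of w] w u by blast
          then show ?thesis using True by (simp add: the_inv_into_f_f[OF iota_inj])
        qed simp
      qed
      also have "\<dots> = ?pt 0" by (rule sum.inter_filter[OF finite_keys, symmetric])
      finally show ?thesis ..
    qed
    then show ?thesis using True p ideal_D(1)[OF I] by simp
  next
    case False
    then have n: "1 \<le> n" by simp
    have "Psi (gam n u) \<in> I" by (rule Psi_N[OF g[OF n]])
    moreover have "Psi (gam n u) - ?pt n \<in> I"
      unfolding gam_def Psi_sum sum_subtractf[symmetric]
    proof (rule I_sum)
      fix w assume "w \<in> {w \<in> Poly_Mapping.keys u. dg w = n}"
      then have w: "w \<in> mor D" "dg w = n" using u by auto
      note f = fc[OF w n]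
      show "Psi (tau (Poly_Mapping.lookup u w) w) - Poly_Mapping.single w (Poly_Mapping.lookup u w) \<in> I"
        using prodl_wd[OF f(1)] f(2) by (simp add: tau_def)
    qed
    ultimately have "Psi (gam n u) - (Psi (gam n u) - ?pt n) \<in> I" by (rule I_diff)
    then show ?thesis by simp
  qed
  ultimately show ?thesis using I_sum[of "dg ` Poly_Mapping.keys u" ?pt] by simp
qed

end

abbreviation B :: "('k, 'n \<Rightarrow>\<^sub>0 'k) module" where
  "B \<equiv> category_algebra D"

lemma Gam_ring_hom: "Gam \<in> ring_hom B T"
  by (rule ring_hom_memI) (simp_all add: Gam_closed Gam_mult Gam_add Gam_one)

lemma Gam_image: "Gam ` carrier B = carrier T"
proof (rule subset_antisym)
  show "Gam ` carrier B \<subseteq> carrier T" using Gam_closed by auto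
  show "carrier T \<subseteq> Gam ` carrier B"
  proof
    fix z assume "z \<in> carrier T"
    then obtain u where "Poly_Mapping.keys u \<subseteq> mor D" "Gam u = z" using Gam_surj by blast
    then show "z \<in> Gam ` carrier B" by auto
  qed
qed

text \<open>\<open>Gam\<close> respects the operations and is onto, and the image of a ring under
  such a map is a ring. Associativity and distributivity of the tensor product are inherited in this
  way.\<close>

lemma T_ring: "ring T"
proof -
  interpret B: ring B by (rule D.category_algebra_ring)
  have "ring (T \<lparr> carrier := Gam ` carrier B, zero := Gam \<zero>\<^bsub>B\<^esub> \<rparr>)"
    by (rule B.ring_hom_imp_img_ring[OF Gam_ring_hom])
  moreover have "T \<lparr> carrier := Gam ` carrier B, zero := Gam \<zero>\<^bsub>B\<^esub> \<rparr> = T"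
    unfolding Gam_image by (simp add: Gam_zero)
  ultimately show ?thesis by simp
qed

text \<open>\<open>Gam_kernel\<close>, applied to the ideal generated by \<open>rho\<close>, gives
  one inclusion, and minimality of that ideal the other. The homomorphism theorem for rings does not
  mention scalars, so these are treated separately on cosets.\<close>

theorem quotient_tensor_algebra: "quotient_algebra B (Idl\<^bsub>B\<^esub> {rho}) \<cong>\<^sub>a\<^sub>l\<^sub>g T"
proof -
  interpret B: ring B by (rule D.category_algebra_ring)
  interpret T: ring T by (rule T_ring)
  interpret G: ring_hom_ring B T Gam
    by (rule ring_hom_ringI2[OF B.ring_axioms T.ring_axioms Gam_ring_hom])
  let ?I = "Idl\<^bsub>B\<^esub> {rho}"
  have rc: "{rho} \<subseteq> carrier B" using rho_keys by auto
  have I: "ideal ?I B" by (rule B.genideal_ideal[OF rc])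
  interpret I: ideal ?I B by (rule I)
  have rI: "rho \<in> ?I" using B.genideal_self[OF rc] by blast
  have ker: "a_kernel B T Gam = {u \<in> carrier B. Gam u = Gam 0}"
    by (simp only: a_kernel_def' Gam_zero)
  have kerI: "a_kernel B T Gam = ?I"
  proof (rule subset_antisym)
    show "a_kernel B T Gam \<subseteq> ?I" 
    proof
      fix u assume "u \<in> a_kernel B T Gam"
      then have "Poly_Mapping.keys u \<subseteq> mor D" "Gam u = Gam 0" unfolding ker by simp_all
      then show "u \<in> ?I" by (rule Gam_kernel[OF I rI])
    qed
    show "?I \<subseteq> a_kernel B T Gam"
    proof (rule B.genideal_minimal[OF G.kernel_is_ideal])
      show "{rho} \<subseteq> a_kernel B T Gam" unfolding ker using rc Gam_rho by blast
    qed
  qed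
  let ?h = "\<lambda>S. the_elem (Gam ` S)"
  have iso: "?h \<in> ring_iso (B Quot ?I) T"
    using G.FactRing_iso_set[OF Gam_image] by (simp add: kerI)
  have hx: "?h (?I +>\<^bsub>B\<^esub> x) = Gam x" if "x \<in> carrier B" for x
    using G.the_elem_simp[of x] that by (simp add: kerI)
  have car: "carrier (B Quot ?I) = {?I +>\<^bsub>B\<^esub> x | x. x \<in> carrier B}"
    by (auto simp: FactRing_def A_RCOSETS_def')
  have h1: "?h \<in> ring_iso (quotient_algebra B ?I) T"
    using iso by (simp add: quotient_algebra_def ring_iso_def ring_hom_def ring.defs)
  have cq: "carrier (quotient_algebra B ?I) = carrier (B Quot ?I)"
    by (simp add: quotient_algebra_def ring.defs)
  have h2: "?h (c \<odot>\<^bsub>quotient_algebra B ?I\<^esub> S) = c \<odot>\<^bsub>T\<^esub> ?h S"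
    if S: "S \<in> carrier (quotient_algebra B ?I)" for c S
  proof -
    obtain x where x: "x \<in> carrier B" "S = ?I +>\<^bsub>B\<^esub> x"
      using S unfolding cq car by blast
    have "Poly_Mapping.keys x \<subseteq> mor D" using x(1) by simp
    then have sx: "scal c x \<in> carrier B" using order_trans[OF keys_scal, of x "mor D" c] by simp
    have "?I +>\<^bsub>B\<^esub> (scal c y) = ?I +>\<^bsub>B\<^esub> (scal c x)" if y: "y \<in> S" for y
    proof -
      obtain i where i: "i \<in> ?I" "y = i + x" using y x by (auto simp: a_r_coset_def')
      have ik: "Poly_Mapping.keys i \<subseteq> mor D" by (rule ideal_D(4)[OF I i(1)])
      have k: "Poly_Mapping.keys (scal c (cone D :: 'n \<Rightarrow>\<^sub>0 'k)) \<subseteq> mor D" by (rule order_trans[OF keys_scal D.cone_closed])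
      \<comment> \<open>Scaling is multiplication by a multiple of the unit, hence preserves the
        ideal and is well defined on cosets.\<close>
      have "scal c i \<in> ?I" using ideal_D(5)[OF I i(1) k] ik by (simp add: cmul_scal_left D.cmul_cone_left)
      then have m: "scal c y \<in> ?I +>\<^bsub>B\<^esub> (scal c x)" by (auto simp: i(2) scal_add a_r_coset_def')
      from sx have "scal c x \<in> carrier B" .
      from B.a_repr_independence[OF m this I.a_subgroup] show ?thesis by simp
    qed
    moreover have "x \<in> S" using I.a_rcos_self[OF x(1)] x(2) by simp
    ultimately have "(\<Union>y\<in>S. ?I +>\<^bsub>B\<^esub> (scal c y)) = ?I +>\<^bsub>B\<^esub> (scal c x)" by blast
    then have "c \<odot>\<^bsub>quotient_algebra B ?I\<^esub> S = ?I +>\<^bsub>B\<^esub> (scal c x)"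
      by (simp add: quotient_algebra_def ring.defs module.defs)
    moreover note sx
    ultimately show ?thesis using hx x Gam_scal[of x c] by simp
  qed
  show ?thesis unfolding algebra_isomorphic_def by (intro bexI[OF _ h1] allI ballI h2)
qed

end

section \<open>The category of an EI quiver\<close>

text \<open>Lists are read in the order of composition, so this describes a walk along the reversed
  list, see \<open>awalk_rev\<close>. The empty list is excluded because trivial paths are covered
  by the constructor \<open>Triv\<close>.\<close>

fun pth :: "('v, 'a) pre_digraph \<Rightarrow> 'a list \<Rightarrow> bool" where
  "pth Q [] = False"
| "pth Q [a] = (a \<in> arcs Q)"
| "pth Q (a # b # p) = (a \<in> arcs Q \<and> tail Q a = head Q b \<and> pth Q (b # p))"

lemma pth_ne: "pth Q p \<Longrightarrow> p \<noteq> []"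
  by auto

lemma pth_Cons: "p \<noteq> [] \<Longrightarrow> pth Q (a # p) \<longleftrightarrow> a \<in> arcs Q \<and> tail Q a = head Q (hd p) \<and> pth Q p"
  by (cases p) auto

lemma pth_append: "p \<noteq> [] \<Longrightarrow> q \<noteq> [] \<Longrightarrow> pth Q (p @ q) \<longleftrightarrow> pth Q p \<and> pth Q q \<and> tail Q (last p) = head Q (hd q)"
proof (induction p)
  case (Cons a p)
  then show ?case by (cases "p = []") (auto simp: pth_Cons)
qed simp

lemma pth_set: "pth Q p \<Longrightarrow> set p \<subseteq> arcs Q"
  by (induction Q p rule: pth.induct) auto

lemma (in wf_digraph) awalk_rev:
  "p \<noteq> [] \<Longrightarrow> (\<exists>u. awalk u (rev p) v) \<longleftrightarrow> pth G p \<and> v = head G (hd p)"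
proof (induction p arbitrary: v)
  case (Cons a p)
  show ?case
  proof (cases "p = []")
    case True
    then show ?thesis by (auto simp: awalk_Cons_iff awalk_Nil_iff intro: exI[of _ "tail G a"])
  next
    case False
    have "(\<exists>u. awalk u (rev (a # p)) v) \<longleftrightarrow> (\<exists>u. awalk u (rev p) (tail G a)) \<and> a \<in> arcs G \<and> v = head G a"
    proof (intro iffI conjI)
      assume "\<exists>u. awalk u (rev (a # p)) v"
      then obtain u where "awalk u (rev p @ [a]) v" by auto
      then have u: "awalk u (rev p) (awlast u (rev p))" "awalk (awlast u (rev p)) [a] v"
        unfolding awalk_append_iff by blast+
      from u(2) have "awlast u (rev p) = tail G a" "a \<in> arcs G" "v = head G a"
        by (auto simp: awalk_Cons_iff awalk_Nil_iff)
      with u(1) show "\<exists>u. awalk u (rev p) (tail G a)" "a \<in> arcs G" "v = head G a" by auto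
    next
      assume "(\<exists>u. awalk u (rev p) (tail G a)) \<and> a \<in> arcs G \<and> v = head G a"
      then obtain u where "awalk u (rev p) (tail G a)" "a \<in> arcs G" "v = head G a" by blast
      then have "awalk u (rev p @ [a]) v" by (auto intro: awalk_appendI arc_implies_awalk)
      then show "\<exists>u. awalk u (rev (a # p)) v" by auto
    qed
    then show ?thesis using Cons.IH[OF False, of "tail G a"] False by (auto simp: pth_Cons)
  qed
qed simp

text \<open>Between two occurrences of one arrow a path encloses a closed walk. In an acyclic quiver
  the arrows of a path are therefore distinct, which bounds its length.\<close>

lemma (in fin_digraph) finite_pth:
  assumes "acyclic_quiver G"
  shows "finite {p. pth G p}"
proof (rule finite_subset)
  show "finite {p. set p \<subseteq> arcs G \<and> distinct p}"
    by (rule finite_subset_distinct) simp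
  show "{p. pth G p} \<subseteq> {p. set p \<subseteq> arcs G \<and> distinct p}"
  proof (rule subsetI, rule CollectI, rule conjI)
    fix p assume "p \<in> {p. pth G p}"
    then have p: "pth G p" by simp
    then show "set p \<subseteq> arcs G" by (rule pth_set)
    show "distinct p"
    proof (rule ccontr)
      assume "\<not> distinct p"
      then obtain xs ys zs y where d: "p = xs @ [y] @ ys @ [y] @ zs" using not_distinct_decomp by blast
      let ?c = "y # ys @ [y]"
      have "pth G ((?c @ zs))"
        using p unfolding d by (cases "xs = []") (auto simp: pth_append)
      then have c: "pth G ?c" using pth_append[of ?c zs] by (cases "zs = []") auto
      have "pth G (y # ys)" "head G (hd (y # ys)) = tail G (last (y # ys))"
        using c pth_append[of "y # ys" "[y]" G] by auto
      then obtain u where u: "awalk u (rev (y # ys)) (head G y)" using awalk_rev[of "y # ys"] by auto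
      \<comment> \<open>The reversed walk begins with the last arrow of the list, whose tail is the
        starting vertex.\<close>
      have "u = tail G (last (y # ys))"
      proof -
        have "awalk u (last (y # ys) # rev (butlast (y # ys))) (head G y)"
          using u by (metis append_butlast_last_id list.distinct(1) rev.simps(2) rev_append append_Nil append_Cons rev_singleton_conv rev_rev_ident)
        then show ?thesis by (simp add: awalk_Cons_iff)
      qed
      then have "awalk u (rev (y # ys)) u" using u \<open>head G (hd (y # ys)) = tail G (last (y # ys))\<close> by simp
      then show False using assms unfolding acyclic_quiver_def by blast
    qed
  qed
qed

section \<open>Tuples along a path and their equivalence\<close>

definition tup :: "('v, 'a, 'g, 'x) assignment \<Rightarrow> 'a list \<Rightarrow> 'x list \<Rightarrow> bool" where
  "tup X p xs \<longleftrightarrow> list_all2 (\<lambda>\<alpha> x. x \<in> bcarrier (abis X \<alpha>)) p xs"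

definition gl :: "('v, 'a, 'g, 'x) assignment \<Rightarrow> 'a list \<Rightarrow> 'g \<Rightarrow> 'x list \<Rightarrow> 'x list" where
  "gl X p g xs = lact (abis X (hd p)) g (hd xs) # tl xs"

definition gr :: "('v, 'a, 'g, 'x) assignment \<Rightarrow> 'a list \<Rightarrow> 'x list \<Rightarrow> 'g \<Rightarrow> 'x list" where
  "gr X p xs g = butlast xs @ [ract (abis X (last p)) (last xs) g]"

text \<open>
  A recursive description of \<^const>\<open>path_equiv\<close>: from left to right, a group element is moved across
  each pair of neighbouring positions.
\<close>

fun peq :: "('v, 'a) pre_digraph \<Rightarrow> ('v, 'a, 'g, 'x) assignment \<Rightarrow> 'a list \<Rightarrow> 'x list \<Rightarrow> 'x list \<Rightarrow> bool" where
  "peq Q X [a] xs xs' = (xs = xs')"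
| "peq Q X (a # p) (x # xs) (x' # xs') = (\<exists>g\<in>carrier (vgrp X (tail Q a)).
      x' = ract (abis X a) x g \<and> peq Q X p xs (gl X p g xs'))"
| "peq Q X _ _ _ = False"

lemma tup_Nil [simp]: "tup X [] xs \<longleftrightarrow> xs = []"
  and tup_Cons: "tup X (a # p) xs \<longleftrightarrow> (\<exists>x ys. xs = x # ys \<and> x \<in> bcarrier (abis X a) \<and> tup X p ys)"
  and tup_Cons_Cons [simp]: "tup X (a # p) (x # ys) \<longleftrightarrow> x \<in> bcarrier (abis X a) \<and> tup X p ys"
  by (auto simp: tup_def list_all2_Cons1)

lemma tup_length: "tup X p xs \<Longrightarrow> length xs = length p"
  by (simp add: tup_def list_all2_lengthD)

lemma tup_append: "length xs = length p \<Longrightarrow> tup X (p @ q) (xs @ ys) \<longleftrightarrow> tup X p xs \<and> tup X q ys"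
  by (simp add: tup_def list_all2_append)

lemma tup_append_ex: "tup X (p @ q) zs \<Longrightarrow> \<exists>xs ys. zs = xs @ ys \<and> tup X p xs \<and> tup X q ys"
  by (auto simp: tup_def list_all2_append1)

lemma tup_ne: "tup X p xs \<Longrightarrow> p \<noteq> [] \<Longrightarrow> xs \<noteq> []"
  by (cases p) (auto simp: tup_Cons)

lemma peq_Cons: "p \<noteq> [] \<Longrightarrow> peq Q X (a # p) (x # xs) (x' # xs') \<longleftrightarrow> (\<exists>g\<in>carrier (vgrp X (tail Q a)).
      x' = ract (abis X a) x g \<and> peq Q X p xs (gl X p g xs'))"
  by (cases p) auto

lemma gl_simp [simp]: "gl X (a # p) g (x # xs) = lact (abis X a) g x # xs"
  by (simp add: gl_def)

lemma gr_single [simp]: "gr X [a] [x] g = [ract (abis X a) x g]"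
  by (simp add: gr_def)

lemma gr_Cons [simp]: "p \<noteq> [] \<Longrightarrow> xs \<noteq> [] \<Longrightarrow> gr X (a # p) (x # xs) g = x # gr X p xs g"
  by (simp add: gr_def)

context finite_EI_quiver
begin

lemma grp: "i \<in> verts Q \<Longrightarrow> group (vgrp X i)"
  by (rule vgrp_group)

lemma arc_verts [simp]: "a \<in> arcs Q \<Longrightarrow> head Q a \<in> verts Q" "a \<in> arcs Q \<Longrightarrow> tail Q a \<in> verts Q"
  by auto

lemma pth_verts: assumes "pth Q p" shows "head Q (hd p) \<in> verts Q" "tail Q (last p) \<in> verts Q"
proof -
  have "hd p \<in> arcs Q" "last p \<in> arcs Q" using pth_set[OF assms] pth_ne[OF assms] by (auto simp: subset_iff)
  then show "head Q (hd p) \<in> verts Q" "tail Q (last p) \<in> verts Q" by auto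
qed

abbreviation hg :: "'a \<Rightarrow> 'g set" where "hg a \<equiv> carrier (vgrp X (head Q a))"
abbreviation tg :: "'a \<Rightarrow> 'g set" where "tg a \<equiv> carrier (vgrp X (tail Q a))"

lemma act:
  assumes a: "a \<in> arcs Q" and x: "x \<in> bcarrier (abis X a)"
  shows "g \<in> hg a \<Longrightarrow> lact (abis X a) g x \<in> bcarrier (abis X a)"
    "h \<in> tg a \<Longrightarrow> ract (abis X a) x h \<in> bcarrier (abis X a)"
    "lact (abis X a) \<one>\<^bsub>vgrp X (head Q a)\<^esub> x = x"
    "ract (abis X a) x \<one>\<^bsub>vgrp X (tail Q a)\<^esub> = x"
    "g \<in> hg a \<Longrightarrow> g' \<in> hg a \<Longrightarrow> lact (abis X a) (g \<otimes>\<^bsub>vgrp X (head Q a)\<^esub> g') x = lact (abis X a) g (lact (abis X a) g' x)"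
    "h \<in> tg a \<Longrightarrow> h' \<in> tg a \<Longrightarrow> ract (abis X a) x (h \<otimes>\<^bsub>vgrp X (tail Q a)\<^esub> h') = ract (abis X a) (ract (abis X a) x h) h'"
    "g \<in> hg a \<Longrightarrow> h \<in> tg a \<Longrightarrow> ract (abis X a) (lact (abis X a) g x) h = lact (abis X a) g (ract (abis X a) x h)"
proof -
  interpret B: biset "vgrp X (head Q a)" "vgrp X (tail Q a)" "abis X a" by (rule abis_biset[OF a])
  show "g \<in> hg a \<Longrightarrow> lact (abis X a) g x \<in> bcarrier (abis X a)" by (rule B.lact_closed[OF _ x])
  show "h \<in> tg a \<Longrightarrow> ract (abis X a) x h \<in> bcarrier (abis X a)" by (rule B.ract_closed[OF _ x])
  show "lact (abis X a) \<one>\<^bsub>vgrp X (head Q a)\<^esub> x = x" by (rule B.lact_one[OF x])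
  show "ract (abis X a) x \<one>\<^bsub>vgrp X (tail Q a)\<^esub> = x" by (rule B.ract_one[OF x])
  show "g \<in> hg a \<Longrightarrow> g' \<in> hg a \<Longrightarrow> lact (abis X a) (g \<otimes>\<^bsub>vgrp X (head Q a)\<^esub> g') x = lact (abis X a) g (lact (abis X a) g' x)"
    by (rule B.lact_mult[OF _ _ x])
  show "h \<in> tg a \<Longrightarrow> h' \<in> tg a \<Longrightarrow> ract (abis X a) x (h \<otimes>\<^bsub>vgrp X (tail Q a)\<^esub> h') = ract (abis X a) (ract (abis X a) x h) h'"
    by (rule B.ract_mult[OF _ _ x])
  show "g \<in> hg a \<Longrightarrow> h \<in> tg a \<Longrightarrow> ract (abis X a) (lact (abis X a) g x) h = lact (abis X a) g (ract (abis X a) x h)"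
    by (rule B.act_commute[OF _ _ x])
qed

lemma gl_props:
  assumes p: "pth Q p" and xs: "tup X p xs"
  shows "g \<in> hg (hd p) \<Longrightarrow> tup X p (gl X p g xs)"
    "gl X p \<one>\<^bsub>vgrp X (head Q (hd p))\<^esub> xs = xs"
    "g \<in> hg (hd p) \<Longrightarrow> g' \<in> hg (hd p) \<Longrightarrow> gl X p (g \<otimes>\<^bsub>vgrp X (head Q (hd p))\<^esub> g') xs = gl X p g (gl X p g' xs)"
proof -
  obtain a p' where pp: "p = a # p'" using pth_ne[OF p] by (cases p) auto
  obtain x ys where xx: "xs = x # ys" "x \<in> bcarrier (abis X a)" "tup X p' ys" using xs pp by (auto simp: tup_Cons)
  have a: "a \<in> arcs Q" using pth_set[OF p] pp by simp
  note A = act[OF a xx(2)]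
  show "g \<in> hg (hd p) \<Longrightarrow> tup X p (gl X p g xs)" using A(1) xx pp by simp
  show "gl X p \<one>\<^bsub>vgrp X (head Q (hd p))\<^esub> xs = xs" using A(3) xx pp by simp
  show "g \<in> hg (hd p) \<Longrightarrow> g' \<in> hg (hd p) \<Longrightarrow> gl X p (g \<otimes>\<^bsub>vgrp X (head Q (hd p))\<^esub> g') xs = gl X p g (gl X p g' xs)"
    using A(5) xx pp by simp
qed

lemma gr_props:
  assumes p: "pth Q p" and xs: "tup X p xs"
  shows "g \<in> tg (last p) \<Longrightarrow> tup X p (gr X p xs g)"
    "gr X p xs \<one>\<^bsub>vgrp X (tail Q (last p))\<^esub> = xs"
    "g \<in> tg (last p) \<Longrightarrow> g' \<in> tg (last p) \<Longrightarrow> gr X p xs (g \<otimes>\<^bsub>vgrp X (tail Q (last p))\<^esub> g') = gr X p (gr X p xs g) g'"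
    "g \<in> hg (hd p) \<Longrightarrow> h \<in> tg (last p) \<Longrightarrow> gr X p (gl X p g xs) h = gl X p g (gr X p xs h)"
proof -
  obtain a p' where pp: "p = p' @ [a]" using pth_ne[OF p] by (cases p rule: rev_cases) auto
  obtain ys x where xx: "xs = ys @ [x]" "x \<in> bcarrier (abis X a)" "tup X p' ys"
    using tup_append_ex[of X p' "[a]" xs] xs pp by (auto simp: tup_Cons)
  have a: "a \<in> arcs Q" using pth_set[OF p] pp by simp
  note A = act[OF a xx(2)]
  have l: "length ys = length p'" by (rule tup_length[OF xx(3)])
  show "g \<in> tg (last p) \<Longrightarrow> tup X p (gr X p xs g)" using A(2) xx pp l by (simp add: gr_def tup_append)
  show "gr X p xs \<one>\<^bsub>vgrp X (tail Q (last p))\<^esub> = xs" using A(4) xx pp by (simp add: gr_def)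
  show "g \<in> tg (last p) \<Longrightarrow> g' \<in> tg (last p) \<Longrightarrow> gr X p xs (g \<otimes>\<^bsub>vgrp X (tail Q (last p))\<^esub> g') = gr X p (gr X p xs g) g'"
    using A(6) xx pp by (simp add: gr_def)
  show "g \<in> hg (hd p) \<Longrightarrow> h \<in> tg (last p) \<Longrightarrow> gr X p (gl X p g xs) h = gl X p g (gr X p xs h)"
  proof (cases p')
    case Nil
    then show "g \<in> hg (hd p) \<Longrightarrow> h \<in> tg (last p) \<Longrightarrow> ?thesis" using A(7) xx pp by simp
  next
    case (Cons b q)
    then obtain y zs where "ys = y # zs" using xx(3) by (auto simp: tup_Cons)
    then show ?thesis using xx pp Cons by (simp add: gr_def gl_def)
  qed
qed

lemma peq_refl: "pth Q p \<Longrightarrow> tup X p xs \<Longrightarrow> peq Q X p xs xs"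
proof (induction p arbitrary: xs)
  case (Cons a p)
  show ?case
  proof (cases "p = []")
    case False
    obtain x ys where x: "xs = x # ys" "x \<in> bcarrier (abis X a)" "tup X p ys" using Cons(3) by (auto simp: tup_Cons)
    have p: "pth Q p" "a \<in> arcs Q" "tail Q a = head Q (hd p)" using Cons(2) False by (auto simp: pth_Cons)
    interpret G: group "vgrp X (tail Q a)" by (rule grp[OF arc_verts(2)[OF p(2)]])
    show ?thesis
      unfolding x(1) peq_Cons[OF False]
      by (intro bexI[OF _ G.one_closed] conjI)
        (use Cons.IH[OF p(1) x(3)] gl_props(2)[OF p(1) x(3)] act(4)[OF p(2) x(2)] p(3) in simp_all)
  qed simp
qed simp

lemma peq_gl:
  "pth Q p \<Longrightarrow> tup X p xs \<Longrightarrow> tup X p ys \<Longrightarrow> g \<in> hg (hd p) \<Longrightarrow> peq Q X p xs ys \<Longrightarrow> peq Q X p (gl X p g xs) (gl X p g ys)"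
proof (cases p)
  case (Cons a p')
  assume *: "pth Q p" "tup X p xs" "tup X p ys" "g \<in> hg (hd p)" "peq Q X p xs ys"
  show ?thesis
  proof (cases "p' = []")
    case False
    obtain x xs' y ys' where x: "xs = x # xs'" "x \<in> bcarrier (abis X a)" "ys = y # ys'" "y \<in> bcarrier (abis X a)"
      using * Cons by (auto simp: tup_Cons)
    have a: "a \<in> arcs Q" using *(1) Cons False by (simp add: pth_Cons)
    have "peq Q X (a # p') (x # xs') (y # ys')" using *(5) x Cons by simp
    then obtain h where h: "h \<in> tg a" "y = ract (abis X a) x h" "peq Q X p' xs' (gl X p' h ys')"
      unfolding peq_Cons[OF False] by blast
    then show ?thesis using act(7)[OF a x(2)] * x Cons False by (auto simp: peq_Cons)
  qed (use * Cons in auto)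
qed simp

text \<open>The element moved across the first gap is replaced by its inverse; \<open>peq_gl\<close>
  shifts the equivalence of the tails accordingly before the induction applies.\<close>

lemma peq_sym:
  "pth Q p \<Longrightarrow> tup X p xs \<Longrightarrow> tup X p ys \<Longrightarrow> peq Q X p xs ys \<Longrightarrow> peq Q X p ys xs"
proof (induction p arbitrary: xs ys)
  case (Cons a p)
  show ?case
  proof (cases "p = []")
    case False
    obtain x xs' y ys' where x: "xs = x # xs'" "x \<in> bcarrier (abis X a)" "tup X p xs'"
      "ys = y # ys'" "y \<in> bcarrier (abis X a)" "tup X p ys'"
      using Cons by (auto simp: tup_Cons)
    have p: "pth Q p" "a \<in> arcs Q" "tail Q a = head Q (hd p)" using Cons(2) False by (auto simp: pth_Cons)
    interpret G: group "vgrp X (tail Q a)" by (rule grp[OF arc_verts(2)[OF p(2)]])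
    have "peq Q X (a # p) (x # xs') (y # ys')" using Cons(5) x by simp
    then obtain h where h: "h \<in> tg a" "y = ract (abis X a) x h" "peq Q X p xs' (gl X p h ys')"
      unfolding peq_Cons[OF False] by blast
    let ?h = "inv\<^bsub>vgrp X (tail Q a)\<^esub> h"
    have ih: "?h \<in> tg a" using h by simp
    have hh: "h \<in> hg (hd p)" "?h \<in> hg (hd p)" using h ih p by auto
    have t: "tup X p (gl X p h ys')" by (rule gl_props(1)[OF p(1) x(6) hh(1)])
    have "gl X p ?h (gl X p h ys') = ys'"
      using gl_props(3)[OF p(1) x(6) hh(2,1)] gl_props(2)[OF p(1) x(6)] G.l_inv[OF h(1)] p(3) by simp
    then have "peq Q X p (gl X p ?h xs') ys'" using peq_gl[OF p(1) x(3) t hh(2) h(3)] by simp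
    then have "peq Q X p ys' (gl X p ?h xs')"
      using Cons.IH[OF p(1) gl_props(1)[OF p(1) x(3) hh(2)] x(6)] by simp
    moreover have "x = ract (abis X a) y ?h"
      using act(6)[OF p(2) x(2) h(1) ih] act(4)[OF p(2) x(2)] G.r_inv[OF h(1)] h(2) by simp
    ultimately show ?thesis unfolding x peq_Cons[OF False] using ih by blast
  qed (use Cons in auto)
qed simp

text \<open>The elements \<open>h\<close> and \<open>k\<close> moved across the first gap multiply
  to \<open>h k\<close>; the second equivalence of tails is first translated by
  \<open>h\<close>.\<close>

lemma peq_trans:
  "pth Q p \<Longrightarrow> tup X p xs \<Longrightarrow> tup X p ys \<Longrightarrow> tup X p zs \<Longrightarrow> peq Q X p xs ys \<Longrightarrow> peq Q X p ys zs \<Longrightarrow> peq Q X p xs zs"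
proof (induction p arbitrary: xs ys zs)
  case (Cons a p)
  show ?case
  proof (cases "p = []")
    case False
    obtain x xs' y ys' z zs' where x: "xs = x # xs'" "x \<in> bcarrier (abis X a)" "tup X p xs'"
      "ys = y # ys'" "y \<in> bcarrier (abis X a)" "tup X p ys'" "zs = z # zs'" "z \<in> bcarrier (abis X a)" "tup X p zs'"
      using Cons by (auto simp: tup_Cons)
    have p: "pth Q p" "a \<in> arcs Q" "tail Q a = head Q (hd p)" using Cons(2) False by (auto simp: pth_Cons)
    interpret G: group "vgrp X (tail Q a)" by (rule grp[OF arc_verts(2)[OF p(2)]])
    have "peq Q X (a # p) (x # xs') (y # ys')" "peq Q X (a # p) (y # ys') (z # zs')" using Cons(6,7) x by simp_all
    then obtain h k where h: "h \<in> tg a" "y = ract (abis X a) x h" "peq Q X p xs' (gl X p h ys')"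
      and k: "k \<in> tg a" "z = ract (abis X a) y k" "peq Q X p ys' (gl X p k zs')"
      unfolding peq_Cons[OF False] by blast
    have hh: "h \<in> hg (hd p)" "k \<in> hg (hd p)" using h k p by auto
    have "peq Q X p (gl X p h ys') (gl X p h (gl X p k zs'))"
      by (rule peq_gl[OF p(1) x(6) gl_props(1)[OF p(1) x(9) hh(2)] hh(1) k(3)])
    then have "peq Q X p xs' (gl X p (h \<otimes>\<^bsub>vgrp X (tail Q a)\<^esub> k) zs')"
      using Cons.IH[OF p(1) x(3) gl_props(1)[OF p(1) x(6) hh(1)] gl_props(1)[OF p(1) gl_props(1)[OF p(1) x(9) hh(2)] hh(1)] h(3)]
        gl_props(3)[OF p(1) x(9) hh] p(3) by simp
    moreover have "z = ract (abis X a) x (h \<otimes>\<^bsub>vgrp X (tail Q a)\<^esub> k)"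
      using act(6)[OF p(2) x(2) h(1) k(1)] h k by simp
    ultimately show ?thesis unfolding x peq_Cons[OF False] using G.m_closed[OF h(1) k(1)] by blast
  qed (use Cons in auto)
qed simp

lemma peq_gr:
  "pth Q p \<Longrightarrow> tup X p xs \<Longrightarrow> tup X p ys \<Longrightarrow> g \<in> tg (last p) \<Longrightarrow> peq Q X p xs ys \<Longrightarrow> peq Q X p (gr X p xs g) (gr X p ys g)"
proof (induction p arbitrary: xs ys)
  case (Cons a p)
  show ?case
  proof (cases "p = []")
    case False
    obtain x xs' y ys' where x: "xs = x # xs'" "x \<in> bcarrier (abis X a)" "tup X p xs'"
      "ys = y # ys'" "y \<in> bcarrier (abis X a)" "tup X p ys'"
      using Cons by (auto simp: tup_Cons)
    have p: "pth Q p" "a \<in> arcs Q" "tail Q a = head Q (hd p)" using Cons(2) False by (auto simp: pth_Cons)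
    have g: "g \<in> tg (last p)" using Cons False by simp
    have "peq Q X (a # p) (x # xs') (y # ys')" using Cons(6) x by simp
    then obtain h where h: "h \<in> tg a" "y = ract (abis X a) x h" "peq Q X p xs' (gl X p h ys')"
      unfolding peq_Cons[OF False] by blast
    have hh: "h \<in> hg (hd p)" using h p by auto
    have "peq Q X p (gr X p xs' g) (gl X p h (gr X p ys' g))"
      using Cons.IH[OF p(1) x(3) gl_props(1)[OF p(1) x(6) hh] g h(3)] gr_props(4)[OF p(1) x(6) hh g] by simp
    then show ?thesis using h x False tup_ne[OF x(3) False] tup_ne[OF x(6) False] by (auto simp: peq_Cons)
  qed (use Cons in \<open>auto simp: tup_Cons\<close>)
qed simp

lemma gl_append: "p \<noteq> [] \<Longrightarrow> xs \<noteq> [] \<Longrightarrow> gl X (p @ q) g (xs @ ys) = gl X p g xs @ ys"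
  by (simp add: gl_def)

lemma gr_append: "q \<noteq> [] \<Longrightarrow> ys \<noteq> [] \<Longrightarrow> gr X (p @ q) (xs @ ys) g = xs @ gr X q ys g"
  by (simp add: gr_def butlast_append)

text \<open>Everything inside the two blocks is absorbed by \<open>peq\<close> on the blocks; the
  only exchange across the seam is one group element. Unique factorisation and cancellation both
  rest on this.\<close>

lemma peq_append:
  "pth Q (p @ q) \<Longrightarrow> p \<noteq> [] \<Longrightarrow> q \<noteq> [] \<Longrightarrow> tup X p xs \<Longrightarrow> tup X p xs' \<Longrightarrow> tup X q ys \<Longrightarrow> tup X q ys' \<Longrightarrow>
   peq Q X (p @ q) (xs @ ys) (xs' @ ys') \<longleftrightarrow>
     (\<exists>g\<in>tg (last p). peq Q X p (gr X p xs g) xs' \<and> peq Q X q ys (gl X q g ys'))"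
proof (induction p arbitrary: xs xs')
  case (Cons a p)
  note y = tup_ne[OF Cons(7) Cons(4)] tup_ne[OF Cons(8) Cons(4)]
  obtain x zs x' zs' where x: "xs = x # zs" "x \<in> bcarrier (abis X a)" "tup X p zs"
    "xs' = x' # zs'" "x' \<in> bcarrier (abis X a)" "tup X p zs'" using Cons(5,6) by (auto simp: tup_Cons)
  show ?case
  proof (cases "p = []")
    case True
    then show ?thesis using x Cons(4) y by (auto simp: peq_Cons)
  next
    case False
    note ne = tup_ne[OF x(3) False] tup_ne[OF x(6) False]
    have p: "pth Q (p @ q)" "a \<in> arcs Q" "tail Q a = head Q (hd p)" using Cons(2) False by (auto simp: pth_Cons)
    have pp: "pth Q p" using p(1) unfolding pth_append[OF False Cons(4)] by blast
    have "peq Q X ((a # p) @ q) (xs @ ys) (xs' @ ys') \<longleftrightarrow>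
      (\<exists>h\<in>tg a. x' = ract (abis X a) x h \<and> peq Q X (p @ q) (zs @ ys) (gl X p h zs' @ ys'))"
      using x False ne by (simp add: peq_Cons gl_append)
    also have "\<dots> \<longleftrightarrow> (\<exists>h\<in>tg a. x' = ract (abis X a) x h \<and>
        (\<exists>g\<in>tg (last p). peq Q X p (gr X p zs g) (gl X p h zs') \<and> peq Q X q ys (gl X q g ys')))"
      using Cons.IH[OF p(1) False Cons(4) x(3) gl_props(1)[OF pp x(6)] Cons(7,8)] p(3) by (intro bex_cong refl) simp
    also have "\<dots> \<longleftrightarrow> (\<exists>g\<in>tg (last (a # p)). peq Q X (a # p) (gr X (a # p) xs g) xs' \<and> peq Q X q ys (gl X q g ys'))"
      using x False ne by (auto simp: peq_Cons)
    finally show ?thesis .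
  qed
qed simp

lemma peq_cong_append:
  assumes p: "pth Q (p @ q)" "p \<noteq> []" "q \<noteq> []" and t: "tup X p xs" "tup X p xs'" "tup X q ys" "tup X q ys'"
    and e: "peq Q X p xs xs'" "peq Q X q ys ys'"
  shows "peq Q X (p @ q) (xs @ ys) (xs' @ ys')"
proof -
  have pq: "pth Q p" "pth Q q" "tail Q (last p) = head Q (hd q)" using p by (auto simp: pth_append)
  interpret G: group "vgrp X (tail Q (last p))" by (rule grp) (rule pth_verts(2)[OF pq(1)])
  show ?thesis
    unfolding peq_append[OF p t]
    by (intro bexI[OF _ G.one_closed])
      (use e gr_props(2)[OF pq(1) t(1)] gl_props(2)[OF pq(2) t(4)] pq(3) in simp_all)
qed

text \<open>The witness for \<open>peq_append\<close> is the inverse of \<open>g\<close>, which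
  removes \<open>g\<close> from the left block of the first tuple and from the right block of the
  second.\<close>

lemma peq_middle:
  assumes p: "pth Q (p @ q)" "p \<noteq> []" "q \<noteq> []" and t: "tup X p xs" "tup X q ys" and g: "g \<in> tg (last p)"
  shows "peq Q X (p @ q) (gr X p xs g @ ys) (xs @ gl X q g ys)"
proof -
  have pq: "pth Q p" "pth Q q" "tail Q (last p) = head Q (hd q)" using p by (auto simp: pth_append)
  have g': "g \<in> hg (hd q)" using g pq by simp
  interpret G: group "vgrp X (tail Q (last p))" by (rule grp) (rule pth_verts(2)[OF pq(1)])
  have i: "inv\<^bsub>vgrp X (tail Q (last p))\<^esub> g \<in> tg (last p)" using g by simp
  note t' = gr_props(1)[OF pq(1) t(1) g] gl_props(1)[OF pq(2) t(2) g']
  have 1: "gr X p (gr X p xs g) (inv\<^bsub>vgrp X (tail Q (last p))\<^esub> g) = xs"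
    using gr_props(3)[OF pq(1) t(1) g i] gr_props(2)[OF pq(1) t(1)] G.r_inv[OF g] by simp
  have 2: "gl X q (inv\<^bsub>vgrp X (tail Q (last p))\<^esub> g) (gl X q g ys) = ys"
    using gl_props(3)[OF pq(2) t(2), of "inv\<^bsub>vgrp X (tail Q (last p))\<^esub> g" g] gl_props(2)[OF pq(2) t(2)] g g' i pq(3) G.l_inv[OF g] by simp
  show ?thesis
    unfolding peq_append[OF p t'(1) t(1) t(2) t'(2)]
    by (intro bexI[OF _ i] conjI) (simp_all only: 1 2 peq_refl[OF pq(1) t(1)] peq_refl[OF pq(2) t(2)])
qed

lemma path_step_eq:
  "path_step Q X p = {(xs[i := ract (abis X (p ! i)) (xs ! i) g],
       xs[Suc i := lact (abis X (p ! Suc i)) g (xs ! Suc i)]) | xs i g.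
        tup X p xs \<and> Suc i < length p \<and> g \<in> tg (p ! i)}"
  by (simp add: path_step_def path_tuples_def tup_def)

text \<open>Cutting the path between the positions \<open>i\<close> and \<open>Suc i\<close>
  exhibits a generating step as an instance of \<open>peq_middle\<close>; the left block then has
  \<open>Suc i\<close> entries.\<close>

lemma step_peq:
  assumes p: "pth Q p" and s: "(us, vs) \<in> path_step Q X p"
  shows "tup X p us \<and> tup X p vs \<and> peq Q X p us vs"
proof -
  obtain xs i g where s: "us = xs[i := ract (abis X (p ! i)) (xs ! i) g]" "vs = xs[Suc i := lact (abis X (p ! Suc i)) g (xs ! Suc i)]"
    "tup X p xs" "Suc i < length p" "g \<in> tg (p ! i)" using s by (auto simp: path_step_eq)
  let ?p = "take (Suc i) p" and ?q = "drop (Suc i) p" and ?x = "take (Suc i) xs" and ?y = "drop (Suc i) xs"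
  have l: "length xs = length p" by (rule tup_length[OF s(3)])
  have pq: "pth Q (?p @ ?q)" "?p \<noteq> []" "?q \<noteq> []" using p s(4) by auto
  have t: "tup X ?p ?x" "tup X ?q ?y"
    using s(3) tup_append[of ?x ?p X ?q ?y] l by (simp_all add: min_def)
  have lp: "last ?p = p ! i" using s(4) by (simp add: take_Suc_conv_app_nth)
  have us: "us = gr X ?p ?x g @ ?y"
    using s l by (simp add: gr_def take_Suc_conv_app_nth lp upd_conv_take_nth_drop butlast_append)
  have vs: "vs = ?x @ gl X ?q g ?y"
    using s l by (simp add: gl_def upd_conv_take_nth_drop hd_drop_conv_nth tl_drop drop_Suc[symmetric] flip: drop_Suc)
  have g: "g \<in> tg (last ?p)" using s(5) lp by simp
  have pp: "pth Q ?p" "pth Q ?q" "tail Q (last ?p) = head Q (hd ?q)" using pth_append[OF pq(2,3)] pq(1) by blast+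
  have g': "g \<in> hg (hd ?q)" using g pp by simp
  have "peq Q X p us vs" using peq_middle[OF pq t g] us vs by simp
  moreover have "tup X p us" unfolding us
    using tup_append[of "gr X ?p ?x g" ?p X ?q ?y] gr_props(1)[OF pp(1) t(1) g] t(2) tup_length[OF gr_props(1)[OF pp(1) t(1) g]] by simp
  moreover have "tup X p vs" unfolding vs
    using tup_append[of ?x ?p X ?q "gl X ?q g ?y"] gl_props(1)[OF pp(2) t(2) g'] t(1) tup_length[OF t(1)] by simp
  ultimately show ?thesis by simp
qed

abbreviation eqp :: "'a list \<Rightarrow> 'x list rel" where
  "eqp p \<equiv> path_equiv Q X p"

lemma eqp_sym: "(x, y) \<in> eqp p \<Longrightarrow> (y, x) \<in> eqp p"
  unfolding path_equiv_def using sym_rtrancl[OF sym_Un_converse] by (meson symD)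

lemma eqp_trans: "(x, y) \<in> eqp p \<Longrightarrow> (y, z) \<in> eqp p \<Longrightarrow> (x, z) \<in> eqp p"
  unfolding path_equiv_def by (rule rtrancl_trans)

lemma eqp_refl: "(x, x) \<in> eqp p"
  by (simp add: path_equiv_def)

lemma eqp_imp_peq:
  assumes p: "pth Q p" and x: "tup X p xs" and e: "(xs, ys) \<in> eqp p"
  shows "tup X p ys \<and> peq Q X p xs ys"
  using e unfolding path_equiv_def
proof (induction rule: rtrancl_induct)
  case base
  show ?case using p x by (simp add: peq_refl)
next
  case (step y z)
  then have "tup X p z \<and> peq Q X p y z"
    using step_peq[OF p, of y z] step_peq[OF p, of z y] peq_sym[OF p, of z y] by auto
  then show ?case using step peq_trans[OF p x] by blast
qed

lemma eqp_Cons: "a \<in> arcs Q \<Longrightarrow> x \<in> bcarrier (abis X a) \<Longrightarrow> (xs, ys) \<in> eqp p \<Longrightarrow> (x # xs, x # ys) \<in> eqp (a # p)"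
proof -
  assume a: "a \<in> arcs Q" "x \<in> bcarrier (abis X a)" and e: "(xs, ys) \<in> eqp p"
  have s: "(x # us, x # vs) \<in> path_step Q X (a # p)" if st: "(us, vs) \<in> path_step Q X p" for us vs
  proof -
    obtain zs i g where s: "us = zs[i := ract (abis X (p ! i)) (zs ! i) g]" "vs = zs[Suc i := lact (abis X (p ! Suc i)) g (zs ! Suc i)]"
    "tup X p zs" "Suc i < length p" "g \<in> tg (p ! i)" using st by (auto simp: path_step_eq)
    then show ?thesis unfolding path_step_eq using a by (intro CollectI exI[of _ "x # zs"] exI[of _ "Suc i"] exI[of _ g]) simp
  qed
  show ?thesis using e unfolding path_equiv_def
  proof (induction rule: rtrancl_induct)
    case (step y z)
    then have "(x # y, x # z) \<in> path_step Q X (a # p) \<union> (path_step Q X (a # p))\<inverse>" using s by auto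
    with step show ?case by (meson rtrancl.rtrancl_into_rtrancl)
  qed simp
qed

text \<open>Induction changes the tail into \<open>gl X p h ys'\<close>. One generating step at the
  first gap then carries \<open>h\<close> back to the first entry.\<close>

lemma peq_imp_eqp: "pth Q p \<Longrightarrow> tup X p xs \<Longrightarrow> tup X p ys \<Longrightarrow> peq Q X p xs ys \<Longrightarrow> (xs, ys) \<in> eqp p"
proof (induction p arbitrary: xs ys)
  case (Cons a p)
  show ?case
  proof (cases "p = []")
    case False
    obtain x xs' y ys' where x: "xs = x # xs'" "x \<in> bcarrier (abis X a)" "tup X p xs'"
      "ys = y # ys'" "y \<in> bcarrier (abis X a)" "tup X p ys'"
      using Cons by (auto simp: tup_Cons)
    have p: "pth Q p" "a \<in> arcs Q" "tail Q a = head Q (hd p)" using Cons(2) False by (auto simp: pth_Cons)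
    have "peq Q X (a # p) (x # xs') (y # ys')" using Cons(5) x by simp
    then obtain h where h: "h \<in> tg a" "y = ract (abis X a) x h" "peq Q X p xs' (gl X p h ys')"
      unfolding peq_Cons[OF False] by blast
    have hh: "h \<in> hg (hd p)" using h p by auto
    have "(xs', gl X p h ys') \<in> eqp p" by (rule Cons.IH[OF p(1) x(3) gl_props(1)[OF p(1) x(6) hh] h(3)])
    then have 1: "(x # xs', x # gl X p h ys') \<in> eqp (a # p)" by (rule eqp_Cons[OF p(2) x(2)])
    obtain b p' where b: "p = b # p'" using False by (cases p) auto
    obtain z zs where z: "ys' = z # zs" using x(6) b by (auto simp: tup_Cons)
    have "(y # ys', x # gl X p h ys') \<in> path_step Q X (a # p)"
      unfolding path_step_eq
      by (intro CollectI exI[of _ "x # ys'"] exI[of _ 0] exI[of _ h]) (use h x b z in simp)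
    then have "(x # gl X p h ys', y # ys') \<in> eqp (a # p)" unfolding path_equiv_def by blast
    with 1 show ?thesis unfolding x by (rule eqp_trans)
  qed (use Cons eqp_refl in auto)
qed simp

end

fun ln :: "('v, 'a, 'g, 'x) ei_mor \<Rightarrow> nat" where
  "ln (Triv i g) = 0"
| "ln (Path p c) = length p"

lemma ei_category_simps [simp]:
  "obj (ei_category Q X) = verts Q" "mor (ei_category Q X) = ei_morphisms Q X"
  "src (ei_category Q X) = ei_src Q" "trg (ei_category Q X) = ei_trg Q"
  "ident (ei_category Q X) = (\<lambda>i. Triv i \<one>\<^bsub>vgrp X i\<^esub>)" "comp (ei_category Q X) = ei_comp Q X"
  by (simp_all add: ei_category_def)

section \<open>Morphisms as classes of tuples, the category laws and unique factorisation\<close>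

context finite_EI_quiver
begin

definition cls :: "'a list \<Rightarrow> 'x list \<Rightarrow> 'x list set" where
  "cls p xs = eqp p `` {xs}"

lemma mem_cls: "pth Q p \<Longrightarrow> tup X p xs \<Longrightarrow> zs \<in> cls p xs \<longleftrightarrow> tup X p zs \<and> peq Q X p xs zs"
  unfolding cls_def using eqp_imp_peq[of p xs zs] peq_imp_eqp[of p xs zs] by auto

lemma cls_eq_iff:
  assumes "pth Q p" "tup X p xs" "tup X p ys"
  shows "cls p xs = cls p ys \<longleftrightarrow> peq Q X p xs ys"
proof
  assume "cls p xs = cls p ys"
  then have "ys \<in> cls p xs" using mem_cls[OF assms(1,3)] assms(3) peq_refl[OF assms(1,3)] by simp
  then show "peq Q X p xs ys" using mem_cls[OF assms(1,2)] by simp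
next
  assume "peq Q X p xs ys"
  then have e: "(xs, ys) \<in> eqp p" by (rule peq_imp_eqp[OF assms])
  show "cls p xs = cls p ys"
    unfolding cls_def using eqp_trans[OF e] eqp_trans[OF eqp_sym[OF e]] by auto
qed

lemma UN_cls:
  assumes p: "pth Q p" "tup X p xs" and eq: "\<And>zs. tup X p zs \<Longrightarrow> peq Q X p xs zs \<Longrightarrow> F zs = F xs"
  shows "(\<Union>zs\<in>cls p xs. F zs) = F xs"
proof -
  have "xs \<in> cls p xs" using mem_cls[OF p] p peq_refl[OF p] by simp
  moreover have "F zs = F xs" if "zs \<in> cls p xs" for zs
    using that unfolding mem_cls[OF p] by (elim conjE, intro eq)
  then have "(\<Union>zs\<in>cls p xs. F zs) = (\<Union>zs\<in>cls p xs. F xs)" by (rule SUP_cong[OF refl])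
  ultimately show ?thesis by auto
qed

lemma ei_morphisms_iff: "m \<in> ei_morphisms Q X \<longleftrightarrow> (\<exists>i g. m = Triv i g \<and> i \<in> verts Q \<and> g \<in> carrier (vgrp X i)) \<or>
    (\<exists>p xs. m = Path p (cls p xs) \<and> pth Q p \<and> tup X p xs)"
proof -
  have 1: "(p \<noteq> [] \<and> (\<exists>u v. awalk u (rev p) v)) \<longleftrightarrow> pth Q p" for p
    using awalk_rev[of p] pth_ne[of Q p] by blast
  have 2: "c \<in> bcarrier (path_biset Q X p) \<longleftrightarrow> (\<exists>xs. tup X p xs \<and> c = cls p xs)" for p c
    by (auto simp: path_biset_def quotient_def path_tuples_def tup_def cls_def)
  have "m \<in> ei_morphisms Q X \<longleftrightarrow> (\<exists>i g. m = Triv i g \<and> i \<in> verts Q \<and> g \<in> carrier (vgrp X i)) \<or>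
    (\<exists>p c. m = Path p c \<and> (p \<noteq> [] \<and> (\<exists>u v. awalk u (rev p) v)) \<and> c \<in> bcarrier (path_biset Q X p))"
    unfolding ei_morphisms_def by (simp only: Un_iff mem_Collect_eq conj_assoc)
  then show ?thesis
    unfolding 1 2 by (cases m) auto
qed

lemma mor_Triv: "Triv i g \<in> ei_morphisms Q X \<longleftrightarrow> i \<in> verts Q \<and> g \<in> carrier (vgrp X i)"
  by (auto simp: ei_morphisms_iff)

lemma mor_Path: "pth Q p \<Longrightarrow> tup X p xs \<Longrightarrow> Path p (cls p xs) \<in> ei_morphisms Q X"
  by (auto simp: ei_morphisms_iff)

lemma mor_cases:
  assumes "m \<in> ei_morphisms Q X"
  obtains (T) i g where "m = Triv i g" "i \<in> verts Q" "g \<in> carrier (vgrp X i)"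
    | (P) p xs where "m = Path p (cls p xs)" "pth Q p" "tup X p xs"
  using assms unfolding ei_morphisms_iff by blast

lemma comp_TP:
  assumes q: "pth Q q" "tup X q ys" and g: "g \<in> hg (hd q)"
  shows "ei_comp Q X (Triv i g) (Path q (cls q ys)) = Path q (cls q (gl X q g ys))"
proof -
  have "(\<Union>zs\<in>cls q ys. eqp q `` {gl X q g zs}) = eqp q `` {gl X q g ys}"
  proof (rule UN_cls[OF q], unfold cls_def[symmetric])
    fix zs assume z: "tup X q zs" "peq Q X q ys zs"
    show "cls q (gl X q g zs) = cls q (gl X q g ys)"
      unfolding cls_eq_iff[OF q(1) gl_props(1)[OF q(1) z(1) g] gl_props(1)[OF q g]]
      by (rule peq_gl[OF q(1) z(1) q(2) g peq_sym[OF q z]])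
  qed
  then show ?thesis by (simp add: path_biset_def gl_def cls_def)
qed

lemma comp_PT:
  assumes q: "pth Q q" "tup X q ys" and g: "g \<in> tg (last q)"
  shows "ei_comp Q X (Path q (cls q ys)) (Triv i g) = Path q (cls q (gr X q ys g))"
proof -
  have "(\<Union>zs\<in>cls q ys. eqp q `` {gr X q zs g}) = eqp q `` {gr X q ys g}"
  proof (rule UN_cls[OF q], unfold cls_def[symmetric])
    fix zs assume z: "tup X q zs" "peq Q X q ys zs"
    show "cls q (gr X q zs g) = cls q (gr X q ys g)"
      unfolding cls_eq_iff[OF q(1) gr_props(1)[OF q(1) z(1) g] gr_props(1)[OF q g]]
      by (rule peq_gr[OF q(1) z(1) q(2) g peq_sym[OF q z]])
  qed
  then show ?thesis by (simp add: path_biset_def gr_def cls_def)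
qed

lemma tup_appendI: "tup X p xs \<Longrightarrow> tup X q ys \<Longrightarrow> tup X (p @ q) (xs @ ys)"
  using tup_append[of xs p X q ys] tup_length[of X p xs] by simp

lemma pth_appendI: "pth Q p \<Longrightarrow> pth Q q \<Longrightarrow> tail Q (last p) = head Q (hd q) \<Longrightarrow> pth Q (p @ q)"
  using pth_append[of p q Q] pth_ne[of Q p] pth_ne[of Q q] by simp

lemma comp_PP:
  assumes p: "pth Q p" "tup X p xs" and q: "pth Q q" "tup X q ys" and c: "tail Q (last p) = head Q (hd q)"
  shows "ei_comp Q X (Path p (cls p xs)) (Path q (cls q ys)) = Path (p @ q) (cls (p @ q) (xs @ ys))"
proof -
  note ne = pth_ne[OF p(1)] pth_ne[OF q(1)]
  have pq: "pth Q (p @ q)" by (rule pth_appendI[OF p(1) q(1) c])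
  have *: "cls (p @ q) (zs @ ws) = cls (p @ q) (xs @ ys)"
    if "tup X p zs" "peq Q X p xs zs" "tup X q ws" "peq Q X q ys ws" for zs ws
    unfolding cls_eq_iff[OF pq tup_appendI[OF that(1,3)] tup_appendI[OF p(2) q(2)]]
    by (rule peq_cong_append[OF pq ne that(1) p(2) that(3) q(2)])
      (use peq_sym[OF p(1,2) that(1,2)] peq_sym[OF q(1,2) that(3,4)] in simp_all)
  have "(\<Union>zs\<in>cls p xs. \<Union>ws\<in>cls q ys. eqp (p @ q) `` {zs @ ws}) = (\<Union>ws\<in>cls q ys. eqp (p @ q) `` {xs @ ws})"
  proof (rule UN_cls[OF p], unfold cls_def[symmetric])
    fix zs assume z: "tup X p zs" "peq Q X p xs zs"
    have A: "(\<Union>ws\<in>cls q ys. cls (p @ q) (zs @ ws)) = cls (p @ q) (zs @ ys)"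
      if "tup X p zs" "peq Q X p xs zs" for zs
      by (rule UN_cls[OF q], rule trans[OF *[OF that] *[OF that q(2) peq_refl[OF q], symmetric]])
    show "(\<Union>ws\<in>cls q ys. cls (p @ q) (zs @ ws)) = (\<Union>ws\<in>cls q ys. cls (p @ q) (xs @ ws))"
      unfolding A[OF z] A[OF p(2) peq_refl[OF p]] by (rule *[OF z q(2) peq_refl[OF q]])
  qed
  also have "\<dots> = eqp (p @ q) `` {xs @ ys}"
    by (rule UN_cls[OF q], unfold cls_def[symmetric], rule *[OF p(2) peq_refl[OF p]])
  finally show ?thesis by (simp add: cls_def)
qed

declare ei_comp.simps(2-4) [simp del]

lemma pth_append_hd_last:
  "pth Q p \<Longrightarrow> pth Q q \<Longrightarrow> hd (p @ q) = hd p" "pth Q p \<Longrightarrow> pth Q q \<Longrightarrow> last (p @ q) = last q"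
  using pth_ne[of Q p] pth_ne[of Q q] by auto

lemma ei_comp_props:
  assumes "a \<in> ei_morphisms Q X" "b \<in> ei_morphisms Q X" "ei_src Q a = ei_trg Q b"
  shows "ei_comp Q X a b \<in> ei_morphisms Q X \<and> ei_src Q (ei_comp Q X a b) = ei_src Q b \<and>
    ei_trg Q (ei_comp Q X a b) = ei_trg Q a \<and> ln (ei_comp Q X a b) = ln a + ln b"
  using assms(1)
proof (cases rule: mor_cases)
  case a: (T i g)
  from assms(2) show ?thesis
  proof (cases rule: mor_cases)
    case b: (T j h)
    have "group (vgrp X i)" using a grp by simp
    then show ?thesis using a b assms(3) by (simp add: mor_Triv group.is_monoid monoid.m_closed)
  next
    case b: (P q ys)
    have g: "g \<in> hg (hd q)" using a b assms(3) by simp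
    show ?thesis using comp_TP[OF b(2,3) g] mor_Path[OF b(2) gl_props(1)[OF b(2,3) g]] a b assms(3) by simp
  qed
next
  case a: (P p xs)
  from assms(2) show ?thesis
  proof (cases rule: mor_cases)
    case b: (T j h)
    have g: "h \<in> tg (last p)" using a b assms(3) by simp
    show ?thesis using comp_PT[OF a(2,3) g] mor_Path[OF a(2) gr_props(1)[OF a(2,3) g]] a b assms(3) by simp
  next
    case b: (P q ys)
    have c: "tail Q (last p) = head Q (hd q)" using a b assms(3) by simp
    show ?thesis
      using comp_PP[OF a(2,3) b(2,3) c] mor_Path[OF pth_appendI[OF a(2) b(2) c] tup_appendI[OF a(3) b(3)]]
        pth_append_hd_last[OF a(2) b(2)] a b by simp
  qed
qed

text \<open>Of the eight shapes, a group element between two paths is the one that uses the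
  equivalence relation: it acts on either neighbour with the same class as result, by
  \<open>peq_middle\<close>. The other cases follow from the action laws and associativity of
  append.\<close>

lemma ei_comp_assoc:
  assumes m: "a \<in> ei_morphisms Q X" "b \<in> ei_morphisms Q X" "c \<in> ei_morphisms Q X"
    and s: "ei_src Q a = ei_trg Q b" "ei_src Q b = ei_trg Q c"
  shows "ei_comp Q X (ei_comp Q X a b) c = ei_comp Q X a (ei_comp Q X b c)"
  using m(1)
proof (cases rule: mor_cases)
  case a: (T i g)
  have G: "group (vgrp X i)" using a grp by simp
  from m(2) show ?thesis
  proof (cases rule: mor_cases)
    case b: (T j h)
    from m(3) show ?thesis
    proof (cases rule: mor_cases)
      case c: (T k l)
      show ?thesis using a b c s G by (simp add: monoid.m_assoc group.is_monoid)
    next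
      case c: (P q ys)
      have gh: "g \<in> hg (hd q)" "h \<in> hg (hd q)" using a b c s by auto
      have i: "i = head Q (hd q)" using a b c s by simp
      have m: "g \<otimes>\<^bsub>vgrp X (head Q (hd q))\<^esub> h \<in> hg (hd q)" using gh G i by (simp add: monoid.m_closed group.is_monoid)
      show ?thesis
        using a(1) b(1) c(1) i comp_TP[OF c(2,3) gh(2)] comp_TP[OF c(2) gl_props(1)[OF c(2,3) gh(2)] gh(1)]
          comp_TP[OF c(2,3) m] gl_props(3)[OF c(2,3) gh] by simp
    qed
  next
    case b: (P p xs)
    have g: "g \<in> hg (hd p)" using a b s by simp
    from m(3) show ?thesis
    proof (cases rule: mor_cases)
      case c: (T k l)
      have l: "l \<in> tg (last p)" using b c s by simp
      show ?thesis
        using a(1) b(1) c(1) comp_TP[OF b(2,3) g] comp_PT[OF b(2,3) l] comp_PT[OF b(2) gl_props(1)[OF b(2,3) g] l]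
          comp_TP[OF b(2) gr_props(1)[OF b(2,3) l] g] gr_props(4)[OF b(2,3) g l] by simp
    next
      case c: (P q ys)
      have t: "tail Q (last p) = head Q (hd q)" using b c s by simp
      have g': "g \<in> hg (hd (p @ q))" using g pth_append_hd_last(1)[OF b(2) c(2)] by simp
      show ?thesis
        using a(1) b(1) c(1) comp_TP[OF b(2,3) g] comp_PP[OF b(2,3) c(2,3) t]
          comp_PP[OF b(2) gl_props(1)[OF b(2,3) g] c(2,3) t]
          comp_TP[OF pth_appendI[OF b(2) c(2) t] tup_appendI[OF b(3) c(3)] g']
          gl_append[OF pth_ne[OF b(2)] tup_ne[OF b(3) pth_ne[OF b(2)]]] by simp
    qed
  qed
next
  case a: (P p xs)
  from m(2) show ?thesis
  proof (cases rule: mor_cases)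
    case b: (T j h)
    have h: "h \<in> tg (last p)" and j: "j = tail Q (last p)" using a b s by auto
    have G: "group (vgrp X (tail Q (last p)))" using b grp j by simp
    from m(3) show ?thesis
    proof (cases rule: mor_cases)
      case c: (T k l)
      have l: "l \<in> tg (last p)" using a b c s by simp
      have m: "h \<otimes>\<^bsub>vgrp X (tail Q (last p))\<^esub> l \<in> tg (last p)" using h l G by (simp add: monoid.m_closed group.is_monoid)
      show ?thesis
        using a(1) b(1) c(1) j comp_PT[OF a(2,3) h] comp_PT[OF a(2) gr_props(1)[OF a(2,3) h] l] comp_PT[OF a(2,3) m]
          gr_props(3)[OF a(2,3) h l] by simp
    next
      case c: (P q ys)
      have t: "tail Q (last p) = head Q (hd q)" using a b c s by simp
      have h': "h \<in> hg (hd q)" using h t by simp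
      note pq = pth_appendI[OF a(2) c(2) t]
      have "cls (p @ q) (gr X p xs h @ ys) = cls (p @ q) (xs @ gl X q h ys)"
        unfolding cls_eq_iff[OF pq tup_appendI[OF gr_props(1)[OF a(2,3) h] c(3)] tup_appendI[OF a(3) gl_props(1)[OF c(2,3) h']]]
        by (rule peq_middle[OF pq pth_ne[OF a(2)] pth_ne[OF c(2)] a(3) c(3) h])
      then show ?thesis
        using a(1) b(1) c(1) comp_PT[OF a(2,3) h] comp_PP[OF a(2) gr_props(1)[OF a(2,3) h] c(2,3) t]
          comp_TP[OF c(2,3) h'] comp_PP[OF a(2,3) c(2) gl_props(1)[OF c(2,3) h'] t] by simp
    qed
  next
    case b: (P q ys)
    have t: "tail Q (last p) = head Q (hd q)" using a b s by simp
    note pq = pth_appendI[OF a(2) b(2) t] and txy = tup_appendI[OF a(3) b(3)]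
    from m(3) show ?thesis
    proof (cases rule: mor_cases)
      case c: (T k l)
      have l: "l \<in> tg (last q)" using b c s by simp
      have l': "l \<in> tg (last (p @ q))" using l pth_append_hd_last(2)[OF a(2) b(2)] by simp
      show ?thesis
        using a(1) b(1) c(1) comp_PP[OF a(2,3) b(2,3) t] comp_PT[OF pq txy l'] comp_PT[OF b(2,3) l]
          comp_PP[OF a(2,3) b(2) gr_props(1)[OF b(2,3) l] t]
          gr_append[OF pth_ne[OF b(2)] tup_ne[OF b(3) pth_ne[OF b(2)]]] by simp
    next
      case c: (P r zs)
      have t': "tail Q (last q) = head Q (hd r)" using b c s by simp
      have t1: "tail Q (last (p @ q)) = head Q (hd r)" "tail Q (last p) = head Q (hd (q @ r))"
        using t t' pth_append_hd_last[OF a(2) b(2)] pth_append_hd_last[OF b(2) c(2)] by auto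
      show ?thesis
        using a(1) b(1) c(1) comp_PP[OF a(2,3) b(2,3) t] comp_PP[OF pq txy c(2,3) t1(1)] comp_PP[OF b(2,3) c(2,3) t']
          comp_PP[OF a(2,3) pth_appendI[OF b(2) c(2) t'] tup_appendI[OF b(3) c(3)] t1(2)] by simp
    qed
  qed
qed

lemma ident_mor: "i \<in> verts Q \<Longrightarrow> Triv i \<one>\<^bsub>vgrp X i\<^esub> \<in> ei_morphisms Q X"
  using grp by (simp add: mor_Triv group.is_monoid monoid.one_closed)

lemma ei_src_trg_verts: "a \<in> ei_morphisms Q X \<Longrightarrow> ei_src Q a \<in> verts Q \<and> ei_trg Q a \<in> verts Q"
  by (elim mor_cases) (simp_all add: pth_verts)

lemma ei_ident:
  assumes "a \<in> ei_morphisms Q X"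
  shows "ei_comp Q X (Triv (ei_trg Q a) \<one>\<^bsub>vgrp X (ei_trg Q a)\<^esub>) a = a"
    "ei_comp Q X a (Triv (ei_src Q a) \<one>\<^bsub>vgrp X (ei_src Q a)\<^esub>) = a"
proof -
  have "ei_comp Q X (Triv (ei_trg Q a) \<one>\<^bsub>vgrp X (ei_trg Q a)\<^esub>) a = a \<and>
    ei_comp Q X a (Triv (ei_src Q a) \<one>\<^bsub>vgrp X (ei_src Q a)\<^esub>) = a"
    using assms
  proof (cases rule: mor_cases)
    case (T i g)
    then show ?thesis using grp[OF T(2)] by (simp add: group.is_monoid monoid.l_one monoid.r_one)
  next
    case (P p xs)
    have o: "\<one>\<^bsub>vgrp X (head Q (hd p))\<^esub> \<in> hg (hd p)" "\<one>\<^bsub>vgrp X (tail Q (last p))\<^esub> \<in> tg (last p)"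
      using grp[OF pth_verts(1)[OF P(2)]] grp[OF pth_verts(2)[OF P(2)]] by (simp_all add: group.is_monoid monoid.one_closed)
    show ?thesis
      using P(1) comp_TP[OF P(2,3) o(1)] comp_PT[OF P(2,3) o(2)] gl_props(2)[OF P(2,3)] gr_props(2)[OF P(2,3)]
      by simp
  qed
  then show "ei_comp Q X (Triv (ei_trg Q a) \<one>\<^bsub>vgrp X (ei_trg Q a)\<^esub>) a = a"
    "ei_comp Q X a (Triv (ei_src Q a) \<one>\<^bsub>vgrp X (ei_src Q a)\<^esub>) = a" by auto
qed

lemma ei_cat: "cat (ei_category Q X)"
proof (rule cat.intro, goal_cases)
  case 1 show ?case by simp
next case (2 a) then show ?case using ei_src_trg_verts[of a] by simp
next case (3 a) then show ?case using ei_src_trg_verts[of a] by simp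
next case (4 i) then show ?case using ident_mor[of i] by simp
next case (5 i) show ?case by simp
next case (6 i) show ?case by simp
next case (7 a b) then show ?case using ei_comp_props[of a b] by simp
next case (8 a b) then show ?case using ei_comp_props[of a b] by simp
next case (9 a b) then show ?case using ei_comp_props[of a b] by simp
next case (10 a b c) then show ?case using ei_comp_assoc[of a b c] by simp
next case (11 a i) then show ?case using ei_ident(1)[of a] by simp
next case (12 a i) then show ?case using ei_ident(2)[of a] by simp
qed

lemma ei_len0:
  assumes "a \<in> ei_morphisms Q X" "ln a = 0"
  obtains i g where "a = Triv i g" "i \<in> verts Q" "g \<in> carrier (vgrp X i)"
  using assms(1)
proof (cases rule: mor_cases)
  case (P p xs)
  then show ?thesis using assms(2) pth_ne[OF P(2)] by simp
qed (rule that)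

lemma ei_len_pos:
  assumes "a \<in> ei_morphisms Q X" "ln a \<noteq> 0"
  obtains p xs where "a = Path p (cls p xs)" "pth Q p" "tup X p xs"
  using assms(1)
proof (cases rule: mor_cases)
  case (T i g)
  then show ?thesis using assms(2) by simp
qed (rule that)

lemma ei_inv:
  assumes "a \<in> ei_morphisms Q X" "ln a = 0"
  shows "ei_trg Q a = ei_src Q a \<and> (\<exists>b\<in>ei_morphisms Q X. ln b = 0 \<and> ei_src Q b = ei_src Q a \<and> ei_trg Q b = ei_src Q a \<and>
    ei_comp Q X a b = Triv (ei_src Q a) \<one>\<^bsub>vgrp X (ei_src Q a)\<^esub> \<and> ei_comp Q X b a = Triv (ei_src Q a) \<one>\<^bsub>vgrp X (ei_src Q a)\<^esub>)"
proof -
  obtain i g where a: "a = Triv i g" "i \<in> verts Q" "g \<in> carrier (vgrp X i)" using assms by (rule ei_len0)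
  interpret G: group "vgrp X i" by (rule grp[OF a(2)])
  show ?thesis
    by (intro conjI bexI[of _ "Triv i (inv\<^bsub>vgrp X i\<^esub> g)"]) (use a in \<open>simp_all add: mor_Triv\<close>)
qed

lemma ei_factor:
  assumes "a \<in> ei_morphisms Q X" "ln a = Suc n"
  shows "\<exists>x\<in>ei_morphisms Q X. \<exists>c\<in>ei_morphisms Q X. ln x = 1 \<and> ei_src Q x = ei_trg Q c \<and> a = ei_comp Q X x c"
proof -
  obtain p xs where a: "a = Path p (cls p xs)" "pth Q p" "tup X p xs" by (rule ei_len_pos[OF assms(1)]) (use assms in auto)
  obtain \<alpha> p' where p: "p = \<alpha> # p'" using pth_ne[OF a(2)] by (cases p) auto
  show ?thesis
  proof (cases "p' = []")
    case True
    then have l: "ln a = 1" using a(1) p by simp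
    show ?thesis
      by (rule bexI[OF _ assms(1)], rule bexI[of _ "Triv (ei_src Q a) \<one>\<^bsub>vgrp X (ei_src Q a)\<^esub>"])
        (use l ei_ident(2)[OF assms(1)] ident_mor ei_src_trg_verts[OF assms(1)] in simp_all)
  next
    case False
    obtain x xs' where x: "xs = x # xs'" "x \<in> bcarrier (abis X \<alpha>)" "tup X p' xs'" using a p by (auto simp: tup_Cons)
    have q: "pth Q [\<alpha>]" "pth Q p'" "tail Q (last [\<alpha>]) = head Q (hd p')" using a(2) p False by (auto simp: pth_Cons)
    have t: "tup X [\<alpha>] [x]" using x by simp
    show ?thesis
      by (intro bexI[OF _ mor_Path[OF q(1) t]] bexI[OF _ mor_Path[OF q(2) x(3)]])
        (use comp_PP[OF q(1) t q(2) x(3) q(3)] q(3) a p x in simp)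
  qed
qed

lemma finite_tup:
  assumes "pth Q p"
  shows "finite {xs. tup X p xs}"
proof (rule finite_subset)
  let ?B = "\<Union>\<alpha>\<in>arcs Q. bcarrier (abis X \<alpha>)"
  show "finite {xs. set xs \<subseteq> ?B \<and> length xs = length p}"
    by (rule finite_lists_length_eq) (use abis_finite in auto)
  have "tup X p xs \<Longrightarrow> set p \<subseteq> arcs Q \<Longrightarrow> set xs \<subseteq> ?B" for xs
    unfolding tup_def by (induction rule: list_all2_induct) auto
  then show "{xs. tup X p xs} \<subseteq> {xs. set xs \<subseteq> ?B \<and> length xs = length p}"
    using pth_set[OF assms] tup_length by blast
qed

text \<open>Acyclicity leaves finitely many paths, and each of them carries finitely many
  tuples.\<close>

lemma finite_ei_morphisms:
  assumes "acyclic_quiver Q"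
  shows "finite (ei_morphisms Q X)"
proof (rule finite_subset)
  show "ei_morphisms Q X \<subseteq> (\<lambda>(i, g). Triv i g) ` (Sigma (verts Q) (\<lambda>i. carrier (vgrp X i))) \<union>
     (\<lambda>(p, xs). Path p (cls p xs)) ` (Sigma {p. pth Q p} (\<lambda>p. {xs. tup X p xs}))"
    by (auto simp: ei_morphisms_iff)
  show "finite ((\<lambda>(i, g). Triv i g) ` (Sigma (verts Q) (\<lambda>i. carrier (vgrp X i))) \<union>
     (\<lambda>(p, xs). Path p (cls p xs)) ` (Sigma {p. pth Q p} (\<lambda>p. {xs. tup X p xs})))"
    by (intro finite_UnI finite_imageI finite_SigmaI) (use vgrp_finite finite_tup finite_pth[OF assms] in auto)
qed

text \<open>The arrow lists satisfy Levi's lemma for words, which yields an overlap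
  \<open>s\<close>; \<open>peq_append\<close> supplies the group element by which the two
  factorisations differ at the seam. Factors of length zero are treated by inverting them.\<close>

lemma ei_levi:
  assumes m: "a \<in> ei_morphisms Q X" "b \<in> ei_morphisms Q X" "a' \<in> ei_morphisms Q X" "b' \<in> ei_morphisms Q X"
    and s: "ei_src Q a = ei_trg Q b" "ei_src Q a' = ei_trg Q b'"
    and eq: "ei_comp Q X a b = ei_comp Q X a' b'" and le: "ln b \<le> ln b'"
  shows "\<exists>r\<in>ei_morphisms Q X. ei_src Q r = ei_trg Q b \<and> ei_trg Q r = ei_src Q a' \<and>
    a = ei_comp Q X a' r \<and> b' = ei_comp Q X r b"
proof -
  interpret C: cat "ei_category Q X" by (rule ei_cat)
  have sb: "ei_src Q b = ei_src Q b'" and ta: "ei_trg Q a = ei_trg Q a'"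
    using ei_comp_props[OF m(1,2) s(1)] ei_comp_props[OF m(3,4) s(2)] eq by auto
  show ?thesis
  proof (cases "ln b = 0")
    case True
    \<comment> \<open>\<open>b\<close> is invertible and the comparison morphism is
      \<open>b' b^-1\<close>.\<close>
    from ei_inv[OF m(2) True] obtain c where c: "ei_trg Q b = ei_src Q b" "c \<in> ei_morphisms Q X" "ei_src Q c = ei_src Q b" "ei_trg Q c = ei_src Q b"
      "ei_comp Q X b c = Triv (ei_src Q b) \<one>\<^bsub>vgrp X (ei_src Q b)\<^esub>" "ei_comp Q X c b = Triv (ei_src Q b) \<one>\<^bsub>vgrp X (ei_src Q b)\<^esub>"
      by auto
    have sc: "ei_src Q b' = ei_trg Q c" using sb c by simp
    note r = ei_comp_props[OF m(4) c(2) sc]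
    have "a = ei_comp Q X a (ei_comp Q X b c)" using c(5) ei_ident(2)[OF m(1)] s(1) c(1) by simp
    also have "\<dots> = ei_comp Q X (ei_comp Q X a b) c" by (rule ei_comp_assoc[OF m(1,2) c(2), symmetric]) (use s c in simp_all)
    also have "\<dots> = ei_comp Q X a' (ei_comp Q X b' c)" unfolding eq by (rule ei_comp_assoc[OF m(3,4) c(2)]) (use s sc in simp_all)
    finally have 1: "a = ei_comp Q X a' (ei_comp Q X b' c)" .
    have "ei_comp Q X (ei_comp Q X b' c) b = ei_comp Q X b' (ei_comp Q X c b)"
      by (rule ei_comp_assoc[OF m(4) c(2) m(2)]) (use sc c in simp_all)
    also have "\<dots> = b'" using c(6) ei_ident(2)[OF m(4)] sb by simp
    finally show ?thesis using 1 r s c by (intro bexI[of _ "ei_comp Q X b' c"]) simp_all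
  next
    case lb: False
    show ?thesis
    proof (cases "ln a' = 0")
      case True
      \<comment> \<open>\<open>a'\<close> is invertible and the comparison morphism is
        \<open>a'^-1 a\<close>.\<close>
      from ei_inv[OF m(3) True] obtain c where c: "ei_trg Q a' = ei_src Q a'" "c \<in> ei_morphisms Q X" "ei_src Q c = ei_src Q a'" "ei_trg Q c = ei_src Q a'"
        "ei_comp Q X a' c = Triv (ei_src Q a') \<one>\<^bsub>vgrp X (ei_src Q a')\<^esub>" "ei_comp Q X c a' = Triv (ei_src Q a') \<one>\<^bsub>vgrp X (ei_src Q a')\<^esub>"
        by auto
      have sc: "ei_src Q c = ei_trg Q a" using ta c by simp
      note r = ei_comp_props[OF c(2) m(1) sc]
      have "ei_comp Q X a' (ei_comp Q X c a) = ei_comp Q X (ei_comp Q X a' c) a"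
        by (rule ei_comp_assoc[OF m(3) c(2) m(1), symmetric]) (use sc c in simp_all)
      also have "\<dots> = a" using c(1,5) ei_ident(1)[OF m(1)] ta by simp
      finally have 1: "a = ei_comp Q X a' (ei_comp Q X c a)" ..
      have "ei_comp Q X (ei_comp Q X c a) b = ei_comp Q X c (ei_comp Q X a b)"
        by (rule ei_comp_assoc[OF c(2) m(1,2)]) (use s sc in simp_all)
      also have "\<dots> = ei_comp Q X (ei_comp Q X c a') b'"
        unfolding eq by (rule ei_comp_assoc[OF c(2) m(3,4), symmetric]) (use s c in simp_all)
      also have "\<dots> = b'" using c(6) ei_ident(1)[OF m(4)] s(2) by simp
      finally show ?thesis using 1 r s c by (intro bexI[of _ "ei_comp Q X c a"]) simp_all
    next
      case la': False
      have lens: "ln a + ln b = ln a' + ln b'"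
        using ei_comp_props[OF m(1,2) s(1)] ei_comp_props[OF m(3,4) s(2)] eq by auto
      have l: "ln a \<noteq> 0" "ln b' \<noteq> 0" using lens lb la' le by auto
      obtain p xs where a: "a = Path p (cls p xs)" "pth Q p" "tup X p xs" by (rule ei_len_pos[OF m(1) l(1)])
      obtain q' ys' where b': "b' = Path q' (cls q' ys')" "pth Q q'" "tup X q' ys'" by (rule ei_len_pos[OF m(4) l(2)])
      obtain q ys where b: "b = Path q (cls q ys)" "pth Q q" "tup X q ys" by (rule ei_len_pos[OF m(2) lb])
      obtain p' xs' where a': "a' = Path p' (cls p' xs')" "pth Q p'" "tup X p' xs'" by (rule ei_len_pos[OF m(3) la'])
      have t: "tail Q (last p) = head Q (hd q)" "tail Q (last p') = head Q (hd q')" using s a b a' b' by auto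
      have "(Path (p @ q) (cls (p @ q) (xs @ ys)) :: ('v, 'a, 'g, 'x) ei_mor) = Path (p' @ q') (cls (p' @ q') (xs' @ ys'))"
        using eq unfolding a(1) b(1) a'(1) b'(1) comp_PP[OF a(2,3) b(2,3) t(1)] comp_PP[OF a'(2,3) b'(2,3) t(2)] .
      then have e': "p @ q = p' @ q' \<and> cls (p @ q) (xs @ ys) = cls (p' @ q') (xs' @ ys')"
        by (rule ei_mor.inject(2)[THEN iffD1])
      note e = e'[THEN conjunct1] e'[THEN conjunct2]
      have lq: "length q \<le> length q'" using le unfolding b(1) b'(1) ln.simps .
      obtain s where s': "p = p' @ s \<and> s @ q = q' \<or> p @ s = p' \<and> q = s @ q'"
        using e(1) unfolding append_eq_append_conv2 by (rule exE)
      \<comment> \<open>The assumption on lengths rules out an overlap in the opposite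
        direction.\<close>
      have "s = []" if "q = s @ q'" using arg_cong[OF that, of length] lq by simp
      with s' have sq: "p = p' @ s" "q' = s @ q" by fastforce+
      have pq: "pth Q (p @ q)" by (rule pth_appendI[OF a(2) b(2) t(1)])
      have "peq Q X (p @ q) (xs @ ys) (xs' @ ys')"
        using e cls_eq_iff[OF pq tup_appendI[OF a(3) b(3)], of "xs' @ ys'"] tup_appendI[OF a'(3) b'(3)] by simp
      then have pe: "peq Q X (p' @ q') (xs @ ys) (xs' @ ys')" using e(1) by simp
      have pq': "pth Q (p' @ q')" using pq e(1) by simp
      interpret G: group "vgrp X (tail Q (last p'))" by (rule grp[OF pth_verts(2)[OF a'(2)]])
      let ?i = "\<lambda>g. inv\<^bsub>vgrp X (tail Q (last p'))\<^esub> g"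
      show ?thesis
      proof (cases "s = []")
        case True
        then have pp: "p = p'" "q = q'" using sq by auto
        \<comment> \<open>With an empty overlap the factorisations differ only by the group element
          at the seam, and its inverse is the comparison morphism.\<close>
        obtain g where g: "g \<in> tg (last p')" "peq Q X p' (gr X p' xs g) xs'" "peq Q X q' ys (gl X q' g ys')"
          using pe peq_append[OF pq' pth_ne[OF a'(2)] pth_ne[OF b'(2)] _ a'(3) _ b'(3), of xs ys] a(3) b(3) pp by auto
        have i: "?i g \<in> tg (last p')" using g(1) by simp
        have g': "g \<in> hg (hd q')" "?i g \<in> hg (hd q')" using g(1) i t by auto
        have x: "tup X p' xs" "tup X q' ys" using a b pp by auto
        have "peq Q X p' (gr X p' (gr X p' xs g) (?i g)) (gr X p' xs' (?i g))"
          by (rule peq_gr[OF a'(2) gr_props(1)[OF a'(2) x(1) g(1)] a'(3) i g(2)])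
        then have "peq Q X p' xs (gr X p' xs' (?i g))"
          using gr_props(3)[OF a'(2) x(1) g(1) i] gr_props(2)[OF a'(2) x(1)] G.r_inv[OF g(1)] by simp
        then have 1: "a = ei_comp Q X a' (Triv (tail Q (last p')) (?i g))"
          unfolding a'(1) comp_PT[OF a'(2,3) i] a(1) pp(1)
          using cls_eq_iff[OF a'(2) x(1) gr_props(1)[OF a'(2,3) i]] by simp
        have "peq Q X q' (gl X q' (?i g) ys) (gl X q' (?i g) (gl X q' g ys'))"
          by (rule peq_gl[OF b'(2) x(2) gl_props(1)[OF b'(2,3) g'(1)] g'(2) g(3)])
        then have "peq Q X q' (gl X q' (?i g) ys) ys'"
          using gl_props(3)[OF b'(2,3) g'(2,1)] gl_props(2)[OF b'(2,3)] G.l_inv[OF g(1)] t(2) by simp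
        then have 2: "b' = ei_comp Q X (Triv (tail Q (last p')) (?i g)) b"
          unfolding b(1) pp(2) comp_TP[OF b'(2) x(2) g'(2)] b'(1)
          using cls_eq_iff[OF b'(2) gl_props(1)[OF b'(2) x(2) g'(2)] b'(3)] by simp
        show ?thesis
          by (rule bexI[of _ "Triv (tail Q (last p')) (?i g)"])
            (use 1 2 i a' b t pp pth_verts(2)[OF a'(2)] in \<open>simp_all add: mor_Triv\<close>)
      next
        case False
        \<comment> \<open>The entries \<open>vs\<close> over the overlap form the comparison
          morphism, after correction by the inverse of the element \<open>g\<close> exchanged at the
          seam.\<close>
        obtain us vs where uv: "xs = us @ vs" "tup X p' us" "tup X s vs" using tup_append_ex[of X p' s xs] a(3) sq by auto
        have ps: "pth Q s" "tail Q (last p') = head Q (hd s)" "tail Q (last s) = head Q (hd q)"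
          using pth_append[OF pth_ne[OF a'(2)] False, of Q] a(2) pth_append[OF False pth_ne[OF b(2)], of Q] b'(2) sq by auto
        note vy = tup_appendI[OF uv(3) b(3)]
        obtain g where g: "g \<in> tg (last p')" "peq Q X p' (gr X p' us g) xs'" "peq Q X q' (vs @ ys) (gl X q' g ys')"
          using pe peq_append[OF pq' pth_ne[OF a'(2)] pth_ne[OF b'(2)] uv(2) a'(3) _ b'(3), of "vs @ ys"] vy sq uv by auto
        have i: "?i g \<in> tg (last p')" using g(1) by simp
        have g': "g \<in> hg (hd s)" "?i g \<in> hg (hd s)" using g(1) i ps by auto
        have hq: "hd q' = hd s" using sq False by simp
        note w = gl_props(1)[OF ps(1) uv(3) g'(2)]
        have "gl X s g (gl X s (?i g) vs) = vs"
          using gl_props(3)[OF ps(1) uv(3) g'] gl_props(2)[OF ps(1) uv(3)] G.r_inv[OF g(1)] ps(2) by simp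
        then have "peq Q X (p' @ s) (us @ vs) (xs' @ gl X s (?i g) vs)"
          using peq_append[OF _ pth_ne[OF a'(2)] False uv(2) a'(3) uv(3) w] a(2) sq g peq_refl[OF ps(1) uv(3)] by auto
        then have "cls (p' @ s) (us @ vs) = cls (p' @ s) (xs' @ gl X s (?i g) vs)"
          using cls_eq_iff[OF _ tup_appendI[OF uv(2,3)] tup_appendI[OF a'(3) w]] a(2) sq by simp
        then have 1: "a = ei_comp Q X a' (Path s (cls s (gl X s (?i g) vs)))"
          unfolding a'(1) comp_PP[OF a'(2,3) ps(1) w ps(2)] a(1) by (simp add: sq uv)
        have "peq Q X q' (gl X q' (?i g) (vs @ ys)) (gl X q' (?i g) (gl X q' g ys'))"
          using peq_gl[OF b'(2) _ gl_props(1)[OF b'(2,3)], of "vs @ ys" g "?i g"] vy sq g g' hq by simp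
        then have "peq Q X q' (gl X s (?i g) vs @ ys) ys'"
          using gl_props(3)[OF b'(2,3), of "?i g" g] gl_props(2)[OF b'(2,3)] G.l_inv[OF g(1)] ps(2) g' hq
            gl_append[OF False tup_ne[OF uv(3) False], of q "?i g" ys] sq by simp
        then have "cls q' (gl X s (?i g) vs @ ys) = cls q' ys'"
          using cls_eq_iff[OF b'(2) _ b'(3), of "gl X s (?i g) vs @ ys"] tup_appendI[OF w b(3)] sq by simp
        then have 2: "b' = ei_comp Q X (Path s (cls s (gl X s (?i g) vs))) b"
          unfolding b(1) comp_PP[OF ps(1) w b(2,3) ps(3)] b'(1) by (simp add: sq)
        show ?thesis
          by (rule bexI[OF _ mor_Path[OF ps(1) w]]) (use 1 2 a' b ps in simp_all)
      qed
    qed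
  qed
qed

end

section \<open>Free actions and cancellation\<close>

locale free_EI_quiver = finite_EI_quiver Q X
  for Q :: "('v, 'a) pre_digraph" and X :: "('v, 'a, 'g, 'x) assignment" +
  assumes action_free: "action_free Q X"
begin

lemma act_free:
  assumes "a \<in> arcs Q" "x \<in> bcarrier (abis X a)"
  shows "h \<in> tg a \<Longrightarrow> ract (abis X a) x h = x \<Longrightarrow> h = \<one>\<^bsub>vgrp X (tail Q a)\<^esub>"
    "g \<in> hg a \<Longrightarrow> lact (abis X a) g x = x \<Longrightarrow> g = \<one>\<^bsub>vgrp X (head Q a)\<^esub>"
  using assms action_free unfolding action_free_def left_free_def right_free_def by blast+

text \<open>Right freeness at the first arrow forces the element moved across the first gap to be
  the unit, which hands the claim on to the rest of the path, down to its last arrow.\<close>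

lemma peq_gr_free: "pth Q p \<Longrightarrow> tup X p xs \<Longrightarrow> g \<in> tg (last p) \<Longrightarrow> peq Q X p (gr X p xs g) xs \<Longrightarrow> g = \<one>\<^bsub>vgrp X (tail Q (last p))\<^esub>"
proof (induction p arbitrary: xs)
  case (Cons a p)
  obtain x ys where x: "xs = x # ys" "x \<in> bcarrier (abis X a)" "tup X p ys" using Cons(3) by (auto simp: tup_Cons)
  show ?case
  proof (cases "p = []")
    case True
    then show ?thesis using Cons x act_free(1)[of a x g] by auto
  next
    case False
    have p: "pth Q p" "a \<in> arcs Q" "tail Q a = head Q (hd p)" using Cons(2) False by (auto simp: pth_Cons)
    have "peq Q X (a # p) (x # gr X p ys g) (x # ys)" using Cons(5) x False tup_ne[OF x(3) False] by simp
    then obtain h where h: "h \<in> tg a" "x = ract (abis X a) x h" "peq Q X p (gr X p ys g) (gl X p h ys)"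
      unfolding peq_Cons[OF False] by blast
    have "h = \<one>\<^bsub>vgrp X (tail Q a)\<^esub>" by (rule act_free(1)[OF p(2) x(2) h(1) h(2)[symmetric]])
    then have "peq Q X p (gr X p ys g) ys" using h(3) gl_props(2)[OF p(1) x(3)] p(3) by simp
    then show ?thesis using Cons.IH[OF p(1) x(3)] Cons(4) False by simp
  qed
qed simp

text \<open>The order is opposite to \<open>peq_gr_free\<close>: the induction hypothesis on the
  tail kills the element moved across the first gap, and left freeness at the first arrow
  finishes.\<close>

lemma peq_gl_free: "pth Q p \<Longrightarrow> tup X p xs \<Longrightarrow> g \<in> hg (hd p) \<Longrightarrow> peq Q X p xs (gl X p g xs) \<Longrightarrow> g = \<one>\<^bsub>vgrp X (head Q (hd p))\<^esub>"
proof (induction p arbitrary: xs g)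
  case (Cons a p)
  obtain x ys where x: "xs = x # ys" "x \<in> bcarrier (abis X a)" "tup X p ys" using Cons(3) by (auto simp: tup_Cons)
  show ?case
  proof (cases "p = []")
    case True
    then show ?thesis using Cons x act_free(2)[of a x g] by auto
  next
    case False
    have p: "pth Q p" "a \<in> arcs Q" "tail Q a = head Q (hd p)" using Cons(2) False by (auto simp: pth_Cons)
    have "peq Q X (a # p) (x # ys) (lact (abis X a) g x # ys)" using Cons(5) x by simp
    then obtain h where h: "h \<in> tg a" "lact (abis X a) g x = ract (abis X a) x h" "peq Q X p ys (gl X p h ys)"
      unfolding peq_Cons[OF False] by blast
    have "h = \<one>\<^bsub>vgrp X (head Q (hd p))\<^esub>" by (rule Cons.IH[OF p(1) x(3) _ h(3)]) (use h(1) p(3) in simp)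
    then have "lact (abis X a) g x = x" using h(2) act(4)[OF p(2) x(2)] p(3) by simp
    then show ?thesis using act_free(2)[OF p(2) x(2), of g] Cons(4) by simp
  qed
qed simp

text \<open>By \<open>peq_append\<close> two such products can differ only through a group element
  at the seam that fixes the class of the common left factor; freeness makes it the unit. A common
  factor of length zero is inverted instead.\<close>

lemma ei_cancel_left:
  assumes m: "a \<in> ei_morphisms Q X" "b \<in> ei_morphisms Q X" "b' \<in> ei_morphisms Q X"
    and s: "ei_src Q a = ei_trg Q b" "ei_src Q a = ei_trg Q b'" and eq: "ei_comp Q X a b = ei_comp Q X a b'"
  shows "b = b'"
proof (cases "ln a = 0")
  case True
  from ei_inv[OF m(1) True] obtain c where c: "c \<in> ei_morphisms Q X" "ei_src Q c = ei_src Q a" "ei_trg Q a = ei_src Q a"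
    "ei_comp Q X c a = Triv (ei_src Q a) \<one>\<^bsub>vgrp X (ei_src Q a)\<^esub>" by auto
  have "ei_comp Q X (ei_comp Q X c a) b = ei_comp Q X (ei_comp Q X c a) b'"
    using ei_comp_assoc[OF c(1) m(1,2)] ei_comp_assoc[OF c(1) m(1,3)] c s eq by simp
  then show ?thesis using c(4) ei_ident(1)[OF m(2)] ei_ident(1)[OF m(3)] s by simp
next
  case False
  then obtain p xs where a: "a = Path p (cls p xs)" "pth Q p" "tup X p xs" using ei_len_pos[OF m(1)] by blast
  have l: "ln b = ln b'" using ei_comp_props[OF m(1,2) s(1)] ei_comp_props[OF m(1,3) s(2)] eq by auto
  interpret G: group "vgrp X (tail Q (last p))" by (rule grp[OF pth_verts(2)[OF a(2)]])
  show ?thesis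
  proof (cases "ln b = 0")
    case True
    obtain i h where b1: "b = Triv i h" "h \<in> carrier (vgrp X i)" by (rule ei_len0[OF m(2) True])
    obtain j h' where b2: "b' = Triv j h'" "h' \<in> carrier (vgrp X j)" by (rule ei_len0[OF m(3) True[unfolded l]])
    note b = b1 b2
    have ij: "i = tail Q (last p)" "j = tail Q (last p)" using s a b by auto
    have h: "h \<in> tg (last p)" "h' \<in> tg (last p)" using b ij by auto
    let ?i = "inv\<^bsub>vgrp X (tail Q (last p))\<^esub> h'"
    have i: "?i \<in> tg (last p)" using h by simp
    have "peq Q X p (gr X p xs h) (gr X p xs h')"
      using eq a(1) b comp_PT[OF a(2,3) h(1)] comp_PT[OF a(2,3) h(2)]
        cls_eq_iff[OF a(2) gr_props(1)[OF a(2,3) h(1)] gr_props(1)[OF a(2,3) h(2)]] by simp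
    from peq_gr[OF a(2) gr_props(1)[OF a(2,3) h(1)] gr_props(1)[OF a(2,3) h(2)] i this]
    have "peq Q X p (gr X p xs (h \<otimes>\<^bsub>vgrp X (tail Q (last p))\<^esub> ?i)) xs"
      using gr_props(3)[OF a(2,3) h(1) i] gr_props(3)[OF a(2,3) h(2) i] gr_props(2)[OF a(2,3)] G.r_inv[OF h(2)] by simp
    then have "h \<otimes>\<^bsub>vgrp X (tail Q (last p))\<^esub> ?i = \<one>\<^bsub>vgrp X (tail Q (last p))\<^esub>"
      by (rule peq_gr_free[OF a(2,3) G.m_closed[OF h(1) i]])
    then have "h = h'" using h G.inv_equality[OF _ i h(1)] G.inv_inv by simp
    then show ?thesis using b ij by simp
  next
    case lb: False
    obtain q ys where b: "b = Path q (cls q ys)" "pth Q q" "tup X q ys" by (rule ei_len_pos[OF m(2) lb])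
    obtain q' ys' where b': "b' = Path q' (cls q' ys')" "pth Q q'" "tup X q' ys'"
      by (rule ei_len_pos[OF m(3) lb[unfolded l]])
    have t: "tail Q (last p) = head Q (hd q)" "tail Q (last p) = head Q (hd q')" using s a b b' by auto
    have e: "(Path (p @ q) (cls (p @ q) (xs @ ys)) :: ('v, 'a, 'g, 'x) ei_mor) = Path (p @ q') (cls (p @ q') (xs @ ys'))"
      using eq unfolding a(1) b(1) b'(1) comp_PP[OF a(2,3) b(2,3) t(1)] comp_PP[OF a(2,3) b'(2,3) t(2)] .
    then have q: "q' = q" by simp
    have y: "tup X q ys'" using b'(3) q by simp
    note pq = pth_appendI[OF a(2) b(2) t(1)]
    have "peq Q X (p @ q) (xs @ ys) (xs @ ys')"
      using e q cls_eq_iff[OF pq tup_appendI[OF a(3) b(3)] tup_appendI[OF a(3) y]] by simp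
    then obtain g where g: "g \<in> tg (last p)" "peq Q X p (gr X p xs g) xs" "peq Q X q ys (gl X q g ys')"
      using peq_append[OF pq pth_ne[OF a(2)] pth_ne[OF b(2)] a(3) a(3) b(3) y] by auto
    have "g = \<one>\<^bsub>vgrp X (tail Q (last p))\<^esub>" by (rule peq_gr_free[OF a(2,3) g(1,2)])
    then have "peq Q X q ys ys'" using g(3) gl_props(2)[OF b(2) y] t(1) by simp
    then show ?thesis using cls_eq_iff[OF b(2,3) y] b b' q by simp
  qed
qed

text \<open>As for \<open>ei_cancel_left\<close>, with the group element at the seam now fixing the
  class of the common right factor, so that \<open>peq_gl_free\<close> applies.\<close>

lemma ei_cancel_right:
  assumes m: "a \<in> ei_morphisms Q X" "a' \<in> ei_morphisms Q X" "b \<in> ei_morphisms Q X"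
    and s: "ei_src Q a = ei_trg Q b" "ei_src Q a' = ei_trg Q b" and eq: "ei_comp Q X a b = ei_comp Q X a' b"
  shows "a = a'"
proof (cases "ln b = 0")
  case True
  from ei_inv[OF m(3) True] obtain c where c: "c \<in> ei_morphisms Q X" "ei_trg Q c = ei_src Q b" "ei_trg Q b = ei_src Q b"
    "ei_comp Q X b c = Triv (ei_src Q b) \<one>\<^bsub>vgrp X (ei_src Q b)\<^esub>" by auto
  have sa: "ei_src Q a = ei_src Q b" "ei_src Q a' = ei_src Q b" using s c(3) by auto
  have "ei_comp Q X a (ei_comp Q X b c) = ei_comp Q X (ei_comp Q X a b) c"
    by (rule ei_comp_assoc[OF m(1,3) c(1), symmetric]) (use s c in simp_all)
  also have "\<dots> = ei_comp Q X a' (ei_comp Q X b c)"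
    unfolding eq by (rule ei_comp_assoc[OF m(2,3) c(1)]) (use s c in simp_all)
  finally show ?thesis
    unfolding c(4) using ei_ident(2)[OF m(1), unfolded sa(1)] ei_ident(2)[OF m(2), unfolded sa(2)] by simp
next
  case False
  then obtain q ys where b: "b = Path q (cls q ys)" "pth Q q" "tup X q ys" using ei_len_pos[OF m(3)] by blast
  have l: "ln a = ln a'" using ei_comp_props[OF m(1,3) s(1)] ei_comp_props[OF m(2,3) s(2)] eq by auto
  interpret G: group "vgrp X (head Q (hd q))" by (rule grp[OF pth_verts(1)[OF b(2)]])
  show ?thesis
  proof (cases "ln a = 0")
    case True
    obtain i h where a1: "a = Triv i h" "h \<in> carrier (vgrp X i)" by (rule ei_len0[OF m(1) True])
    obtain j h' where a2: "a' = Triv j h'" "h' \<in> carrier (vgrp X j)" by (rule ei_len0[OF m(2) True[unfolded l]])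
    note a = a1 a2
    have ij: "i = head Q (hd q)" "j = head Q (hd q)" using s a b by auto
    have h: "h \<in> hg (hd q)" "h' \<in> hg (hd q)" using a ij by auto
    let ?i = "inv\<^bsub>vgrp X (head Q (hd q))\<^esub> h"
    have i: "?i \<in> hg (hd q)" using h by simp
    have "peq Q X q (gl X q h ys) (gl X q h' ys)"
      using eq b(1) a comp_TP[OF b(2,3) h(1)] comp_TP[OF b(2,3) h(2)]
        cls_eq_iff[OF b(2) gl_props(1)[OF b(2,3) h(1)] gl_props(1)[OF b(2,3) h(2)]] by simp
    from peq_gl[OF b(2) gl_props(1)[OF b(2,3) h(1)] gl_props(1)[OF b(2,3) h(2)] i this]
    have "peq Q X q ys (gl X q (?i \<otimes>\<^bsub>vgrp X (head Q (hd q))\<^esub> h') ys)"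
      using gl_props(3)[OF b(2,3) i h(1)] gl_props(3)[OF b(2,3) i h(2)] gl_props(2)[OF b(2,3)] G.l_inv[OF h(1)] by simp
    then have "?i \<otimes>\<^bsub>vgrp X (head Q (hd q))\<^esub> h' = \<one>\<^bsub>vgrp X (head Q (hd q))\<^esub>"
      by (rule peq_gl_free[OF b(2,3) G.m_closed[OF i h(2)]])
    then have "inv\<^bsub>vgrp X (head Q (hd q))\<^esub> h' = inv\<^bsub>vgrp X (head Q (hd q))\<^esub> h"
      by (rule G.inv_equality[OF _ h(2) i])
    then have "h = h'" by (rule inj_onD[OF G.inv_inj _ h(2,1), symmetric])
    then show ?thesis using a ij by simp
  next
    case la: False
    obtain p xs where a: "a = Path p (cls p xs)" "pth Q p" "tup X p xs" by (rule ei_len_pos[OF m(1) la])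
    obtain p' xs' where a': "a' = Path p' (cls p' xs')" "pth Q p'" "tup X p' xs'"
      by (rule ei_len_pos[OF m(2) la[unfolded l]])
    have t: "tail Q (last p) = head Q (hd q)" "tail Q (last p') = head Q (hd q)" using s a b a' by auto
    have e: "(Path (p @ q) (cls (p @ q) (xs @ ys)) :: ('v, 'a, 'g, 'x) ei_mor) = Path (p' @ q) (cls (p' @ q) (xs' @ ys))"
      using eq unfolding a(1) b(1) a'(1) comp_PP[OF a(2,3) b(2,3) t(1)] comp_PP[OF a'(2,3) b(2,3) t(2)] .
    then have p: "p' = p" by simp
    have x: "tup X p xs'" using a'(3) p by simp
    note pq = pth_appendI[OF a(2) b(2) t(1)]
    have "peq Q X (p @ q) (xs @ ys) (xs' @ ys)"
      using e p cls_eq_iff[OF pq tup_appendI[OF a(3) b(3)] tup_appendI[OF x b(3)]] by simp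
    then obtain g where g: "g \<in> tg (last p)" "peq Q X p (gr X p xs g) xs'" "peq Q X q ys (gl X q g ys)"
      using peq_append[OF pq pth_ne[OF a(2)] pth_ne[OF b(2)] a(3) x b(3) b(3)] by auto
    have "g = \<one>\<^bsub>vgrp X (head Q (hd q))\<^esub>" by (rule peq_gl_free[OF b(2,3) _ g(3)]) (use g(1) t in simp)
    then have "peq Q X p xs xs'" using g(2) gr_props(2)[OF a(2,3)] t(1) by simp
    then show ?thesis using cls_eq_iff[OF a(2,3) x] a a' p by simp
  qed
qed

lemma ei_free_cat:
  assumes "acyclic_quiver Q"
  shows "free_cat (ei_category Q X) ln"
proof (intro free_cat.intro ei_cat free_cat_axioms.intro, goal_cases)
  case 1 show ?case using finite_ei_morphisms[OF assms] by simp
next case (2 a b) then show ?case using ei_comp_props[of a b] by simp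
next case (3 i) show ?case by simp
next case (4 a) then show ?case using ei_inv[of a] by simp
next case (5 a) then show ?case using ei_inv[of a] by auto
next case (6 a n) then show ?case using ei_factor[of a n] by simp
next case (7 a b a' b') then show ?case using ei_levi[of a b a' b'] by simp
next case (8 a b b') then show ?case using ei_cancel_left[of a b b'] by simp
next case (9 a a' b) then show ?case using ei_cancel_right[of a a' b] by simp
qed

end

section \<open>The double of an EI quiver\<close>

lemma dual_biset_simps [simp]:
  "bcarrier (dual_biset G1 G2 Y) = bcarrier Y"
  "lact (dual_biset G1 G2 Y) g y = ract Y y (inv\<^bsub>G2\<^esub> g)"
  "ract (dual_biset G1 G2 Y) y g = lact Y (inv\<^bsub>G1\<^esub> g) y"
  by (simp_all add: dual_biset_def)

text \<open>Inversion reverses products, so it exchanges left and right actions.\<close>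

lemma biset_dual:
  assumes "biset G1 G2 Y"
  shows "biset G2 G1 (dual_biset G1 G2 Y)"
proof -
  interpret biset G1 G2 Y by (rule assms)
  show ?thesis
    by (intro biset.intro biset_axioms.intro G1.group_axioms G2.group_axioms)
      (simp_all add: lact_closed ract_closed lact_one ract_one lact_mult ract_mult act_commute
        G1.inv_mult_group G2.inv_mult_group)
qed

lemma double_simps [simp]:
  "verts (double_quiver Q) = verts Q"
  "Fwd a \<in> arcs (double_quiver Q) \<longleftrightarrow> a \<in> arcs Q" "Rev a \<in> arcs (double_quiver Q) \<longleftrightarrow> a \<in> arcs Q"
  "tail (double_quiver Q) (Fwd a) = tail Q a" "tail (double_quiver Q) (Rev a) = head Q a"
  "head (double_quiver Q) (Fwd a) = head Q a" "head (double_quiver Q) (Rev a) = tail Q a"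
  "vgrp (double_assignment Q X) = vgrp X"
  "abis (double_assignment Q X) (Fwd a) = abis X a"
  "abis (double_assignment Q X) (Rev a) = dual_biset (vgrp X (head Q a)) (vgrp X (tail Q a)) (abis X a)"
  by (auto simp: double_quiver_def double_assignment_def)

lemma (in finite_EI_quiver) double_EI: "finite_EI_quiver (double_quiver Q) (double_assignment Q X)"
proof -
  have arcs: "arcs (double_quiver Q) = Fwd ` arcs Q \<union> Rev ` arcs Q" by (simp add: double_quiver_def)
  have "fin_digraph (double_quiver Q)"
    by (unfold_locales) (auto simp: arcs)
  then show ?thesis
    by (intro finite_EI_quiver.intro finite_EI_quiver_axioms.intro)
      (auto simp: arcs vgrp_group vgrp_finite abis_finite abis_nonempty abis_biset[THEN biset_dual] intro: abis_biset)
qed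

fun is_rev :: "'a double_arrow \<Rightarrow> bool" where
  "is_rev (Fwd a) = False"
| "is_rev (Rev a) = True"

lemma filter_is_rev_Fwd [simp]: "filter is_rev (map Fwd p) = []"
  by (induction p) auto

lemma map_Fwd_eq [simp]: "map Fwd p = map Fwd q \<longleftrightarrow> p = q"
  by (rule inj_map_eq_map) (auto intro: injI)

lemma no_rev: "filter is_rev p = [] \<Longrightarrow> \<exists>q. p = map Fwd q"
proof (induction p)
  case (Cons b p)
  then show ?case by (cases b) (auto intro: exI[of _ "_ # _"])
qed simp

lemma one_rev: "length (filter is_rev p) = 1 \<Longrightarrow> \<exists>q a r. p = map Fwd q @ [Rev a] @ map Fwd r"
proof (induction p)
  case (Cons b p)
  show ?case
  proof (cases b)
    case (Fwd c)
    then obtain q a r where "p = map Fwd q @ [Rev a] @ map Fwd r" using Cons by auto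
    then have "b # p = map Fwd (c # q) @ [Rev a] @ map Fwd r" using Fwd by simp
    then show ?thesis by blast
  next
    case (Rev a)
    then obtain r where "p = map Fwd r" using Cons(2) no_rev[of p] by auto
    then have "b # p = map Fwd [] @ [Rev a] @ map Fwd r" using Rev by simp
    then show ?thesis by blast
  qed
qed simp

lemma first_rev: "filter is_rev p \<noteq> [] \<Longrightarrow> \<exists>q r. p = q @ r \<and> length (filter is_rev q) = 1"
proof (induction p)
  case (Cons b p)
  show ?case
  proof (cases b)
    case (Fwd c)
    then obtain q r where "p = q @ r" "length (filter is_rev q) = 1" using Cons by auto
    then have "b # p = (b # q) @ r \<and> length (filter is_rev (b # q)) = 1" using Fwd by simp
    then show ?thesis by blast
  next
    case (Rev a)
    then have "b # p = [b] @ p \<and> length (filter is_rev [b]) = 1" by simp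
    then show ?thesis by blast
  qed
qed simp

lemma one_rev_unique:
  "map Fwd q @ Rev a # map Fwd r = map Fwd q' @ Rev a' # map Fwd r' \<Longrightarrow> q = q' \<and> a = a' \<and> r = r'"
proof (induction q arbitrary: q')
  case Nil
  then show ?case by (cases q') auto
next
  case (Cons b q)
  then show ?case by (cases q') auto
qed

text \<open>Composition becomes concatenation here, also for group elements, which have the empty
  list; length and degree are therefore additive without case distinctions.\<close>

fun pl :: "('v, 'a, 'g, 'x) ei_mor \<Rightarrow> 'a list" where
  "pl (Triv i g) = []"
| "pl (Path p c) = p"

lemma ln_pl: "ln w = length (pl w)"
  by (cases w) auto

lemma pl_comp [simp]: "pl (ei_comp Q X a b) = pl a @ pl b"
  by (cases a; cases b) (auto simp: ei_comp.simps)

context finite_EI_quiver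
begin

text \<open>A tuple over the path can be cut at the same place as the arrow list; an empty side is
  filled with an identity.\<close>

lemma ei_split:
  assumes w: "w \<in> ei_morphisms Q X" and p: "pl w = p @ q"
  shows "\<exists>a\<in>ei_morphisms Q X. \<exists>b\<in>ei_morphisms Q X. ei_src Q a = ei_trg Q b \<and> w = ei_comp Q X a b \<and> pl a = p \<and> pl b = q"
proof -
  consider "p = []" | "q = []" | "p \<noteq> []" "q \<noteq> []" by blast
  then show ?thesis
  proof cases
    case 1
    show ?thesis
      by (rule bexI[of _ "Triv (ei_trg Q w) \<one>\<^bsub>vgrp X (ei_trg Q w)\<^esub>"], rule bexI[OF _ w])
        (use 1 p ei_ident(1)[OF w] ident_mor ei_src_trg_verts[OF w] in simp_all)
  next
    case 2
    show ?thesis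
      by (rule bexI[OF _ w], rule bexI[of _ "Triv (ei_src Q w) \<one>\<^bsub>vgrp X (ei_src Q w)\<^esub>"])
        (use 2 p ei_ident(2)[OF w] ident_mor ei_src_trg_verts[OF w] in simp_all)
  next
    case 3
    from w show ?thesis
    proof (cases rule: mor_cases)
      case (T i g)
      then show ?thesis using p 3 by simp
    next
      case (P r zs)
      then have pr: "r = p @ q" using p by simp
      obtain xs ys where z: "zs = xs @ ys" "tup X p xs" "tup X q ys" using tup_append_ex[of X p q zs] P(3) pr by auto
      have pq: "pth Q p" "pth Q q" "tail Q (last p) = head Q (hd q)"
        using pth_append[OF 3, of Q] P(2) pr by auto
      show ?thesis
        by (rule bexI[OF _ mor_Path[OF pq(1) z(2)]], rule bexI[OF _ mor_Path[OF pq(2) z(3)]])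
          (use comp_PP[OF pq(1) z(2) pq(2) z(3) pq(3)] pq P(1) pr z(1) in simp)
    qed
  qed
qed

text \<open>A single entry has no neighbour with which to exchange a group element.\<close>

lemma cls_single:
  assumes "a \<in> arcs Q" "y \<in> bcarrier (abis X a)"
  shows "cls [a] [y] = {[y]}"
proof (rule Set.set_eqI)
  fix zs
  have "zs \<in> cls [a] [y] \<longleftrightarrow> tup X [a] zs \<and> peq Q X [a] [y] zs"
    by (rule mem_cls) (use assms in simp_all)
  also have "\<dots> \<longleftrightarrow> zs = [y]" using assms by auto
  finally show "zs \<in> cls [a] [y] \<longleftrightarrow> zs \<in> {[y]}" by simp
qed

lemma arrow_mor_eq: "a \<in> arcs Q \<Longrightarrow> y \<in> bcarrier (abis X a) \<Longrightarrow> arrow_mor Q X a y = Path [a] {[y]}"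
  using cls_single[of a y] by (simp add: arrow_mor_def cls_def)

lemma arrow_in_mor: "a \<in> arcs Q \<Longrightarrow> y \<in> bcarrier (abis X a) \<Longrightarrow> Path [a] {[y]} \<in> ei_morphisms Q X"
  using mor_Path[of "[a]" "[y]"] cls_single[of a y] by simp

lemma arrow_ex:
  assumes "w \<in> ei_morphisms Q X" "pl w = [a]"
  obtains y where "a \<in> arcs Q" "y \<in> bcarrier (abis X a)" "w = Path [a] {[y]}"
  using assms(1)
proof (cases rule: mor_cases)
  case (P p xs)
  then have p: "p = [a]" using assms(2) by simp
  obtain y where y: "xs = [y]" "y \<in> bcarrier (abis X a)" using P(3) p by (auto simp: tup_Cons)
  have a: "a \<in> arcs Q" using P(2) p by simp
  show ?thesis by (rule that[OF a y(2)]) (use P(1) p y cls_single[OF a y(2)] in simp)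
qed (use assms(2) in simp)

lemma arrow_act:
  assumes a: "a \<in> arcs Q" "y \<in> bcarrier (abis X a)"
  shows "g \<in> hg a \<Longrightarrow> ei_comp Q X (Triv i g) (Path [a] {[y]}) = Path [a] {[lact (abis X a) g y]}"
    "h \<in> tg a \<Longrightarrow> ei_comp Q X (Path [a] {[y]}) (Triv i h) = Path [a] {[ract (abis X a) y h]}"
proof -
  have p: "pth Q [a]" "tup X [a] [y]" using a by auto
  show "g \<in> hg a \<Longrightarrow> ei_comp Q X (Triv i g) (Path [a] {[y]}) = Path [a] {[lact (abis X a) g y]}"
    using comp_TP[OF p, of g i] cls_single[OF a] cls_single[OF a(1) act(1)[OF a]] by simp
  show "h \<in> tg a \<Longrightarrow> ei_comp Q X (Path [a] {[y]}) (Triv i h) = Path [a] {[ract (abis X a) y h]}"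
    using comp_PT[OF p, of h i] cls_single[OF a] cls_single[OF a(1) act(2)[OF a]] by simp
qed

end

section \<open>The copy of the category inside its double, and the reversed arrows\<close>

fun io :: "('v, 'a, 'g, 'x) ei_mor \<Rightarrow> ('v, 'a double_arrow, 'g, 'x) ei_mor" where
  "io (Triv i g) = Triv i g"
| "io (Path p c) = Path (map Fwd p) c"

text \<open>Applied to single arrows, whose class is a singleton; the dual biset has the same
  underlying elements, so only the arrow label changes.\<close>

fun st :: "('v, 'a, 'g, 'x) ei_mor \<Rightarrow> ('v, 'a double_arrow, 'g, 'x) ei_mor" where
  "st (Triv i g) = Triv i g"
| "st (Path p c) = Path (map Rev p) c"

definition dgr :: "('v, 'a double_arrow, 'g, 'x) ei_mor \<Rightarrow> nat" where
  "dgr w = length (filter is_rev (pl w))"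

lemma pl_io [simp]: "pl (io c) = map Fwd (pl c)"
  by (cases c) auto

lemma io_inj: "io a = io b \<longleftrightarrow> a = b"
  by (cases a; cases b) auto

lemma pth_Fwd [simp]: "pth (double_quiver Q) (map Fwd p) \<longleftrightarrow> pth Q p"
proof (induction p)
  case (Cons a p)
  then show ?case by (cases p) auto
qed simp

lemma tup_Fwd [simp]: "tup (double_assignment Q X) (map Fwd p) xs \<longleftrightarrow> tup X p xs"
  by (simp add: tup_def list_all2_map1)

lemma gl_Fwd: "p \<noteq> [] \<Longrightarrow> gl (double_assignment Q X) (map Fwd p) g xs = gl X p g xs"
  by (simp add: gl_def hd_map)

lemma gr_Fwd: "p \<noteq> [] \<Longrightarrow> gr (double_assignment Q X) (map Fwd p) xs g = gr X p xs g"
  by (simp add: gr_def last_map)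

lemma peq_Fwd [simp]: "peq (double_quiver Q) (double_assignment Q X) (map Fwd p) xs ys \<longleftrightarrow> peq Q X p xs ys"
proof (induction p arbitrary: xs ys)
  case (Cons a p)
  show ?case
  proof (cases p)
    case (Cons b q)
    then show ?thesis
      using Cons.IH gl_Fwd[of p Q X] by (cases xs; cases ys) (simp_all add: Cons)
  qed simp
qed simp

context free_EI_quiver
begin

text \<open>The double inherits finiteness and the bisets but is acyclic only if there are no
  arrows. It therefore yields \<open>cat\<close>, with infinitely many morphisms in general, and its
  Levi property comes from \<open>ei_levi\<close>, which needs no acyclicity.\<close>

sublocale D: finite_EI_quiver "double_quiver Q" "double_assignment Q X"
  by (rule double_EI)

abbreviation "mC \<equiv> ei_morphisms Q X"
abbreviation "mD \<equiv> ei_morphisms (double_quiver Q) (double_assignment Q X)"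
abbreviation "cC \<equiv> ei_comp Q X"
abbreviation "cD \<equiv> ei_comp (double_quiver Q) (double_assignment Q X)"
abbreviation "sD \<equiv> ei_src (double_quiver Q)"
abbreviation "tD \<equiv> ei_trg (double_quiver Q)"

lemma cls_Fwd: "pth Q p \<Longrightarrow> tup X p xs \<Longrightarrow> D.cls (map Fwd p) xs = cls p xs"
  by (intro Set.set_eqI) (simp add: D.mem_cls mem_cls)

lemma io_mor: "a \<in> mC \<Longrightarrow> io a \<in> mD"
proof (elim mor_cases)
  fix p xs assume a: "a = Path p (cls p xs)" "pth Q p" "tup X p xs"
  then show "io a \<in> mD" using D.mor_Path[of "map Fwd p" xs] cls_Fwd[of p xs] by simp
qed (simp add: mor_Triv D.mor_Triv)

lemma io_src_trg:
  assumes "a \<in> mC"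
  shows "sD (io a) = ei_src Q a" "tD (io a) = ei_trg Q a"
proof -
  have "sD (io a) = ei_src Q a \<and> tD (io a) = ei_trg Q a"
    using assms
  proof (cases rule: mor_cases)
    case (P p xs)
    then show ?thesis using pth_ne[OF P(2)] by (simp add: hd_map last_map)
  qed simp
  then show "sD (io a) = ei_src Q a" "tD (io a) = ei_trg Q a" by auto
qed

lemma io_comp:
  assumes m: "a \<in> mC" "b \<in> mC" and s: "ei_src Q a = ei_trg Q b"
  shows "io (cC a b) = cD (io a) (io b)"
  using m(1)
proof (cases rule: mor_cases)
  case a: (T i g)
  from m(2) show ?thesis
  proof (cases rule: mor_cases)
    case (T j h)
    then show ?thesis using a by simp
  next
    case b: (P q ys)
    have g: "g \<in> hg (hd q)" "g \<in> D.hg (hd (map Fwd q))" using a b s pth_ne[OF b(2)] by (auto simp: hd_map)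
    note b' = pth_Fwd[of Q, THEN iffD2, OF b(2)] tup_Fwd[of Q, THEN iffD2, OF b(3)]
    show ?thesis
      using a(1) b(1) comp_TP[OF b(2,3) g(1)] D.comp_TP[OF b' g(2)] gl_Fwd[OF pth_ne[OF b(2)], of Q X g ys]
        cls_Fwd[OF b(2,3)] cls_Fwd[OF b(2) gl_props(1)[OF b(2,3) g(1)]] by simp
  qed
next
  case a: (P p xs)
  note a' = pth_Fwd[of Q, THEN iffD2, OF a(2)] tup_Fwd[of Q, THEN iffD2, OF a(3)]
  from m(2) show ?thesis
  proof (cases rule: mor_cases)
    case b: (T j h)
    have h: "h \<in> tg (last p)" "h \<in> D.tg (last (map Fwd p))" using a b s pth_ne[OF a(2)] by (auto simp: last_map)
    show ?thesis
      using a(1) b(1) comp_PT[OF a(2,3) h(1)] D.comp_PT[OF a' h(2)] gr_Fwd[OF pth_ne[OF a(2)], of Q X xs h]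
        cls_Fwd[OF a(2,3)] cls_Fwd[OF a(2) gr_props(1)[OF a(2,3) h(1)]] by simp
  next
    case b: (P q ys)
    note b' = pth_Fwd[of Q, THEN iffD2, OF b(2)] tup_Fwd[of Q, THEN iffD2, OF b(3)]
    have c: "tail Q (last p) = head Q (hd q)" using a b s by simp
    have c': "tail (double_quiver Q) (last (map Fwd p)) = head (double_quiver Q) (hd (map Fwd q))"
      using c pth_ne[OF a(2)] pth_ne[OF b(2)] by (simp add: hd_map last_map)
    show ?thesis
      using a(1) b(1) comp_PP[OF a(2,3) b(2,3) c] D.comp_PP[OF a' b' c']
        cls_Fwd[OF a(2,3)] cls_Fwd[OF b(2,3)] cls_Fwd[OF pth_appendI[OF a(2) b(2) c] tup_appendI[OF a(3) b(3)]] by simp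
  qed
qed

lemma io_surj:
  assumes "w \<in> mD" "dgr w = 0"
  shows "\<exists>c\<in>mC. w = io c"
  using assms(1)
proof (cases rule: D.mor_cases)
  case (T i g)
  then show ?thesis by (intro bexI[of _ "Triv i g"]) (simp_all add: mor_Triv)
next
  case (P p xs)
  then obtain q where q: "p = map Fwd q" using no_rev[of p] assms(2) by (auto simp: dgr_def)
  have x: "pth Q q" "tup X q xs" using P q by auto
  show ?thesis by (rule bexI[OF _ mor_Path[OF x]]) (use P q cls_Fwd[OF x] in simp)
qed

lemma graded: "graded_cat (ei_category Q X) (ei_category (double_quiver Q) (double_assignment Q X)) io dgr"
proof (intro graded_cat.intro ei_cat D.ei_cat graded_cat_axioms.intro, goal_cases)
  case (1 c) then show ?case using io_mor by simp
next case (2 c) then show ?case using io_src_trg by simp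
next case (3 c) then show ?case using io_src_trg by simp
next case (4 c) then show ?case by (simp add: dgr_def)
next case (5 a b) then show ?case using io_comp by simp
next case 6 show ?case by simp
next case (7 i) show ?case by simp
next case 8 show ?case by (simp add: inj_on_def io_inj)
next case (9 w) then show ?case using io_surj by simp
next case (10 v w) then show ?case by (simp add: dgr_def)
next
  case (11 v w v' w')
  \<comment> \<open>Equal degree does not decide which right factor is longer, so
    \<open>ei_levi\<close> is used in whichever direction the lengths allow; this is the disjunction
    in \<open>dg_levi\<close>.\<close>
  then show ?case using D.ei_levi[of v w v' w'] D.ei_levi[of v' w' v w] nat_le_linear[of "ln w" "ln w'"] by auto
next
  case (12 w n)
  then have "filter is_rev (pl w) \<noteq> []" by (auto simp: dgr_def)
  from first_rev[OF this] obtain p q where "pl w = p @ q" "length (filter is_rev p) = 1" by blast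
  then show ?case using D.ei_split[of w p q] 12 by (auto simp: dgr_def)
qed

lemma arrow_cases:
  assumes "x \<in> mC" "ln x = 1"
  obtains a y where "a \<in> arcs Q" "y \<in> bcarrier (abis X a)" "x = Path [a] {[y]}"
proof -
  obtain a where "pl x = [a]" using assms(2) by (auto simp: ln_pl length_Suc_conv)
  then show ?thesis using arrow_ex[OF assms(1)] that by blast
qed

lemma Rev_act:
  assumes a: "a \<in> arcs Q" "y \<in> bcarrier (abis X a)"
  shows "Path [Rev a] {[y]} \<in> mD"
    "g \<in> hg a \<Longrightarrow> cD (Path [Rev a] {[y]}) (Triv i g) = Path [Rev a] {[lact (abis X a) (inv\<^bsub>vgrp X (head Q a)\<^esub> g) y]}"
    "h \<in> tg a \<Longrightarrow> cD (Triv i h) (Path [Rev a] {[y]}) = Path [Rev a] {[ract (abis X a) y (inv\<^bsub>vgrp X (tail Q a)\<^esub> h)]}"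
  using D.arrow_in_mor[of "Rev a" y] D.arrow_act[of "Rev a" y] a by simp_all

text \<open>The arrow list is cut just before and just after its single reversed arrow; both outer
  pieces contain no reversed arrow and hence come from \<open>C\<close>.\<close>

lemma Rev_triple:
  assumes w: "w \<in> mD" "dgr w = 1"
  shows "\<exists>d\<in>mC. \<exists>e\<in>mC. \<exists>a\<in>arcs Q. \<exists>y\<in>bcarrier (abis X a). ei_src Q d = tail Q a \<and> ei_trg Q e = head Q a \<and>
    w = cD (cD (io d) (Path [Rev a] {[y]})) (io e)"
proof -
  obtain q a r where p: "pl w = map Fwd q @ [Rev a] @ map Fwd r" using one_rev[of "pl w"] w(2) by (auto simp: dgr_def)
  from D.ei_split[OF w(1) p] obtain u v where u: "u \<in> mD" "v \<in> mD" "sD u = tD v" "w = cD u v" "pl u = map Fwd q" "pl v = [Rev a] @ map Fwd r"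
    by blast
  from D.ei_split[OF u(2,6)] obtain s t where s: "s \<in> mD" "t \<in> mD" "sD s = tD t" "v = cD s t" "pl s = [Rev a]" "pl t = map Fwd r"
    by blast
  obtain d where d: "d \<in> mC" "u = io d" using io_surj[OF u(1)] u(5) by (auto simp: dgr_def)
  obtain e where e: "e \<in> mC" "t = io e" using io_surj[OF s(2)] s(6) by (auto simp: dgr_def)
  obtain y where y: "Rev a \<in> arcs (double_quiver Q)" "y \<in> bcarrier (abis (double_assignment Q X) (Rev a))" "s = Path [Rev a] {[y]}"
    by (rule D.arrow_ex[OF s(1,5)])
  have us: "sD u = tD s" using u(3) D.ei_comp_props[OF s(1-3)] s(4) by simp
  have 1: "ei_src Q d = tail Q a" using us io_src_trg[OF d(1)] d(2) y(3) by simp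
  have 2: "ei_trg Q e = head Q a" using s(3) io_src_trg[OF e(1)] e(2) y(3) by simp
  have "w = cD (cD u s) t" unfolding u(4) s(4) by (rule D.ei_comp_assoc[OF u(1) s(1,2) us s(3), symmetric])
  then have 3: "w = cD (cD (io d) (Path [Rev a] {[y]})) (io e)" unfolding d(2) e(2) y(3) .
  have "a \<in> arcs Q" "y \<in> bcarrier (abis X a)" using y by auto
  then show ?thesis using d(1) e(1) 1 2 3 by blast
qed

text \<open>Equal arrow lists give the same reversed arrow and outer factors of the same lengths.
  Two uses of \<open>ei_levi\<close> then compare the factors by morphisms of length zero, which are
  the group elements \<open>g\<close> and \<open>h\<close>.\<close>

lemma Rev_triple_unique:
  assumes m: "d \<in> mC" "e \<in> mC" "d' \<in> mC" "e' \<in> mC"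
    and a: "a \<in> arcs Q" "y \<in> bcarrier (abis X a)" "a' \<in> arcs Q" "y' \<in> bcarrier (abis X a')"
    and s: "ei_src Q d = tail Q a" "ei_trg Q e = head Q a" "ei_src Q d' = tail Q a'" "ei_trg Q e' = head Q a'"
    and eq: "cD (cD (io d) (Path [Rev a] {[y]})) (io e) = cD (cD (io d') (Path [Rev a'] {[y']})) (io e')"
  shows "\<exists>g\<in>hg a. \<exists>h\<in>tg a. a' = a \<and> y' = ract (abis X a) (lact (abis X a) g y) h \<and>
    d' = cC d (Triv (tail Q a) h) \<and> e' = cC (Triv (head Q a) g) e"
proof -
  interpret H: group "vgrp X (head Q a)" by (rule grp) (use a in simp)
  interpret T: group "vgrp X (tail Q a)" by (rule grp) (use a in simp)
  have "map Fwd (pl d) @ Rev a # map Fwd (pl e) = map Fwd (pl d') @ Rev a' # map Fwd (pl e')"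
    using arg_cong[OF eq, of pl] by simp
  from one_rev_unique[OF this] have pe: "pl e = pl e'" and aa: "a' = a" by auto
  note a' = a(3,4)[unfolded aa] and s' = s(3,4)[unfolded aa]
  let ?S = "Path [Rev a] {[y]} :: ('v, 'a double_arrow, 'g, 'x) ei_mor"
  let ?S' = "Path [Rev a] {[y']} :: ('v, 'a double_arrow, 'g, 'x) ei_mor"
  note S = Rev_act(1)[OF a(1,2)] and S' = Rev_act(1)[OF a']
  have sS: "sD (io d) = tD ?S" "sD ?S = tD (io e)" "sD (io d') = tD ?S'" "sD ?S' = tD (io e')"
    using s s' m by (simp_all add: io_src_trg)
  note dS = D.ei_comp_props[OF io_mor[OF m(1)] S sS(1)] and dS' = D.ei_comp_props[OF io_mor[OF m(3)] S' sS(3)]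
  have le: "ln (io e) \<le> ln (io e')" using pe by (simp add: ln_pl)
  have eq': "cD (cD (io d) ?S) (io e) = cD (cD (io d') ?S') (io e')" using eq unfolding aa .
  \<comment> \<open>First seam, between the reversed arrow and the right factor; \<open>r\<close>
    will be the group element \<open>g\<close>.\<close>
  obtain r where r: "r \<in> mD" "sD r = tD (io e)" "tD r = sD (cD (io d') ?S')" "cD (io d) ?S = cD (cD (io d') ?S') r" "io e' = cD r (io e)"
    using D.ei_levi[OF _ io_mor[OF m(2)] _ io_mor[OF m(4)] _ _ eq' le] dS dS' sS by auto
  have "ln r = 0" using arg_cong[OF r(5), of pl] pe by (simp add: ln_pl)
  then obtain i g where g: "r = Triv i g" "g \<in> carrier (vgrp (double_assignment Q X) i)" using D.ei_len0[OF r(1)] by blast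
  have i: "i = head Q a" using r(2) g(1) s(2) io_src_trg[OF m(2)] by simp
  have g': "g \<in> hg a" "inv\<^bsub>vgrp X (head Q a)\<^esub> g \<in> hg a" using g(2) i by auto
  let ?z = "lact (abis X a) (inv\<^bsub>vgrp X (head Q a)\<^esub> g) y'"
  have z: "?z \<in> bcarrier (abis X a)" by (rule act(1)[OF a' g'(2)])
  have Sr: "cD ?S' r = Path [Rev a] {[?z]}" unfolding g(1) by (rule Rev_act(2)[OF a' g'(1)])
  have sr: "sD ?S' = tD r" using r(3) dS' by simp
  have "cD (io d) ?S = cD (io d') (cD ?S' r)"
    unfolding r(4) by (rule D.ei_comp_assoc[OF io_mor[OF m(3)] S' r(1) sS(3) sr])
  then have eq2: "cD (io d) ?S = cD (io d') (Path [Rev a] {[?z]})" unfolding Sr .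
  \<comment> \<open>Second seam, between the left factor and the reversed arrow; \<open>r2\<close>
    is the inverse of the element \<open>h\<close> to be produced.\<close>
  obtain r2 where r2: "r2 \<in> mD" "sD r2 = tD ?S" "tD r2 = sD (io d')" "io d = cD (io d') r2" "Path [Rev a] {[?z]} = cD r2 ?S"
    using D.ei_levi[OF io_mor[OF m(1)] S io_mor[OF m(3)] Rev_act(1)[OF a(1) z] sS(1) _ eq2] sS by auto
  have "ln r2 = 0" using arg_cong[OF r2(5), of pl] by (simp add: ln_pl)
  then obtain j k where k: "r2 = Triv j k" "k \<in> carrier (vgrp (double_assignment Q X) j)" using D.ei_len0[OF r2(1)] by blast
  have j: "j = tail Q a" using r2(2) k(1) by simp
  let ?h = "inv\<^bsub>vgrp X (tail Q a)\<^esub> k"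
  have k': "k \<in> tg a" "?h \<in> tg a" using k(2) j by auto
  have "cD r2 ?S = Path [Rev a] {[ract (abis X a) y ?h]}" unfolding k(1) by (rule Rev_act(3)[OF a(1,2) k'(1)])
  then have zz: "?z = ract (abis X a) y ?h" using r2(5) by simp
  \<comment> \<open>The actions on a reversed arrow involve inverses, so \<open>g\<close> is applied
    to \<open>?z\<close> to recover \<open>y'\<close> in terms of the original actions.\<close>
  have "y' = lact (abis X a) (g \<otimes>\<^bsub>vgrp X (head Q a)\<^esub> inv\<^bsub>vgrp X (head Q a)\<^esub> g) y'"
    using act(3)[OF a'] H.r_inv[OF g'(1)] by simp
  also have "\<dots> = lact (abis X a) g ?z" by (rule act(5)[OF a' g'])
  also have "\<dots> = ract (abis X a) (lact (abis X a) g y) ?h" unfolding zz by (rule act(7)[OF a(1,2) g'(1) k'(2), symmetric])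
  finally have 1: "y' = ract (abis X a) (lact (abis X a) g y) ?h" .
  have tv: "Triv (tail Q a) k \<in> mC" "Triv (tail Q a) ?h \<in> mC" "Triv (head Q a) g \<in> mC"
    using k' g' a by (simp_all add: mor_Triv)
  have "io d = io (cC d' (Triv (tail Q a) k))" using io_comp[OF m(3) tv(1)] r2(4) k(1) j s'(1) by simp
  then have d: "d = cC d' (Triv (tail Q a) k)" by (simp only: io_inj)
  have "cC d (Triv (tail Q a) ?h) = cC d' (cC (Triv (tail Q a) k) (Triv (tail Q a) ?h))"
    unfolding d by (rule ei_comp_assoc[OF m(3) tv(1,2)]) (use s'(1) in simp_all)
  also have "\<dots> = d'" using ei_ident(2)[OF m(3)] s'(1) T.r_inv[OF k'(1)] by simp
  finally have 2: "d' = cC d (Triv (tail Q a) ?h)" ..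
  have "io e' = io (cC (Triv (head Q a) g) e)" using io_comp[OF tv(3) m(2)] r(5) g(1) i s(2) by simp
  then have 3: "e' = cC (Triv (head Q a) g) e" by (simp only: io_inj)
  show ?thesis using 1 2 3 aa g'(1) k'(2) by blast
qed

section \<open>Orbit representatives of all arrows together, and the final assembly\<close>

definition reps :: "('a \<Rightarrow> 'x set) \<Rightarrow> ('v, 'a, 'g, 'x) ei_mor set" where
  "reps R = (\<lambda>(a, y). Path [a] {[y]}) ` Sigma (arcs Q) R"

abbreviation arr :: "'a \<Rightarrow> 'x \<Rightarrow> ('v, 'a, 'g, 'x) ei_mor" where
  "arr a y \<equiv> Path [a] {[y]}"

text \<open>Multiplication by a group element keeps the arrow label, so orbits of different arrows
  never meet and the representatives of the single bisets can be united.\<close>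

lemma right_reps:
  assumes R: "\<And>a. a \<in> arcs Q \<Longrightarrow> right_orbit_reps (vgrp X (tail Q a)) (abis X a) (R a)" and x: "x \<in> mC" "ln x = 1"
  shows "\<exists>!b. b \<in> reps R \<and> (\<exists>h\<in>mC. ln h = 0 \<and> ei_trg Q h = ei_src Q b \<and> x = cC b h)"
proof -
  obtain a y where a: "a \<in> arcs Q" "y \<in> bcarrier (abis X a)" "x = arr a y" by (rule arrow_cases[OF x])
  have sub: "R c \<subseteq> bcarrier (abis X c)" if "c \<in> arcs Q" for c using R[OF that] by (simp add: right_orbit_reps_def)
  have *: "(\<exists>h\<in>mC. ln h = 0 \<and> ei_trg Q h = ei_src Q (arr c b) \<and> x = cC (arr c b) h) \<longleftrightarrow>
      c = a \<and> (\<exists>g\<in>tg a. y = ract (abis X a) b g)" if "c \<in> arcs Q" "b \<in> R c" for c b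
  proof
    assume "\<exists>h\<in>mC. ln h = 0 \<and> ei_trg Q h = ei_src Q (arr c b) \<and> x = cC (arr c b) h"
    then obtain h where h: "h \<in> mC" "ln h = 0" "ei_trg Q h = tail Q c" "x = cC (arr c b) h" by auto
    obtain i g where g: "h = Triv i g" "g \<in> carrier (vgrp X i)" by (rule ei_len0[OF h(1,2)])
    have b: "b \<in> bcarrier (abis X c)" using sub[OF that(1)] that(2) by blast
    have gc: "g \<in> tg c" using h(3) g by simp
    have "arr a y = arr c (ract (abis X c) b g)"
      unfolding a(3)[symmetric] h(4) g(1) by (rule arrow_act(2)[OF that(1) b gc])
    then show "c = a \<and> (\<exists>g\<in>tg a. y = ract (abis X a) b g)" using gc by auto
  next
    assume "c = a \<and> (\<exists>g\<in>tg a. y = ract (abis X a) b g)"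
    then obtain g where g: "c = a" "g \<in> tg a" "y = ract (abis X a) b g" by blast
    show "\<exists>h\<in>mC. ln h = 0 \<and> ei_trg Q h = ei_src Q (arr c b) \<and> x = cC (arr c b) h"
      by (rule bexI[of _ "Triv (tail Q a) g"])
        (use g a arrow_act(2)[OF a(1), of b g] sub[OF that(1)] that(2) in \<open>auto simp: mor_Triv\<close>)
  qed
  obtain b where b: "b \<in> R a" "\<exists>g\<in>tg a. y = ract (abis X a) b g"
    and u: "\<And>b'. b' \<in> R a \<Longrightarrow> \<exists>g\<in>tg a. y = ract (abis X a) b' g \<Longrightarrow> b' = b"
    using R[OF a(1)] a(2) unfolding right_orbit_reps_def by (metis (no_types, lifting))
  show ?thesis
  proof (rule ex1I[of _ "arr a b"])
    show "arr a b \<in> reps R \<and> (\<exists>h\<in>mC. ln h = 0 \<and> ei_trg Q h = ei_src Q (arr a b) \<and> x = cC (arr a b) h)"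
      unfolding *[OF a(1) b(1)] using a(1) b by (auto simp: reps_def image_iff)
  next
    fix b' assume b': "b' \<in> reps R \<and> (\<exists>h\<in>mC. ln h = 0 \<and> ei_trg Q h = ei_src Q b' \<and> x = cC b' h)"
    then obtain c z where c: "b' = arr c z" "c \<in> arcs Q" "z \<in> R c" by (auto simp: reps_def)
    have "c = a \<and> (\<exists>g\<in>tg a. y = ract (abis X a) z g)"
      using b' unfolding c(1) *[OF c(2,3)] by blast
    then show "b' = arr a b" using u[of z] c by simp
  qed
qed

lemma left_reps:
  assumes L: "\<And>a. a \<in> arcs Q \<Longrightarrow> left_orbit_reps (vgrp X (head Q a)) (abis X a) (L a)" and x: "x \<in> mC" "ln x = 1"
  shows "\<exists>!b. b \<in> reps L \<and> (\<exists>h\<in>mC. ln h = 0 \<and> ei_src Q h = ei_trg Q b \<and> x = cC h b)"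
proof -
  obtain a y where a: "a \<in> arcs Q" "y \<in> bcarrier (abis X a)" "x = arr a y" by (rule arrow_cases[OF x])
  have sub: "L c \<subseteq> bcarrier (abis X c)" if "c \<in> arcs Q" for c using L[OF that] by (simp add: left_orbit_reps_def)
  have *: "(\<exists>h\<in>mC. ln h = 0 \<and> ei_src Q h = ei_trg Q (arr c b) \<and> x = cC h (arr c b)) \<longleftrightarrow>
      c = a \<and> (\<exists>g\<in>hg a. y = lact (abis X a) g b)" if "c \<in> arcs Q" "b \<in> L c" for c b
  proof
    assume "\<exists>h\<in>mC. ln h = 0 \<and> ei_src Q h = ei_trg Q (arr c b) \<and> x = cC h (arr c b)"
    then obtain h where h: "h \<in> mC" "ln h = 0" "ei_src Q h = head Q c" "x = cC h (arr c b)" by auto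
    obtain i g where g: "h = Triv i g" "g \<in> carrier (vgrp X i)" by (rule ei_len0[OF h(1,2)])
    have b: "b \<in> bcarrier (abis X c)" using sub[OF that(1)] that(2) by blast
    have gc: "g \<in> hg c" using h(3) g by simp
    have "arr a y = arr c (lact (abis X c) g b)"
      unfolding a(3)[symmetric] h(4) g(1) by (rule arrow_act(1)[OF that(1) b gc])
    then show "c = a \<and> (\<exists>g\<in>hg a. y = lact (abis X a) g b)" using gc by auto
  next
    assume "c = a \<and> (\<exists>g\<in>hg a. y = lact (abis X a) g b)"
    then obtain g where g: "c = a" "g \<in> hg a" "y = lact (abis X a) g b" by blast
    show "\<exists>h\<in>mC. ln h = 0 \<and> ei_src Q h = ei_trg Q (arr c b) \<and> x = cC h (arr c b)"
      by (rule bexI[of _ "Triv (head Q a) g"])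
        (use g a arrow_act(1)[OF a(1), of b g] sub[OF that(1)] that(2) in \<open>auto simp: mor_Triv\<close>)
  qed
  obtain b where b: "b \<in> L a" "\<exists>g\<in>hg a. y = lact (abis X a) g b"
    and u: "\<And>b'. b' \<in> L a \<Longrightarrow> \<exists>g\<in>hg a. y = lact (abis X a) g b' \<Longrightarrow> b' = b"
    using L[OF a(1)] a(2) unfolding left_orbit_reps_def by (metis (no_types, lifting))
  show ?thesis
  proof (rule ex1I[of _ "arr a b"])
    show "arr a b \<in> reps L \<and> (\<exists>h\<in>mC. ln h = 0 \<and> ei_src Q h = ei_trg Q (arr a b) \<and> x = cC h (arr a b))"
      unfolding *[OF a(1) b(1)] using a(1) b by (auto simp: reps_def image_iff)
  next
    fix b' assume b': "b' \<in> reps L \<and> (\<exists>h\<in>mC. ln h = 0 \<and> ei_src Q h = ei_trg Q b' \<and> x = cC h b')"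
    then obtain c z where c: "b' = arr c z" "c \<in> arcs Q" "z \<in> L c" by (auto simp: reps_def)
    have "c = a \<and> (\<exists>g\<in>hg a. y = lact (abis X a) g z)"
      using b' unfolding c(1) *[OF c(2,3)] by blast
    then show "b' = arr a b" using u[of z] c by simp
  qed
qed

lemma reps_sub:
  assumes "\<And>a. a \<in> arcs Q \<Longrightarrow> R a \<subseteq> bcarrier (abis X a)"
  shows "reps R \<subseteq> {x \<in> mC. ln x = 1}"
  using assms arrow_in_mor by (auto simp: reps_def)

lemma sum_reps:
  assumes "\<And>a. a \<in> arcs Q \<Longrightarrow> R a \<subseteq> bcarrier (abis X a)"
  shows "(\<Sum>b\<in>reps R. f b) = (\<Sum>a\<in>arcs Q. \<Sum>y\<in>R a. f (Path [a] {[y]}))"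
proof -
  have "inj_on (\<lambda>(a, y). (Path [a] {[y]} :: ('v, 'a, 'g, 'x) ei_mor)) (Sigma (arcs Q) R)" by (auto simp: inj_on_def)
  moreover have "\<forall>a\<in>arcs Q. finite (R a)" using assms abis_finite finite_subset by blast
  ultimately show ?thesis
    unfolding reps_def by (subst sum.reindex) (auto simp: sum.Sigma o_def split_beta)
qed

lemma ei_double_cat:
  assumes ac: "acyclic_quiver Q"
    and L: "\<And>a. a \<in> arcs Q \<Longrightarrow> left_orbit_reps (vgrp X (head Q a)) (abis X a) (L a)"
    and R: "\<And>a. a \<in> arcs Q \<Longrightarrow> right_orbit_reps (vgrp X (tail Q a)) (abis X a) (R a)"
  shows "double_cat (ei_category Q X) ln (ei_category (double_quiver Q) (double_assignment Q X)) io dgr st (reps R) (reps L)"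
proof -
  have A: "alg_cat (ei_category Q X) ln" by (rule alg_cat.intro[OF ei_free_cat[OF ac]])
  note triple = alg_cat.triple_def[OF A]
  have sub: "\<And>a. a \<in> arcs Q \<Longrightarrow> L a \<subseteq> bcarrier (abis X a)" "\<And>a. a \<in> arcs Q \<Longrightarrow> R a \<subseteq> bcarrier (abis X a)"
    using L R by (simp_all add: left_orbit_reps_def right_orbit_reps_def)
  have st: "st x \<in> mD \<and> sD (st x) = ei_trg Q x \<and> tD (st x) = ei_src Q x \<and> dgr (st x) = 1" if x: "x \<in> mC" "ln x = 1" for x
  proof -
    obtain a y where a: "a \<in> arcs Q" "y \<in> bcarrier (abis X a)" "x = Path [a] {[y]}" by (rule arrow_cases[OF x])
    show ?thesis using Rev_act(1)[OF a(1,2)] a(3) by (simp add: dgr_def)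
  qed
  show ?thesis
  proof (intro double_cat.intro A graded double_cat_axioms.intro, goal_cases)
    case (1 x) then show ?case using st by simp
  next case (2 x) then show ?case using st by simp
  next case (3 x) then show ?case using st by simp
  next case (4 x) then show ?case using st by simp
  next
    case (5 x g h)
    then have m: "x \<in> mC" "ln x = 1" "g \<in> mC" "h \<in> mC" "ln g = 0" "ln h = 0" "ei_src Q g = ei_trg Q x" "ei_src Q x = ei_trg Q h"
      by simp_all
    obtain a y where a: "a \<in> arcs Q" "y \<in> bcarrier (abis X a)" "x = Path [a] {[y]}" by (rule arrow_cases[OF m(1,2)])
    obtain i k where k: "g = Triv i k" "k \<in> carrier (vgrp X i)" by (rule ei_len0[OF m(3,5)])
    obtain j l where l: "h = Triv j l" "l \<in> carrier (vgrp X j)" by (rule ei_len0[OF m(4,6)])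
    have kl: "k \<in> hg a" "l \<in> tg a" using k l m(7,8) a(3) by auto
    interpret H: group "vgrp X (head Q a)" by (rule grp) (use a in simp)
    interpret T: group "vgrp X (tail Q a)" by (rule grp) (use a in simp)
    note u = act(1)[OF a(1,2) kl(1)]
    note v = act(2)[OF a(1) u kl(2)]
    have c: "cC (cC g x) h = Path [a] {[ract (abis X a) (lact (abis X a) k y) l]}"
      unfolding a(3) k(1) l(1) arrow_act(1)[OF a(1,2) kl(1)] by (rule arrow_act(2)[OF a(1) u kl(2)])
    \<comment> \<open>The dual action inverts: the left action of \<open>h\<close> removes
      \<open>l\<close> from the entry, and below the right action of \<open>g\<close> removes
      \<open>k\<close>.\<close>
    have 1: "cD (io h) (st (cC (cC g x) h)) = Path [Rev a] {[lact (abis X a) k y]}"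
      unfolding c unfolding l(1) using Rev_act(3)[OF a(1) v kl(2), of j]
        act(6)[OF a(1) u kl(2) T.inv_closed[OF kl(2)]] T.r_inv[OF kl(2)] act(4)[OF a(1) u] by simp
    have "cD (Path [Rev a] {[lact (abis X a) k y]}) (io g) = st x"
      unfolding k(1) a(3) using Rev_act(2)[OF a(1) u kl(1), of i]
        act(5)[OF a(1,2) H.inv_closed[OF kl(1)] kl(1)] H.l_inv[OF kl(1)] act(3)[OF a(1,2)] by simp
    then have "cD (cD (io h) (st (cC (cC g x) h))) (io g) = st x" unfolding 1 .
    then show ?case by simp
  next
    case (6 w)
    then have w: "w \<in> mD" "dgr w = 1" by simp_all
    from Rev_triple[OF w] obtain d e a y where d: "d \<in> mC" "e \<in> mC" "a \<in> arcs Q" "y \<in> bcarrier (abis X a)"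
      "ei_src Q d = tail Q a" "ei_trg Q e = head Q a" "w = cD (cD (io d) (Path [Rev a] {[y]})) (io e)" by blast
    show ?case
      by (rule exI[of _ d], rule exI[of _ "Path [a] {[y]}"], rule exI[of _ e])
        (use d arrow_in_mor[OF d(3,4)] in \<open>simp add: triple\<close>)
  next
    case (7 d x e d' x' e')
    then have m: "d \<in> mC" "x \<in> mC" "e \<in> mC" "ln x = 1" "ei_src Q d = ei_src Q x" "ei_trg Q e = ei_trg Q x"
      "d' \<in> mC" "x' \<in> mC" "e' \<in> mC" "ln x' = 1" "ei_src Q d' = ei_src Q x'" "ei_trg Q e' = ei_trg Q x'"
      and eq: "cD (cD (io d) (st x)) (io e) = cD (cD (io d') (st x')) (io e')"
      by (simp_all add: triple)
    obtain a y where a: "a \<in> arcs Q" "y \<in> bcarrier (abis X a)" "x = Path [a] {[y]}" by (rule arrow_cases[OF m(2,4)])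
    obtain a' y' where a': "a' \<in> arcs Q" "y' \<in> bcarrier (abis X a')" "x' = Path [a'] {[y']}" by (rule arrow_cases[OF m(8,10)])
    have s: "ei_src Q d = tail Q a" "ei_trg Q e = head Q a" "ei_src Q d' = tail Q a'" "ei_trg Q e' = head Q a'"
      using m(5,6,11,12) a(3) a'(3) by simp_all
    have "cD (cD (io d) (Path [Rev a] {[y]})) (io e) = cD (cD (io d') (Path [Rev a'] {[y']})) (io e')"
      using eq unfolding a(3) a'(3) by simp
    from Rev_triple_unique[OF m(1,3,7,9) a(1,2) a'(1,2) s this]
    obtain g h where g: "g \<in> hg a" "h \<in> tg a" "a' = a" "y' = ract (abis X a) (lact (abis X a) g y) h"
      "d' = cC d (Triv (tail Q a) h)" "e' = cC (Triv (head Q a) g) e" by blast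
    have "x' = cC (cC (Triv (head Q a) g) x) (Triv (tail Q a) h)"
      unfolding a(3) a'(3) g(3,4) arrow_act(1)[OF a(1,2) g(1)]
      by (rule arrow_act(2)[OF a(1) act(1)[OF a(1,2) g(1)] g(2), symmetric])
    then show ?case
      by (intro bexI[of _ "Triv (head Q a) g"] bexI[of _ "Triv (tail Q a) h"])
        (use g a in \<open>simp_all add: mor_Triv\<close>)
  next case 8 show ?case using reps_sub[OF sub(2)] by simp
  next case (9 x) then show ?case using right_reps[OF R, of x] by simp
  next case 10 show ?case using reps_sub[OF sub(1)] by simp
  next case (11 x) then show ?case using left_reps[OF L, of x] by simp
  qed
qed

lemma preprojective_relation_reps:
  assumes L: "\<And>a. a \<in> arcs Q \<Longrightarrow> L a \<subseteq> bcarrier (abis X a)" and R: "\<And>a. a \<in> arcs Q \<Longrightarrow> R a \<subseteq> bcarrier (abis X a)"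
  shows "preprojective_relation Q X L R = (\<Sum>b\<in>reps R. Poly_Mapping.single (cD (io b) (st b)) (1::'k::field)) -
    (\<Sum>c\<in>reps L. Poly_Mapping.single (cD (st c) (io c)) 1)"
proof -
  have e: "double_elem Q X (Fwd a) y = (Poly_Mapping.single (Path [Fwd a] {[y]}) 1 :: _ \<Rightarrow>\<^sub>0 'k)"
    "double_elem Q X (Rev a) y = (Poly_Mapping.single (Path [Rev a] {[y]}) 1 :: _ \<Rightarrow>\<^sub>0 'k)"
    if "a \<in> arcs Q" "y \<in> bcarrier (abis X a)" for a y
    using that by (simp_all add: double_elem_def D.arrow_mor_eq)
  have 1: "(\<Sum>y\<in>R a. cmul (ei_category (double_quiver Q) (double_assignment Q X)) (double_elem Q X (Fwd a) y) (double_elem Q X (Rev a) y)) =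
      (\<Sum>y\<in>R a. Poly_Mapping.single (cD (io (Path [a] {[y]})) (st (Path [a] {[y]}))) (1::'k))" if "a \<in> arcs Q" for a
  proof (rule sum.cong[OF refl])
    fix y assume "y \<in> R a"
    then have "y \<in> bcarrier (abis X a)" using R[OF that] by blast
    then show "cmul (ei_category (double_quiver Q) (double_assignment Q X)) (double_elem Q X (Fwd a) y) (double_elem Q X (Rev a) y) =
      Poly_Mapping.single (cD (io (Path [a] {[y]})) (st (Path [a] {[y]}))) (1::'k)"
      using e[OF that] by (simp add: cmul_single)
  qed
  have 2: "(\<Sum>y\<in>L a. cmul (ei_category (double_quiver Q) (double_assignment Q X)) (double_elem Q X (Rev a) y) (double_elem Q X (Fwd a) y)) =
      (\<Sum>y\<in>L a. Poly_Mapping.single (cD (st (Path [a] {[y]})) (io (Path [a] {[y]}))) (1::'k))" if "a \<in> arcs Q" for a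
  proof (rule sum.cong[OF refl])
    fix y assume "y \<in> L a"
    then have "y \<in> bcarrier (abis X a)" using L[OF that] by blast
    then show "cmul (ei_category (double_quiver Q) (double_assignment Q X)) (double_elem Q X (Rev a) y) (double_elem Q X (Fwd a) y) =
      Poly_Mapping.single (cD (st (Path [a] {[y]})) (io (Path [a] {[y]}))) (1::'k)"
      using e[OF that] by (simp add: cmul_single)
  qed
  have R': "(\<Sum>b\<in>reps R. f b) = (\<Sum>a\<in>arcs Q. \<Sum>y\<in>R a. f (Path [a] {[y]}))"
    for f :: "_ \<Rightarrow> (('v, 'a double_arrow, 'g, 'x) ei_mor \<Rightarrow>\<^sub>0 'k)"
    by (rule sum_reps, rule R)
  have L': "(\<Sum>b\<in>reps L. f b) = (\<Sum>a\<in>arcs Q. \<Sum>y\<in>L a. f (Path [a] {[y]}))"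
    for f :: "_ \<Rightarrow> (('v, 'a double_arrow, 'g, 'x) ei_mor \<Rightarrow>\<^sub>0 'k)"
    by (rule sum_reps, rule L)
  show ?thesis
    unfolding R' L' sum_subtractf[symmetric] preprojective_relation_def Let_def
      double_category_algebra_def category_algebra_simps
    by (rule sum.cong[OF refl]) (simp only: 1 2)
qed

end

theorem theoremA:
  fixes Q :: "('v, 'a) pre_digraph"
    and X :: "('v, 'a, 'g, 'x) assignment"
    and L R :: "'a \<Rightarrow> 'x set"
    and KC :: "('k::field, ('v, 'a, 'g, 'x) ei_mor \<Rightarrow>\<^sub>0 'k) module"
  defines "KC \<equiv> category_algebra (ei_category Q X)"
  assumes "finite_EI_quiver Q X"
    and "acyclic_quiver Q"
    and "action_free Q X"
    and "\<And>\<alpha>. \<alpha> \<in> arcs Q \<Longrightarrow> left_orbit_reps (vgrp X (head Q \<alpha>)) (abis X \<alpha>) (L \<alpha>)"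
    and "\<And>\<alpha>. \<alpha> \<in> arcs Q \<Longrightarrow> right_orbit_reps (vgrp X (tail Q \<alpha>)) (abis X \<alpha>) (R \<alpha>)"
  shows "(preprojective_algebra Q X L R
            :: ('k, (('v, 'a double_arrow, 'g, 'x) ei_mor \<Rightarrow>\<^sub>0 'k) set) module)
         \<cong>\<^sub>a\<^sub>l\<^sub>g
         tensor_algebra KC (ext1_bimodule KC (dual_bimodule KC) (regular_bimodule KC))"
proof -
  interpret free_EI_quiver Q X by (intro free_EI_quiver.intro free_EI_quiver_axioms.intro assms(2,4))
  let ?D = "ei_category (double_quiver Q) (double_assignment Q X)"
  interpret DC: double_cat "ei_category Q X" ln "TYPE('k)" ?D io dgr st "reps R" "reps L"
    by (rule ei_double_cat[OF assms(3,5,6)])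
  \<comment> \<open>The extension bimodule plays the role of \<open>V\<close>, with the class map
    \<open>DC.vv\<close> as the required surjection from degree one.\<close>
  interpret GT: graded_tensor "ei_category Q X" ?D io dgr
      "ext1_bimodule KC (dual_bimodule KC) (regular_bimodule KC)" DC.vv DC.rho
    unfolding KC_def
    by (intro graded_tensor.intro graded graded_tensor_axioms.intro)
      (fact DC.vv_closed DC.vv_add DC.vv_left DC.vv_right DC.vv_kernel DC.rho_keys DC.vv_rho | blast elim: DC.vv_surj)+
  have sub: "\<And>a. a \<in> arcs Q \<Longrightarrow> L a \<subseteq> bcarrier (abis X a)" "\<And>a. a \<in> arcs Q \<Longrightarrow> R a \<subseteq> bcarrier (abis X a)"
    using assms(5,6) by (simp_all add: left_orbit_reps_def right_orbit_reps_def)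
  have rho: "preprojective_relation Q X L R = DC.rho"
    unfolding DC.rho_def ei_category_simps by (rule preprojective_relation_reps) (erule sub)+
  show ?thesis
    unfolding preprojective_algebra_def double_category_algebra_def rho
    using GT.quotient_tensor_algebra unfolding KC_def .
qed

end
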